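(* Let $k\geq 2$ be an integer and let $f$ be a positive multiplicative function such that $f(p)\to 1$ as $p\to\infty$ over primes. Let $K:=k(k+1)((k-1)!)^2$. (a) If $\sum_{p:\, f(p)>1}(f(p)-1)=\infty$, then the set of tuples $\{(f(p+1),\ldots,f(p+k)) : p\text{ prime}\}$ is dense in $[f(K),\infty)\times[f(1),\infty)\times[f(2),\infty)\times\cdots\times[f(k-1),\infty)$. (b) If $\sum_{p:\, f(p)<1}(1-f(p))=\infty$, then the set of tuples $\{(f(p+1),\ldots,f(p+k)) : p\text{ prime}\}$ is dense in $[0,f(K)]\times[0,f(1)]\times[0,f(2)]\times\cdots\times[0,f(k-1)]$.
   Context: A multiplicative function satisfies $f(1)=1$ and $f(mn)=f(m)f(n)$ whenever $\gcd(m,n)=1$; positive means $f(n)>0$ for all $n$. Sums indexed by $p$ run over primes. In the product of intervals, the first factor corresponds to the coordinate $f(p+1)$ and the $i$-th factor ($2\le i\le k$) is $[f(i-1),\infty)$ resp. $[0,f(i-1)]$. *)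

theory Defs
  imports "HOL-Computational_Algebra.Primes" Complex_Main
begin

definition multiplicative :: "(nat \<Rightarrow> real) \<Rightarrow> bool" where
  "multiplicative f \<longleftrightarrow> f 1 = 1 \<and> (\<forall>m n. m > 0 \<longrightarrow> n > 0 \<longrightarrow> coprime m n \<longrightarrow> f (m * n) = f m * f n)"

definition prime_tuples_dense_in :: "(nat \<Rightarrow> real) \<Rightarrow> nat \<Rightarrow> (nat \<Rightarrow> real set) \<Rightarrow> bool" where
  "prime_tuples_dense_in f k I \<longleftrightarrow>
     (\<forall>x :: nat \<Rightarrow> real. (\<forall>i\<in>{1..k}. x i \<in> I i) \<longrightarrow>
        (\<forall>\<epsilon>>0. \<exists>p. prime p \<and> (\<forall>i\<in>{1..k}. \<bar>f (p + i) - x i\<bar> < \<epsilon>)))"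

end

theory Submission
  imports Defs "HOL-Number_Theory.Number_Theory" "HOL-Analysis.Analysis" "HOL-Real_Asymp.Real_Asymp"
    "HOL-Computational_Algebra.Squarefree"
begin

text \<open>
  Choose disjoint finite sets \<open>P i\<close> of primes such that the product of \<open>f\<close> over \<open>P i\<close> approximates the
  quotient of the \<open>i\<close>-th target by \<open>f K\<close>, respectively \<open>f (i - 1)\<close>; divergence of the series makes this
  possible by a greedy choice. A residue class modulo a suitable \<open>Q\<close> forces \<open>p + i\<close> to be \<open>K\<close>
  (for \<open>i = 1\<close>) or \<open>i - 1\<close>, times the primes in \<open>P i\<close>, times a cofactor without prime factors up to \<open>w\<close>.
  It remains to find a prime \<open>p\<close> in this class for which the cofactors are squarefree with boundedly
  many prime factors, all of them large, since \<open>f\<close> is then close to \<open>1\<close> at the cofactors.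

  For this, let \<open>Z = w ^ 2 ^ J\<close> with \<open>J\<close> tending to infinity, and count the integers \<open>n\<close> of size a power of \<open>Z\<close>
  in the class that have no prime factor in \<open>(w, Z]\<close>, with weight \<open>mangoldt n / n\<close>. The proportion for which
  the shifts \<open>n + i\<close> have no such prime factor either is the expected one up to a small relative error.
  Indeed \<open>mangoldt n\<close> is \<open>ln n\<close> minus the sum of \<open>mangoldt l\<close> over the proper divisors \<open>l\<close> of \<open>n\<close>. The term \<open>ln n\<close>
  is handled by the Brun--Hooley sieve. In the other terms both \<open>l\<close> and \<open>n div l\<close> exceed \<open>Z\<close>; the dispersion
  method reduces them to sieving linear forms \<open>u v + i\<close>, \<open>u v' + i\<close> in \<open>u\<close>, whose singular series is \<open>1 + O(1/w)\<close>
  on average over \<open>v\<close>, \<open>v'\<close>. So neither the large sieve nor the Bombieri--Vinogradov theorem is needed. The main term is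
  Mertens' theorem for arithmetic progressions.
\<close>

section \<open>Bonferroni inequalities and the Brun--Hooley sieve\<close>

text \<open>How large the prime factors of a cofactor must be depends on how many there are. Their
  number therefore has to be bounded in terms of \<open>k\<close> alone, before \<open>B\<close> and
  \<open>Q\<close> are known. Hence the primes are sought up to \<open>Z ^ (4 * m)\<close> with
  \<open>m\<close> depending only on \<open>k\<close>, while \<open>J\<close> is chosen last; for
  this a theorem with fixed modulus is enough, and the weight \<open>1 / n\<close> lets Mertens'
  theorem replace the prime number theorem for progressions. The price is that the bilinear terms
  are as large as the main term: by Mertens' product \<open>La\<close> is at most
  \<open>1 / totient Q\<close>, and a trivial bound would still exceed the main term by a factor of
  order \<open>m ^ 2\<close>. They are beaten because the variance in the dispersion step is small
  relative to \<open>cc ^ 2\<close>. Its relative error consists of the sieve error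
  \<open>3 * \<theta>\<close>, which decays like \<open>4 ^ (-b)\<close> while \<open>m\<close>
  grows only linearly in \<open>b\<close>, of the singular series excess
  \<open>exp (8 * k ^ 3 / w) - 1\<close>, and of terms that vanish as \<open>J\<close> grows. This
  dictates the order of choice: \<open>b\<close> and \<open>m\<close>, then \<open>w\<close>, then
  \<open>J\<close>.\<close>

definition alt_sum :: "('a \<Rightarrow> real) \<Rightarrow> 'a set \<Rightarrow> nat \<Rightarrow> real" where
  "alt_sum g P r = (\<Sum>D | D \<subseteq> P \<and> card D \<le> r. (-1) ^ card D * prod g D)"

definition elem_sym :: "('a \<Rightarrow> real) \<Rightarrow> 'a set \<Rightarrow> nat \<Rightarrow> real" where
  "elem_sym g P r = (\<Sum>D | D \<subseteq> P \<and> card D = r. prod g D)"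

lemma sum_subsets_insert:
  fixes F :: "'a set \<Rightarrow> real"
  assumes "finite P" "q \<notin> P"
  shows "(\<Sum>D | D \<subseteq> insert q P \<and> \<Phi> (card D). F D) =
    (\<Sum>D | D \<subseteq> P \<and> \<Phi> (card D). F D) + (\<Sum>D | D \<subseteq> P \<and> \<Phi> (Suc (card D)). F (insert q D))"
proof -
  let ?A = "{D. D \<subseteq> P \<and> \<Phi> (card D)}" and ?B = "{D. D \<subseteq> P \<and> \<Phi> (Suc (card D))}"
  have fin: "finite ?A" "finite ?B" using assms by auto
  have cd: "card (insert q D) = Suc (card D)" if "D \<subseteq> P" for D
    using that assms by (meson card_insert_disjoint finite_subset subsetD)
  have "{D. D \<subseteq> insert q P \<and> \<Phi> (card D)} = ?A \<union> insert q ` ?B"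
  proof (intro equalityI subsetI)
    fix D assume D: "D \<in> {D. D \<subseteq> insert q P \<and> \<Phi> (card D)}"
    show "D \<in> ?A \<union> insert q ` ?B"
    proof (cases "q \<in> D")
      case True
      then have 1: "D = insert q (D - {q})" by blast
      have 2: "D - {q} \<subseteq> P" using D by blast
      have "Suc (card (D - {q})) = card D" using cd[OF 2] 1 by simp
      then have "D - {q} \<in> ?B" using D 2 by simp
      then show ?thesis using 1 by blast
    next
      case False
      then show ?thesis using D by blast
    qed
  next
    fix D assume "D \<in> ?A \<union> insert q ` ?B"
    then consider "D \<subseteq> P" "\<Phi> (card D)" | D' where "D = insert q D'" "D' \<subseteq> P" "\<Phi> (Suc (card D'))"
      by blast
    then show "D \<in> {D. D \<subseteq> insert q P \<and> \<Phi> (card D)}"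
    proof cases
      case 1
      then show ?thesis by blast
    next
      case 2
      then have "\<Phi> (card D)" using cd[of D'] by presburger
      then show ?thesis using 2 by blast
    qed
  qed
  moreover have "?A \<inter> insert q ` ?B = {}" using assms by auto
  moreover have "inj_on (insert q) ?B"
    using assms(2) by (intro inj_onI) (auto dest!: insert_ident[THEN iffD1, rotated 2])
  ultimately show ?thesis using fin by (simp add: sum.union_disjoint sum.reindex)
qed

lemma prod_insert_sub:
  fixes g :: "'a \<Rightarrow> real"
  assumes "finite P" "q \<notin> P" "D \<subseteq> P"
  shows "prod g (insert q D) = g q * prod g D" "card (insert q D) = Suc (card D)"
proof -
  have "finite D" "q \<notin> D" using assms finite_subset by auto
  then show "prod g (insert q D) = g q * prod g D" "card (insert q D) = Suc (card D)" by auto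
qed

lemma alt_sum_insert:
  assumes "finite P" "q \<notin> P"
  shows "alt_sum g (insert q P) (Suc r) = alt_sum g P (Suc r) - g q * alt_sum g P r"
proof -
  have "(\<Sum>D | D \<subseteq> P \<and> card D \<le> r. (-1) ^ card (insert q D) * prod g (insert q D))
      = (\<Sum>D | D \<subseteq> P \<and> card D \<le> r. - g q * ((-1) ^ card D * prod g D))"
    by (rule sum.cong) (use assms in \<open>auto simp: prod_insert_sub\<close>)
  then show "alt_sum g (insert q P) (Suc r) = alt_sum g P (Suc r) - g q * alt_sum g P r"
    unfolding alt_sum_def using sum_subsets_insert[OF assms, where \<Phi> = "\<lambda>c. c \<le> Suc r"]
    by (simp add: sum_distrib_left sum_negf)
qed

lemma alt_sum_0:
  assumes "finite P" shows "alt_sum g P 0 = 1"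
proof -
  have "{D. D \<subseteq> P \<and> card D \<le> 0} = {{}}" using assms finite_subset[of _ P] by (auto simp: card_eq_0_iff)
  then show ?thesis by (simp add: alt_sum_def)
qed

lemma elem_sym_insert:
  assumes "finite P" "q \<notin> P"
  shows "elem_sym g (insert q P) (Suc r) = elem_sym g P (Suc r) + g q * elem_sym g P r"
proof -
  have "(\<Sum>D | D \<subseteq> P \<and> card D = r. prod g (insert q D))
      = (\<Sum>D | D \<subseteq> P \<and> card D = r. g q * prod g D)"
    by (rule sum.cong) (use assms in \<open>auto simp: prod_insert_sub\<close>)
  then show ?thesis
    unfolding elem_sym_def using sum_subsets_insert[OF assms, where \<Phi> = "\<lambda>c. c = Suc r"]
    by (simp add: sum_distrib_left)
qed

lemma elem_sym_0:
  assumes "finite P" shows "elem_sym g P 0 = 1"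
proof -
  have "{D. D \<subseteq> P \<and> card D = 0} = {{}}" using assms finite_subset[of _ P] by (auto simp: card_eq_0_iff)
  then show ?thesis by (simp add: elem_sym_def)
qed

lemma elem_sym_nonneg: "(\<And>p. p \<in> P \<Longrightarrow> 0 \<le> g p) \<Longrightarrow> 0 \<le> elem_sym g P r"
  unfolding elem_sym_def by (intro sum_nonneg prod_nonneg) auto

lemma elem_sym_empty_Suc: "elem_sym g {} (Suc r) = 0"
  unfolding elem_sym_def by (intro sum.neutral) auto

text \<open>Specialised to 0/1-valued \<open>g\<close>, this is the Bonferroni inequality for counting.\<close>
lemma bonferroni:
  assumes "finite P" "\<And>p. p \<in> P \<Longrightarrow> 0 \<le> g p" "\<And>p. p \<in> P \<Longrightarrow> g p \<le> 1"
  shows "0 \<le> (-1) ^ r * (alt_sum g P r - (\<Prod>p\<in>P. 1 - g p))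
     \<and> (-1) ^ r * (alt_sum g P r - (\<Prod>p\<in>P. 1 - g p)) \<le> elem_sym g P (Suc r)"
  using assms
proof (induction P arbitrary: r rule: finite_induct)
  case empty
  have "{D. D = {} \<and> card D \<le> r} = {{}::'a set}" by auto
  then show ?case by (simp add: alt_sum_def elem_sym_empty_Suc)
next
  case (insert q P)
  let ?V = "\<Prod>p\<in>P. 1 - g p"
  have V: "0 \<le> ?V" "?V \<le> 1" using insert.prems by (auto intro!: prod_nonneg prod_le_1)
  have ih: "0 \<le> (-1) ^ r * (alt_sum g P r - ?V)"
     "(-1) ^ r * (alt_sum g P r - ?V) \<le> elem_sym g P (Suc r)" for r
    using insert.IH[of r] insert.prems by auto
  have gq: "0 \<le> g q" "g q \<le> 1" using insert.prems by auto
  show ?case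
  proof (cases r)
    case 0
    have "?V * (1 - g q) \<le> 1" using V gq by (simp add: mult_le_one)
    moreover have "1 - ?V \<le> elem_sym g P (Suc 0)" using ih(2)[of 0] insert.hyps by (simp add: alt_sum_0)
    moreover have "1 - ?V * (1 - g q) = (1 - ?V) + g q * ?V" by (simp add: algebra_simps)
    moreover have "g q * ?V \<le> g q" using V gq by (simp add: mult_left_le)
    ultimately show ?thesis using 0 insert.hyps
      by (simp add: alt_sum_0 elem_sym_insert elem_sym_0 mult.commute)
  next
    case (Suc s)
    \<comment> \<open>Peeling off \<open>q\<close> turns the deviation over the larger set into the
      deviation of the same order over \<open>P\<close> minus \<open>g q\<close> times that of the
      preceding order. The alternating sign makes both contributions nonnegative, and
      \<open>elem_sym\<close> obeys the same recursion.\<close>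
    have "(-1) ^ r * (alt_sum g (insert q P) r - (\<Prod>p\<in>insert q P. 1 - g p))
       = (-1) ^ Suc s * (alt_sum g P (Suc s) - ?V) + g q * ((-1) ^ s * (alt_sum g P s - ?V))"
      using insert.hyps by (simp add: Suc alt_sum_insert algebra_simps)
    moreover have "g q * ((-1) ^ s * (alt_sum g P s - ?V)) \<le> g q * elem_sym g P (Suc s)"
      using ih(2)[of s] gq by (intro mult_left_mono) auto
    moreover have "0 \<le> g q * ((-1) ^ s * (alt_sum g P s - ?V))" using ih(1)[of s] gq by simp
    ultimately show ?thesis using ih[of "Suc s"] insert.hyps by (simp add: elem_sym_insert Suc)
  qed
qed

text \<open>In the expansion of \<open>sum g P ^ r\<close> every product over a subset of size
  \<open>r\<close> occurs \<open>r!\<close> times. The induction needs only the first two terms of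
  the binomial expansion of \<open>(sum g P + g q) ^ r\<close>.\<close>

lemma elem_sym_le:
  assumes "finite P" "\<And>p. p \<in> P \<Longrightarrow> 0 \<le> g p"
  shows "elem_sym g P r \<le> (sum g P) ^ r / fact r"
  using assms
proof (induction P arbitrary: r rule: finite_induct)
  case empty
  then show ?case by (cases r) (auto simp: elem_sym_0 elem_sym_empty_Suc)
next
  case (insert q P)
  have S: "0 \<le> sum g P" and q: "0 \<le> g q" using insert.prems by (auto intro: sum_nonneg)
  show ?case
  proof (cases r)
    case 0
    then show ?thesis using insert.hyps by (simp add: elem_sym_0)
  next
    case (Suc s)
    have mono: "sum g P ^ Suc s + real (Suc s) * g q * sum g P ^ s \<le> (sum g P + g q) ^ Suc s" for s
    proof (induction s)
      case (Suc s)
      have "sum g P ^ Suc (Suc s) + real (Suc (Suc s)) * g q * sum g P ^ Suc s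
         \<le> (sum g P ^ Suc s + real (Suc s) * g q * sum g P ^ s) * (sum g P + g q)"
        using S q by (simp add: algebra_simps)
      also have "\<dots> \<le> (sum g P + g q) ^ Suc s * (sum g P + g q)"
        using Suc S q by (intro mult_right_mono) auto
      finally show ?case by (simp add: mult.commute)
    qed simp
    have "elem_sym g (insert q P) r = elem_sym g P (Suc s) + g q * elem_sym g P s"
      using insert.hyps by (simp add: Suc elem_sym_insert)
    also have "\<dots> \<le> sum g P ^ Suc s / fact (Suc s) + g q * (sum g P ^ s / fact s)"
      using insert.IH[of "Suc s"] insert.IH[of s] insert.prems q
      by (intro add_mono mult_left_mono) (simp_all del: fact_Suc power_Suc)
    also have "\<dots> = (sum g P ^ Suc s + real (Suc s) * g q * sum g P ^ s) / fact (Suc s)"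
      by (simp add: add_divide_distrib del: of_nat_Suc)
    also have "\<dots> \<le> (sum g P + g q) ^ Suc s / fact (Suc s)"
      using mono by (intro divide_right_mono) auto
    finally show ?thesis using insert.hyps Suc by (simp add: add.commute)
  qed
qed

text \<open>Later \<open>\<kappa>\<close> bounds the number of forbidden classes per prime, so the
  left side is what the rounding errors of all sets in a truncated sieve cost together.\<close>

lemma sum_bounded_subsets_le:
  assumes "finite P" "\<kappa> \<ge> 0"
  shows "(\<Sum>D | D \<subseteq> P \<and> card D \<le> r. \<kappa> ^ card D) \<le> (1 + \<kappa> * real (card P)) ^ r"
proof -
  let ?S = "\<lambda>i. {D. D \<subseteq> P \<and> card D = i}"
  have "{D. D \<subseteq> P \<and> card D \<le> r} = (\<Union>i\<in>{..r}. ?S i)" by auto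
  then have "(\<Sum>D | D \<subseteq> P \<and> card D \<le> r. \<kappa> ^ card D) = (\<Sum>i\<le>r. \<Sum>D\<in>?S i. \<kappa> ^ card D)"
    using assms by (simp add: sum.UNION_disjoint disjoint_iff)
  also have "\<dots> \<le> (\<Sum>i\<le>r. real (r choose i) * (\<kappa> * real (card P)) ^ i)"
  proof (rule sum_mono)
    fix i assume i: "i \<in> {..r}"
    have "(\<Sum>D\<in>?S i. \<kappa> ^ card D) = elem_sym (\<lambda>_. \<kappa>) P i"
      unfolding elem_sym_def by (intro sum.cong) auto
    also have "\<dots> \<le> (\<Sum>p\<in>P. \<kappa>) ^ i / fact i" using assms by (intro elem_sym_le) auto
    also have "\<dots> \<le> (\<kappa> * real (card P)) ^ i"
      using divide_left_mono[of 1 "fact i" "(\<kappa> * real (card P)) ^ i"] assms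
      by (simp add: fact_ge_1 mult.commute)
    also have "\<dots> \<le> real (r choose i) * (\<kappa> * real (card P)) ^ i"
    proof -
      have "1 \<le> real (r choose i)" using i by (simp add: Suc_leI)
      then show ?thesis using assms mult_right_mono[of 1 "real (r choose i)" "(\<kappa> * real (card P)) ^ i"] by auto
    qed
    finally show "(\<Sum>D\<in>?S i. \<kappa> ^ card D) \<le> real (r choose i) * (\<kappa> * real (card P)) ^ i" .
  qed
  also have "\<dots> = (1 + \<kappa> * real (card P)) ^ r"
    using binomial_ring[of "\<kappa> * real (card P)" 1 r] by (simp add: add.commute)
  finally show ?thesis .
qed

text \<open>Exchanging the factors one at a time gives telescoping differences, in which the
  remaining factors \<open>x\<close> are enlarged to \<open>y\<close>. This is Hooley's device for a
  lower bound sieve: only upper truncations occur, with a single block replaced by its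
  error.\<close>

lemma prod_diff_le_sum:
  fixes x y e :: "nat \<Rightarrow> real"
  assumes "\<And>j. j < J \<Longrightarrow> 0 \<le> x j" "\<And>j. j < J \<Longrightarrow> x j \<le> y j" "\<And>j. j < J \<Longrightarrow> y j - x j \<le> e j"
  shows "(\<Prod>j<J. y j) - (\<Prod>j<J. x j) \<le> (\<Sum>l<J. \<Prod>j<J. if j = l then e j else y j)"
  using assms
proof (induction J)
  case 0
  then show ?case by simp
next
  case (Suc J)
  let ?X = "\<Prod>j<J. x j" and ?Y = "\<Prod>j<J. y j"
  have pos: "0 \<le> ?X" "0 \<le> ?Y" "?X \<le> ?Y"
    using Suc.prems by (auto intro!: prod_nonneg prod_mono intro: order_trans simp: less_Suc_eq)
  have "(\<Prod>j<Suc J. y j) - (\<Prod>j<Suc J. x j) = (y J - x J) * ?Y + x J * (?Y - ?X)"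
    by (simp add: algebra_simps)
  also have "\<dots> \<le> e J * ?Y + y J * (\<Sum>l<J. \<Prod>j<J. if j = l then e j else y j)"
  proof (rule add_mono)
    show "(y J - x J) * ?Y \<le> e J * ?Y" using Suc.prems pos by (intro mult_right_mono) auto
    have "x J * (?Y - ?X) \<le> y J * (?Y - ?X)" using Suc.prems pos by (intro mult_right_mono) auto
    also have "\<dots> \<le> y J * (\<Sum>l<J. \<Prod>j<J. if j = l then e j else y j)"
      using Suc.prems by (intro mult_left_mono Suc.IH) (auto intro: order_trans simp: less_Suc_eq)
    finally show "x J * (?Y - ?X) \<le> y J * (\<Sum>l<J. \<Prod>j<J. if j = l then e j else y j)" .
  qed
  also have "e J * ?Y = (\<Prod>j<Suc J. if j = J then e j else y j)" by simp
  also have "y J * (\<Sum>l<J. \<Prod>j<J. if j = l then e j else y j) = (\<Sum>l<J. \<Prod>j<Suc J. if j = l then e j else y j)"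
    unfolding sum_distrib_left by (intro sum.cong) (auto simp: mult.commute)
  finally show ?case by simp
qed

text \<open>Multiplying out picks one set in each block. As the blocks are disjoint, both the
  divisibility conditions and the densities combine to those of the union. Coefficients of modulus
  at most \<open>1\<close> let the density errors simply add up.\<close>

lemma block_expansion:
  fixes a :: "'n \<Rightarrow> real" and P :: "nat \<Rightarrow> 'p set" and c :: "nat \<Rightarrow> 'p set \<Rightarrow> real"
  assumes "finite N" and finP: "\<And>j. j < J \<Longrightarrow> finite (P j)"
    and disj: "\<And>i j. i < J \<Longrightarrow> j < J \<Longrightarrow> i \<noteq> j \<Longrightarrow> P i \<inter> P j = {}"
    and dens: "\<And>D. D \<subseteq> (\<Union>j<J. P j) \<Longrightarrow>
       \<bar>(\<Sum>n | n \<in> N \<and> (\<forall>p\<in>D. hit p n). a n) - X * prod g D\<bar> \<le> \<tau> * \<kappa> ^ card D"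
    and c: "\<And>j D. \<bar>c j D\<bar> \<le> 1" and "0 \<le> \<tau>" "0 \<le> \<kappa>"
  shows "\<bar>(\<Sum>n\<in>N. a n * (\<Prod>j<J. \<Sum>D | D \<subseteq> P j \<and> card D \<le> r j. c j D * of_bool (\<forall>p\<in>D. hit p n)))
      - X * (\<Prod>j<J. \<Sum>D | D \<subseteq> P j \<and> card D \<le> r j. c j D * prod g D)\<bar>
      \<le> \<tau> * (\<Prod>j<J. (1 + \<kappa> * real (card (P j))) ^ r j)"
proof -
  define B where "B = (\<lambda>j. {D. D \<subseteq> P j \<and> card D \<le> r j})"
  define F where "F = PiE {..<J} B"
  have finB: "finite (B j)" if "j < J" for j using finP[OF that] by (auto simp: B_def)
  have expand: "(\<Prod>j<J. \<Sum>D\<in>B j. u j D) = (\<Sum>\<phi>\<in>F. \<Prod>j<J. u j (\<phi> j))" for u :: "nat \<Rightarrow> 'p set \<Rightarrow> real"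
    unfolding F_def by (intro prod_sum_PiE) (use finB in auto)
  define U where "U = (\<lambda>\<phi>::nat\<Rightarrow>'p set. \<Union>j<J. \<phi> j)"
  have \<phi>B: "\<phi> j \<subseteq> P j" "finite (\<phi> j)" if "\<phi> \<in> F" "j < J" for \<phi> j
  proof -
    show "\<phi> j \<subseteq> P j" using that by (auto simp: F_def B_def PiE_def Pi_def)
    then show "finite (\<phi> j)" using finP that finite_subset by blast
  qed
  have disj': "\<forall>i\<in>{..<J}. \<forall>j\<in>{..<J}. i \<noteq> j \<longrightarrow> \<phi> i \<inter> \<phi> j = {}" if "\<phi> \<in> F" for \<phi>
    using \<phi>B(1)[OF that] disj by blast
  have U: "prod g (U \<phi>) = (\<Prod>j<J. prod g (\<phi> j))" "card (U \<phi>) = (\<Sum>j<J. card (\<phi> j))"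
    if "\<phi> \<in> F" for \<phi>
    unfolding U_def using \<phi>B[OF that] disj'[OF that]
    by (intro prod.UNION_disjoint card_UN_disjoint; simp)+
  have Usub: "U \<phi> \<subseteq> (\<Union>j<J. P j)" if "\<phi> \<in> F" for \<phi>
    using \<phi>B(1)[OF that] by (auto simp: U_def)
  have ob: "(\<Prod>j<J. of_bool (\<forall>p\<in>\<phi> j. hit p n)) = (of_bool (\<forall>p\<in>U \<phi>. hit p n) :: real)" for \<phi> n
  proof (cases "\<forall>p\<in>U \<phi>. hit p n")
    case True
    then have "\<forall>p\<in>\<phi> j. hit p n" if "j < J" for j using that by (auto simp: U_def)
    then show ?thesis using True by simp
  next
    case False
    then obtain j where "j < J" "\<not> (\<forall>p\<in>\<phi> j. hit p n)" by (auto simp: U_def)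
    then have "(\<Prod>j<J. of_bool (\<forall>p\<in>\<phi> j. hit p n)) = (0::real)" by (intro prod_zero) auto
    then show ?thesis using False by (simp only: of_bool_def if_False)
  qed
  define C where "C = (\<lambda>\<phi>. \<Prod>j<J. c j (\<phi> j))"
  have C: "\<bar>C \<phi>\<bar> \<le> 1" for \<phi> unfolding C_def abs_prod by (intro prod_le_1) (use c in auto)
  have L: "(\<Sum>n\<in>N. a n * (\<Prod>j<J. \<Sum>D\<in>B j. c j D * of_bool (\<forall>p\<in>D. hit p n)))
     = (\<Sum>\<phi>\<in>F. C \<phi> * (\<Sum>n | n \<in> N \<and> (\<forall>p\<in>U \<phi>. hit p n). a n))"
  proof -
    have "(\<Sum>n\<in>N. a n * (\<Prod>j<J. \<Sum>D\<in>B j. c j D * of_bool (\<forall>p\<in>D. hit p n)))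
      = (\<Sum>n\<in>N. \<Sum>\<phi>\<in>F. C \<phi> * (a n * of_bool (\<forall>p\<in>U \<phi>. hit p n)))"
      by (simp only: expand prod.distrib ob C_def sum_distrib_left mult_ac)
    also have "\<dots> = (\<Sum>\<phi>\<in>F. C \<phi> * (\<Sum>n\<in>N. a n * of_bool (\<forall>p\<in>U \<phi>. hit p n)))"
      by (subst sum.swap) (simp add: sum_distrib_left)
    also have "\<dots> = (\<Sum>\<phi>\<in>F. C \<phi> * (\<Sum>n | n \<in> N \<and> (\<forall>p\<in>U \<phi>. hit p n). a n))"
      using \<open>finite N\<close>
      by (intro sum.cong refl arg_cong2[of _ _ _ _ "(*)"] sum.mono_neutral_cong_right) auto
    finally show ?thesis .
  qed
  have R: "X * (\<Prod>j<J. \<Sum>D\<in>B j. c j D * prod g D) = (\<Sum>\<phi>\<in>F. C \<phi> * (X * prod g (U \<phi>)))"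
    unfolding expand by (simp add: prod.distrib C_def U sum_distrib_left mult_ac cong: sum.cong)
  have "\<bar>(\<Sum>n\<in>N. a n * (\<Prod>j<J. \<Sum>D\<in>B j. c j D * of_bool (\<forall>p\<in>D. hit p n)))
      - X * (\<Prod>j<J. \<Sum>D\<in>B j. c j D * prod g D)\<bar>
    = \<bar>\<Sum>\<phi>\<in>F. C \<phi> * ((\<Sum>n | n \<in> N \<and> (\<forall>p\<in>U \<phi>. hit p n). a n) - X * prod g (U \<phi>))\<bar>"
    unfolding L R by (simp add: sum_subtractf right_diff_distrib)
  also have "\<dots> \<le> (\<Sum>\<phi>\<in>F. \<bar>C \<phi>\<bar> * \<bar>(\<Sum>n | n \<in> N \<and> (\<forall>p\<in>U \<phi>. hit p n). a n) - X * prod g (U \<phi>)\<bar>)"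
    by (rule order_trans[OF sum_abs]) (simp add: abs_mult)
  also have "\<dots> \<le> (\<Sum>\<phi>\<in>F. 1 * (\<tau> * \<kappa> ^ card (U \<phi>)))"
    by (intro sum_mono mult_mono dens Usub C) auto
  also have "\<dots> = \<tau> * (\<Sum>\<phi>\<in>F. \<Prod>j<J. \<kappa> ^ card (\<phi> j))"
    by (simp add: sum_distrib_left U power_sum cong: sum.cong)
  also have "\<dots> = \<tau> * (\<Prod>j<J. \<Sum>D\<in>B j. \<kappa> ^ card D)" by (simp only: expand)
  also have "\<dots> \<le> \<tau> * (\<Prod>j<J. (1 + \<kappa> * real (card (P j))) ^ r j)"
    using assms(6-) unfolding B_def
    by (intro mult_left_mono prod_mono conjI sum_nonneg sum_bounded_subsets_le finP) auto
  finally show ?thesis unfolding B_def .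
qed

text \<open>The Brun--Hooley sieve: Bonferroni truncation is done separately in every block of primes.\<close>
lemma brun_hooley:
  fixes a :: "'n \<Rightarrow> real" and P :: "nat \<Rightarrow> 'p set" and g :: "'p \<Rightarrow> real"
  defines "V \<equiv> \<lambda>j. \<Prod>p\<in>P j. 1 - g p"
  assumes "finite N" and finP: "\<And>j. j < J \<Longrightarrow> finite (P j)"
    and disj: "\<And>i j. i < J \<Longrightarrow> j < J \<Longrightarrow> i \<noteq> j \<Longrightarrow> P i \<inter> P j = {}"
    and a: "\<And>n. n \<in> N \<Longrightarrow> 0 \<le> a n"
    and dens: "\<And>D. D \<subseteq> (\<Union>j<J. P j) \<Longrightarrow>
       \<bar>(\<Sum>n | n \<in> N \<and> (\<forall>p\<in>D. hit p n). a n) - X * prod g D\<bar> \<le> \<tau> * \<kappa> ^ card D"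
    and "0 \<le> \<tau>" "0 \<le> \<kappa>" "0 \<le> X"
    and g: "\<And>j p. j < J \<Longrightarrow> p \<in> P j \<Longrightarrow> 0 \<le> g p \<and> g p < 1"
    and \<theta>: "(\<Sum>j<J. elem_sym g (P j) (2 * b j + 1) / V j) \<le> \<theta>" "\<theta> \<le> 1"
  shows "\<bar>(\<Sum>n | n \<in> N \<and> (\<forall>p\<in>(\<Union>j<J. P j). \<not> hit p n). a n) - X * (\<Prod>j<J. V j)\<bar>
     \<le> 3 * \<theta> * X * (\<Prod>j<J. V j)
        + (real J + 1) * (\<tau> * (\<Prod>j<J. (1 + \<kappa> * real (card (P j))) ^ (2 * b j + 1)))"
proof -
  define h where "h = (\<lambda>n p. of_bool (hit p n) :: real)"
  \<comment> \<open>\<open>up\<close> truncates every block at the even order \<open>2 * b j\<close>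
    and so majorises; \<open>lo l\<close> puts the first omitted term, of order
    \<open>2 * b j + 1\<close>, into block \<open>l\<close>. Both are written with sets of size up
    to \<open>2 * b j + 1\<close>, so that one expansion lemma serves for both.\<close>
  define up where "up = (\<lambda>j D. if card (D :: 'p set) \<le> 2 * b j then (-1 :: real) ^ card D else 0)"
  define lo where "lo = (\<lambda>l j D. if j = l then of_bool (card (D :: 'p set) = 2 * b j + 1) else up j D :: real)"
  define R where "R = \<tau> * (\<Prod>j<J. (1 + \<kappa> * real (card (P j))) ^ (2 * b j + 1))"
  have up_sum: "(\<Sum>D | D \<subseteq> P j \<and> card D \<le> 2 * b j + 1. up j D * prod f D) = alt_sum f (P j) (2 * b j)"
    if "j < J" for j and f :: "'p \<Rightarrow> real"
    unfolding alt_sum_def up_def using finP[OF that]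
    by (intro sum.mono_neutral_cong_right) auto
  have lo_sum: "(\<Sum>D | D \<subseteq> P j \<and> card D \<le> 2 * b j + 1. lo l j D * prod f D)
      = (if j = l then elem_sym f (P j) (2 * b j + 1) else alt_sum f (P j) (2 * b j))"
    if "j < J" for j l and f :: "'p \<Rightarrow> real"
  proof (cases "j = l")
    case True
    have "(\<Sum>D | D \<subseteq> P j \<and> card D \<le> 2 * b j + 1. of_bool (card D = 2 * b j + 1) * prod f D)
      = elem_sym f (P j) (2 * b j + 1)"
      unfolding elem_sym_def using finP[OF that]
      by (intro sum.mono_neutral_cong_right) auto
    then show ?thesis using True by (simp add: lo_def)
  next
    case False
    then show ?thesis using up_sum[OF that] by (simp add: lo_def)
  qed
  have hprod: "of_bool (\<forall>p\<in>D. hit p n) = prod (h n) D" if "finite D" for D n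
    using that by (auto simp: h_def of_bool_def prod_zero_iff intro!: prod.neutral[symmetric])
  have hprod': "(\<Sum>D | D \<subseteq> P j \<and> card D \<le> s. c D * of_bool (\<forall>p\<in>D. hit p n))
      = (\<Sum>D | D \<subseteq> P j \<and> card D \<le> s. c D * prod (h n) D)" if "j < J" for j s n and c :: "'p set \<Rightarrow> real"
  proof (rule sum.cong)
    fix D assume "D \<in> {D. D \<subseteq> P j \<and> card D \<le> s}"
    then have "finite D" using finP[OF that] finite_subset by blast
    then show "c D * of_bool (\<forall>p\<in>D. hit p n) = c D * prod (h n) D" by (simp only: hprod)
  qed simp
  define T where "T = (\<lambda>n j. alt_sum (h n) (P j) (2 * b j))"
  define x where "x = (\<lambda>n j. \<Prod>p\<in>P j. 1 - h n p)"
  define e where "e = (\<lambda>n j. elem_sym (h n) (P j) (2 * b j + 1))"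
  define G where "G = (\<lambda>j. alt_sum g (P j) (2 * b j))"
  define E where "E = (\<lambda>j. elem_sym g (P j) (2 * b j + 1))"
  have bonf_n: "0 \<le> x n j" "x n j \<le> T n j" "T n j - x n j \<le> e n j" if "j < J" for n j
  proof -
    show "0 \<le> x n j" unfolding x_def h_def by (intro prod_nonneg) auto
    have "0 \<le> (- 1) ^ (2 * b j) * (alt_sum (h n) (P j) (2 * b j) - (\<Prod>p\<in>P j. 1 - h n p)) \<and>
      (- 1) ^ (2 * b j) * (alt_sum (h n) (P j) (2 * b j) - (\<Prod>p\<in>P j. 1 - h n p)) \<le> elem_sym (h n) (P j) (Suc (2 * b j))"
      by (intro bonferroni finP that) (auto simp: h_def)
    then show "x n j \<le> T n j" "T n j - x n j \<le> e n j" by (auto simp: x_def T_def e_def)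
  qed
  have bonf: "0 < V j" "V j \<le> G j" "G j - V j \<le> E j" "0 \<le> E j" if "j < J" for j
  proof -
    show "0 < V j" unfolding V_def using g[OF that] by (intro prod_pos) auto
    have "0 \<le> (- 1) ^ (2 * b j) * (alt_sum g (P j) (2 * b j) - (\<Prod>p\<in>P j. 1 - g p)) \<and>
      (- 1) ^ (2 * b j) * (alt_sum g (P j) (2 * b j) - (\<Prod>p\<in>P j. 1 - g p)) \<le> elem_sym g (P j) (Suc (2 * b j))"
      using g[OF that] by (intro bonferroni finP that) (auto simp: less_imp_le)
    then show "V j \<le> G j" "G j - V j \<le> E j" by (auto simp: V_def G_def E_def)
    show "0 \<le> E j" unfolding E_def using g[OF that] by (intro elem_sym_nonneg) auto
  qed
  define S where "S = (\<Sum>n | n \<in> N \<and> (\<forall>p\<in>(\<Union>j<J. P j). \<not> hit p n). a n)"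
  have S: "S = (\<Sum>n\<in>N. a n * (\<Prod>j<J. x n j))"
  proof -
    have "(\<Prod>j<J. x n j) = of_bool (\<forall>p\<in>(\<Union>j<J. P j). \<not> hit p n)" for n
    proof (cases "\<forall>p\<in>(\<Union>j<J. P j). \<not> hit p n")
      case True
      then have "(\<Prod>j<J. x n j) = 1"
        unfolding x_def by (intro prod.neutral ballI) (auto simp: h_def)
      then show ?thesis using True by simp
    next
      case False
      then obtain j p where jp: "j < J" "p \<in> P j" "hit p n" by auto
      then have "x n j = 0" unfolding x_def using finP by (intro prod_zero) (auto simp: h_def)
      then have "(\<Prod>j<J. x n j) = 0" using jp by (intro prod_zero) auto
      then show ?thesis using False by (simp only: of_bool_def if_False)
    qed
    then show ?thesis unfolding S_def using \<open>finite N\<close>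
      by (intro sum.mono_neutral_cong_left) auto
  qed
  have prodle: "(\<Prod>j<J. x n j) \<le> (\<Prod>j<J. T n j)" for n
    using bonf_n by (intro prod_mono) auto
  have Tev: "\<bar>(\<Sum>n\<in>N. a n * (\<Prod>j<J. T n j)) - X * (\<Prod>j<J. G j)\<bar> \<le> R"
  proof -
    have 1: "(\<Prod>j<J. \<Sum>D | D \<subseteq> P j \<and> card D \<le> 2 * b j + 1. up j D * of_bool (\<forall>p\<in>D. hit p n)) = (\<Prod>j<J. T n j)" for n
      unfolding T_def by (intro prod.cong refl) (simp only: hprod' up_sum lessThan_iff)
    have 2: "(\<Prod>j<J. \<Sum>D | D \<subseteq> P j \<and> card D \<le> 2 * b j + 1. up j D * prod g D) = (\<Prod>j<J. G j)"
      unfolding G_def by (intro prod.cong refl up_sum) simp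
    show ?thesis unfolding R_def 1[symmetric] 2[symmetric]
      by (rule block_expansion) (use assms in \<open>auto simp: up_def\<close>)
  qed
  have eev: "\<bar>(\<Sum>n\<in>N. a n * (\<Prod>j<J. if j = l then e n j else T n j)) - X * (\<Prod>j<J. if j = l then E j else G j)\<bar> \<le> R" for l
  proof -
    have 1: "(\<Prod>j<J. \<Sum>D | D \<subseteq> P j \<and> card D \<le> 2 * b j + 1. lo l j D * of_bool (\<forall>p\<in>D. hit p n)) = (\<Prod>j<J. if j = l then e n j else T n j)" for n
      unfolding T_def e_def by (intro prod.cong refl) (simp only: hprod' lo_sum lessThan_iff)
    have 2: "(\<Prod>j<J. \<Sum>D | D \<subseteq> P j \<and> card D \<le> 2 * b j + 1. lo l j D * prod g D) = (\<Prod>j<J. if j = l then E j else G j)"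
      unfolding G_def E_def by (intro prod.cong refl lo_sum) simp
    show ?thesis unfolding R_def 1[symmetric] 2[symmetric]
      by (rule block_expansion) (use assms in \<open>auto simp: lo_def up_def\<close>)
  qed
  define W where "W = (\<Prod>j<J. V j)"
  define u where "u = (\<lambda>j. E j / V j)"
  have u: "0 \<le> u j" if "j < J" for j using bonf[OF that] by (simp add: u_def)
  have usum: "(\<Sum>j<J. u j) \<le> \<theta>" using \<theta>(1) by (simp add: u_def E_def)
  have \<theta>0: "0 \<le> \<theta>" using usum u by (meson lessThan_iff order_trans sum_nonneg)
  have W: "0 < W" unfolding W_def using bonf by (intro prod_pos) auto
  have expu: "(\<Prod>j<J. 1 + u j) \<le> 1 + 2 * \<theta>" "(\<Prod>j<J. 1 + u j) \<le> 3"
  proof -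
    have "(\<Prod>j<J. 1 + u j) \<le> (\<Prod>j<J. exp (u j))"
      using u by (intro prod_mono) (auto intro: add_nonneg_nonneg)
    also have "\<dots> = exp (\<Sum>j<J. u j)" by (simp add: exp_sum)
    also have "\<dots> \<le> exp \<theta>" using usum by simp
    also have "\<dots> \<le> 1 + \<theta> + \<theta>\<^sup>2" using \<theta>0 \<theta>(2) by (intro exp_bound)
    also have "\<dots> \<le> 1 + 2 * \<theta>" using \<theta>0 \<theta>(2) by (simp add: power2_eq_square mult_left_le)
    finally show "(\<Prod>j<J. 1 + u j) \<le> 1 + 2 * \<theta>" .
    then show "(\<Prod>j<J. 1 + u j) \<le> 3" using \<theta>(2) by simp
  qed
  have GV: "G j \<le> V j * (1 + u j)" if "j < J" for j
  proof -
    have "V j * (1 + u j) = V j + E j" using bonf(1)[OF that] by (simp add: u_def field_simps)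
    then show ?thesis using bonf(3)[OF that] by simp
  qed
  have Gup: "(\<Prod>j<J. G j) \<le> W * (\<Prod>j<J. 1 + u j)"
    unfolding W_def prod.distrib[symmetric] using GV bonf
    by (intro prod_mono) (auto intro: less_imp_le order_trans[OF less_imp_le])
  have Glo: "W \<le> (\<Prod>j<J. G j)"
    unfolding W_def using bonf by (intro prod_mono) (auto intro: less_imp_le)
  \<comment> \<open>\<open>u l\<close> is the relative truncation error of block \<open>l\<close>,
    and all blocks together exceed their true products by a factor of at most \<open>3\<close>. So
    the corrections cost at most \<open>3 * u l\<close> each relative to \<open>W\<close>, and
    \<open>3 * \<theta>\<close> in total.\<close>
  have El: "(\<Prod>j<J. if j = l then E j else G j) \<le> u l * (W * 3)" if "l < J" for l
  proof -
    have "(\<Prod>j<J. if j = l then E j else G j) \<le> (\<Prod>j<J. (if j = l then u l else 1) * (V j * (1 + u j)))"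
    proof (intro prod_mono conjI)
      fix j assume j: "j \<in> {..<J}"
      show "0 \<le> (if j = l then E j else G j)" using bonf[of j] j by auto
      have "E j = u j * V j" using bonf[of j] j by (simp add: u_def)
      moreover have "u j * V j \<le> u j * (V j * (1 + u j))"
        using bonf[of j] u[of j] j by (intro mult_left_mono) (auto simp: algebra_simps)
      ultimately show "(if j = l then E j else G j) \<le> (if j = l then u l else 1) * (V j * (1 + u j))"
        using GV[of j] j by auto
    qed
    also have "\<dots> = u l * (W * (\<Prod>j<J. 1 + u j))"
      using that by (simp add: prod.distrib W_def)
    also have "\<dots> \<le> u l * (W * 3)"
      using expu(2) W u[OF that] by (intro mult_left_mono) auto
    finally show ?thesis .
  qed
  have R0: "0 \<le> R" using assms by (auto simp: R_def intro!: mult_nonneg_nonneg prod_nonneg)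
  have upper: "S - X * W \<le> 3 * \<theta> * X * W + (real J + 1) * R"
  proof -
    have "S \<le> (\<Sum>n\<in>N. a n * (\<Prod>j<J. T n j))" unfolding S using a prodle by (intro sum_mono mult_left_mono) auto
    also have "\<dots> \<le> X * (\<Prod>j<J. G j) + R" using Tev by linarith
    also have "X * (\<Prod>j<J. G j) \<le> X * (W * (1 + 2 * \<theta>))"
      using Gup expu(1) W \<open>0 \<le> X\<close> by (intro mult_left_mono order_trans[OF Gup]) auto
    finally have "S - X * W \<le> 2 * \<theta> * X * W + R" by (simp add: algebra_simps)
    also have "\<dots> \<le> 3 * \<theta> * X * W + (real J + 1) * R"
      using \<theta>0 \<open>0 \<le> X\<close> W R0 by (intro add_mono mult_right_mono) (auto simp: algebra_simps)
    finally show ?thesis .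
  qed
  have lower: "X * W - S \<le> 3 * \<theta> * X * W + (real J + 1) * R"
  proof -
    have "(\<Prod>j<J. T n j) - (\<Prod>j<J. x n j) \<le> (\<Sum>l<J. \<Prod>j<J. if j = l then e n j else T n j)" for n
      using bonf_n by (intro prod_diff_le_sum) auto
    then have "(\<Sum>n\<in>N. a n * ((\<Prod>j<J. T n j) - (\<Prod>j<J. x n j)))
       \<le> (\<Sum>n\<in>N. a n * (\<Sum>l<J. \<Prod>j<J. if j = l then e n j else T n j))"
      using a by (intro sum_mono mult_left_mono) auto
    then have "(\<Sum>n\<in>N. a n * (\<Prod>j<J. T n j)) - S \<le> (\<Sum>l<J. \<Sum>n\<in>N. a n * (\<Prod>j<J. if j = l then e n j else T n j))"
      unfolding S by (subst sum.swap) (simp add: right_diff_distrib sum_subtractf sum_distrib_left)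
    also have "\<dots> \<le> (\<Sum>l<J. X * (u l * (W * 3)) + R)"
    proof (rule sum_mono)
      fix l assume "l \<in> {..<J}"
      then have "X * (\<Prod>j<J. if j = l then E j else G j) \<le> X * (u l * (W * 3))"
        using El \<open>0 \<le> X\<close> by (intro mult_left_mono) auto
      then show "(\<Sum>n\<in>N. a n * (\<Prod>j<J. if j = l then e n j else T n j)) \<le> X * (u l * (W * 3)) + R"
        using eev[of l] by linarith
    qed
    also have "\<dots> = 3 * X * W * (\<Sum>l<J. u l) + real J * R"
      by (simp add: sum.distrib sum_distrib_left sum_distrib_right mult_ac)
    also have "\<dots> \<le> 3 * X * W * \<theta> + real J * R"
      using usum W \<open>0 \<le> X\<close> by (intro add_right_mono mult_left_mono) auto
    finally have "(\<Sum>n\<in>N. a n * (\<Prod>j<J. T n j)) - S \<le> 3 * X * W * \<theta> + real J * R" .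
    moreover have "X * W \<le> X * (\<Prod>j<J. G j)" using Glo \<open>0 \<le> X\<close> by (intro mult_left_mono)
    ultimately show ?thesis using Tev by (simp add: algebra_simps)
  qed
  show ?thesis using upper lower unfolding S_def W_def R_def by (simp add: abs_le_iff)
qed

section \<open>Partial summation and sums over residue classes\<close>

text \<open>The induction keeps the boundary term \<open>g Y * S Y\<close> apart: the differences of
  the decreasing weight telescope to \<open>g (Suc X) - g Y\<close>, and the boundary term restores
  \<open>g Y\<close>. The values lie in a normed space because both real indicator functions and
  complex characters are summed.\<close>

lemma abel_bound:
  fixes a :: "nat \<Rightarrow> 'a::real_normed_vector" and g :: "nat \<Rightarrow> real"
  assumes A: "\<And>t. norm (\<Sum>n\<in>{X<..t}. a n) \<le> B"
    and g: "\<And>n. X < n \<Longrightarrow> 0 \<le> g n" "\<And>m n. X < m \<Longrightarrow> m \<le> n \<Longrightarrow> g n \<le> g m"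
  shows "norm (\<Sum>n\<in>{X<..Y}. g n *\<^sub>R a n) \<le> B * g (Suc X)"
proof (cases "Y \<le> X")
  case True
  have "0 \<le> B" using A[of 0] norm_ge_zero order_trans by blast
  then show ?thesis using True g(1)[of "Suc X"] by simp
next
  case False
  define S where "S = (\<lambda>t. \<Sum>n\<in>{X<..t}. a n)"
  have B: "0 \<le> B" using A[of 0] norm_ge_zero order_trans by blast
  have "norm ((\<Sum>n\<in>{X<..Suc X + d}. g n *\<^sub>R a n) - g (Suc X + d) *\<^sub>R S (Suc X + d))
     \<le> B * (g (Suc X) - g (Suc X + d))" for d
  proof (induction d)
    case 0
    have "{X<..Suc X} = {Suc X}" by auto
    then show ?case by (simp add: S_def)
  next
    case (Suc d)
    let ?t = "Suc X + d"
    have I: "{X<..Suc ?t} = insert (Suc ?t) {X<..?t}" by auto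
    have eq: "(\<Sum>n\<in>{X<..Suc ?t}. g n *\<^sub>R a n) - g (Suc ?t) *\<^sub>R S (Suc ?t)
      = ((\<Sum>n\<in>{X<..?t}. g n *\<^sub>R a n) - g ?t *\<^sub>R S ?t) + (g ?t - g (Suc ?t)) *\<^sub>R S ?t"
      unfolding S_def I by (simp add: algebra_simps)
    have "norm ((\<Sum>n\<in>{X<..Suc ?t}. g n *\<^sub>R a n) - g (Suc ?t) *\<^sub>R S (Suc ?t))
      \<le> norm ((\<Sum>n\<in>{X<..?t}. g n *\<^sub>R a n) - g ?t *\<^sub>R S ?t) + norm ((g ?t - g (Suc ?t)) *\<^sub>R S ?t)"
      unfolding eq by (rule norm_triangle_ineq)
    also have "norm ((g ?t - g (Suc ?t)) *\<^sub>R S ?t) \<le> (g ?t - g (Suc ?t)) * B"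
      using g(2)[of ?t "Suc ?t"] A[of ?t] by (simp add: S_def mult_left_mono)
    finally show ?case using Suc by (simp add: algebra_simps)
  qed
  from this[of "Y - Suc X"] False
  have "norm ((\<Sum>n\<in>{X<..Y}. g n *\<^sub>R a n) - g Y *\<^sub>R S Y) \<le> B * (g (Suc X) - g Y)" by simp
  moreover have "norm (g Y *\<^sub>R S Y) \<le> g Y * B"
    using A[of Y] g(1)[of Y] False by (simp add: S_def mult_left_mono)
  moreover have "norm (\<Sum>n\<in>{X<..Y}. g n *\<^sub>R a n)
    \<le> norm ((\<Sum>n\<in>{X<..Y}. g n *\<^sub>R a n) - g Y *\<^sub>R S Y) + norm (g Y *\<^sub>R S Y)"
    by (metis diff_add_cancel norm_triangle_ineq)
  ultimately show ?thesis by (simp add: algebra_simps)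
qed

text \<open>Whole windows of length \<open>M\<close> cancel, so a sum of any length reduces to fewer
  than \<open>M\<close> terms.\<close>

lemma interval_sum_periodic:
  fixes a :: "nat \<Rightarrow> 'a::comm_monoid_add"
  assumes M: "M > 0" and block: "\<And>X. (\<Sum>n\<in>{X<..X + M}. a n) = 0"
  shows "(\<Sum>n\<in>{X<..X + t}. a n) = (\<Sum>n\<in>{X + (t - t mod M)<..X + t}. a n)"
proof (induction t rule: less_induct)
  case (less t)
  show ?case
  proof (cases "t < M")
    case False
    have shift: "(\<Sum>n\<in>{X + (s - s mod M)<..X + s}. a n) = (\<Sum>n\<in>{X<..X + s}. a n)" if "s < t" for s
      using less.IH[OF that] by simp
    have q0: "(\<Sum>n\<in>{X<..X + M * q}. a n) = 0" for q
    proof (induction q)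
      case (Suc q)
      have "{X<..X + M * Suc q} = {X<..X + M * q} \<union> {X + M * q<..X + M * q + M}" by auto
      moreover have "{X<..X + M * q} \<inter> {X + M * q<..X + M * q + M} = {}" by auto
      ultimately show ?case using Suc block[of "X + M * q"] by (simp add: sum.union_disjoint)
    qed simp
    have e: "t - t mod M = M * (t div M)" by (simp add: minus_mod_eq_mult_div)
    have "{X<..X + t} = {X<..X + M * (t div M)} \<union> {X + M * (t div M)<..X + t}"
      using e by (auto simp: less_eq_Suc_le)
    moreover have "{X<..X + M * (t div M)} \<inter> {X + M * (t div M)<..X + t} = {}" by auto
    ultimately have "(\<Sum>n\<in>{X<..X + t}. a n) =
      (\<Sum>n\<in>{X<..X + M * (t div M)}. a n) + (\<Sum>n\<in>{X + M * (t div M)<..X + t}. a n)"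
      by (simp add: sum.union_disjoint)
    then show ?thesis using e q0 by simp
  qed simp
qed

lemma card_residue_block:
  fixes M r :: nat
  assumes "M > 0"
  shows "card {n \<in> {X<..X + M}. [n = r] (mod M)} = 1"
proof -
  \<comment> \<open>The summand \<open>M * Suc X\<close> keeps the natural subtraction
    exact.\<close>
  have "{n \<in> {X<..X + M}. [n = r] (mod M)} = {Suc X + (r + M * Suc X - Suc X) mod M}"
  proof (intro equalityI subsetI)
    have le: "Suc X \<le> r + M * Suc X" using assms by (cases M) auto
    have "(Suc X + (r + M * Suc X - Suc X) mod M) mod M = (Suc X + (r + M * Suc X - Suc X)) mod M"
      by (rule mod_add_right_eq)
    also have "\<dots> = (r + M * Suc X) mod M" using le by (simp only: le_add_diff_inverse)
    also have "\<dots> = r mod M" by (rule mod_mult_self2)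
    finally have cong: "[Suc X + (r + M * Suc X - Suc X) mod M = r] (mod M)"
      by (simp only: Cong.cong_def)
    show "n \<in> {n \<in> {X<..X + M}. [n = r] (mod M)}" if "n \<in> {Suc X + (r + M * Suc X - Suc X) mod M}" for n
    proof -
      have "(r + M * Suc X - Suc X) mod M < M" using assms by simp
      then have "Suc X + (r + M * Suc X - Suc X) mod M \<in> {X<..X + M}"
        by (simp add: Suc_le_eq del: mult_Suc_right)
      then show ?thesis using cong that by blast
    qed
    fix n assume n: "n \<in> {n \<in> {X<..X + M}. [n = r] (mod M)}"
    define m where "m = Suc X + (r + M * Suc X - Suc X) mod M"
    have m: "X < m" "m \<le> X + M" using assms mod_less_divisor[OF assms, of "r + M * Suc X - Suc X"]
      unfolding m_def by linarith+
    have "[n = m] (mod M)" using n cong unfolding m_def by (metis (no_types, lifting) cong_sym cong_trans mem_Collect_eq)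
    then have eq: "n mod M = m mod M" by (simp only: Cong.cong_def)
    have "n = m"
    proof (cases "n \<le> m")
      case True
      then have "M dvd m - n" using eq mod_eq_dvd_iff_nat[of n m M] by simp
      moreover have "m - n < M" using n m by auto
      ultimately show ?thesis using True by (auto dest: dvd_imp_le)
    next
      case False
      then have "M dvd n - m" using eq mod_eq_dvd_iff_nat[of m n M] by simp
      moreover have "n - m < M" using n m by auto
      ultimately show ?thesis using False by (auto dest: dvd_imp_le)
    qed
    then show "n \<in> {Suc X + (r + M * Suc X - Suc X) mod M}" by (simp add: m_def)
  qed
  then show ?thesis by simp
qed

text \<open>Subtracting the mean \<open>1 / M\<close> from the indicator of the class leaves a
  function whose sums over windows of length \<open>M\<close> vanish, hence with partial sums
  bounded by \<open>1\<close>; partial summation brings in the weight.\<close>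

lemma residue_class_sum:
  fixes g :: "nat \<Rightarrow> real"
  assumes M: "M > 0" and g: "\<And>n. X < n \<Longrightarrow> 0 \<le> g n" "\<And>m n. X < m \<Longrightarrow> m \<le> n \<Longrightarrow> g n \<le> g m"
  shows "\<bar>(\<Sum>n | n \<in> {X<..Y} \<and> [n = r] (mod M). g n) - (\<Sum>n\<in>{X<..Y}. g n) / real M\<bar> \<le> g (Suc X)"
proof -
  define a :: "nat \<Rightarrow> real" where "a = (\<lambda>n. of_bool ([n = r] (mod M)) - 1 / real M)"
  have sa: "(\<Sum>n\<in>{u<..v}. a n) = real (card {n \<in> {u<..v}. [n = r] (mod M)}) - real (v - u) / real M" for u v
  proof -
    have "(\<Sum>n\<in>{u<..v}. a n) = (\<Sum>n\<in>{u<..v}. of_bool ([n = r] (mod M))) - real (v - u) / real M"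
      unfolding a_def by (simp add: sum_subtractf)
    also have "(\<Sum>n\<in>{u<..v}. of_bool ([n = r] (mod M))) = real (card {n \<in> {u<..v}. [n = r] (mod M)})"
      by (simp add: of_bool_def sum.If_cases Int_def)
    finally show ?thesis .
  qed
  have block: "(\<Sum>n\<in>{u<..u + M}. a n) = 0" for u
    using card_residue_block[OF M, of u r] M unfolding sa by simp
  have A: "norm (\<Sum>n\<in>{X<..t}. a n) \<le> 1" for t
  proof (cases "t \<le> X")
    case False
    define s where "s = t - X"
    define u where "u = X + (s - s mod M)"
    have "(\<Sum>n\<in>{X<..t}. a n) = (\<Sum>n\<in>{u<..X + s}. a n)"
      using interval_sum_periodic[OF M, of a X s] block False by (simp add: s_def u_def)
    moreover have us: "X + s - u = s mod M"
      using mod_less_eq_dividend[of s M] unfolding u_def by linarith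
    have "card {n \<in> {u<..X + s}. [n = r] (mod M)} \<le> card {n \<in> {u<..u + M}. [n = r] (mod M)}"
    proof (intro card_mono)
      have "s mod M < M" using M by simp
      then show "{n \<in> {u<..X + s}. [n = r] (mod M)} \<subseteq> {n \<in> {u<..u + M}. [n = r] (mod M)}"
        using us by auto
    qed simp
    then have "card {n \<in> {u<..X + s}. [n = r] (mod M)} \<le> 1" using card_residue_block[OF M] by simp
    moreover have "real (s mod M) / real M \<le> 1" using M by (simp add: less_imp_le)
    moreover have "0 \<le> real (s mod M) / real M" by simp
    moreover have "real (card {n \<in> {u<..X + s}. [n = r] (mod M)}) \<le> 1"
      using \<open>card {n \<in> {u<..X + s}. [n = r] (mod M)} \<le> 1\<close> by linarith
    ultimately show ?thesis unfolding sa us real_norm_def by linarith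
  qed simp
  have "norm (\<Sum>n\<in>{X<..Y}. g n *\<^sub>R a n) \<le> 1 * g (Suc X)" by (rule abel_bound[OF A g])
  moreover have "(\<Sum>n\<in>{X<..Y}. g n *\<^sub>R a n) =
     (\<Sum>n | n \<in> {X<..Y} \<and> [n = r] (mod M). g n) - (\<Sum>n\<in>{X<..Y}. g n) / real M"
  proof -
    have "(\<Sum>n\<in>{X<..Y}. g n * of_bool ([n = r] (mod M))) = (\<Sum>n | n \<in> {X<..Y} \<and> [n = r] (mod M). g n)"
      by (intro sum.mono_neutral_cong_right) auto
    then show ?thesis by (simp add: a_def right_diff_distrib sum_subtractf sum_divide_distrib)
  qed
  ultimately show ?thesis by simp
qed

lemma sum_partition_card:
  fixes F :: "nat \<Rightarrow> real"
  assumes "finite N" "finite T"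
  shows "(\<Sum>n | n \<in> N \<and> h n \<in> T. F n) = (\<Sum>t\<in>T. \<Sum>n | n \<in> N \<and> h n = t. F n)"
proof -
  have "{n. n \<in> N \<and> h n \<in> T} = (\<Union>t\<in>T. {n. n \<in> N \<and> h n = t})" by auto
  then show ?thesis using assms by (simp add: sum.UNION_disjoint disjoint_iff)
qed

lemma mod_insert_cong:
  fixes p M r t :: nat
  assumes "coprime p M" "t < p"
  obtains r' where "\<And>n. [n = r'] (mod (M * p)) \<longleftrightarrow> [n = r] (mod M) \<and> n mod p = t"
proof -
  obtain r' where r': "[r' = r] (mod M)" "[r' = t] (mod p)"
    using binary_chinese_remainder_nat[of M p r t] assms by (auto simp: coprime_commute)
  have "[n = r'] (mod (M * p)) \<longleftrightarrow> [n = r] (mod M) \<and> n mod p = t" for n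
  proof -
    have "[n = r'] (mod (M * p)) \<longleftrightarrow> [n = r'] (mod M) \<and> [n = r'] (mod p)"
      using coprime_cong_mult_nat[of n r' M p] cong_modulus_mult_nat[of n r' M p]
        cong_modulus_mult_nat[of n r' p M] assms(1) by (auto simp: mult.commute coprime_commute)
    moreover have "[n = r'] (mod M) \<longleftrightarrow> [n = r] (mod M)" using r' by (meson cong_sym cong_trans)
    moreover have "[n = r'] (mod p) \<longleftrightarrow> n mod p = t"
    proof -
      have "r' mod p = t" using r'(2) assms(2) by (simp add: Cong.cong_def)
      then show ?thesis by (simp add: Cong.cong_def)
    qed
    ultimately show ?thesis by simp
  qed
  then show ?thesis using that by blast
qed

text \<open>Residue conditions modulo finitely many primes are resolved one prime at a time by the
  Chinese remainder theorem, so that no count of residue classes modulo the product is needed.\<close>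
lemma sifted_density:
  fixes g :: "nat \<Rightarrow> real" and \<Omega> :: "nat \<Rightarrow> nat set"
  assumes "finite D" and M: "M > 0"
    and g: "\<And>n. X < n \<Longrightarrow> 0 \<le> g n" "\<And>m n. X < m \<Longrightarrow> m \<le> n \<Longrightarrow> g n \<le> g m"
    and D: "\<And>p. p \<in> D \<Longrightarrow> prime p \<and> \<Omega> p \<subseteq> {..<p} \<and> (coprime p M \<or> \<Omega> p = {})"
  shows "\<bar>(\<Sum>n | n \<in> {X<..Y} \<and> [n = r] (mod M) \<and> (\<forall>p\<in>D. n mod p \<in> \<Omega> p). g n)
     - (\<Sum>n\<in>{X<..Y}. g n) / real M * (\<Prod>p\<in>D. real (card (\<Omega> p)) / real p)\<bar>
     \<le> g (Suc X) * (\<Prod>p\<in>D. real (card (\<Omega> p)))"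
  using assms(1) M D
proof (induction D arbitrary: M r rule: finite_induct)
  case empty
  then show ?case using residue_class_sum[of M X g Y r] g by simp
next
  case (insert q D)
  let ?H = "\<Sum>n\<in>{X<..Y}. g n"
  let ?pr = "\<Prod>p\<in>D. real (card (\<Omega> p)) / real p"
  let ?pc = "\<Prod>p\<in>D. real (card (\<Omega> p))"
  have q: "prime q" "\<Omega> q \<subseteq> {..<q}" and q': "coprime q M \<or> \<Omega> q = {}" using insert.prems by auto
  have fin: "finite (\<Omega> q)" using q(2) finite_subset by blast
  have split: "(\<Sum>n | n \<in> {X<..Y} \<and> [n = r] (mod M) \<and> (\<forall>p\<in>insert q D. n mod p \<in> \<Omega> p). g n)
     = (\<Sum>t\<in>\<Omega> q. \<Sum>n | n \<in> {X<..Y} \<and> [n = r] (mod M) \<and> n mod q = t \<and> (\<forall>p\<in>D. n mod p \<in> \<Omega> p). g n)"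
  proof -
    have "(\<Sum>n | n \<in> {n\<in>{X<..Y}. [n = r] (mod M) \<and> (\<forall>p\<in>D. n mod p \<in> \<Omega> p)} \<and> n mod q \<in> \<Omega> q. g n) =
      (\<Sum>t\<in>\<Omega> q. \<Sum>n | n \<in> {n\<in>{X<..Y}. [n = r] (mod M) \<and> (\<forall>p\<in>D. n mod p \<in> \<Omega> p)} \<and> n mod q = t. g n)"
      using fin by (intro sum_partition_card) auto
    moreover have "{n. n \<in> {n\<in>{X<..Y}. [n = r] (mod M) \<and> (\<forall>p\<in>D. n mod p \<in> \<Omega> p)} \<and> n mod q \<in> \<Omega> q}
        = {n. n \<in> {X<..Y} \<and> [n = r] (mod M) \<and> (\<forall>p\<in>insert q D. n mod p \<in> \<Omega> p)}" by blast
    moreover have "{n. n \<in> {n\<in>{X<..Y}. [n = r] (mod M) \<and> (\<forall>p\<in>D. n mod p \<in> \<Omega> p)} \<and> n mod q = t}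
        = {n. n \<in> {X<..Y} \<and> [n = r] (mod M) \<and> n mod q = t \<and> (\<forall>p\<in>D. n mod p \<in> \<Omega> p)}" for t by blast
    ultimately show ?thesis by simp
  qed
  have each: "\<bar>(\<Sum>n | n \<in> {X<..Y} \<and> [n = r] (mod M) \<and> n mod q = t \<and> (\<forall>p\<in>D. n mod p \<in> \<Omega> p). g n)
     - ?H / real M * ?pr / real q\<bar> \<le> g (Suc X) * ?pc" if t: "t \<in> \<Omega> q" for t
  proof -
    have cop: "coprime q M" using q' t by auto
    obtain r' where r': "\<And>n. [n = r'] (mod (M * q)) \<longleftrightarrow> [n = r] (mod M) \<and> n mod q = t"
      using mod_insert_cong[OF cop, of t r] q(2) t by blast
    have "\<bar>(\<Sum>n | n \<in> {X<..Y} \<and> [n = r'] (mod (M * q)) \<and> (\<forall>p\<in>D. n mod p \<in> \<Omega> p). g n)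
     - ?H / real (M * q) * ?pr\<bar> \<le> g (Suc X) * ?pc"
    proof (rule insert.IH)
      show "M * q > 0" using insert.prems(1) q(1) by (simp add: prime_gt_0_nat)
      fix p assume p: "p \<in> D"
      then have "p \<noteq> q" using insert.hyps by auto
      then show "prime p \<and> \<Omega> p \<subseteq> {..<p} \<and> (coprime p (M * q) \<or> \<Omega> p = {})"
        using insert.prems(2)[of p] p q(1) by (auto simp: primes_coprime)
    qed
    then show ?thesis by (simp add: r' mult.commute)
  qed
  have "\<bar>(\<Sum>t\<in>\<Omega> q. (\<Sum>n | n \<in> {X<..Y} \<and> [n = r] (mod M) \<and> n mod q = t \<and> (\<forall>p\<in>D. n mod p \<in> \<Omega> p). g n)
     - ?H / real M * ?pr / real q)\<bar> \<le> (\<Sum>t\<in>\<Omega> q. g (Suc X) * ?pc)"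
    by (rule order_trans[OF sum_abs sum_mono]) (use each in auto)
  then show ?case using insert.hyps unfolding split by (simp add: sum_subtractf mult_ac)
qed

section \<open>Dirichlet characters\<close>

definition dchar :: "nat \<Rightarrow> (nat \<Rightarrow> complex) \<Rightarrow> bool" where
  "dchar Q \<xi> \<longleftrightarrow> (\<forall>m n. \<xi> (m * n) = \<xi> m * \<xi> n) \<and> (\<forall>n. \<xi> (n + Q) = \<xi> n) \<and> (\<forall>n. \<xi> n \<noteq> 0 \<longleftrightarrow> coprime n Q)"

definition dchars :: "nat \<Rightarrow> (nat \<Rightarrow> complex) set" where
  "dchars Q = {\<xi>. dchar Q \<xi>}"

definition principal :: "nat \<Rightarrow> nat \<Rightarrow> complex" where
  "principal Q n = of_bool (coprime n Q)"

lemma dchar_mult: "dchar Q \<xi> \<Longrightarrow> \<xi> (m * n) = \<xi> m * \<xi> n"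
  and dchar_nonzero: "dchar Q \<xi> \<Longrightarrow> \<xi> n \<noteq> 0 \<longleftrightarrow> coprime n Q"
  by (auto simp: dchar_def)

lemma dchar_add: assumes "dchar Q \<xi>" shows "\<xi> (n + k * Q) = \<xi> n"
proof (induction k)
  case (Suc k)
  have "n + Suc k * Q = (n + k * Q) + Q" by simp
  then show ?case using assms Suc by (simp only: dchar_def)
qed simp

lemma dchar_mod: assumes "dchar Q \<xi>" shows "\<xi> (n mod Q) = \<xi> n"
  using dchar_add[OF assms, of "n mod Q" "n div Q"] by simp

lemma dchar_cong: assumes "dchar Q \<xi>" "[m = n] (mod Q)" shows "\<xi> m = \<xi> n"
  using dchar_mod[OF assms(1), of m] dchar_mod[OF assms(1), of n] assms(2) by (simp add: Cong.cong_def)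

lemma dchar_1: assumes "dchar Q \<xi>" shows "\<xi> 1 = 1"
proof -
  have "\<xi> 1 * \<xi> 1 = \<xi> 1" using dchar_mult[OF assms, of 1 1] by simp
  moreover have "\<xi> 1 \<noteq> 0" using dchar_nonzero[OF assms] by simp
  ultimately show ?thesis by simp
qed

lemma dchar_power: assumes "dchar Q \<xi>" shows "\<xi> (n ^ k) = \<xi> n ^ k"
  by (induction k) (use dchar_1[OF assms] dchar_mult[OF assms] in auto)

lemma dchar_root: assumes "dchar Q \<xi>" "coprime n Q" shows "\<xi> n ^ totient Q = 1"
proof -
  have "\<xi> n ^ totient Q = \<xi> (n ^ totient Q)" by (simp add: dchar_power[OF assms(1)])
  also have "\<dots> = \<xi> 1" using euler_theorem[OF assms(2)] by (rule dchar_cong[OF assms(1)])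
  finally show ?thesis using dchar_1[OF assms(1)] by simp
qed

lemma dchar_norm: assumes "dchar Q \<xi>" "Q > 0" shows "norm (\<xi> n) = of_bool (coprime n Q)"
proof (cases "coprime n Q")
  case True
  have "norm (\<xi> n) ^ totient Q = 1" using dchar_root[OF assms(1) True] by (metis norm_one norm_power)
  then have "norm (\<xi> n) = 1" using assms(2)
    using power_eq_imp_eq_base[of "norm (\<xi> n)" "totient Q" 1] by simp
  then show ?thesis using True by simp
next
  case False
  then show ?thesis using dchar_nonzero[OF assms(1)] by auto
qed

lemma dchar_norm_le: "dchar Q \<xi> \<Longrightarrow> Q > 0 \<Longrightarrow> norm (\<xi> n) \<le> 1"
  by (simp add: dchar_norm)

lemma coprime_add_modulus: "coprime (n + Q) Q \<longleftrightarrow> coprime n (Q::nat)"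
proof -
  have "gcd (n + Q) Q = gcd n Q" by simp
  then show ?thesis unfolding coprime_iff_gcd_eq_1 by (rule arg_cong)
qed

lemma dchar_principal: "dchar Q (principal Q)"
  by (simp add: dchar_def principal_def coprime_add_modulus)

lemma dchar_times: "dchar Q \<xi> \<Longrightarrow> dchar Q \<psi> \<Longrightarrow> dchar Q (\<lambda>n. \<xi> n * \<psi> n)"
  unfolding dchar_def
proof (intro conjI allI)
  assume *: "(\<forall>m n. \<xi> (m * n) = \<xi> m * \<xi> n) \<and> (\<forall>n. \<xi> (n + Q) = \<xi> n) \<and> (\<forall>n. (\<xi> n \<noteq> 0) = coprime n Q)"
    "(\<forall>m n. \<psi> (m * n) = \<psi> m * \<psi> n) \<and> (\<forall>n. \<psi> (n + Q) = \<psi> n) \<and> (\<forall>n. (\<psi> n \<noteq> 0) = coprime n Q)"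
  fix m n
  have "\<xi> (m * n) = \<xi> m * \<xi> n" "\<psi> (m * n) = \<psi> m * \<psi> n" using * by blast+
  then show "\<xi> (m * n) * \<psi> (m * n) = \<xi> m * \<psi> m * (\<xi> n * \<psi> n)" by (simp add: mult_ac)
  show "\<xi> (n + Q) * \<psi> (n + Q) = \<xi> n * \<psi> n" using * by metis
  show "(\<xi> n * \<psi> n \<noteq> 0) = coprime n Q" using * by (metis mult_eq_0_iff)
qed

lemma dchar_cnj: "dchar Q \<xi> \<Longrightarrow> dchar Q (\<lambda>n. cnj (\<xi> n))"
  by (auto simp: dchar_def)

lemma finite_dchars:
  assumes "Q > 0" shows "finite (dchars Q)"
proof -
  define R where "R = insert 0 {w::complex. w ^ totient Q = 1}"
  have R: "finite R" unfolding R_def using finite_roots_unity[of "totient Q"] assms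
    by (simp add: Suc_leI)
  define E where "E = (\<lambda>\<xi> :: nat \<Rightarrow> complex. restrict \<xi> {..<Q})"
  have "E ` dchars Q \<subseteq> PiE {..<Q} (\<lambda>_. R)"
  proof (intro image_subsetI)
    fix \<xi> assume "\<xi> \<in> dchars Q"
    then have \<xi>: "dchar Q \<xi>" by (simp add: dchars_def)
    have "\<xi> n \<in> R" for n
      using dchar_root[OF \<xi>, of n] dchar_nonzero[OF \<xi>, of n] by (auto simp: R_def)
    then show "E \<xi> \<in> PiE {..<Q} (\<lambda>_. R)" by (auto simp: E_def)
  qed
  then have "finite (E ` dchars Q)" using R finite_PiE[of "{..<Q}" "\<lambda>_. R"] finite_subset by auto
  moreover have "inj_on E (dchars Q)"
  proof (rule inj_onI)
    fix \<xi> \<psi> assume *: "\<xi> \<in> dchars Q" "\<psi> \<in> dchars Q" "E \<xi> = E \<psi>"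
    then have d: "dchar Q \<xi>" "dchar Q \<psi>" by (auto simp: dchars_def)
    have "\<xi> (n mod Q) = \<psi> (n mod Q)" for n
      using fun_cong[OF *(3), of "n mod Q"] assms by (simp add: E_def)
    then show "\<xi> = \<psi>" using dchar_mod[OF d(1)] dchar_mod[OF d(2)] by (intro ext) metis
  qed
  ultimately show ?thesis by (rule finite_imageD)
qed

text \<open>A character on a subgroup of the units modulo \<open>Q\<close>; the subgroup is represented by the
  saturated set of all natural numbers whose residues lie in it.\<close>
definition partial_char :: "nat \<Rightarrow> nat set \<Rightarrow> (nat \<Rightarrow> complex) \<Rightarrow> bool" where
  "partial_char Q H \<psi> \<longleftrightarrow> 1 \<in> H \<and> (\<forall>m\<in>H. coprime m Q) \<and> (\<forall>m\<in>H. \<forall>n\<in>H. m * n \<in> H \<and> \<psi> (m * n) = \<psi> m * \<psi> n)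
     \<and> (\<forall>m n. m \<in> H \<longrightarrow> [m = n] (mod Q) \<longrightarrow> n \<in> H \<and> \<psi> m = \<psi> n) \<and> (\<forall>m\<in>H. \<psi> m \<noteq> 0)"

lemma partial_char_power:
  assumes "partial_char Q H \<psi>" "m \<in> H"
  shows "m ^ j \<in> H" "\<psi> (m ^ j) = \<psi> m ^ j"
proof -
  have 1: "1 \<in> H" "\<psi> 1 = 1"
  proof -
    show "1 \<in> H" using assms by (simp add: partial_char_def)
    then have "\<psi> (1 * 1) = \<psi> 1 * \<psi> 1" "\<psi> 1 \<noteq> 0" using assms unfolding partial_char_def by blast+
    then show "\<psi> 1 = 1" by simp
  qed
  have "m ^ j \<in> H \<and> \<psi> (m ^ j) = \<psi> m ^ j"
  proof (induction j)
    case (Suc j)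
    then show ?case using assms unfolding partial_char_def by simp
  qed (use 1 in auto)
  then show "m ^ j \<in> H" "\<psi> (m ^ j) = \<psi> m ^ j" by auto
qed

text \<open>The elements of the larger group are \<open>h * g ^ i\<close>, with value
  \<open>\<psi> h * c ^ i\<close>. By minimality of \<open>n\<close>, a power \<open>g ^ j\<close>
  lies in \<open>H\<close> only if \<open>n dvd j\<close>, and there the condition on
  \<open>c\<close> makes the two prescriptions agree. Well-definedness rests on nothing
  else.\<close>

lemma partial_char_extend:
  assumes pc: "partial_char Q H \<psi>" and Q: "Q > 0" and g: "coprime g Q" "g \<notin> H"
    and n: "n > 0" "g ^ n \<in> H" "\<And>j. 0 < j \<Longrightarrow> j < n \<Longrightarrow> g ^ j \<notin> H"
    and c: "c ^ n = \<psi> (g ^ n)"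
  shows "\<exists>H' \<psi>'. partial_char Q H' \<psi>' \<and> H \<subseteq> H' \<and> g \<in> H' \<and> (\<forall>m\<in>H. \<psi>' m = \<psi> m) \<and> \<psi>' g = c"
proof -
  note pcd = pc[unfolded partial_char_def]
  have mul: "\<And>a b. a \<in> H \<Longrightarrow> b \<in> H \<Longrightarrow> a * b \<in> H \<and> \<psi> (a * b) = \<psi> a * \<psi> b"
    and sat: "\<And>a b. a \<in> H \<Longrightarrow> [a = b] (mod Q) \<Longrightarrow> b \<in> H \<and> \<psi> a = \<psi> b"
    and nz: "\<And>a. a \<in> H \<Longrightarrow> \<psi> a \<noteq> 0" and cop: "\<And>a. a \<in> H \<Longrightarrow> coprime a Q" and one: "1 \<in> H"
    using pcd by blast+
  have c0: "c \<noteq> 0" using c nz[OF n(2)] n(1) by (metis power_0_left neq0_conv power_eq_0_iff)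
  have psi1: "\<psi> 1 = 1" using partial_char_power[OF pc one, of 0] by simp
  have cancel: "b \<in> H" if "a \<in> H" "a * b \<in> H" "coprime b Q" for a b
  proof -
    \<comment> \<open>By Euler's theorem \<open>a ^ (totient Q - 1)\<close> is an inverse of
      \<open>a\<close> modulo \<open>Q\<close>, and it stays inside \<open>H\<close>.\<close>
    have "a ^ (totient Q - 1) * (a * b) \<in> H" using partial_char_power(1)[OF pc that(1)] mul that by blast
    moreover have "a ^ (totient Q - 1) * (a * b) = a ^ totient Q * b"
      using Q by (cases "totient Q") auto
    moreover have "[a ^ totient Q * b = 1 * b] (mod Q)"
      using euler_theorem[OF cop[OF that(1)]] by (rule cong_scalar_right)
    ultimately show ?thesis using sat by (metis mult_1)
  qed
  have ndvd: "n dvd j" if "g ^ j \<in> H" for j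
  proof -
    have "g ^ (n * (j div n)) * g ^ (j mod n) \<in> H" using that by (simp flip: power_add)
    moreover have "g ^ (n * (j div n)) \<in> H" using partial_char_power(1)[OF pc n(2)] by (simp add: power_mult)
    ultimately have "g ^ (j mod n) \<in> H" using cancel g(1) by (meson coprime_power_left_iff)
    then have "j mod n = 0" using n(3)[of "j mod n"] n(1) by (metis mod_less_divisor neq0_conv)
    then show ?thesis by auto
  qed
  have psig: "\<psi> (g ^ j) = c ^ j" if "g ^ j \<in> H" for j
  proof -
    have "n dvd j" using ndvd that by blast
    then obtain i where "j = n * i" by auto
    then show ?thesis using partial_char_power(2)[OF pc n(2), of i] c by (simp add: power_mult)
  qed
  have wd_le: "\<psi> h * c ^ i = \<psi> h' * c ^ j"
    if "h \<in> H" "h' \<in> H" "[h * g ^ i = h' * g ^ j] (mod Q)" "i \<le> j" for h h' i j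
  proof -
    have "[h * g ^ i = (h' * g ^ (j - i)) * g ^ i] (mod Q)"
      using that by (simp add: mult.assoc flip: power_add)
    then have eq: "[h = h' * g ^ (j - i)] (mod Q)"
      using g(1) by (simp add: cong_mult_rcancel_nat)
    then have "h' * g ^ (j - i) \<in> H" "\<psi> h = \<psi> (h' * g ^ (j - i))" using sat that by blast+
    moreover from this have gin: "g ^ (j - i) \<in> H" using cancel that g(1) by (meson coprime_power_left_iff)
    ultimately have "\<psi> h = \<psi> h' * c ^ (j - i)" using mul that psig by simp
    then show ?thesis using that by (simp add: mult.assoc flip: power_add)
  qed
  have wd: "\<psi> h * c ^ i = \<psi> h' * c ^ j"
    if "h \<in> H" "h' \<in> H" "[h * g ^ i = h' * g ^ j] (mod Q)" for h h' i j
    using wd_le[of h h' i j] wd_le[of h' h j i] that cong_sym by (cases "i \<le> j") force+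
  define H' where "H' = {m. \<exists>h i. h \<in> H \<and> [m = h * g ^ i] (mod Q)}"
  \<comment> \<open>An arbitrary representation is chosen; \<open>val\<close> derives from
    \<open>wd\<close> that the choice does not matter.\<close>
  define \<psi>' where "\<psi>' = (\<lambda>m. SOME x. \<exists>h i. h \<in> H \<and> [m = h * g ^ i] (mod Q) \<and> x = \<psi> h * c ^ i)"
  have val: "\<psi>' m = \<psi> h * c ^ i" if "h \<in> H" "[m = h * g ^ i] (mod Q)" for m h i
  proof -
    have "\<exists>x. \<exists>h i. h \<in> H \<and> [m = h * g ^ i] (mod Q) \<and> x = \<psi> h * c ^ i" using that by blast
    from someI_ex[OF this] obtain h' j where h': "h' \<in> H" "[m = h' * g ^ j] (mod Q)" "\<psi>' m = \<psi> h' * c ^ j"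
      unfolding \<psi>'_def by blast
    then show ?thesis using wd[of h' h j i] that by (metis cong_sym cong_trans)
  qed
  have "partial_char Q H' \<psi>'"
    unfolding partial_char_def
  proof (intro conjI ballI allI impI)
    show "1 \<in> H'" unfolding H'_def using one
      by (intro CollectI exI[of _ 1] exI[of _ 0]) auto
    show "coprime m Q" if "m \<in> H'" for m
    proof -
      obtain h i where "h \<in> H" "[m = h * g ^ i] (mod Q)" using \<open>m \<in> H'\<close> by (auto simp: H'_def)
      then show ?thesis using cop g(1) cong_imp_coprime cong_sym
        by (metis coprime_mult_left_iff coprime_power_left_iff)
    qed
    show "\<psi>' m \<noteq> 0" if "m \<in> H'" for m
    proof -
      obtain h i where "h \<in> H" "[m = h * g ^ i] (mod Q)" using \<open>m \<in> H'\<close> by (auto simp: H'_def)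
      then show ?thesis using val nz c0 by simp
    qed
    fix m k assume "m \<in> H'" "k \<in> H'"
    then obtain h i h' j where *: "h \<in> H" "[m = h * g ^ i] (mod Q)" "h' \<in> H" "[k = h' * g ^ j] (mod Q)"
      by (auto simp: H'_def)
    then have e: "[m * k = (h * h') * g ^ (i + j)] (mod Q)"
      using cong_mult[OF *(2,4)] by (simp add: power_add mult_ac)
    then show "m * k \<in> H'" unfolding H'_def using mul * by blast
    show "\<psi>' (m * k) = \<psi>' m * \<psi>' k"
      using val[OF _ e] val[OF *(1,2)] val[OF *(3,4)] mul * by (simp add: power_add mult_ac)
  next
    fix m k assume "m \<in> H'" "[m = k] (mod Q)"
    then obtain h i where *: "h \<in> H" "[m = h * g ^ i] (mod Q)" by (auto simp: H'_def)
    then have k: "[k = h * g ^ i] (mod Q)" using \<open>[m = k] (mod Q)\<close> by (metis cong_sym cong_trans)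
    then show "k \<in> H'" using * by (auto simp: H'_def)
    show "\<psi>' m = \<psi>' k" using val * k by metis
  qed
  moreover have "m \<in> H' \<and> \<psi>' m = \<psi> m" if "m \<in> H" for m
  proof
    have m: "[m = m * g ^ 0] (mod Q)" by simp
    show "m \<in> H'" unfolding H'_def using that m by blast
    show "\<psi>' m = \<psi> m" using val[OF that m] by simp
  qed
  moreover have "g \<in> H' \<and> \<psi>' g = c"
  proof
    have m: "[g = 1 * g ^ 1] (mod Q)" by simp
    show "g \<in> H'" unfolding H'_def using one m by blast
    show "\<psi>' g = c" using val[OF one m] psi1 by simp
  qed
  ultimately show ?thesis by blast
qed

lemma partial_char_step:
  assumes pc: "partial_char Q H \<psi>" and Q: "Q > 0" and g: "coprime g Q" "g \<notin> H"
  obtains n where "n > 1" "g ^ n \<in> H" "\<And>j. 0 < j \<Longrightarrow> j < n \<Longrightarrow> g ^ j \<notin> H"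
proof -
  have "[g ^ totient Q = 1] (mod Q)" using g(1) by (rule euler_theorem)
  then have "g ^ totient Q \<in> H" using pc unfolding partial_char_def by (metis cong_sym)
  moreover have "totient Q > 0" using Q by simp
  ultimately have ex: "\<exists>n. n > 0 \<and> g ^ n \<in> H" by blast
  define n where "n = (LEAST n. n > 0 \<and> g ^ n \<in> H)"
  have n: "n > 0" "g ^ n \<in> H" using LeastI_ex[OF ex] by (auto simp: n_def)
  moreover have "n \<noteq> 1" using n g(2) by auto
  ultimately have "n > 1" by linarith
  moreover have "g ^ j \<notin> H" if "0 < j" "j < n" for j using not_less_Least[of j] that by (auto simp: n_def)
  ultimately show ?thesis using that n(2) by blast
qed

lemma complex_root_exists:
  fixes a :: complex assumes "n > 0" shows "\<exists>c. c ^ n = a"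
proof (cases "a = 0")
  case True
  then show ?thesis using assms by (intro exI[of _ 0]) simp
next
  case False
  have "exp (Ln a / of_nat n) ^ n = exp (of_nat n * (Ln a / of_nat n))"
    by (rule exp_of_nat_mult[symmetric])
  also have "of_nat n * (Ln a / of_nat n) = Ln a" using assms by simp
  finally have "exp (Ln a / of_nat n) ^ n = exp (Ln a)" .
  then have "exp (Ln a / of_nat n) ^ n = a" using False by simp
  then show ?thesis by blast
qed

text \<open>On the group generated by \<open>a\<close> there is a character whose value at
  \<open>a\<close> differs from \<open>1\<close>. Among all partial characters with this property
  one with the largest domain is taken; a unit outside its domain would permit a further extension,
  so it is defined on all units.\<close>

lemma dchar_separates:
  assumes Q: "Q > 0" and a: "coprime a Q" "\<not> [a = 1] (mod Q)"
  obtains \<xi> where "dchar Q \<xi>" "\<xi> a \<noteq> 1"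
proof -
  define good where "good = (\<lambda>H. \<exists>\<psi>. partial_char Q H \<psi> \<and> a \<in> H \<and> \<psi> a \<noteq> 1)"
  define sz where "sz = (\<lambda>H :: nat set. card (H \<inter> {..<Q}))"
  have H0: "partial_char Q {n. [n = 1] (mod Q)} (\<lambda>_. 1)"
    unfolding partial_char_def
  proof (intro conjI ballI allI impI)
    show "coprime m Q" if "m \<in> {n. [n = 1] (mod Q)}" for m
      using that cong_imp_coprime[of 1 m Q] cong_sym by auto
    show "m * k \<in> {n. [n = 1] (mod Q)}" if "m \<in> {n. [n = 1] (mod Q)}" "k \<in> {n. [n = 1] (mod Q)}" for m k
      using that cong_mult[of m 1 Q k 1] by simp
    show "k \<in> {n. [n = 1] (mod Q)}" if "m \<in> {n. [n = 1] (mod Q)}" "[m = k] (mod Q)" for m k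
      using that by (auto intro: cong_trans cong_sym)
  qed auto
  have ex: "\<exists>H. good H"
  proof -
    obtain n where n: "n > 1" "a ^ n \<in> {n. [n = 1] (mod Q)}" "\<And>j. 0 < j \<Longrightarrow> j < n \<Longrightarrow> a ^ j \<notin> {n. [n = 1] (mod Q)}"
      using partial_char_step[OF H0 Q a(1)] a(2) by auto
    \<comment> \<open>A primitive root of unity of order \<open>n\<close>, the order of
      \<open>a\<close> modulo \<open>Q\<close>; since \<open>n > 1\<close> it is not
      \<open>1\<close>.\<close>
    define c where "c = cis (2 * pi / real n)"
    have "real n * (2 * pi / real n) = 2 * pi" using n(1) by simp
    moreover have "c ^ n = cis (real n * (2 * pi / real n))" unfolding c_def by (rule Complex.DeMoivre)
    ultimately have cn: "c ^ n = 1" by simp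
    have "c \<noteq> 1"
    proof
      assume "c = 1"
      then have "Re c = 1" by simp
      then have "cos (2 * pi / real n) = 1" by (simp only: c_def cis.sel)
      then obtain k :: int where k: "2 * pi / real n = of_int k * 2 * pi"
        unfolding cos_one_2pi_int by blast
      then have "1 = real_of_int k * real n" using n(1) by (simp add: field_simps)
      then have "1 = k * int n" by (metis of_int_1 of_int_eq_iff of_int_mult of_int_of_nat_eq)
      then have "int n dvd 1" by (metis dvd_triv_right)
      then show False using n(1) by simp
    qed
    moreover have "n > 0" using n(1) by simp
    moreover have "a \<notin> {n. [n = 1] (mod Q)}" using a(2) by simp
    moreover have "c ^ n = (\<lambda>_. 1) (a ^ n)" using cn by simp
    ultimately obtain H' \<psi>' where "partial_char Q H' \<psi>'" "a \<in> H'" "\<psi>' a = c"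
      using partial_char_extend[OF H0 Q a(1) _ _ n(2,3)] by blast
    then show ?thesis using \<open>c \<noteq> 1\<close> unfolding good_def by blast
  qed
  have bound: "\<forall>H. good H \<longrightarrow> sz H \<le> Q"
    unfolding sz_def using card_mono[of "{..<Q}"] by (metis card_lessThan finite_lessThan inf_le2)
  obtain H where H: "good H" "\<forall>H'. good H' \<longrightarrow> sz H' \<le> sz H"
  proof -
    obtain H0 where "good H0" using ex by blast
    then have "\<exists>x. good x \<and> (\<forall>y. good y \<longrightarrow> sz y \<le> sz x)"
      by (rule ex_has_greatest_nat[of good _ sz "Suc Q"]) (use bound in \<open>auto simp: less_Suc_eq_le\<close>)
    then show ?thesis using that by blast
  qed
  then obtain \<psi> where \<psi>: "partial_char Q H \<psi>" "a \<in> H" "\<psi> a \<noteq> 1" by (auto simp: good_def)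
  have full: "g \<in> H" if gc: "coprime g Q" for g
  proof (rule ccontr)
    assume g: "g \<notin> H"
    obtain n where n: "n > 1" "g ^ n \<in> H" "\<And>j. 0 < j \<Longrightarrow> j < n \<Longrightarrow> g ^ j \<notin> H"
      using partial_char_step[OF \<psi>(1) Q gc g] by blast
    have n0: "n > 0" using n(1) by simp
    obtain c where c: "c ^ n = \<psi> (g ^ n)" using complex_root_exists[OF n0] by blast
    then obtain H' \<psi>' where H': "partial_char Q H' \<psi>'" "H \<subseteq> H'" "g \<in> H'" "\<forall>m\<in>H. \<psi>' m = \<psi> m"
      using partial_char_extend[OF \<psi>(1) Q gc g n0 n(2,3) c] by blast
    then have "good H'" using \<psi> by (auto simp: good_def)
    have cg: "[g = g mod Q] (mod Q)" "[g mod Q = g] (mod Q)" by (simp_all add: Cong.cong_def)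
    have gm: "g mod Q \<in> H'" using H'(1,3) cg(1) unfolding partial_char_def by blast
    have "g mod Q \<notin> H" using \<psi>(1) g cg(2) unfolding partial_char_def by blast
    then have "H \<inter> {..<Q} \<subset> H' \<inter> {..<Q}" using gm H'(2) Q by auto
    then have "sz H < sz H'" unfolding sz_def by (intro psubset_card_mono) auto
    then show False using H(2) \<open>good H'\<close> by fastforce
  qed
  have \<psi>mul: "\<psi> (m * n) = \<psi> m * \<psi> n" if "m \<in> H" "n \<in> H" for m n
    using \<psi>(1) that unfolding partial_char_def by blast
  have \<psi>sat: "\<psi> m = \<psi> n" if "m \<in> H" "[m = n] (mod Q)" for m n
    using \<psi>(1) that unfolding partial_char_def by blast
  have \<psi>nz: "\<psi> m \<noteq> 0" if "m \<in> H" for m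
    using \<psi>(1) that unfolding partial_char_def by blast
  define \<xi> where "\<xi> = (\<lambda>n. if coprime n Q then \<psi> n else 0)"
  have "dchar Q \<xi>"
    unfolding dchar_def
  proof (intro conjI allI)
    fix m n
    show "\<xi> (m * n) = \<xi> m * \<xi> n"
      using \<psi>mul[OF full full, of m n] by (simp add: \<xi>_def)
    have "[n = n + Q] (mod Q)" by (simp add: Cong.cong_def)
    moreover note coprime_add_modulus[of n Q]
    ultimately show "\<xi> (n + Q) = \<xi> n"
      using \<psi>sat[OF full, of n "n + Q"] by (simp add: \<xi>_def)
    show "(\<xi> n \<noteq> 0) = coprime n Q"
      using \<psi>nz[OF full, of n] by (simp add: \<xi>_def)
  qed
  moreover have "\<xi> a \<noteq> 1" using a \<psi> by (simp add: \<xi>_def)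
  ultimately show ?thesis using that by blast
qed

section \<open>Orthogonality relations\<close>

lemma sum_dchar_residues:
  assumes "Q > 0" "dchar Q \<xi>" "\<xi> \<noteq> principal Q"
  shows "(\<Sum>n<Q. \<xi> n) = 0"
proof -
  have "\<exists>b. coprime b Q \<and> \<xi> b \<noteq> 1"
  proof (rule ccontr)
    assume "\<nexists>b. coprime b Q \<and> \<xi> b \<noteq> 1"
    then have "\<xi> = principal Q" using dchar_nonzero[OF assms(2)] by (intro ext) (auto simp: principal_def)
    then show False using assms by simp
  qed
  then obtain b where b: "coprime b Q" "\<xi> b \<noteq> 1" by blast
  have inj: "inj_on (\<lambda>n. b * n mod Q) {..<Q}"
  proof (rule inj_onI)
    fix m n assume "m \<in> {..<Q}" "n \<in> {..<Q}" "b * m mod Q = b * n mod Q"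
    then show "m = n" using b(1) by (metis Cong.cong_def cong_mult_lcancel_nat lessThan_iff mod_less)
  qed
  have "(\<lambda>n. b * n mod Q) ` {..<Q} = {..<Q}"
    using inj assms(1) by (intro endo_inj_surj) auto
  then have "(\<Sum>n<Q. \<xi> n) = (\<Sum>n<Q. \<xi> (b * n mod Q))"
    using sum.reindex[OF inj, of \<xi>] by simp
  also have "\<dots> = \<xi> b * (\<Sum>n<Q. \<xi> n)"
    by (simp add: dchar_mod[OF assms(2)] dchar_mult[OF assms(2)] sum_distrib_left)
  finally show ?thesis using b(2) by (metis mult_cancel_right1)
qed

lemma sum_principal: "Q > 0 \<Longrightarrow> (\<Sum>n<Q. principal Q n) = of_nat (totient Q)"
proof -
  assume Q: "Q > 0"
  have "(\<Sum>n<Q. principal Q n) = of_nat (card {n\<in>{..<Q}. coprime n Q})"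
    by (simp add: principal_def of_bool_def sum.If_cases Int_def)
  also have "card {n\<in>{..<Q}. coprime n Q} = totient Q"
  proof (cases "Q = 1")
    case True
    have "{n\<in>{..<1::nat}. coprime n 1} = {0}" by auto
    then show ?thesis using True by simp
  next
    case False
    have "{n\<in>{..<Q}. coprime n Q} = totatives Q"
    proof (intro equalityI subsetI)
      fix n assume "n \<in> {n\<in>{..<Q}. coprime n Q}"
      then show "n \<in> totatives Q" using False by (cases "n = 0") (auto simp: in_totatives_iff)
    next
      fix n assume "n \<in> totatives Q"
      then show "n \<in> {n\<in>{..<Q}. coprime n Q}" using False Q totatives_less[of n Q]
        by (auto simp: in_totatives_iff)
    qed
    then show ?thesis by (simp add: totient_def)
  qed
  finally show ?thesis .
qed

text \<open>Multiplication by a character that is not \<open>1\<close> at \<open>a\<close> permutes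
  the characters and multiplies the sum by a factor different from \<open>1\<close>. That the number
  of characters is \<open>totient Q\<close> is obtained by double counting, without the structure of
  the unit group.\<close>

lemma sum_over_dchars:
  assumes Q: "Q > 0"
  shows "(\<Sum>\<xi>\<in>dchars Q. \<xi> a) = (if [a = 1] (mod Q) then of_nat (totient Q) else 0)"
proof -
  have fin: "finite (dchars Q)" using finite_dchars[OF Q] .
  have zero: "(\<Sum>\<xi>\<in>dchars Q. \<xi> a) = 0" if na: "\<not> [a = 1] (mod Q)" for a
  proof (cases "coprime a Q")
    case False
    then show ?thesis using dchar_nonzero by (intro sum.neutral) (auto simp: dchars_def)
  next
    case True
    obtain \<psi> where \<psi>: "dchar Q \<psi>" "\<psi> a \<noteq> 1" using dchar_separates[OF Q True na] by blast
    have inv: "\<psi> n * cnj (\<psi> n) = of_bool (coprime n Q)" for n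
    proof -
      have "\<psi> n * cnj (\<psi> n) = of_real ((norm (\<psi> n))\<^sup>2)" by (rule complex_norm_square[symmetric])
      then show ?thesis unfolding dchar_norm[OF \<psi>(1) Q] by auto
    qed
    have ident: "(\<lambda>n. \<xi> n * of_bool (coprime n Q)) = \<xi>" if "dchar Q \<xi>" for \<xi>
      using dchar_nonzero[OF that] by (intro ext) auto
    have "(\<Sum>\<xi>\<in>dchars Q. \<xi> a) = (\<Sum>\<xi>\<in>dchars Q. \<psi> a * \<xi> a)"
    proof (rule sum.reindex_bij_witness[where i = "\<lambda>\<xi> n. \<psi> n * \<xi> n" and j = "\<lambda>\<xi> n. cnj (\<psi> n) * \<xi> n"])
      fix \<xi> assume "\<xi> \<in> dchars Q"
      then have c: "dchar Q \<xi>" by (simp add: dchars_def)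
      have e1: "\<psi> n * (cnj (\<psi> n) * \<xi> n) = \<xi> n" for n
        using fun_cong[OF ident[OF c], of n] inv[of n] by (metis mult.assoc mult.commute)
      then have e: "(\<lambda>n. \<psi> n * (cnj (\<psi> n) * \<xi> n)) = \<xi>" "(\<lambda>n. cnj (\<psi> n) * (\<psi> n * \<xi> n)) = \<xi>"
        by (simp_all only: mult.left_commute[of "cnj _" "\<psi> _"])
      show "(\<lambda>n. \<psi> n * (cnj (\<psi> n) * \<xi> n)) = \<xi>" "(\<lambda>n. cnj (\<psi> n) * (\<psi> n * \<xi> n)) = \<xi>" using e by auto
      show "(\<lambda>n. cnj (\<psi> n) * \<xi> n) \<in> dchars Q" "(\<lambda>n. \<psi> n * \<xi> n) \<in> dchars Q"
        using c \<psi>(1) dchar_times dchar_cnj by (auto simp: dchars_def)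
      show "\<psi> a * (cnj (\<psi> a) * \<xi> a) = \<xi> a" using fun_cong[OF e(1), of a] by simp
    qed
    also have "\<dots> = \<psi> a * (\<Sum>\<xi>\<in>dchars Q. \<xi> a)" by (simp add: sum_distrib_left)
    finally show ?thesis using \<psi>(2) by (metis mult_cancel_right1)
  qed
  have pin: "principal Q \<in> dchars Q" using dchar_principal by (simp add: dchars_def)
  have one: "(\<Sum>\<xi>\<in>dchars Q. \<xi> a) = of_nat (card (dchars Q))" if "[a = 1] (mod Q)" for a
  proof -
    have "\<xi> a = 1" if "\<xi> \<in> dchars Q" for \<xi>
      using dchar_cong[OF _ \<open>[a = 1] (mod Q)\<close>, of \<xi>] dchar_1[of Q \<xi>] that by (simp add: dchars_def)
    then have "(\<Sum>\<xi>\<in>dchars Q. \<xi> a) = (\<Sum>\<xi>\<in>dchars Q. 1)" by (intro sum.cong) auto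
    then show ?thesis by simp
  qed
  \<comment> \<open>Summed over the residues first, only the principal character contributes; summed
    over the characters first, only the residue of \<open>1\<close>.\<close>
  have "(\<Sum>n<Q. \<Sum>\<xi>\<in>dchars Q. \<xi> n) = (\<Sum>\<xi>\<in>dchars Q. \<Sum>n<Q. \<xi> n)" by (rule sum.swap)
  also have "\<dots> = (\<Sum>\<xi>\<in>dchars Q. if \<xi> = principal Q then of_nat (totient Q) else 0)"
    by (intro sum.cong) (auto simp: sum_dchar_residues[OF Q] sum_principal[OF Q] dchars_def)
  also have "\<dots> = of_nat (totient Q)" using pin fin by simp
  finally have tot: "(\<Sum>n<Q. \<Sum>\<xi>\<in>dchars Q. \<xi> n) = of_nat (totient Q)" .
  have "(\<Sum>n<Q. \<Sum>\<xi>\<in>dchars Q. \<xi> n) = (\<Sum>n<Q. if n = 1 mod Q then of_nat (card (dchars Q)) else 0)"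
  proof (rule sum.cong)
    fix n assume n: "n \<in> {..<Q}"
    then have "[n = 1] (mod Q) \<longleftrightarrow> n = 1 mod Q" by (simp add: Cong.cong_def)
    then show "(\<Sum>\<xi>\<in>dchars Q. \<xi> n) = (if n = 1 mod Q then of_nat (card (dchars Q)) else 0)"
      using zero[of n] one[of n] by auto
  qed simp
  also have "\<dots> = of_nat (card (dchars Q))" using Q by simp
  finally have "of_nat (card (dchars Q)) = (of_nat (totient Q) :: complex)" using tot by simp
  then show ?thesis using zero[of a] one[of a] by auto
qed

text \<open>The conjugate of a character value at \<open>a\<close> is its value at an inverse of
  \<open>a\<close>, which reduces the claim to the sum at a single argument.\<close>

lemma dchar_orthogonality:
  assumes Q: "Q > 0" and a: "coprime a Q"
  shows "(\<Sum>\<xi>\<in>dchars Q. cnj (\<xi> a) * \<xi> n) = (if [n = a] (mod Q) then of_nat (totient Q) else 0)"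
proof -
  obtain b where b: "[a * b = 1] (mod Q)" using cong_solve_coprime_nat[OF a] by auto
  have "cnj (\<xi> a) = \<xi> b" if "\<xi> \<in> dchars Q" for \<xi>
  proof -
    have d: "dchar Q \<xi>" using that by (simp add: dchars_def)
    have "\<xi> a * \<xi> b = 1" using dchar_cong[OF d b] dchar_mult[OF d] dchar_1[OF d] by simp
    moreover have "cnj (\<xi> a) * \<xi> a = 1"
    proof -
      have "\<xi> a * cnj (\<xi> a) = of_real ((norm (\<xi> a))\<^sup>2)" by (rule complex_norm_square[symmetric])
      then show ?thesis unfolding dchar_norm[OF d Q] using a by (simp add: mult.commute)
    qed
    ultimately show ?thesis by (metis mult.assoc mult.right_neutral mult_1)
  qed
  then have "(\<Sum>\<xi>\<in>dchars Q. cnj (\<xi> a) * \<xi> n) = (\<Sum>\<xi>\<in>dchars Q. \<xi> (b * n))"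
    by (intro sum.cong) (auto simp: dchars_def dchar_mult)
  moreover have "[b * n = 1] (mod Q) \<longleftrightarrow> [n = a] (mod Q)"
  proof
    assume "[b * n = 1] (mod Q)"
    then have "[a * (b * n) = a * 1] (mod Q)" by (rule cong_scalar_left)
    moreover have "[a * b * n = 1 * n] (mod Q)" using b by (rule cong_scalar_right)
    ultimately show "[n = a] (mod Q)" by (metis cong_sym cong_trans mult.assoc mult.right_neutral mult_1)
  next
    assume "[n = a] (mod Q)"
    then have "[b * n = b * a] (mod Q)" by (rule cong_scalar_left)
    then show "[b * n = 1] (mod Q)" using b by (metis cong_trans mult.commute)
  qed
  ultimately show ?thesis by (simp add: sum_over_dchars[OF Q])
qed

section \<open>Estimates of Chebyshev and Mertens\<close>

lemma sum_divisors_swap: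
  fixes F :: "nat \<Rightarrow> nat \<Rightarrow> 'a::comm_monoid_add"
  shows "(\<Sum>n\<in>{1..N}. \<Sum>d | d dvd n. F d (n div d)) = (\<Sum>d\<in>{1..N}. \<Sum>m\<in>{1..N div d}. F d m)"
proof -
  have "(\<Sum>n\<in>{1..N}. \<Sum>d | d dvd n. F d (n div d)) = (\<Sum>(n,d)\<in>Sigma {1..N} (\<lambda>n. {d. d dvd n}). F d (n div d))"
    by (rule sum.Sigma) auto
  also have "\<dots> = (\<Sum>(d,m)\<in>Sigma {1..N} (\<lambda>d. {1..N div d}). F d m)"
  proof (rule sum.reindex_bij_witness[where i = "\<lambda>(d,m). (d * m, d)" and j = "\<lambda>(n,d). (d, n div d)"])
    fix a assume "a \<in> Sigma {1..N} (\<lambda>n. {d. d dvd n})"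
    then obtain n d where a: "a = (n, d)" "1 \<le> n" "n \<le> N" "d dvd n" by auto
    then have d: "d > 0" "d \<le> n" by (auto intro: dvd_imp_le Nat.gr0I)
    show "(case case a of (n, d) \<Rightarrow> (d, n div d) of (d, m) \<Rightarrow> (d * m, d)) = a" using a by simp
    have "1 \<le> n div d" using d by (simp add: div_greater_zero_iff Suc_leI)
    moreover have "n div d \<le> N div d" using a by (simp add: div_le_mono)
    ultimately show "(case a of (n, d) \<Rightarrow> (d, n div d)) \<in> Sigma {1..N} (\<lambda>d. {1..N div d})"
      using a d by auto
    show "(case case a of (n, d) \<Rightarrow> (d, n div d) of (d, m) \<Rightarrow> F d m) = (case a of (n, d) \<Rightarrow> F d (n div d))"
      using a by simp
  next
    fix c assume "c \<in> Sigma {1..N} (\<lambda>d. {1..N div d})"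
    then obtain d m where c: "c = (d, m)" "1 \<le> d" "d \<le> N" "1 \<le> m" "m \<le> N div d" by auto
    show "(case case c of (d, m) \<Rightarrow> (d * m, d) of (n, d) \<Rightarrow> (d, n div d)) = c" using c by simp
    have "d * m \<le> N" using c by (metis less_eq_div_iff_mult_less_eq mult.commute not_one_le_zero not_gr0)
    moreover have "1 \<le> d * m" using c by (simp add: Suc_leI)
    ultimately show "(case c of (d, m) \<Rightarrow> (d * m, d)) \<in> Sigma {1..N} (\<lambda>n. {d. d dvd n})"
      using c by simp
  qed
  also have "\<dots> = (\<Sum>d\<in>{1..N}. \<Sum>m\<in>{1..N div d}. F d m)" by (rule sum.Sigma[symmetric]) auto
  finally show ?thesis .
qed

lemma sum_ln_eq_mangoldt:
  "(\<Sum>n\<in>{1..N}. ln (real n)) = (\<Sum>d\<in>{1..N}. mangoldt d * real (N div d))"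
proof -
  have "(\<Sum>n\<in>{1..N}. ln (real n)) = (\<Sum>n\<in>{1..N}. \<Sum>d | d dvd n. mangoldt d)"
    using mangoldt_sum[where 'a = real] by (intro sum.cong) auto
  also have "\<dots> = (\<Sum>d\<in>{1..N}. \<Sum>m\<in>{1..N div d}. mangoldt d)"
    using sum_divisors_swap[of "\<lambda>d m. mangoldt d :: real" N] by simp
  finally show ?thesis by (simp add: mult.commute)
qed

lemma sum_ln_eq_ln_fact: "(\<Sum>n\<in>{1..N}. ln (real n)) = ln (fact N)"
  by (induction N) (simp_all add: ln_mult)

text \<open>Chebyshev's argument: the weight \<open>2 * N div d - 2 * (N div d)\<close> is
  nonnegative throughout and at least \<open>1\<close> on the block, while its total against
  \<open>mangoldt\<close> is the logarithm of the central binomial coefficient, which is at most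
  \<open>4 ^ N\<close>.\<close>

lemma mangoldt_double_block:
  "(\<Sum>d\<in>{N<..2*N}. mangoldt d :: real) \<le> 2 * real N * ln 2"
proof -
  have "(\<Sum>d\<in>{N<..2*N}. mangoldt d :: real) \<le> (\<Sum>d\<in>{1..2*N}. mangoldt d * (real (2 * N div d) - 2 * real (N div d)))"
  proof (rule order_trans[OF _ sum_mono2[of _ "{N<..2*N}"]])
    show "(\<Sum>d\<in>{N<..2*N}. mangoldt d :: real) \<le> (\<Sum>d\<in>{N<..2*N}. mangoldt d * (real (2 * N div d) - 2 * real (N div d)))"
    proof (rule sum_mono)
      fix d assume d: "d \<in> {N<..2*N}"
      then have "N div d = 0" "1 \<le> 2 * N div d" by (auto simp: Suc_leI div_greater_zero_iff)
      then have "1 \<le> real (2 * N div d) - 2 * real (N div d)" by simp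
      then show "mangoldt d \<le> mangoldt d * (real (2 * N div d) - 2 * real (N div d))"
        using mangoldt_nonneg[of d] by (metis mult.right_neutral mult_left_mono)
    qed
    fix d
    have "2 * (N div d) \<le> 2 * N div d"
    proof (cases "d = 0")
      case False
      have "2 * (N div d) * d \<le> 2 * N" by (metis mult.assoc mult_le_mono2 div_times_less_eq_dividend)
      then show ?thesis using False by (simp add: less_eq_div_iff_mult_less_eq)
    qed simp
    then have "0 \<le> real (2 * N div d) - 2 * real (N div d)" by linarith
    then show "0 \<le> mangoldt d * (real (2 * N div d) - 2 * real (N div d))" by (simp add: mangoldt_nonneg)
  qed auto
  also have "\<dots> = (\<Sum>d\<in>{1..2*N}. mangoldt d * real (2 * N div d)) - 2 * (\<Sum>d\<in>{1..2*N}. mangoldt d * real (N div d))"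
    by (simp add: right_diff_distrib sum_subtractf sum_distrib_left mult_ac)
  also have "(\<Sum>d\<in>{1..2*N}. mangoldt d * real (N div d)) = (\<Sum>d\<in>{1..N}. mangoldt d * real (N div d))"
    by (intro sum.mono_neutral_right) auto
  also have "(\<Sum>d\<in>{1..2*N}. mangoldt d * real (2 * N div d)) - 2 * (\<Sum>d\<in>{1..N}. mangoldt d * real (N div d))
    = ln (fact (2 * N)) - 2 * ln (fact N)"
    using sum_ln_eq_mangoldt[of N] sum_ln_eq_mangoldt[of "2 * N"] sum_ln_eq_ln_fact[of N] sum_ln_eq_ln_fact[of "2*N"] by simp
  also have "\<dots> = ln (real ((2 * N) choose N))"
  proof -
    have "fact (2 * N) = fact N * (fact N * real ((2 * N) choose N))"
      using binomial_fact_lemma[of N "2 * N"] by (metis (no_types, lifting) diff_add_inverse2 le_add2 mult_2 of_nat_fact of_nat_mult mult.assoc)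
    then show ?thesis by (simp add: ln_mult)
  qed
  also have "\<dots> \<le> ln (2 ^ (2 * N))"
  proof -
    have "(2 * N) choose N \<le> 2 ^ (2 * N)" by (rule binomial_le_pow2)
    then have "real ((2 * N) choose N) \<le> 2 ^ (2 * N)" by (metis of_nat_le_iff of_nat_numeral of_nat_power)
    then show ?thesis by (subst ln_le_cancel_iff) auto
  qed
  also have "\<dots> = 2 * real N * ln 2" by (simp add: ln_realpow)
  finally show ?thesis .
qed

lemma chebyshev_upper: "(\<Sum>d\<in>{1..N}. mangoldt d :: real) \<le> 4 * real N"
proof (induction N rule: less_induct)
  case (less N)
  consider "N = 0" | "N = 1" | "N \<ge> 2" by linarith
  then show ?case
  proof cases
    case 3
    define m where "m = (N + 1) div 2"
    have m: "m < N" "N \<le> 2 * m" "2 * m \<le> N + 1" using 3 by (auto simp: m_def)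
    have "(\<Sum>d\<in>{1..N}. mangoldt d :: real) \<le> (\<Sum>d\<in>{1..2*m}. mangoldt d)"
      using m by (intro sum_mono2) (auto simp: mangoldt_nonneg)
    also have "{1..2*m} = {1..m} \<union> {m<..2*m}" by auto
    also have "(\<Sum>d\<in>{1..m} \<union> {m<..2*m}. mangoldt d :: real) = (\<Sum>d\<in>{1..m}. mangoldt d) + (\<Sum>d\<in>{m<..2*m}. mangoldt d)"
      by (intro sum.union_disjoint) auto
    also have "\<dots> \<le> 4 * real m + 2 * real m * ln 2" using less[OF m(1)] mangoldt_double_block[of m] by simp
    also have "\<dots> \<le> 4 * real m + 2 * real m * (3/4)"
      using ln2_le_25_over_36 by (intro add_left_mono mult_left_mono) auto
    also have "\<dots> = 5.5 * real m" by simp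
    also have "\<dots> \<le> 4 * real N" using m 3 by linarith
    finally show ?thesis .
  qed auto
qed

lemma sum_ln_lower: "real N * ln (real N) - real N \<le> (\<Sum>n\<in>{1..N}. ln (real n))"
proof (induction N)
  case (Suc N)
  show ?case
  proof (cases "N = 0")
    case False
    have "ln (real (Suc N)) - ln (real N) = ln (real (Suc N) / real N)" using False by (simp add: ln_div)
    also have "real (Suc N) / real N = 1 + 1 / real N" using False by (simp add: field_simps)
    also have "ln (1 + 1 / real N) \<le> 1 / real N" by (rule ln_add_one_self_le_self) simp
    finally have "ln (real (Suc N)) - ln (real N) \<le> 1 / real N" .
    then have "real N * (ln (real (Suc N)) - ln (real N)) \<le> real N * (1 / real N)"
      by (intro mult_left_mono) auto
    then have "real N * ln (real (Suc N)) - real N * ln (real N) \<le> 1"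
      using False unfolding right_diff_distrib by simp
    moreover have "(\<Sum>n\<in>{1..Suc N}. ln (real n)) = (\<Sum>n\<in>{1..N}. ln (real n)) + ln (real (Suc N))" by simp
    moreover have "real (Suc N) * ln (real (Suc N)) = real N * ln (real (Suc N)) + ln (real (Suc N))"
      by (simp add: distrib_right)
    ultimately show ?thesis using Suc by linarith
  qed simp
qed simp

text \<open>Replacing \<open>N div d\<close> by \<open>N / d\<close> in the prime factorisation of
  the factorial costs the Chebyshev sum, which is linear in \<open>N\<close>.\<close>

lemma mertens_upper:
  assumes "N > 0" shows "(\<Sum>d\<in>{1..N}. mangoldt d / real d) \<le> ln (real N) + 4"
proof -
  have "real N * (\<Sum>d\<in>{1..N}. mangoldt d / real d) \<le> (\<Sum>d\<in>{1..N}. mangoldt d * (real (N div d) + 1))"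
    unfolding sum_distrib_left
  proof (rule sum_mono)
    fix d assume "d \<in> {1..N}"
    then have "real N / real d \<le> real (N div d) + 1"
      by (metis add.commute floor_divide_of_nat_eq less_imp_le of_int_of_nat_eq real_of_int_floor_add_one_gt)
    then have "mangoldt d * (real N / real d) \<le> mangoldt d * (real (N div d) + 1)"
      by (intro mult_left_mono mangoldt_nonneg)
    then show "real N * (mangoldt d / real d) \<le> mangoldt d * (real (N div d) + 1)" by (simp add: mult_ac)
  qed
  also have "\<dots> = (\<Sum>n\<in>{1..N}. ln (real n)) + (\<Sum>d\<in>{1..N}. mangoldt d)"
    unfolding sum_ln_eq_mangoldt by (simp add: distrib_left sum.distrib)
  also have "\<dots> \<le> real N * ln (real N) + 4 * real N"
  proof -
    have "(\<Sum>n\<in>{1..N}. ln (real n)) \<le> (\<Sum>n\<in>{1..N}. ln (real N))" by (intro sum_mono) simp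
    then show ?thesis using chebyshev_upper[of N] by simp
  qed
  finally have "real N * (\<Sum>d\<in>{1..N}. mangoldt d / real d) \<le> real N * (ln (real N) + 4)" by (simp add: algebra_simps)
  then show ?thesis using assms by simp
qed

lemma mertens_lower:
  assumes "N > 0" shows "ln (real N) - 1 \<le> (\<Sum>d\<in>{1..N}. mangoldt d / real d)"
proof -
  have "real N * ln (real N) - real N \<le> (\<Sum>d\<in>{1..N}. mangoldt d * real (N div d))"
    using sum_ln_lower[of N] unfolding sum_ln_eq_mangoldt .
  also have "\<dots> \<le> (\<Sum>d\<in>{1..N}. mangoldt d * (real N / real d))"
    by (intro sum_mono mult_left_mono mangoldt_nonneg of_nat_div_le_of_nat)
  also have "\<dots> = real N * (\<Sum>d\<in>{1..N}. mangoldt d / real d)" by (simp add: sum_distrib_left mult_ac)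
  finally have "real N * (ln (real N) - 1) \<le> real N * (\<Sum>d\<in>{1..N}. mangoldt d / real d)" by (simp add: algebra_simps)
  then show ?thesis using assms by simp
qed

section \<open>Reciprocal sums over primes in squaring blocks\<close>

definition primes_in :: "nat \<Rightarrow> nat \<Rightarrow> nat set" where
  "primes_in w z = {p. prime p \<and> w < p \<and> p \<le> z}"

lemma finite_primes_in [simp]: "finite (primes_in w z)"
  by (rule finite_subset[of _ "{..z}"]) (auto simp: primes_in_def)

text \<open>On the block \<open>ln p\<close> exceeds \<open>ln y\<close>, so
  \<open>mertens_upper\<close> divided by \<open>ln y\<close> gives \<open>2 + 4 / ln y\<close>, and
  \<open>ln y\<close> is at least \<open>ln 2\<close>. Squaring blocks are used because this bound
  does not depend on \<open>y\<close>.\<close>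

lemma primes_in_recip_le:
  assumes "y \<ge> 2" shows "(\<Sum>p\<in>primes_in y (y\<^sup>2). 1 / real p) \<le> 10"
proof -
  have y: "ln (real y) > 0" using assms by simp
  have "ln (real y) * (\<Sum>p\<in>primes_in y (y\<^sup>2). 1 / real p) \<le> (\<Sum>p\<in>primes_in y (y\<^sup>2). mangoldt p / real p)"
    unfolding sum_distrib_left using assms
    by (intro sum_mono) (auto simp: primes_in_def divide_right_mono)
  also have "\<dots> \<le> (\<Sum>d\<in>{1..y\<^sup>2}. mangoldt d / real d)"
    by (intro sum_mono2) (auto simp: primes_in_def mangoldt_nonneg)
  also have "\<dots> \<le> ln (real (y\<^sup>2)) + 4" using assms by (intro mertens_upper) auto
  also have "\<dots> = 2 * ln (real y) + 4" using assms by (simp add: ln_realpow)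
  also have "\<dots> \<le> 10 * ln (real y)"
  proof -
    have "ln 2 \<le> ln (real y)" using assms by simp
    then show ?thesis using ln2_ge_two_thirds by simp
  qed
  finally show ?thesis using y by (simp add: mult.commute)
qed

lemma primes_in_split:
  assumes "a \<le> b" "b \<le> c"
  shows "primes_in a c = primes_in a b \<union> primes_in b c" "primes_in a b \<inter> primes_in b c = {}"
  using assms by (auto simp: primes_in_def)

lemma power_two_power_mono: "w \<ge> 1 \<Longrightarrow> i \<le> j \<Longrightarrow> (w::nat) ^ 2 ^ i \<le> w ^ 2 ^ j"
  by (intro power_increasing) auto

lemma primes_in_blocks:
  assumes "w \<ge> 1"
  shows "primes_in w (w ^ 2 ^ J) = (\<Union>j<J. primes_in (w ^ 2 ^ j) (w ^ 2 ^ Suc j))"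
proof (induction J)
  case (Suc J)
  have "w \<le> w ^ 2 ^ J" using power_two_power_mono[OF assms, of 0 J] by simp
  then have "primes_in w (w ^ 2 ^ Suc J) = primes_in w (w ^ 2 ^ J) \<union> primes_in (w ^ 2 ^ J) (w ^ 2 ^ Suc J)"
    using power_two_power_mono[OF assms, of J "Suc J"] by (intro primes_in_split) auto
  then show ?case using Suc by (auto simp: lessThan_Suc)
qed (auto simp: primes_in_def)

lemma primes_in_blocks_disjoint:
  assumes "w \<ge> 1" "i \<noteq> j"
  shows "primes_in (w ^ 2 ^ i) (w ^ 2 ^ Suc i) \<inter> primes_in (w ^ 2 ^ j) (w ^ 2 ^ Suc j) = {}"
  using assms(2)
proof (induction i j rule: linorder_wlog)
  case (le i j)
  then have "w ^ 2 ^ Suc i \<le> w ^ 2 ^ j" by (intro power_two_power_mono assms) auto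
  then show ?case by (auto simp: primes_in_def)
qed (simp add: Int_commute)

lemma primes_in_block_recip_le:
  assumes "w \<ge> 2"
  shows "(\<Sum>p\<in>primes_in (w ^ 2 ^ j) (w ^ 2 ^ Suc j). 1 / real p) \<le> 10"
proof -
  have "w ^ 2 ^ 0 \<le> w ^ 2 ^ j" using assms by (intro power_two_power_mono) auto
  then have "2 \<le> w ^ 2 ^ j" using assms by simp
  then have "(\<Sum>p\<in>primes_in (w ^ 2 ^ j) ((w ^ 2 ^ j)\<^sup>2). 1 / real p) \<le> 10" by (rule primes_in_recip_le)
  then show ?thesis by (simp add: power_mult[symmetric] mult.commute)
qed

lemma primes_in_blocks_recip_le:
  assumes "w \<ge> 2" "i \<le> J"
  shows "(\<Sum>p\<in>primes_in (w ^ 2 ^ i) (w ^ 2 ^ J). 1 / real p) \<le> 10 * real (J - i)"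
  using assms(2)
proof (induction J rule: dec_induct)
  case base
  then show ?case by (auto simp: primes_in_def intro!: order.trans[OF eq_refl[OF sum.neutral]])
next
  case (step J)
  have "w \<ge> 1" using assms(1) by simp
  then have le: "w ^ 2 ^ i \<le> w ^ 2 ^ J" "w ^ 2 ^ J \<le> w ^ 2 ^ Suc J"
    using step.hyps by (simp_all add: power_two_power_mono del: power_Suc)
  note s = primes_in_split[OF le]
  have "(\<Sum>p\<in>primes_in (w ^ 2 ^ i) (w ^ 2 ^ Suc J). 1 / real p) \<le> 10 * real (J - i) + 10"
    unfolding s(1) using s(2) step.IH primes_in_block_recip_le[OF assms(1), of J]
    by (simp add: sum.union_disjoint)
  then show ?case using step.hyps by (simp add: Suc_diff_le)
qed

lemma exp_minus_two_le: assumes "0 \<le> x" "x \<le> (1/2 :: real)" shows "exp (- 2 * x) \<le> 1 - x"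
proof -
  have "- 2 * x \<le> - x - 2 * x\<^sup>2" using assms mult_left_le[of "2 * x" x] by (simp add: power2_eq_square)
  also have "\<dots> \<le> ln (1 - x)" using assms by (intro ln_one_minus_pos_lower_bound) auto
  finally have "exp (- 2 * x) \<le> exp (ln (1 - x))" by simp
  then show ?thesis using assms by simp
qed

lemma prod_one_minus_ge:
  assumes "\<And>p. p \<in> P \<Longrightarrow> 0 \<le> g p \<and> g p \<le> (1/2 :: real)" "finite P"
  shows "exp (- 2 * sum g P) \<le> (\<Prod>p\<in>P. 1 - g p)"
proof -
  have "exp (- 2 * sum g P) = (\<Prod>p\<in>P. exp (- 2 * g p))"
    using assms(2) by (simp add: exp_sum[symmetric] sum_distrib_left)
  also have "\<dots> \<le> (\<Prod>p\<in>P. 1 - g p)" using assms(1) exp_minus_two_le by (intro prod_mono) auto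
  finally show ?thesis .
qed

lemma power_le_fact_exp: assumes "0 \<le> (x::real)" shows "x ^ n / fact n \<le> exp x"
proof -
  have s: "(\<lambda>n. x ^ n / fact n) sums exp x" using exp_converges[of x] by (simp add: divide_inverse mult.commute)
  have "(\<Sum>i\<in>{n}. x ^ i / fact i) \<le> (\<Sum>i. x ^ i / fact i)"
    using s assms by (intro sum_le_suminf) (auto simp: sums_iff)
  then show ?thesis using s by (simp add: sums_iff)
qed

section \<open>The sieve for residue classes modulo primes\<close>

text \<open>In \<open>prime_sieve\<close> the remainder of block \<open>j\<close> is at most
  \<open>w\<close> to the power of the \<open>j\<close>-th summand. Towards the small primes the
  truncation order grows linearly while the exponent \<open>2 ^ (j + 2)\<close> decays
  geometrically, so the whole level is a fixed power of \<open>w ^ 2 ^ J\<close>. Stated as an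
  equation, the claim can be proved by induction without subtraction.\<close>

lemma sieve_level_exponent:
  "(\<Sum>j<J. 2 ^ (j + 2) * (2 * (b + (J - Suc j)) + 1)) + (8 * b + 12 + 8 * J) = 2 ^ J * (8 * b + 12 :: nat)"
proof (induction J)
  case (Suc J)
  have "(\<Sum>j<Suc J. 2 ^ (j + 2) * (2 * (b + (Suc J - Suc j)) + 1))
    = 4 * (2 * (b + J) + 1) + (\<Sum>j<J. 2 ^ (Suc j + 2) * (2 * (b + (J - Suc j)) + 1))"
    by (subst sum.lessThan_Suc_shift) simp
  also have "(\<Sum>j<J. 2 ^ (Suc j + 2) * (2 * (b + (J - Suc j)) + 1)) = 2 * (\<Sum>j<J. 2 ^ (j + 2) * (2 * (b + (J - Suc j)) + 1))"
    unfolding sum_distrib_left by (intro sum.cong) auto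
  finally show ?case using Suc by simp
qed simp

lemma geometric_half_bound: "(\<Sum>i<J. (1/2::real) ^ (2 * i + 1)) \<le> 1 - (1/4) ^ J"
proof (induction J)
  case (Suc J)
  have "(1/2::real) ^ (2 * J + 1) = (1/4) ^ J / 2" by (simp add: power_mult power2_eq_square)
  moreover have "0 \<le> (1/4 :: real) ^ J" by simp
  ultimately show ?case using Suc by (simp del: zero_le_power)
qed simp

text \<open>The level is the fixed power \<open>8 * b + 13\<close> of the sifting limit
  \<open>w ^ 2 ^ J\<close>, and the relative error \<open>3 * \<theta>\<close> does not depend on
  \<open>J\<close>. This works because all squaring blocks satisfy the same bound for their
  reciprocal sums. The condition \<open>2 * \<kappa> \<le> w\<close> keeps the local densities at
  most \<open>1 / 2\<close>.\<close>

lemma prime_sieve: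
  fixes \<kappa> w b J Q r X Y :: nat and \<Omega> :: "nat \<Rightarrow> nat set" and g :: "nat \<Rightarrow> real"
  defines "P \<equiv> primes_in w (w ^ 2 ^ J)"
  defines "V \<equiv> \<Prod>p\<in>P. 1 - real (card (\<Omega> p)) / real p"
  defines "H \<equiv> (\<Sum>n\<in>{X<..Y}. g n) / real Q"
  assumes w: "2 * \<kappa> \<le> w" "2 \<le> w" and Q: "Q > 0"
    and \<theta>: "exp (40 * real \<kappa>) / 4 ^ b \<le> \<theta>" "\<theta> \<le> 1"
    and g: "\<And>n. X < n \<Longrightarrow> 0 \<le> g n" "\<And>m n. X < m \<Longrightarrow> m \<le> n \<Longrightarrow> g n \<le> g m"
    and \<Omega>: "\<And>p. p \<in> P \<Longrightarrow> \<Omega> p \<subseteq> {..<p} \<and> card (\<Omega> p) \<le> \<kappa> \<and> (coprime p Q \<or> \<Omega> p = {})"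
  shows "\<bar>(\<Sum>n | n \<in> {X<..Y} \<and> [n = r] (mod Q) \<and> (\<forall>p\<in>P. n mod p \<notin> \<Omega> p). g n) - H * V\<bar>
    \<le> 3 * \<theta> * (H * V) + g (Suc X) * real (w ^ 2 ^ J) ^ (8 * b + 13)"
proof -
  define B where "B = (\<lambda>j. primes_in (w ^ 2 ^ j) (w ^ 2 ^ Suc j))"
  \<comment> \<open>Blocks of smaller primes are truncated later. The errors of the blocks then form
    a geometric series dominated by the top block, whose order is \<open>2 * b + 1\<close>.\<close>
  define bb where "bb = (\<lambda>j. b + (J - Suc j))"
  define h where "h = (\<lambda>p. real (card (\<Omega> p)) / real p)"
  define N where "N = {n \<in> {X<..Y}. [n = r] (mod Q)}"
  define L where "L = 10 * real \<kappa>"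
  have w1: "w \<ge> 1" using w by simp
  have P: "P = (\<Union>j<J. B j)" unfolding P_def B_def by (rule primes_in_blocks[OF w1])
  have disj: "B i \<inter> B j = {}" if "i \<noteq> j" for i j
    unfolding B_def by (rule primes_in_blocks_disjoint[OF w1 that])
  have h: "0 \<le> h p" "h p \<le> real \<kappa> / real p" "h p \<le> 1/2" if "p \<in> P" for p
  proof -
    have p: "2 * \<kappa> \<le> p" "p > 0" using that w by (auto simp: P_def primes_in_def)
    show "0 \<le> h p" by (simp add: h_def)
    show le: "h p \<le> real \<kappa> / real p" unfolding h_def using \<Omega>[OF that] by (intro divide_right_mono) auto
    have "real \<kappa> / real p \<le> 1/2" using p by (simp add: field_simps)
    then show "h p \<le> 1/2" using le by linarith
  qed
  have sumh: "sum h (B j) \<le> L" "0 \<le> sum h (B j)" if "j < J" for j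
  proof -
    have BP: "B j \<subseteq> P" using that P by auto
    have "sum h (B j) \<le> (\<Sum>p\<in>B j. real \<kappa> * (1 / real p))"
      using h(2) BP by (intro sum_mono) auto
    also have "\<dots> = real \<kappa> * (\<Sum>p\<in>B j. 1 / real p)" by (simp add: sum_distrib_left)
    also have "\<dots> \<le> real \<kappa> * 10"
      unfolding B_def by (intro mult_left_mono primes_in_block_recip_le w) auto
    finally show "sum h (B j) \<le> L" by (simp add: L_def)
    show "0 \<le> sum h (B j)" using h(1) BP by (intro sum_nonneg) auto
  qed
  \<comment> \<open>\<open>elem_sym\<close> is at most \<open>L ^ r / r!\<close>, that is
    \<open>2 ^ (-r)\<close> times a term of the series for \<open>exp (2 * L)\<close>. Dividing by
    the product over the block, which is at least \<open>exp (- 2 * L)\<close>, produces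
    \<open>exp (4 * L) = exp (40 * \<kappa>)\<close>.\<close>
  have th: "elem_sym h (B j) (2 * bb j + 1) / (\<Prod>p\<in>B j. 1 - h p) \<le> exp (4 * L) * (1/2) ^ (2 * bb j + 1)"
    if "j < J" for j
  proof -
    let ?r = "2 * bb j + 1"
    have BP: "B j \<subseteq> P" using that P by auto
    have L0: "0 \<le> L" by (simp add: L_def)
    have fB: "finite (B j)" by (simp add: B_def)
    have "exp (- 2 * L) \<le> exp (- 2 * sum h (B j))" using sumh[OF that] by simp
    also have "\<dots> \<le> (\<Prod>p\<in>B j. 1 - h p)" using h BP fB by (intro prod_one_minus_ge) auto
    finally have V: "exp (- 2 * L) \<le> (\<Prod>p\<in>B j. 1 - h p)" .
    have "elem_sym h (B j) ?r \<le> sum h (B j) ^ ?r / fact ?r"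
      using h BP fB by (intro elem_sym_le) auto
    also have "\<dots> \<le> L ^ ?r / fact ?r"
      using sumh[OF that] by (intro divide_right_mono power_mono) auto
    also have "\<dots> = (1/2) ^ ?r * ((2 * L) ^ ?r / fact ?r)" by (simp add: power_mult_distrib power_divide)
    also have "\<dots> \<le> (1/2) ^ ?r * exp (2 * L)"
      using L0 by (intro mult_left_mono power_le_fact_exp) auto
    finally have E: "elem_sym h (B j) ?r \<le> (1/2) ^ ?r * exp (2 * L)" .
    have "elem_sym h (B j) ?r / (\<Prod>p\<in>B j. 1 - h p) \<le> ((1/2) ^ ?r * exp (2 * L)) / exp (- 2 * L)"
      using E V h BP by (intro frac_le) (auto intro: order_trans[OF elem_sym_nonneg])
    also have "\<dots> = exp (4 * L) * (1/2) ^ ?r"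
      by (simp add: exp_minus field_simps flip: exp_add)
    finally show ?thesis .
  qed
  have theta_sum: "(\<Sum>j<J. elem_sym h (B j) (2 * bb j + 1) / (\<Prod>p\<in>B j. 1 - h p)) \<le> \<theta>"
  proof -
    have "(\<Sum>j<J. elem_sym h (B j) (2 * bb j + 1) / (\<Prod>p\<in>B j. 1 - h p))
       \<le> (\<Sum>j<J. exp (4 * L) * (1/2) ^ (2 * bb j + 1))" using th by (intro sum_mono) auto
    also have "\<dots> = exp (4 * L) / 4 ^ b * (\<Sum>j<J. (1/2) ^ (2 * (J - Suc j) + 1))"
    proof -
      have pw: "(1/2 :: real) ^ (2 * (b + i) + 1) = (1/2) ^ (2 * i + 1) / 4 ^ b" for i
        by (simp add: power_add power_mult power_divide power2_eq_square distrib_left)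
      show ?thesis unfolding sum_distrib_left bb_def pw by (simp add: mult.commute)
    qed
    also have "(\<Sum>j<J. (1/2::real) ^ (2 * (J - Suc j) + 1)) = (\<Sum>i<J. (1/2) ^ (2 * i + 1))"
      by (rule sum.nat_diff_reindex)
    also have "exp (4 * L) / 4 ^ b * \<dots> \<le> exp (4 * L) / 4 ^ b * 1"
      using geometric_half_bound[of J] by (intro mult_left_mono order_trans[OF geometric_half_bound]) auto
    also have "\<dots> \<le> \<theta>" using \<theta>(1) by (simp add: L_def)
    finally show ?thesis .
  qed
  have H0: "0 \<le> H" unfolding H_def using g(1) by (intro divide_nonneg_nonneg sum_nonneg) auto
  have tau: "0 \<le> g (Suc X)" using g(1) by simp
  have main: "\<bar>(\<Sum>n | n \<in> N \<and> (\<forall>p\<in>(\<Union>j<J. B j). \<not> n mod p \<in> \<Omega> p). g n) - H * (\<Prod>j<J. \<Prod>p\<in>B j. 1 - h p)\<bar>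
     \<le> 3 * \<theta> * H * (\<Prod>j<J. \<Prod>p\<in>B j. 1 - h p)
        + (real J + 1) * (g (Suc X) * (\<Prod>j<J. (1 + real \<kappa> * real (card (B j))) ^ (2 * bb j + 1)))"
  proof (rule brun_hooley)
    show "finite N" by (simp add: N_def)
    show "finite (B j)" for j by (simp add: B_def)
    show "B i \<inter> B j = {}" if "i \<noteq> j" for i j using disj that .
    show "0 \<le> g n" if "n \<in> N" for n using that g(1) by (simp add: N_def)
    show "0 \<le> h p \<and> h p < 1" if "j < J" "p \<in> B j" for j p using h[of p] that P by force
    fix D assume D: "D \<subseteq> (\<Union>j<J. B j)"
    then have DP: "D \<subseteq> P" using P by simp
    then have fD: "finite D" using finite_subset P_def finite_primes_in by blast
    have "\<bar>(\<Sum>n | n \<in> {X<..Y} \<and> [n = r] (mod Q) \<and> (\<forall>p\<in>D. n mod p \<in> \<Omega> p). g n)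
      - (\<Sum>n\<in>{X<..Y}. g n) / real Q * (\<Prod>p\<in>D. real (card (\<Omega> p)) / real p)\<bar>
      \<le> g (Suc X) * (\<Prod>p\<in>D. real (card (\<Omega> p)))"
    proof (rule sifted_density[OF fD Q g])
      fix p assume "p \<in> D"
      then have "p \<in> P" using DP by blast
      then show "prime p \<and> \<Omega> p \<subseteq> {..<p} \<and> (coprime p Q \<or> \<Omega> p = {})"
        using \<Omega>[of p] by (simp add: P_def primes_in_def)
    qed
    also have "\<dots> \<le> g (Suc X) * (\<Prod>p\<in>D. real \<kappa>)"
      using \<Omega> DP tau by (intro mult_left_mono prod_mono) auto
    finally show "\<bar>(\<Sum>n | n \<in> N \<and> (\<forall>p\<in>D. n mod p \<in> \<Omega> p). g n) - H * prod h D\<bar> \<le> g (Suc X) * real \<kappa> ^ card D"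
      unfolding N_def H_def h_def by simp
  qed (use H0 tau theta_sum \<theta> in auto)
  have rem: "(real J + 1) * (g (Suc X) * (\<Prod>j<J. (1 + real \<kappa> * real (card (B j))) ^ (2 * bb j + 1)))
     \<le> g (Suc X) * real (w ^ 2 ^ J) ^ (8 * b + 13)"
  proof -
    have "(\<Prod>j<J. (1 + real \<kappa> * real (card (B j))) ^ (2 * bb j + 1)) \<le> (\<Prod>j<J. real w ^ (2 ^ (j + 2) * (2 * bb j + 1)))"
    proof (intro prod_mono conjI)
      fix j
      let ?z = "w ^ 2 ^ Suc j"
      have "w ^ 2 ^ 0 \<le> ?z" by (intro power_two_power_mono w1) auto
      then have wz: "w \<le> ?z" by simp
      have "B j \<subseteq> {1..?z}" by (auto simp: B_def primes_in_def)
      then have "card (B j) \<le> ?z" using card_mono[of "{1..?z}" "B j"] by simp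
      then have "1 + \<kappa> * card (B j) \<le> 1 + \<kappa> * ?z" by simp
      also have "\<dots> \<le> ?z * ?z"
      proof -
        have "2 * (1 + \<kappa> * ?z) \<le> ?z + 2 * \<kappa> * ?z" using wz w(2) by simp
        also have "\<dots> \<le> ?z + w * ?z" using w(1) by simp
        also have "\<dots> \<le> ?z * ?z + ?z * ?z" using wz w1 by (intro add_mono mult_right_mono) auto
        finally show ?thesis by simp
      qed
      also have "\<dots> = w ^ 2 ^ (j + 2)" by (simp flip: power_add)
      finally have "real (1 + \<kappa> * card (B j)) \<le> real (w ^ 2 ^ (j + 2))" by (simp only: of_nat_le_iff)
      then have "1 + real \<kappa> * real (card (B j)) \<le> real w ^ 2 ^ (j + 2)" by simp
      then have "(1 + real \<kappa> * real (card (B j))) ^ (2 * bb j + 1) \<le> (real w ^ 2 ^ (j + 2)) ^ (2 * bb j + 1)"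
        by (intro power_mono) auto
      then show "(1 + real \<kappa> * real (card (B j))) ^ (2 * bb j + 1) \<le> real w ^ (2 ^ (j + 2) * (2 * bb j + 1))"
        by (simp only: power_mult)
    qed auto
    also have "\<dots> = real w ^ (\<Sum>j<J. 2 ^ (j + 2) * (2 * bb j + 1))" by (simp add: power_sum)
    also have "\<dots> \<le> real w ^ (2 ^ J * (8 * b + 12))"
      using w1 sieve_level_exponent[where J = J and b = b] by (intro power_increasing) (auto simp: bb_def)
    also have "\<dots> = real (w ^ 2 ^ J) ^ (8 * b + 12)" by (simp add: power_mult)
    finally have 1: "(\<Prod>j<J. (1 + real \<kappa> * real (card (B j))) ^ (2 * bb j + 1)) \<le> real (w ^ 2 ^ J) ^ (8 * b + 12)" .
    \<comment> \<open>The number \<open>J + 1\<close> of expansions is absorbed by one more power of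
      \<open>w ^ 2 ^ J\<close>, which raises the exponent from \<open>8 * b + 12\<close> to
      \<open>8 * b + 13\<close>.\<close>
    have "J < 2 ^ J" by (rule less_exp)
    also have "2 ^ J < w ^ 2 ^ J" using w(2) by (meson less_exp order_less_le_trans power_mono zero_le)
    finally have 2: "real J + 1 \<le> real (w ^ 2 ^ J)" by linarith
    have "(real J + 1) * (g (Suc X) * (\<Prod>j<J. (1 + real \<kappa> * real (card (B j))) ^ (2 * bb j + 1)))
      \<le> real (w ^ 2 ^ J) * (g (Suc X) * real (w ^ 2 ^ J) ^ (8 * b + 12))"
      using 1 2 tau by (intro mult_mono mult_left_mono mult_nonneg_nonneg prod_nonneg) auto
    also have "\<dots> = g (Suc X) * (real (w ^ 2 ^ J) ^ (8 * b + 12) * real (w ^ 2 ^ J))"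
      by (simp only: mult_ac)
    also have "real (w ^ 2 ^ J) ^ (8 * b + 12) * real (w ^ 2 ^ J) = real (w ^ 2 ^ J) ^ (8 * b + 13)"
      using power_Suc2[of "real (w ^ 2 ^ J)" "8 * b + 12"] by (simp only: add_Suc_right[symmetric]) simp
    finally show ?thesis .
  qed
  have VV: "(\<Prod>j<J. \<Prod>p\<in>B j. 1 - h p) = V"
    unfolding V_def P h_def using disj by (subst prod.UNION_disjoint) (auto simp: B_def)
  have SS: "{n. n \<in> N \<and> (\<forall>p\<in>(\<Union>j<J. B j). \<not> n mod p \<in> \<Omega> p)}
     = {n. n \<in> {X<..Y} \<and> [n = r] (mod Q) \<and> (\<forall>p\<in>P. n mod p \<notin> \<Omega> p)}"
    unfolding P[symmetric] N_def by auto
  show ?thesis using main rem unfolding VV SS by (simp add: mult.assoc)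
qed

section \<open>Mertens' theorem in arithmetic progressions\<close>

lemma ln_over_antimono:
  assumes "3 \<le> m" "m \<le> n"
  shows "ln (real n) / real n \<le> ln (real m) / real m"
proof -
  have m: "real m > 0" "real n > 0" using assms by auto
  have "exp 1 \<le> (3::real)" by (rule exp_le)
  also have "3 \<le> real m" using assms by simp
  finally have l: "1 \<le> ln (real m)" using m by (simp add: ln_ge_iff)
  have "ln (real n / real m) \<le> real n / real m - 1" using m by (intro ln_le_minus_one) auto
  then have "real m * (ln (real n) - ln (real m)) \<le> real m * (real n / real m - 1)"
    using m by (intro mult_left_mono) (auto simp: ln_div)
  also have "\<dots> = (real n - real m) * 1" using m by (simp add: field_simps)
  also have "\<dots> \<le> (real n - real m) * ln (real m)" using l assms by (intro mult_left_mono) auto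
  finally have "real m * ln (real n) \<le> real n * ln (real m)" by (simp add: algebra_simps)
  then show ?thesis using m by (simp add: field_simps)
qed

lemma dchar_block_sum:
  assumes "Q > 0" "dchar Q \<xi>" "\<xi> \<noteq> principal Q"
  shows "(\<Sum>n\<in>{X<..X + Q}. \<xi> n) = 0"
proof (induction X)
  case 0
  have e1: "{0<..0 + Q} = insert Q {0<..<Q}" using assms(1) by auto
  have e2: "{..<Q} = insert 0 {0<..<Q}" using assms(1) by auto
  have "\<xi> Q = \<xi> 0" using dchar_mod[OF assms(2), of Q] by simp
  then have "(\<Sum>n\<in>{0<..0 + Q}. \<xi> n) = (\<Sum>n<Q. \<xi> n)"
    unfolding e1 e2 by (subst (1 2) sum.insert) auto
  then show ?case using sum_dchar_residues[OF assms] by simp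
next
  case (Suc X)
  have e1: "insert (Suc X) {Suc X<..Suc X + Q} = insert (Suc X + Q) {X<..X + Q}" using assms(1) by auto
  have "(\<Sum>n\<in>insert (Suc X) {Suc X<..Suc X + Q}. \<xi> n) = \<xi> (Suc X) + (\<Sum>n\<in>{Suc X<..Suc X + Q}. \<xi> n)"
    by (subst sum.insert) auto
  moreover have "(\<Sum>n\<in>insert (Suc X + Q) {X<..X + Q}. \<xi> n) = \<xi> (Suc X + Q) + (\<Sum>n\<in>{X<..X + Q}. \<xi> n)"
    by (subst sum.insert) auto
  moreover have "\<xi> (Suc X + Q) = \<xi> (Suc X)" using dchar_add[OF assms(2), of "Suc X" 1] by simp
  moreover have "sum \<xi> (insert (Suc X) {Suc X<..Suc X + Q}) = sum \<xi> (insert (Suc X + Q) {X<..X + Q})"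
    by (simp only: e1)
  ultimately have "(\<Sum>n\<in>{Suc X<..Suc X + Q}. \<xi> n) = (\<Sum>n\<in>{X<..X + Q}. \<xi> n)" by (metis add_left_cancel)
  then show ?case using Suc by simp
qed

lemma dchar_interval_bound:
  assumes "Q > 0" "dchar Q \<xi>" "\<xi> \<noteq> principal Q"
  shows "norm (\<Sum>n\<in>{X<..t}. \<xi> n) \<le> real Q"
proof (cases "t \<le> X")
  case False
  define s where "s = t - X"
  define u where "u = X + (s - s mod Q)"
  have us: "X + s - u = s mod Q"
    using mod_less_eq_dividend[of s Q] unfolding u_def by linarith
  have "(\<Sum>n\<in>{X<..t}. \<xi> n) = (\<Sum>n\<in>{u<..X + s}. \<xi> n)"
    using interval_sum_periodic[OF assms(1), of \<xi> X s] dchar_block_sum[OF assms] False by (simp add: s_def u_def)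
  also have "norm \<dots> \<le> (\<Sum>n\<in>{u<..X + s}. 1)"
    by (rule sum_norm_le) (rule dchar_norm_le[OF assms(2,1)])
  also have "\<dots> = real (s mod Q)" using us by simp
  also have "\<dots> \<le> real Q" using assms(1) by (simp add: less_imp_le)
  finally show ?thesis .
qed simp

section \<open>Partial sums of L(1) and of character sums over prime powers\<close>

definition Lsum :: "(nat \<Rightarrow> complex) \<Rightarrow> nat \<Rightarrow> complex" where
  "Lsum \<xi> N = (\<Sum>n\<in>{1..N}. (1 / real n) *\<^sub>R \<xi> n)"

definition Lval :: "(nat \<Rightarrow> complex) \<Rightarrow> complex" where
  "Lval \<xi> = lim (Lsum \<xi>)"

lemma sum_atLeast1_split: "N \<le> M \<Longrightarrow> sum f {1..M} = sum f {1..N} + sum f {N<..(M::nat)}"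
proof -
  assume "N \<le> M"
  then have "{1..M} = {1..N} \<union> {N<..M}" "{1..N} \<inter> {N<..M} = {}" by auto
  then show ?thesis by (simp add: sum.union_disjoint)
qed

text \<open>The explicit rate matters more than convergence: below, the partial sums are taken at
  \<open>N div d\<close> and their errors are summed over \<open>d\<close>.\<close>

lemma Lsum_tail:
  assumes "Q > 0" "dchar Q \<xi>" "\<xi> \<noteq> principal Q"
  shows "N \<le> M \<Longrightarrow> norm (Lsum \<xi> M - Lsum \<xi> N) \<le> real Q / real (Suc N)"
    and "Lsum \<xi> \<longlonglongrightarrow> Lval \<xi>"
    and "norm (Lval \<xi> - Lsum \<xi> N) \<le> real Q / real (Suc N)"
proof -
  have 1: "norm (Lsum \<xi> M - Lsum \<xi> N) \<le> real Q / real (Suc N)" if "N \<le> M" for N M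
  proof -
    have "norm (\<Sum>n\<in>{N<..M}. (1 / real n) *\<^sub>R \<xi> n) \<le> real Q * (1 / real (Suc N))"
      by (rule abel_bound[OF dchar_interval_bound[OF assms]]) (auto simp: frac_le)
    then show ?thesis unfolding Lsum_def sum_atLeast1_split[OF that] by simp
  qed
  show "norm (Lsum \<xi> M - Lsum \<xi> N) \<le> real Q / real (Suc N)" if "N \<le> M" using 1[OF that] .
  have "Cauchy (Lsum \<xi>)"
  proof (rule metric_CauchyI)
    fix e :: real assume e: "0 < e"
    obtain K where K: "real Q / e < real K" using reals_Archimedean2 by blast
    have *: "dist (Lsum \<xi> m) (Lsum \<xi> n) < e" if "K \<le> n" "n \<le> m" for m n
    proof -
      have "real Q < e * real K" using K e by (simp add: field_simps)
      also have "\<dots> \<le> e * real (Suc n)" using that e by (intro mult_left_mono) auto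
      finally have "real Q / real (Suc n) < e" by (simp add: divide_less_eq)
      then show ?thesis using 1[OF that(2)] by (simp add: dist_norm)
    qed
    show "\<exists>M. \<forall>m\<ge>M. \<forall>n\<ge>M. dist (Lsum \<xi> m) (Lsum \<xi> n) < e"
    proof (intro exI[of _ K] allI impI)
      fix m n assume "K \<le> m" "K \<le> n"
      then show "dist (Lsum \<xi> m) (Lsum \<xi> n) < e" using *[of n m] *[of m n] by (cases "n \<le> m") (auto simp: dist_commute)
    qed
  qed
  then show 2: "Lsum \<xi> \<longlonglongrightarrow> Lval \<xi>" unfolding Lval_def by (simp add: Cauchy_convergent_iff convergent_LIMSEQ_iff)
  show "norm (Lval \<xi> - Lsum \<xi> N) \<le> real Q / real (Suc N)"
  proof (rule tendsto_upperbound)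
    show "(\<lambda>M. norm (Lsum \<xi> M - Lsum \<xi> N)) \<longlonglongrightarrow> norm (Lval \<xi> - Lsum \<xi> N)"
      by (intro tendsto_intros 2)
    show "\<forall>\<^sub>F M in sequentially. norm (Lsum \<xi> M - Lsum \<xi> N) \<le> real Q / real (Suc N)"
      using eventually_ge_at_top[of N] by eventually_elim (rule 1)
  qed simp
qed

lemma dchar_log_sum_bounded:
  assumes "Q > 0" "dchar Q \<xi>" "\<xi> \<noteq> principal Q"
  shows "norm (\<Sum>n\<in>{1..N}. (ln (real n) / real n) *\<^sub>R \<xi> n) \<le> 3 * ln 3 + real Q * ln 4"
proof -
  define F where "F = (\<lambda>n. (ln (real n) / real n) *\<^sub>R \<xi> n)"
  \<comment> \<open>\<open>ln n / n\<close> decreases only from \<open>3\<close> on, so the first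
    three terms are kept out of the partial summation.\<close>
  have small: "norm (\<Sum>n\<in>{1..M}. F n) \<le> 3 * ln 3" if "M \<le> 3" for M
  proof -
    have "norm (\<Sum>n\<in>{1..M}. F n) \<le> (\<Sum>n\<in>{1..M}. ln 3)"
    proof (rule sum_norm_le)
      fix n assume n: "n \<in> {1..M}"
      have "norm (F n) = ln (real n) / real n * norm (\<xi> n)" using n by (simp add: F_def)
      also have "\<dots> \<le> ln (real n) / real n * 1"
        using n dchar_norm_le[OF assms(2,1), of n] by (intro mult_left_mono) auto
      also have "\<dots> \<le> ln (real n)"
        using n divide_left_mono[of 1 "real n" "ln (real n)"] by auto
      also have "\<dots> \<le> ln 3" using n that by simp
      finally show "norm (F n) \<le> ln 3" .
    qed
    also have "\<dots> \<le> 3 * ln 3" using that by (simp add: mult_right_mono)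
    finally show ?thesis .
  qed
  show ?thesis
  proof (cases "N \<le> 3")
    case True
    have "0 \<le> real Q * ln 4" by simp
    then show ?thesis using small[OF True] unfolding F_def by linarith
  next
    case False
    have "norm (\<Sum>n\<in>{3<..N}. F n) \<le> real Q * (ln (real (Suc 3)) / real (Suc 3))"
      unfolding F_def
      by (rule abel_bound[OF dchar_interval_bound[OF assms]]) (auto intro: ln_over_antimono)
    also have "\<dots> \<le> real Q * ln 4" by (intro mult_left_mono) auto
    finally have t: "norm (\<Sum>n\<in>{3<..N}. F n) \<le> real Q * ln 4" .
    have "norm (\<Sum>n\<in>{1..N}. F n) \<le> norm (\<Sum>n\<in>{1..3}. F n) + norm (\<Sum>n\<in>{3<..N}. F n)"
      using False sum_atLeast1_split[of 3 N F] by (simp add: norm_triangle_ineq)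
    then show ?thesis using t small[of 3] unfolding F_def by simp
  qed
qed

definition psi_sum :: "(nat \<Rightarrow> complex) \<Rightarrow> nat \<Rightarrow> complex" where
  "psi_sum \<xi> N = (\<Sum>n\<in>{1..N}. (mangoldt n / real n) *\<^sub>R \<xi> n)"

lemma div_Suc_bound: assumes "d \<ge> 1" "N \<ge> 1" shows "1 / real (Suc (N div d)) \<le> real d / real N"
proof -
  have "N < d * Suc (N div d)" using assms by (metis dividend_less_times_div less_le_trans mult_Suc_right not_less not_one_le_zero zero_less_iff_neq_zero)
  then have "real N \<le> real d * real (Suc (N div d))" by (metis less_imp_le of_nat_le_iff of_nat_mult)
  then show ?thesis using assms by (simp add: field_simps del: of_nat_Suc)
qed

text \<open>Writing \<open>ln n\<close> as a divisor sum of \<open>mangoldt\<close> turns the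
  bounded sum of \<open>\<xi> n * ln n / n\<close> into a convolution with inner sums
  \<open>Lsum \<xi> (N div d)\<close>. Each of these is \<open>Lval \<xi>\<close> up to
  \<open>Q * d / N\<close>, and by Chebyshev's bound the errors add up to a constant, so division by
  \<open>Lval \<xi>\<close> is possible.\<close>

lemma psi_sum_bounded:
  assumes "Q > 0" "dchar Q \<xi>" "\<xi> \<noteq> principal Q" "Lval \<xi> \<noteq> 0"
  shows "\<exists>C. \<forall>N\<ge>1. norm (psi_sum \<xi> N) \<le> C"
proof (intro exI allI impI)
  fix N :: nat assume N: "N \<ge> 1"
  have "(\<Sum>n\<in>{1..N}. (ln (real n) / real n) *\<^sub>R \<xi> n)
    = (\<Sum>n\<in>{1..N}. \<Sum>d | d dvd n. ((mangoldt d / real d) *\<^sub>R \<xi> d) * ((1 / real (n div d)) *\<^sub>R \<xi> (n div d)))"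
  proof (rule sum.cong)
    fix n assume n: "n \<in> {1..N}"
    have "(\<Sum>d | d dvd n. ((mangoldt d / real d) *\<^sub>R \<xi> d) * ((1 / real (n div d)) *\<^sub>R \<xi> (n div d)))
      = (\<Sum>d | d dvd n. (mangoldt d / real n) *\<^sub>R \<xi> n)"
    proof (rule sum.cong)
      fix d assume "d \<in> {d. d dvd n}"
      then obtain e where e: "n = d * e" by auto
      then have "d > 0" using n by (auto intro!: Nat.gr0I)
      then show "((mangoldt d / real d) *\<^sub>R \<xi> d) * ((1 / real (n div d)) *\<^sub>R \<xi> (n div d)) = (mangoldt d / real n) *\<^sub>R \<xi> n"
        using dchar_mult[OF assms(2), of d e] e by simp
    qed simp
    also have "\<dots> = ((\<Sum>d | d dvd n. mangoldt d) / real n) *\<^sub>R \<xi> n"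
      by (simp add: scaleR_sum_left sum_divide_distrib)
    also have "(\<Sum>d | d dvd n. mangoldt d) = ln (real n)" using mangoldt_sum[of n, where 'a = real] n by simp
    finally show "(ln (real n) / real n) *\<^sub>R \<xi> n = (\<Sum>d | d dvd n. ((mangoldt d / real d) *\<^sub>R \<xi> d) * ((1 / real (n div d)) *\<^sub>R \<xi> (n div d)))" ..
  qed simp
  also have "\<dots> = (\<Sum>d\<in>{1..N}. \<Sum>m\<in>{1..N div d}. ((mangoldt d / real d) *\<^sub>R \<xi> d) * ((1 / real m) *\<^sub>R \<xi> m))"
    by (rule sum_divisors_swap)
  also have "\<dots> = (\<Sum>d\<in>{1..N}. ((mangoldt d / real d) *\<^sub>R \<xi> d) * Lsum \<xi> (N div d))"
    by (simp add: Lsum_def sum_distrib_left)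
  finally have id: "(\<Sum>n\<in>{1..N}. (ln (real n) / real n) *\<^sub>R \<xi> n) = (\<Sum>d\<in>{1..N}. ((mangoldt d / real d) *\<^sub>R \<xi> d) * Lsum \<xi> (N div d))" .
  have "norm (psi_sum \<xi> N * Lval \<xi> - (\<Sum>n\<in>{1..N}. (ln (real n) / real n) *\<^sub>R \<xi> n))
    = norm (\<Sum>d\<in>{1..N}. ((mangoldt d / real d) *\<^sub>R \<xi> d) * (Lval \<xi> - Lsum \<xi> (N div d)))"
    unfolding id psi_sum_def by (simp add: sum_distrib_right right_diff_distrib sum_subtractf)
  also have "\<dots> \<le> (\<Sum>d\<in>{1..N}. mangoldt d * (real Q / real N))"
  proof (rule sum_norm_le)
    fix d assume d: "d \<in> {1..N}"
    have "norm (((mangoldt d / real d) *\<^sub>R \<xi> d) * (Lval \<xi> - Lsum \<xi> (N div d)))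
      = (mangoldt d / real d * norm (\<xi> d)) * norm (Lval \<xi> - Lsum \<xi> (N div d))"
      by (simp add: norm_mult mangoldt_nonneg)
    also have "\<dots> \<le> (mangoldt d / real d * 1) * (real Q * (real d / real N))"
    proof (intro mult_mono mult_left_mono dchar_norm_le[OF assms(2,1)])
      have "norm (Lval \<xi> - Lsum \<xi> (N div d)) \<le> real Q * (1 / real (Suc (N div d)))"
        using Lsum_tail(3)[OF assms(1-3), of "N div d"] by simp
      also have "\<dots> \<le> real Q * (real d / real N)"
        using div_Suc_bound[of d N] d N by (intro mult_left_mono) auto
      finally show "norm (Lval \<xi> - Lsum \<xi> (N div d)) \<le> real Q * (real d / real N)" .
    qed (auto simp: mangoldt_nonneg)
    also have "\<dots> = mangoldt d * (real Q / real N)" using d by simp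
    finally show "norm (((mangoldt d / real d) *\<^sub>R \<xi> d) * (Lval \<xi> - Lsum \<xi> (N div d))) \<le> mangoldt d * (real Q / real N)" .
  qed
  also have "\<dots> = (\<Sum>d\<in>{1..N}. mangoldt d) * (real Q / real N)" by (simp only: sum_distrib_right)
  also have "\<dots> \<le> 4 * real N * (real Q / real N)" by (intro mult_right_mono chebyshev_upper) auto
  also have "\<dots> = 4 * real Q" using N by simp
  finally have "norm (psi_sum \<xi> N * Lval \<xi> - (\<Sum>n\<in>{1..N}. (ln (real n) / real n) *\<^sub>R \<xi> n)) \<le> 4 * real Q" .
  moreover have "norm (psi_sum \<xi> N * Lval \<xi>) \<le> norm (psi_sum \<xi> N * Lval \<xi> - (\<Sum>n\<in>{1..N}. (ln (real n) / real n) *\<^sub>R \<xi> n))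
     + norm (\<Sum>n\<in>{1..N}. (ln (real n) / real n) *\<^sub>R \<xi> n)"
    by (subst add.commute) (rule norm_triangle_sub)
  ultimately have "norm (psi_sum \<xi> N) * norm (Lval \<xi>) \<le> 4 * real Q + (3 * ln 3 + real Q * ln 4)"
    using dchar_log_sum_bounded[OF assms(1-3), of N] by (simp add: norm_mult)
  then show "norm (psi_sum \<xi> N) \<le> (4 * real Q + (3 * ln 3 + real Q * ln 4)) / norm (Lval \<xi>)"
    using assms(4) by (simp add: field_simps)
qed

section \<open>The Moebius function and characters with vanishing L(1)\<close>

definition moeb :: "nat \<Rightarrow> real" where
  "moeb n = (if squarefree n then (-1) ^ card (prime_factors n) else 0)"

text \<open>At order \<open>card P\<close> nothing is truncated: the error term of
  \<open>bonferroni\<close> is an empty sum and the inequality becomes an identity.\<close>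

lemma alternating_subsets:
  assumes "finite P" "P \<noteq> {}" shows "(\<Sum>D\<in>Pow P. (-1 :: real) ^ card D) = 0"
proof -
  have "elem_sym (\<lambda>_. 1) P (Suc (card P)) = 0"
  proof -
    have "{D. D \<subseteq> P \<and> card D = Suc (card P)} = {}"
    proof (intro equals0I)
      fix D assume "D \<in> {D. D \<subseteq> P \<and> card D = Suc (card P)}"
      then have "card D \<le> card P" "card D = Suc (card P)" using card_mono[OF assms(1), of D] by auto
      then show False by simp
    qed
    then show ?thesis by (simp only: elem_sym_def sum.empty)
  qed
  moreover have "0 \<le> (-1) ^ card P * (alt_sum (\<lambda>_. 1) P (card P) - (\<Prod>p\<in>P. 1 - 1)) \<and>
    (-1) ^ card P * (alt_sum (\<lambda>_. 1) P (card P) - (\<Prod>p\<in>P. 1 - 1)) \<le> elem_sym (\<lambda>_. 1) P (Suc (card P))"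
    by (rule bonferroni[OF assms(1)]) auto
  moreover have "x = 0" if "e = 0" "0 \<le> x \<and> x \<le> e" for x e :: real using that by linarith
  ultimately have "(-1) ^ card P * (alt_sum (\<lambda>_. 1) P (card P) - (\<Prod>p\<in>P. 1 - 1)) = 0" by blast
  moreover have "(\<Prod>p\<in>P. 1 - (1::real)) = 0" using assms by (simp add: card_gt_0_iff)
  ultimately have "alt_sum (\<lambda>_. 1) P (card P) = 0" by simp
  moreover have "{D. D \<subseteq> P \<and> card D \<le> card P} = Pow P" using card_mono[OF assms(1)] by auto
  ultimately show ?thesis by (simp add: alt_sum_def)
qed

lemma prime_factors_prod_primes:
  fixes D :: "nat set"
  assumes "finite D" "\<And>p. p \<in> D \<Longrightarrow> prime p"
  shows "prime_factors (\<Prod>D) = D"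
proof -
  have "prime_factors (\<Prod>D) = (\<Union>p\<in>D. prime_factors p)"
  proof -
    have "0 \<notin> id ` D" using assms(2)[of 0] by auto
    then show ?thesis using prime_factors_prod[OF assms(1), of id] by simp
  qed
  also have "\<dots> = (\<Union>p\<in>D. {p})" using assms by (intro SUP_cong) (auto simp: prime_prime_factors)
  finally show ?thesis by simp
qed

lemma squarefree_prod_primes:
  fixes D :: "nat set"
  assumes "finite D" "\<And>p. p \<in> D \<Longrightarrow> prime p"
  shows "squarefree (\<Prod>D)"
  using assms by (intro squarefree_prod_coprime) (auto simp: primes_coprime squarefree_prime)

lemma prod_prime_factors_squarefree:
  assumes "squarefree (n::nat)" shows "\<Prod>(prime_factors n) = n"
proof -
  have n: "n \<noteq> 0" using assms by (metis not_squarefree_0)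
  have "(\<Prod>p\<in>prime_factors n. p ^ multiplicity p n) = n" using n by (simp add: prime_factorization_nat[symmetric])
  moreover have "multiplicity p n = 1" if "p \<in> prime_factors n" for p
    using assms n that squarefree_factorial_semiring'[of n] by simp
  ultimately show ?thesis by simp
qed

lemma prod_primes_dvd:
  fixes n :: nat
  assumes "D \<subseteq> prime_factors n" "n > 0" shows "\<Prod>D dvd n"
proof -
  have "\<Prod>D dvd \<Prod>(prime_factors n)" using assms by (intro prod_dvd_prod_subset) auto
  also have "\<dots> dvd (\<Prod>p\<in>prime_factors n. p ^ multiplicity p n)"
    by (intro prod_dvd_prod) (auto simp: prime_factors_multiplicity intro!: dvd_power)
  also have "\<dots> = n" using assms by (simp add: prime_factorization_nat[symmetric])
  finally show ?thesis .
qed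

lemma moeb_sum:
  assumes "n > 0" shows "(\<Sum>d | d dvd n. moeb d) = of_bool (n = 1)"
proof -
  let ?P = "prime_factors n"
  have pr: "\<And>D p. D \<subseteq> ?P \<Longrightarrow> p \<in> D \<Longrightarrow> prime p" by auto
  have fin: "\<And>D. D \<subseteq> ?P \<Longrightarrow> finite D" using finite_subset by auto
  have "(\<Sum>d | d dvd n. moeb d) = (\<Sum>d | d dvd n \<and> squarefree d. moeb d)"
    using assms by (intro sum.mono_neutral_right) (auto simp: moeb_def)
  also have "\<dots> = (\<Sum>D\<in>Pow ?P. (-1) ^ card D)"
  proof (rule sum.reindex_bij_witness[where i = "\<lambda>D. \<Prod>D" and j = prime_factors])
    fix d assume d: "d \<in> {d. d dvd n \<and> squarefree d}"
    then show "\<Prod>(prime_factors d) = d" by (simp add: prod_prime_factors_squarefree)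
    show "prime_factors d \<in> Pow ?P" using d assms dvd_prime_factors[of n d] by auto
    show "(-1) ^ card (prime_factors d) = moeb d" using d by (simp add: moeb_def)
  next
    fix D assume "D \<in> Pow ?P"
    then have D: "D \<subseteq> ?P" by simp
    show "prime_factors (\<Prod>D) = D" using prime_factors_prod_primes[OF fin[OF D] pr[OF D]] .
    show "\<Prod>D \<in> {d. d dvd n \<and> squarefree d}"
      using prod_primes_dvd[OF D assms] squarefree_prod_primes[OF fin[OF D] pr[OF D]] by simp
  qed
  also have "\<dots> = of_bool (n = 1)"
  proof (cases "n = 1")
    case False
    then have "?P \<noteq> {}" using assms by (auto simp: prime_factorization_empty_iff set_mset_eq_empty_iff)
    then show ?thesis using alternating_subsets[of ?P] False by simp
  qed simp
  finally show ?thesis .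
qed

lemma divisor_pairs_swap:
  fixes F :: "nat \<Rightarrow> nat \<Rightarrow> real"
  assumes "n > 0"
  shows "(\<Sum>d | d dvd n. \<Sum>e | e dvd n div d. F d e) = (\<Sum>e | e dvd n. \<Sum>d | d dvd n div e. F d e)"
proof -
  have fin: "finite {d. d dvd m}" if "m > 0" for m :: nat using that by simp
  have pos: "n div d > 0" if "d dvd n" for d using that assms by (metis dvd_div_eq_0_iff neq0_conv)
  have "(\<Sum>d | d dvd n. \<Sum>e | e dvd n div d. F d e) = (\<Sum>(d,e)\<in>Sigma {d. d dvd n} (\<lambda>d. {e. e dvd n div d}). F d e)"
    using fin pos assms by (intro sum.Sigma) auto
  also have "\<dots> = (\<Sum>(e,d)\<in>Sigma {e. e dvd n} (\<lambda>e. {d. d dvd n div e}). F d e)"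
    by (rule sum.reindex_bij_witness[where i = "\<lambda>(e,d). (d,e)" and j = "\<lambda>(d,e). (e,d)"])
      (auto simp: dvd_div_iff_mult mult.commute dest: dvd_mult_left dvd_mult_right intro: dvd_mult_left dvd_mult_right,
       (metis dvd_div_iff_mult dvd_mult_left dvd_mult_right mult.commute dvd_0_left_iff assms neq0_conv)+)
  also have "\<dots> = (\<Sum>e | e dvd n. \<Sum>d | d dvd n div e. F d e)"
    using fin pos assms by (intro sum.Sigma[symmetric]) auto
  finally show ?thesis .
qed

lemma moeb_ln_sum:
  assumes "n > 0" shows "(\<Sum>d | d dvd n. moeb d * ln (real d)) = - mangoldt n"
proof -
  have "(\<Sum>d | d dvd n. moeb d * ln (real (n div d))) = (\<Sum>d | d dvd n. \<Sum>e | e dvd n div d. moeb d * mangoldt e)"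
  proof (rule sum.cong)
    fix d assume "d \<in> {d. d dvd n}"
    then have "n div d \<noteq> 0" using assms by (metis dvd_div_eq_0_iff mem_Collect_eq neq0_conv)
    then show "moeb d * ln (real (n div d)) = (\<Sum>e | e dvd n div d. moeb d * mangoldt e)"
      using mangoldt_sum[of "n div d", where 'a = real] by (simp add: sum_distrib_left[symmetric])
  qed simp
  also have "\<dots> = (\<Sum>e | e dvd n. \<Sum>d | d dvd n div e. moeb d * mangoldt e)"
    by (rule divisor_pairs_swap[OF assms])
  also have "\<dots> = (\<Sum>e | e dvd n. if e = n then mangoldt n else 0)"
  proof (rule sum.cong)
    fix e assume e: "e \<in> {e. e dvd n}"
    then have pos: "n div e > 0" using assms by (metis dvd_div_eq_0_iff mem_Collect_eq neq0_conv)
    have "n div e = 1 \<longleftrightarrow> e = n" using e assms by auto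
    then show "(\<Sum>d | d dvd n div e. moeb d * mangoldt e) = (if e = n then mangoldt n else 0)"
      using moeb_sum[OF pos] by (simp add: sum_distrib_right[symmetric])
  qed simp
  also have "\<dots> = mangoldt n" using assms by simp
  finally have 1: "(\<Sum>d | d dvd n. moeb d * ln (real (n div d))) = mangoldt n" .
  have "(\<Sum>d | d dvd n. moeb d * ln (real (n div d))) = (\<Sum>d | d dvd n. moeb d * ln (real n) - moeb d * ln (real d))"
  proof (rule sum.cong)
    fix d assume "d \<in> {d. d dvd n}"
    then obtain e where "n = d * e" by auto
    moreover from this have "d > 0" "e > 0" using assms by auto
    ultimately show "moeb d * ln (real (n div d)) = moeb d * ln (real n) - moeb d * ln (real d)"
      by (simp add: ln_mult algebra_simps)
  qed simp
  also have "\<dots> = of_bool (n = 1) * ln (real n) - (\<Sum>d | d dvd n. moeb d * ln (real d))"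
    by (simp add: sum_subtractf moeb_sum[OF assms] flip: sum_distrib_right)
  finally show ?thesis using 1 by (auto simp: of_bool_def split: if_splits)
qed

text \<open>When L(1) vanishes, the partial sums \<open>Lsum \<xi> (N div d)\<close> are themselves
  at most \<open>Q * d / N\<close>. The weights \<open>moeb d * ln (N / d)\<close> are chosen
  because their divisor sum is \<open>ln N\<close> at \<open>n = 1\<close> plus
  \<open>mangoldt n\<close>, and their total size is controlled by \<open>sum_ln_lower\<close>. Thus
  a zero costs a full logarithm.\<close>

lemma psi_sum_zero_case:
  assumes "Q > 0" "dchar Q \<xi>" "\<xi> \<noteq> principal Q" "Lval \<xi> = 0" "N \<ge> 1"
  shows "norm (psi_sum \<xi> N + of_real (ln (real N))) \<le> real Q"
proof -
  define c where "c = (\<lambda>d. moeb d * (ln (real N) - ln (real d)) / real d)"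
  have "(\<Sum>d\<in>{1..N}. (c d *\<^sub>R \<xi> d) * Lsum \<xi> (N div d)) = (\<Sum>d\<in>{1..N}. \<Sum>m\<in>{1..N div d}. (c d *\<^sub>R \<xi> d) * ((1 / real m) *\<^sub>R \<xi> m))"
    by (simp add: Lsum_def sum_distrib_left)
  also have "\<dots> = (\<Sum>n\<in>{1..N}. \<Sum>d | d dvd n. (c d *\<^sub>R \<xi> d) * ((1 / real (n div d)) *\<^sub>R \<xi> (n div d)))"
    by (rule sum_divisors_swap[symmetric])
  also have "\<dots> = (\<Sum>n\<in>{1..N}. ((of_bool (n = 1) * ln (real N) + mangoldt n) / real n) *\<^sub>R \<xi> n)"
  proof (rule sum.cong)
    fix n assume n: "n \<in> {1..N}"
    have "(\<Sum>d | d dvd n. (c d *\<^sub>R \<xi> d) * ((1 / real (n div d)) *\<^sub>R \<xi> (n div d)))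
      = (\<Sum>d | d dvd n. (moeb d * (ln (real N) - ln (real d)) / real n) *\<^sub>R \<xi> n)"
    proof (rule sum.cong)
      fix d assume "d \<in> {d. d dvd n}"
      then obtain e where e: "n = d * e" by auto
      then have "d > 0" using n by (auto intro!: Nat.gr0I)
      then show "(c d *\<^sub>R \<xi> d) * ((1 / real (n div d)) *\<^sub>R \<xi> (n div d)) = (moeb d * (ln (real N) - ln (real d)) / real n) *\<^sub>R \<xi> n"
        using dchar_mult[OF assms(2), of d e] e by (simp add: c_def)
    qed simp
    also have "\<dots> = ((\<Sum>d | d dvd n. moeb d * (ln (real N) - ln (real d))) / real n) *\<^sub>R \<xi> n"
      by (simp add: scaleR_sum_left sum_divide_distrib)
    also have "(\<Sum>d | d dvd n. moeb d * (ln (real N) - ln (real d))) = of_bool (n = 1) * ln (real N) + mangoldt n"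
      using n moeb_sum[of n] moeb_ln_sum[of n]
      by (simp add: right_diff_distrib sum_subtractf flip: sum_distrib_right)
    finally show "(\<Sum>d | d dvd n. (c d *\<^sub>R \<xi> d) * ((1 / real (n div d)) *\<^sub>R \<xi> (n div d))) = ((of_bool (n = 1) * ln (real N) + mangoldt n) / real n) *\<^sub>R \<xi> n" .
  qed simp
  also have "\<dots> = (\<Sum>n\<in>{1..N}. (of_bool (n = 1) * ln (real N) / real n) *\<^sub>R \<xi> n) + psi_sum \<xi> N"
    by (simp add: psi_sum_def sum.distrib add_divide_distrib scaleR_add_left)
  also have "(\<Sum>n\<in>{1..N}. (of_bool (n = 1) * ln (real N) / real n) *\<^sub>R \<xi> n) = (\<Sum>n\<in>{1}. (of_bool (n = 1) * ln (real N) / real n) *\<^sub>R \<xi> n)"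
    using assms(5) by (intro sum.mono_neutral_right) auto
  also have "\<dots> = of_real (ln (real N))" using dchar_1[OF assms(2)] by (simp add: scaleR_conv_of_real)
  finally have id: "psi_sum \<xi> N + of_real (ln (real N)) = (\<Sum>d\<in>{1..N}. (c d *\<^sub>R \<xi> d) * Lsum \<xi> (N div d))" by (simp add: add.commute)
  have "norm (psi_sum \<xi> N + of_real (ln (real N))) \<le> (\<Sum>d\<in>{1..N}. (ln (real N) - ln (real d)) * (real Q / real N))"
    unfolding id
  proof (rule sum_norm_le)
    fix d assume d: "d \<in> {1..N}"
    have l: "0 \<le> ln (real N) - ln (real d)" using d by simp
    have mo: "\<bar>moeb d\<bar> \<le> 1" by (simp add: moeb_def power_abs)
    have "norm ((c d *\<^sub>R \<xi> d) * Lsum \<xi> (N div d)) = \<bar>c d\<bar> * norm (\<xi> d) * norm (Lsum \<xi> (N div d))"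
      by (simp add: norm_mult)
    also have "\<dots> \<le> ((ln (real N) - ln (real d)) / real d) * 1 * (real Q * (real d / real N))"
    proof (intro mult_mono dchar_norm_le[OF assms(2,1)])
      have "\<bar>c d\<bar> = \<bar>moeb d\<bar> * ((ln (real N) - ln (real d)) / real d)" using l by (simp add: c_def abs_mult)
      also have "\<dots> \<le> 1 * ((ln (real N) - ln (real d)) / real d)" using mo l by (intro mult_right_mono) auto
      finally show "\<bar>c d\<bar> \<le> (ln (real N) - ln (real d)) / real d" by simp
      have "norm (Lsum \<xi> (N div d)) \<le> real Q * (1 / real (Suc (N div d)))"
        using Lsum_tail(3)[OF assms(1-3), of "N div d"] assms(4) by simp
      also have "\<dots> \<le> real Q * (real d / real N)"
        using div_Suc_bound[of d N] d assms(5) by (intro mult_left_mono) auto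
      finally show "norm (Lsum \<xi> (N div d)) \<le> real Q * (real d / real N)" .
    qed (use l in auto)
    also have "\<dots> = (ln (real N) - ln (real d)) * (real Q / real N)" using d by simp
    finally show "norm ((c d *\<^sub>R \<xi> d) * Lsum \<xi> (N div d)) \<le> (ln (real N) - ln (real d)) * (real Q / real N)" .
  qed
  also have "\<dots> = (real N * ln (real N) - (\<Sum>d\<in>{1..N}. ln (real d))) * (real Q / real N)"
    unfolding sum_distrib_right[symmetric] sum_subtractf by simp
  also have "\<dots> \<le> real N * (real Q / real N)"
    using sum_ln_lower[of N] by (intro mult_right_mono) auto
  also have "\<dots> = real Q" using assms(5) by simp
  finally show ?thesis .
qed

section \<open>Nonvanishing of L(1) for real characters\<close>

text \<open>The powers of \<open>t\<close> decrease by steps that themselves decrease, so the drop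
  from \<open>t ^ n\<close> to \<open>t ^ b\<close> is at most the one from \<open>t ^ a\<close> to
  \<open>t ^ n\<close>.\<close>

lemma power_pair_ge:
  fixes t :: real
  assumes "0 \<le> t" "t \<le> 1" "a \<le> n" "n \<le> b" "b - n \<le> n - a"
  shows "2 * t ^ n \<le> t ^ a + t ^ b"
proof -
  have "t ^ n * (1 - t ^ (b - n)) \<le> t ^ a * (1 - t ^ (n - a))"
    using assms by (intro mult_mono power_decreasing diff_left_mono) (auto simp: power_le_one)
  moreover have "t ^ n * t ^ (b - n) = t ^ b" "t ^ a * t ^ (n - a) = t ^ n"
    using assms by (simp_all flip: power_add)
  ultimately show ?thesis by (simp add: right_diff_distrib)
qed

text \<open>In the expanded product the pair \<open>(i, j)\<close> is matched with its reflection
  \<open>(n - 1 - i, n - j)\<close>. The two exponents add up to \<open>2 * n - 1\<close>, so the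
  two powers together are at least \<open>2 * t ^ n\<close>.\<close>

lemma geometric_sums_product_ge:
  fixes t :: real
  assumes "0 \<le> t" "t \<le> 1"
  shows "real n * real (n + 1) * t ^ n \<le> (\<Sum>i<n. t ^ i) * (\<Sum>j<n + 1. t ^ j)"
proof -
  let ?s = "\<Sum>i<n. t ^ i" and ?s' = "\<Sum>j<n + 1. t ^ j"
  have r1: "?s = (\<Sum>i<n. t ^ (n - Suc i))" by (rule sum.nat_diff_reindex[symmetric])
  have r2: "?s' = (\<Sum>j<n + 1. t ^ (n + 1 - Suc j))" by (rule sum.nat_diff_reindex[symmetric])
  have "(\<Sum>i<n. \<Sum>j<n + 1. 2 * t ^ n) \<le> (\<Sum>i<n. \<Sum>j<n + 1. t ^ i * t ^ j + t ^ (n - Suc i) * t ^ (n + 1 - Suc j))"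
  proof (intro sum_mono)
    fix i j assume "i \<in> {..<n}" "j \<in> {..<n + 1}"
    then have ij: "i < n" "j \<le> n" by auto
    have *: "2 * t ^ n \<le> t ^ (i + j) + t ^ ((n - Suc i) + (n + 1 - Suc j))"
    proof (cases "i + j \<le> n")
      case True
      then have "n \<le> (n - Suc i) + (n + 1 - Suc j) \<or> (i + j = n)" using ij by auto
      then show ?thesis
      proof
        assume "i + j = n"
        then have "(n - Suc i) + (n + 1 - Suc j) \<le> n" using ij by auto
        then have "t ^ n \<le> t ^ ((n - Suc i) + (n + 1 - Suc j))" using assms by (intro power_decreasing) auto
        then show ?thesis using \<open>i + j = n\<close> by simp
      qed (use assms True ij in \<open>intro power_pair_ge; auto\<close>)
    next
      case False
      then have "2 * t ^ n \<le> t ^ ((n - Suc i) + (n + 1 - Suc j)) + t ^ (i + j)"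
        using assms ij by (intro power_pair_ge) auto
      then show ?thesis by simp
    qed
    then show "2 * t ^ n \<le> t ^ i * t ^ j + t ^ (n - Suc i) * t ^ (n + 1 - Suc j)" by (simp only: power_add)
  qed
  also have "\<dots> = ?s * ?s' + (\<Sum>i<n. t ^ (n - Suc i)) * (\<Sum>j<n + 1. t ^ (n + 1 - Suc j))"
    by (simp only: sum.distrib sum_product)
  also have "\<dots> = 2 * (?s * ?s')" unfolding r1[symmetric] r2[symmetric] by simp
  finally show ?thesis by simp
qed

text \<open>Monsky's weights: comparing the Lambert series of a character with its value \<open>L(1)\<close>.\<close>
definition monsky :: "real \<Rightarrow> nat \<Rightarrow> real" where
  "monsky t n = 1 / (real n * (1 - t)) - t ^ n / (1 - t ^ n)"

lemma monsky_altdef: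
  assumes "0 < t" "t < 1" "n > 0"
  shows "monsky t n = (1 / real n - t ^ n / (\<Sum>i<n. t ^ i)) / (1 - t)"
proof -
  have "1 - t ^ n = (1 - t) * (\<Sum>i<n. t ^ i)" by (rule one_diff_power_eq)
  then show ?thesis using assms unfolding monsky_def by (simp add: diff_divide_distrib)
qed

lemma geometric_sum_pos: assumes "0 < t" "n > 0" shows "0 < (\<Sum>i<n. (t::real) ^ i)"
  using assms by (intro sum_pos) auto

lemma monsky_nonneg:
  assumes "0 < t" "t < 1" "n > 0" shows "0 \<le> monsky t n"
proof -
  have "(\<Sum>i<n. t ^ n) \<le> (\<Sum>i<n. t ^ i)" using assms by (intro sum_mono power_decreasing) auto
  then have "real n * t ^ n \<le> (\<Sum>i<n. t ^ i)" by simp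
  then have "t ^ n / (\<Sum>i<n. t ^ i) \<le> 1 / real n"
    using assms geometric_sum_pos[of t n] by (simp add: field_simps)
  then show ?thesis unfolding monsky_altdef[OF assms] using assms by (intro divide_nonneg_pos) auto
qed

text \<open>After clearing \<open>1 - t\<close>, the difference of consecutive terms
  \<open>t ^ n / (1 + ... + t ^ (n - 1))\<close> simplifies to \<open>t ^ n\<close> over the product
  of the two geometric sums, and must be compared with \<open>1 / (n * (n + 1))\<close>.\<close>

lemma monsky_Suc_le:
  assumes "0 < t" "t < 1" "n > 0" shows "monsky t (Suc n) \<le> monsky t n"
proof -
  let ?s = "\<Sum>i<n. t ^ i" and ?s' = "\<Sum>j<Suc n. t ^ j"
  have pos: "0 < ?s" "0 < ?s'" using assms geometric_sum_pos[of t n] geometric_sum_pos[of t "Suc n"] by auto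
  have s': "?s' = 1 + t * ?s" by (subst sum.lessThan_Suc_shift) (simp add: sum_distrib_left)
  have "t ^ n / ?s - t ^ Suc n / ?s' = t ^ n * (?s' - t * ?s) / (?s * ?s')"
    using pos by (simp add: field_simps)
  also have "?s' - t * ?s = 1" using s' by simp
  also have "t ^ n * 1 / (?s * ?s') = t ^ n / (?s * ?s')" by simp
  also have "\<dots> \<le> 1 / (real n * real (n + 1))"
  proof -
    have gen: "x / A \<le> 1 / B" if "B * x \<le> A" "0 < A" "0 < B" for x A B :: real
      using that by (simp add: field_simps)
    show ?thesis using geometric_sums_product_ge[of t n] assms pos by (intro gen) auto
  qed
  also have "\<dots> = 1 / real n - 1 / real (Suc n)" using assms by (simp add: field_simps)
  finally have "1 / real (Suc n) - t ^ Suc n / ?s' \<le> 1 / real n - t ^ n / ?s" by linarith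
  then show ?thesis using assms monsky_altdef[of t n] monsky_altdef[of t "Suc n"]
    by (simp add: divide_right_mono del: sum.lessThan_Suc power_Suc)
qed

lemma monsky_antimono:
  assumes "0 < t" "t < 1" "m > 0" "m \<le> n" shows "monsky t n \<le> monsky t m"
  using assms(4)
proof (induction n rule: dec_induct)
  case (step n)
  then show ?case using monsky_Suc_le[OF assms(1,2), of n] assms(3) by linarith
qed simp

lemma divisors_prime_power_times:
  fixes p m a :: nat and r :: "nat \<Rightarrow> real"
  assumes p: "prime p" "\<not> p dvd m" "m > 0" and r: "\<And>x y. r (x * y) = r x * r y" "r 1 = 1"
  shows "(\<Sum>d | d dvd p ^ a * m. r d) = (\<Sum>i\<le>a. r p ^ i) * (\<Sum>d | d dvd m. r d)"
proof -
  have rp: "r (p ^ i) = r p ^ i" for i by (induction i) (use r in auto)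
  have "(\<Sum>i\<le>a. r p ^ i) * (\<Sum>d | d dvd m. r d) = (\<Sum>(i,d)\<in>{..a} \<times> {d. d dvd m}. r (p ^ i * d))"
    by (simp add: sum_product sum.cartesian_product r rp)
  also have "\<dots> = (\<Sum>e\<in>(\<lambda>(i,d). p ^ i * d) ` ({..a} \<times> {d. d dvd m}). r e)"
  proof (subst sum.reindex)
    show "inj_on (\<lambda>(i,d). p ^ i * d) ({..a} \<times> {d. d dvd m})"
    proof (rule inj_onI, clarsimp)
      fix i d j e assume *: "d dvd m" "e dvd m" "p ^ i * d = p ^ j * e"
      have nd': "\<not> p dvd d \<and> d \<noteq> 0" if "d dvd m" for d
        using dvd_trans[of p d m] that p(2,3) by auto
      note nd = nd'[OF *(1), THEN conjunct1] nd'[OF *(2), THEN conjunct1] nd'[OF *(1), THEN conjunct2] nd'[OF *(2), THEN conjunct2]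
      have mult: "multiplicity p (p ^ i * d) = i" if "\<not> p dvd d" "d \<noteq> 0" for i d
      proof -
        have "p \<noteq> 0" "\<not> is_unit p" using p(1) by (auto simp: prime_nat_iff)
        then show ?thesis using that p(1)
          by (simp add: prime_elem_multiplicity_mult_distrib not_dvd_imp_multiplicity_0 prime_imp_prime_elem)
      qed
      have "i = j" using mult[OF nd(1,3), of i] mult[OF nd(2,4), of j] *(3) by simp
      then show "i = j \<and> d = e" using *(3) p(1) by (simp add: prime_gt_0_nat)
    qed
  qed (simp add: case_prod_unfold)
  also have "(\<lambda>(i,d). p ^ i * d) ` ({..a} \<times> {d. d dvd m}) = {d. d dvd p ^ a * m}"
  proof (intro equalityI subsetI)
    fix e assume "e \<in> (\<lambda>(i,d). p ^ i * d) ` ({..a} \<times> {d. d dvd m})"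
    then show "e \<in> {d. d dvd p ^ a * m}" by (auto intro: mult_dvd_mono le_imp_power_dvd)
  next
    fix e assume e: "e \<in> {d. d dvd p ^ a * m}"
    have "p ^ a * m \<noteq> 0" using p(3) prime_gt_0_nat[OF p(1)] by simp
    then have e0: "e \<noteq> 0" using e by (metis dvd_0_left mem_Collect_eq)
    have np: "\<not> is_unit p" using p(1) by (auto simp: prime_nat_iff)
    obtain d where d: "e = p ^ multiplicity p e * d" "\<not> p dvd d" using multiplicity_decompose'[OF e0 np] .
    define i where "i = multiplicity p e"
    have "p ^ i dvd p ^ a * m" using e d(1) unfolding i_def by (metis dvd_mult_left mem_Collect_eq)
    moreover have "coprime (p ^ i) m" using p by (simp add: prime_imp_coprime)
    ultimately have "p ^ i dvd p ^ a" using coprime_dvd_mult_left_iff by blast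
    then have "i \<le> a" using p(1) by (metis power_dvd_imp_le prime_gt_1_nat)
    moreover have "d dvd m"
    proof -
      have "d dvd p ^ a * m" using e d(1) by (metis dvd_mult_right mem_Collect_eq)
      moreover have "coprime d (p ^ a)" using p(1) d(2) by (metis coprime_commute coprime_power_right_iff prime_imp_coprime)
      ultimately show ?thesis using coprime_dvd_mult_right_iff by blast
    qed
    ultimately show "e \<in> (\<lambda>(i,d). p ^ i * d) ` ({..a} \<times> {d. d dvd m})"
      using d(1) unfolding i_def[symmetric] by (intro image_eqI[of _ _ "(i, d)"]) auto
  qed
  finally show ?thesis ..
qed

lemma sum_powers_sign:
  fixes x :: real assumes "x \<in> {-1, 0, 1}"
  shows "0 \<le> (\<Sum>i\<le>a. x ^ i)" "1 \<le> (\<Sum>i\<le>2 * a. x ^ i)"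
proof -
  have m: "(\<Sum>i\<le>a. (-1::real) ^ i) = of_bool (even a)" for a by (induction a) auto
  have z: "(\<Sum>i\<le>a. (0::real) ^ i) = 1" for a by (induction a) auto
  show "0 \<le> (\<Sum>i\<le>a. x ^ i)" "1 \<le> (\<Sum>i\<le>2 * a. x ^ i)" using assms m z by auto
qed

lemma prime_power_split:
  fixes n :: nat assumes "n > 1"
  obtains p a m where "prime p" "n = p ^ a * m" "\<not> p dvd m" "0 < m" "m < n"
proof -
  obtain p where p: "prime p" "p dvd n" using assms prime_factor_nat[of n] by auto
  have n0: "n \<noteq> 0" and np: "\<not> is_unit p" using assms p(1) by (auto simp: prime_nat_iff)
  obtain m where m: "n = p ^ multiplicity p n * m" "\<not> p dvd m" using multiplicity_decompose'[OF n0 np] .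
  have "m \<noteq> 0" using m(1) n0 by (metis mult_0_right)
  moreover have "m \<noteq> n" using m p by auto
  moreover have "m dvd n" using m(1) by (metis dvd_triv_right)
  then have "m \<le> n" using n0 by (simp add: dvd_imp_le)
  ultimately show ?thesis using that[of p "multiplicity p n" m] p m by auto
qed

text \<open>Splitting off one prime power at a time exhibits the divisor sum as a product of factors
  \<open>1 + x + ... + x ^ a\<close> with \<open>x\<close> in \<open>{-1, 0, 1}\<close>; these are
  nonnegative, and at least \<open>1\<close> for even \<open>a\<close>. They will be the
  coefficients of a Lambert series.\<close>

lemma divisor_sum_sign:
  fixes r :: "nat \<Rightarrow> real"
  assumes r: "\<And>x y. r (x * y) = r x * r y" "r 1 = 1" "\<And>x. r x \<in> {-1, 0, 1}"
  shows "n > 0 \<Longrightarrow> 0 \<le> (\<Sum>d | d dvd n. r d)" "k > 0 \<Longrightarrow> 1 \<le> (\<Sum>d | d dvd k\<^sup>2. r d)"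
proof -
  show "0 \<le> (\<Sum>d | d dvd n. r d)" if "n > 0" using that
  proof (induction n rule: less_induct)
    case (less n)
    show ?case
    proof (cases "n = 1")
      case True
      then show ?thesis using r by simp
    next
      case False
      then have "n > 1" using less.prems by linarith
      then obtain p a m where *: "prime p" "n = p ^ a * m" "\<not> p dvd m" "0 < m" "m < n"
        by (rule prime_power_split)
      then show ?thesis using less.IH[of m] divisors_prime_power_times[where r = r, OF *(1,3,4) r(1,2), of a] sum_powers_sign(1)[OF r(3)]
        by simp
    qed
  qed
  show "1 \<le> (\<Sum>d | d dvd k\<^sup>2. r d)" if "k > 0" using that
  proof (induction k rule: less_induct)
    case (less k)
    show ?case
    proof (cases "k = 1")
      case True
      then show ?thesis using r by simp
    next
      case False
      then have "k > 1" using less.prems by linarith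
      then obtain p a m where *: "prime p" "k = p ^ a * m" "\<not> p dvd m" "0 < m" "m < k"
        by (rule prime_power_split)
      have "k\<^sup>2 = p ^ (2 * a) * m\<^sup>2" using *(2) by (simp add: power_mult_distrib power_mult[symmetric] mult.commute)
      moreover have "\<not> p dvd m\<^sup>2" using * by (metis prime_dvd_power)
      ultimately have "(\<Sum>d | d dvd k\<^sup>2. r d) = (\<Sum>i\<le>2*a. r p ^ i) * (\<Sum>d | d dvd m\<^sup>2. r d)"
        using divisors_prime_power_times[where r = r and m = "m\<^sup>2" and a = "2 * a" and p = p] r * by simp
      moreover have "1 * 1 \<le> (\<Sum>i\<le>2*a. r p ^ i) * (\<Sum>d | d dvd m\<^sup>2. r d)"
        using less.IH[of m] * sum_powers_sign(2)[OF r(3), of p a] by (intro mult_mono) auto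
      ultimately show ?thesis by simp
    qed
  qed
qed

lemma real_dchar_values:
  assumes "Q > 0" "dchar Q \<xi>" "\<And>n. cnj (\<xi> n) = \<xi> n"
  shows "Re (\<xi> n) \<in> {-1, 0, 1}" "\<xi> n = of_real (Re (\<xi> n))"
proof -
  show e: "\<xi> n = of_real (Re (\<xi> n))" using assms(3)[of n] by (simp add: complex_eq_iff)
  have "norm (\<xi> n) = \<bar>Re (\<xi> n)\<bar>" by (subst e) simp
  then have "\<bar>Re (\<xi> n)\<bar> = of_bool (coprime n Q)" using dchar_norm[OF assms(2,1), of n] by simp
  then show "Re (\<xi> n) \<in> {-1, 0, 1}" by (auto simp: of_bool_def abs_if split: if_splits)
qed

text \<open>Monsky's argument: the Lambert series of the character has nonnegative coefficients that
  are at least \<open>1\<close> at the squares, so it is unbounded as \<open>t\<close> tends to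
  \<open>1\<close>. If L(1) were \<open>0\<close>, it would be bounded by \<open>Q\<close>.\<close>

lemma Lval_real_nonzero:
  assumes Q: "Q > 0" and d: "dchar Q \<xi>" "\<xi> \<noteq> principal Q" and real: "\<And>n. cnj (\<xi> n) = \<xi> n"
  shows "Lval \<xi> \<noteq> 0"
proof
  assume L0: "Lval \<xi> = 0"
  define r where "r = (\<lambda>n. Re (\<xi> n))"
  have rr: "\<xi> n = of_real (r n)" "r n \<in> {-1, 0, 1}" for n using real_dchar_values[OF Q d(1) real] by (auto simp: r_def)
  have rmult: "r (m * n) = r m * r n" for m n
    using dchar_mult[OF d(1), of m n] rr(1) by (metis of_real_eq_iff of_real_mult)
  have r1: "r 1 = 1" using dchar_1[OF d(1)] by (simp add: r_def)
  have rabs: "\<bar>r n\<bar> \<le> 1" for n using rr(2)[of n] by auto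
  have pw: "(\<Sum>k\<in>{1..K}. t ^ k\<^sup>2) \<le> real Q" if t: "0 < t" "t < 1" for t K
  proof -
    \<comment> \<open>The bound obtained by cutting all series at \<open>N\<close>. For fixed
      \<open>t\<close> its first and last terms vanish as \<open>N\<close> grows, leaving
      \<open>Q\<close>.\<close>
    define E where "E = (\<lambda>N. real N * t ^ N / (1 - t) + real Q + 1 / (1 - t) * (real Q / real (Suc N)))"
    have bound: "(\<Sum>k\<in>{1..K}. t ^ k\<^sup>2) \<le> E N" if N: "K\<^sup>2 \<le> N" for N
    proof -
      define c where "c = (\<lambda>n. \<Sum>d | d dvd n. r d)"
      have c: "n > 0 \<Longrightarrow> 0 \<le> c n" "k > 0 \<Longrightarrow> 1 \<le> c (k\<^sup>2)" for n k
        using divisor_sum_sign[of r, OF rmult r1 rr(2)] by (auto simp: c_def)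
      have "(\<Sum>k\<in>{1..K}. t ^ k\<^sup>2) \<le> (\<Sum>k\<in>{1..K}. c (k\<^sup>2) * t ^ k\<^sup>2)"
        using c(2) t by (intro sum_mono) (auto simp: mult_le_cancel_right1)
      also have "\<dots> = (\<Sum>n\<in>(\<lambda>k. k\<^sup>2) ` {1..K}. c n * t ^ n)"
        by (subst sum.reindex) (auto simp: inj_on_def)
      also have "\<dots> \<le> (\<Sum>n\<in>{1..N}. c n * t ^ n)"
      proof (rule sum_mono2)
        show "(\<lambda>k. k\<^sup>2) ` {1..K} \<subseteq> {1..N}"
        proof
          fix n assume "n \<in> (\<lambda>k. k\<^sup>2) ` {1..K}"
          then obtain k where k: "n = k\<^sup>2" "1 \<le> k" "k \<le> K" by auto
          have "k\<^sup>2 \<le> K\<^sup>2" using k by (intro power_mono) auto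
          then have "k\<^sup>2 \<le> N" using N by (rule order_trans)
          then show "n \<in> {1..N}" using k by simp
        qed
      qed (use c(1) t in auto)
      also have "\<dots> = (\<Sum>n\<in>{1..N}. \<Sum>d | d dvd n. r d * t ^ (d * (n div d)))"
        unfolding c_def sum_distrib_right by (intro sum.cong) auto
      also have "\<dots> = (\<Sum>d\<in>{1..N}. \<Sum>m\<in>{1..N div d}. r d * t ^ (d * m))"
        by (rule sum_divisors_swap[of "\<lambda>d m. r d * t ^ (d * m)"])
      also have "\<dots> \<le> (\<Sum>d\<in>{1..N}. r d * (t ^ d / (1 - t ^ d)) + t ^ N / (1 - t))"
      proof (rule sum_mono)
        fix d assume dN: "d \<in> {1..N}"
        let ?M = "N div d"
        have td: "0 \<le> t ^ d" "t ^ d \<le> t" "t ^ d < 1"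
          using t dN power_decreasing[of 1 d t] by auto
        have "(\<Sum>m\<in>{1..M}. (t ^ d) ^ m) * (1 - t ^ d) = t ^ d - (t ^ d) ^ Suc M" for M
        proof (induction M)
          case (Suc M)
          have "(\<Sum>m\<in>{1..Suc M}. (t ^ d) ^ m) * (1 - t ^ d) = (t ^ d - (t ^ d) ^ Suc M) + (t ^ d) ^ Suc M * (1 - t ^ d)"
            using Suc by (simp add: distrib_right del: power_Suc)
          also have "\<dots> = t ^ d - (t ^ d) ^ Suc (Suc M)" by (simp add: algebra_simps)
          finally show ?case .
        qed simp
        then have "(\<Sum>m\<in>{1..?M}. (t ^ d) ^ m) = (t ^ d - (t ^ d) ^ Suc ?M) / (1 - t ^ d)"
          using td by (simp add: field_simps)
        then have "(\<Sum>m\<in>{1..?M}. r d * t ^ (d * m)) = r d * (t ^ d / (1 - t ^ d)) - r d * ((t ^ d) ^ Suc ?M / (1 - t ^ d))"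
          by (simp add: power_mult sum_distrib_left[symmetric] diff_divide_distrib right_diff_distrib)
        moreover have "\<bar>r d * ((t ^ d) ^ Suc ?M / (1 - t ^ d))\<bar> \<le> 1 * (t ^ N / (1 - t))"
          unfolding abs_mult
        proof (intro mult_mono rabs)
          have "N \<le> d * Suc ?M" using dN by (metis atLeastAtMost_iff dividend_less_times_div less_imp_le mult_Suc_right not_one_le_zero zero_less_iff_neq_zero)
          then have "t ^ (d * Suc ?M) \<le> t ^ N" using t by (intro power_decreasing) auto
          then have "(t ^ d) ^ Suc ?M \<le> t ^ N" by (simp only: power_mult)
          then have "(t ^ d) ^ Suc ?M / (1 - t ^ d) \<le> t ^ N / (1 - t)" using td t by (intro frac_le) auto
          then show "\<bar>(t ^ d) ^ Suc ?M / (1 - t ^ d)\<bar> \<le> t ^ N / (1 - t)" using td by (subst abs_of_nonneg) auto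
        qed auto
        ultimately show "(\<Sum>m\<in>{1..?M}. r d * t ^ (d * m)) \<le> r d * (t ^ d / (1 - t ^ d)) + t ^ N / (1 - t)" by linarith
      qed
      also have "\<dots> = real N * t ^ N / (1 - t) + (\<Sum>d\<in>{1..N}. r d * (t ^ d / (1 - t ^ d)))"
        by (simp add: sum.distrib)
      \<comment> \<open>Up to the weights \<open>monsky t d\<close> the Lambert terms are
        \<open>r d / (d * (1 - t))\<close>, which sum to a multiple of a partial sum of the
        vanishing L(1). The weights decrease from the value \<open>1\<close>, so their contribution
        is at most \<open>Q\<close>, uniformly in \<open>t\<close>.\<close>
      also have "(\<Sum>d\<in>{1..N}. r d * (t ^ d / (1 - t ^ d))) = 1 / (1 - t) * (\<Sum>d\<in>{1..N}. 1 / real d * r d) - (\<Sum>d\<in>{1..N}. monsky t d * r d)"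
        unfolding sum_distrib_left sum_subtractf[symmetric] monsky_def
        by (intro sum.cong) (auto simp: algebra_simps)
      also have "\<dots> \<le> 1 / (1 - t) * (real Q / real (Suc N)) + real Q"
      proof -
        have "Re (Lsum \<xi> N) = (\<Sum>d\<in>{1..N}. 1 / real d * r d)" by (simp add: Lsum_def r_def)
        moreover have "norm (Lsum \<xi> N) \<le> real Q / real (Suc N)" using Lsum_tail(3)[OF Q d, of N] L0 by simp
        ultimately have "(\<Sum>d\<in>{1..N}. 1 / real d * r d) \<le> real Q / real (Suc N)"
          using complex_Re_le_cmod[of "Lsum \<xi> N"] by linarith
        then have 1: "1 / (1 - t) * (\<Sum>d\<in>{1..N}. 1 / real d * r d) \<le> 1 / (1 - t) * (real Q / real (Suc N))"
          using t by (intro mult_left_mono) auto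
        have "norm (\<Sum>n\<in>{0<..N}. monsky t n *\<^sub>R \<xi> n) \<le> real Q * monsky t (Suc 0)"
          by (rule abel_bound[OF dchar_interval_bound[OF Q d]]) (use monsky_nonneg monsky_antimono t in auto)
        also have "monsky t (Suc 0) = 1" using t by (simp add: monsky_def field_simps)
        finally have n: "norm (\<Sum>n\<in>{0<..N}. monsky t n *\<^sub>R \<xi> n) \<le> real Q" by simp
        have "{0<..N} = {1..N}" by auto
        then have "Re (\<Sum>n\<in>{0<..N}. monsky t n *\<^sub>R \<xi> n) = (\<Sum>d\<in>{1..N}. monsky t d * r d)" by (simp add: r_def)
        then have "\<bar>\<Sum>d\<in>{1..N}. monsky t d * r d\<bar> \<le> real Q"
          using n abs_Re_le_cmod[of "\<Sum>n\<in>{0<..N}. monsky t n *\<^sub>R \<xi> n"] by linarith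
        then show ?thesis using 1 by linarith
      qed
      finally show ?thesis by (simp add: E_def)
    qed
    have "(\<lambda>N. real N * t ^ N) \<longlonglongrightarrow> 0" using powser_times_n_limit_0[of t] t by simp
    then have "(\<lambda>N. real N * t ^ N / (1 - t)) \<longlonglongrightarrow> 0 / (1 - t)" using t by (intro tendsto_divide tendsto_const) auto
    moreover have "(\<lambda>N. real Q / real (Suc N)) \<longlonglongrightarrow> 0"
      by (intro LIMSEQ_Suc[of "\<lambda>n. real Q / real n"] lim_const_over_n)
    then have "(\<lambda>N. 1 / (1 - t) * (real Q / real (Suc N))) \<longlonglongrightarrow> 1 / (1 - t) * 0" by (intro tendsto_mult tendsto_const)
    ultimately have "E \<longlonglongrightarrow> 0 / (1 - t) + real Q + 1 / (1 - t) * 0"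
      unfolding E_def by (intro tendsto_add tendsto_const)
    then have "E \<longlonglongrightarrow> real Q" by simp
    moreover have "\<forall>\<^sub>F N in sequentially. (\<Sum>k\<in>{1..K}. t ^ k\<^sup>2) \<le> E N"
      using eventually_ge_at_top[of "K\<^sup>2"] by eventually_elim (rule bound)
    ultimately show ?thesis by (rule tendsto_lowerbound) simp
  qed
  \<comment> \<open>With \<open>Q + 1\<close> squares the limit \<open>t\<close> to \<open>1\<close>
    from below contradicts the uniform bound.\<close>
  have "real (Q + 1) \<le> real Q"
  proof (rule tendsto_upperbound)
    have "((\<lambda>t::real. \<Sum>k\<in>{1..Q+1}. t ^ k\<^sup>2) \<longlongrightarrow> (\<Sum>k\<in>{1..Q+1}. 1 ^ k\<^sup>2)) (at_left 1)"
      by (intro tendsto_intros)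
    then show "((\<lambda>t::real. \<Sum>k\<in>{1..Q+1}. t ^ k\<^sup>2) \<longlongrightarrow> real (Q + 1)) (at_left 1)" by simp
    show "\<forall>\<^sub>F t in at_left 1. (\<Sum>k\<in>{1..Q+1}. t ^ k\<^sup>2) \<le> real Q"
      using eventually_at_left[of 0 "1::real"] pw by (metis (mono_tags, lifting) eventually_at_left_field zero_less_one)
  qed simp
  then show False by simp
qed

section \<open>Prime powers and the principal character\<close>

lemma geometric_tail_le:
  fixes x :: real
  assumes "0 \<le> x" "x \<le> 1/2" shows "(\<Sum>e\<in>{j..N}. x ^ e) \<le> 2 * x ^ j"
proof (cases "j \<le> N")
  case True
  then have "(\<Sum>e\<in>{j..N}. x ^ e) \<le> 2 * x ^ j - 2 * x ^ Suc N"
  proof (induction N rule: dec_induct)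
    case base
    have "x * x ^ j \<le> 1/2 * x ^ j" using assms by (intro mult_right_mono) auto
    then show ?case by simp
  next
    case (step N)
    have "x * x ^ Suc N \<le> 1/2 * x ^ Suc N" using assms by (intro mult_right_mono) auto
    then show ?case using step by simp
  qed
  moreover have "0 \<le> x ^ Suc N" using assms by (intro zero_le_power)
  ultimately show ?thesis by linarith
qed (use assms in auto)

lemma mangoldt_support:
  assumes "mangoldt n \<noteq> (0::real)" obtains p e where "prime p" "e > 0" "n = p ^ e"
  using assms by (auto simp: mangoldt_def primepow_def split: if_splits)

text \<open>The index set may contain pairs with composite \<open>p\<close>, since
  \<open>mangoldt (p ^ e) \<le> ln p\<close> holds for every positive \<open>p\<close> and
  \<open>e\<close>. A sum over primes can thus be replaced by one over a full box.\<close>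

lemma mangoldt_sum_image_le:
  assumes "finite A" "finite I" "\<And>n. n \<in> A \<Longrightarrow> mangoldt n \<noteq> (0::real) \<Longrightarrow> \<exists>p e. (p, e) \<in> I \<and> n = p ^ e"
    and I: "\<And>p e. (p, e) \<in> I \<Longrightarrow> p > 0 \<and> e > 0"
  shows "(\<Sum>n\<in>A. mangoldt n / real n) \<le> (\<Sum>(p,e)\<in>I. ln (real p) * (1 / real p) ^ e)"
proof -
  let ?f = "\<lambda>(p, e). p ^ e :: nat"
  have "(\<Sum>n\<in>A. mangoldt n / real n) = (\<Sum>n\<in>{n\<in>A. mangoldt n \<noteq> (0::real)}. mangoldt n / real n)"
    using assms(1) by (intro sum.mono_neutral_right) auto
  also have "\<dots> \<le> (\<Sum>n\<in>?f ` I. mangoldt n / real n)"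
    using assms by (intro sum_mono2) (fastforce simp: mangoldt_nonneg)+
  also have "\<dots> \<le> (\<Sum>i\<in>I. mangoldt (?f i) / real (?f i))"
    using sum_image_le[OF assms(2), of "\<lambda>n. mangoldt n / real n" ?f] by (simp add: mangoldt_nonneg o_def)
  also have "\<dots> \<le> (\<Sum>(p,e)\<in>I. ln (real p) * (1 / real p) ^ e)"
  proof (rule sum_mono, clarify)
    fix p e assume "(p, e) \<in> I"
    then have pe: "p > 0" "e > 0" using I by auto
    have "mangoldt (p ^ e) \<le> ln (real p)"
    proof (cases "primepow (p ^ e)")
      case True
      then have gt: "p ^ e \<noteq> 0" "\<not> is_unit (p ^ e)" using primepow_gt_Suc_0[OF True] pe by auto
      then have "aprimedivisor (p ^ e) dvd p ^ e" by (rule aprimedivisor_dvd')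
      moreover have "prime (aprimedivisor (p ^ e))" using gt by (rule prime_aprimedivisor')
      ultimately have "aprimedivisor (p ^ e) dvd p" by (metis prime_dvd_power)
      then have "aprimedivisor (p ^ e) \<le> p" using pe by (simp add: dvd_imp_le)
      moreover have "0 < aprimedivisor (p ^ e)" using \<open>prime (aprimedivisor (p ^ e))\<close> by (rule prime_gt_0_nat)
      ultimately have "ln (real (aprimedivisor (p ^ e))) \<le> ln (real p)" by (subst ln_le_cancel_iff) auto
      then show ?thesis using True by (simp add: mangoldt_def)
    qed (use pe in \<open>simp add: mangoldt_def\<close>)
    then show "mangoldt (p ^ e) / real (p ^ e) \<le> ln (real p) * (1 / real p) ^ e"
      by (simp add: power_divide divide_right_mono)
  qed
  finally show ?thesis .
qed

lemma exponent_le_power: "(2::nat) \<le> p \<Longrightarrow> e \<le> p ^ e"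
  by (metis less_exp less_imp_le_nat order_trans power_mono zero_le)

lemma mangoldt_noncoprime_bounded:
  assumes "Q > 0"
  shows "\<exists>C. \<forall>N. (\<Sum>n | n \<in> {1..N} \<and> \<not> coprime n Q. mangoldt n / real n) \<le> C"
proof (intro exI allI)
  fix N
  have "(\<Sum>n | n \<in> {1..N} \<and> \<not> coprime n Q. mangoldt n / real n) \<le> (\<Sum>(p,e)\<in>prime_factors Q \<times> {1..N}. ln (real p) * (1 / real p) ^ e)"
  proof (rule mangoldt_sum_image_le)
    fix n assume n: "n \<in> {n. n \<in> {1..N} \<and> \<not> coprime n Q}" "mangoldt n \<noteq> (0::real)"
    obtain p e where pe: "prime p" "e > 0" "n = p ^ e" using mangoldt_support[OF n(2)] .
    have "\<not> coprime p Q" using n(1) pe by auto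
    then have "p \<in> prime_factors Q" using pe(1) assms by (auto simp: prime_factors_dvd dest: prime_imp_coprime)
    moreover have "p ^ e \<le> N" using n(1) pe(3) by simp
    then have "e \<le> N" using exponent_le_power[OF prime_ge_2_nat[OF pe(1)], of e] by (rule order_trans[rotated])
    ultimately show "\<exists>p e. (p, e) \<in> prime_factors Q \<times> {1..N} \<and> n = p ^ e" using pe by (intro exI[of _ p] exI[of _ e]) auto
  qed (auto intro: prime_gt_0_nat in_prime_factors_imp_prime)
  also have "\<dots> = (\<Sum>p\<in>prime_factors Q. ln (real p) * (\<Sum>e\<in>{1..N}. (1 / real p) ^ e))"
    by (simp add: sum_distrib_left sum.cartesian_product)
  also have "\<dots> \<le> (\<Sum>p\<in>prime_factors Q. ln (real p) * (2 * (1 / real p) ^ 1))"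
  proof (intro sum_mono mult_left_mono)
    fix p assume "p \<in> prime_factors Q"
    then have p: "2 \<le> p" by (auto intro: prime_ge_2_nat)
    then show "0 \<le> ln (real p)" by simp
    have "1 / real p \<le> 1 / 2" using p by (intro divide_left_mono) auto
    then show "(\<Sum>e\<in>{1..N}. (1 / real p) ^ e) \<le> 2 * (1 / real p) ^ 1" by (intro geometric_tail_le) auto
  qed
  finally show "(\<Sum>n | n \<in> {1..N} \<and> \<not> coprime n Q. mangoldt n / real n) \<le> (\<Sum>p\<in>prime_factors Q. ln (real p) * (2 * (1 / real p) ^ 1))" .
qed

lemma mangoldt_nonprime_bounded:
  "\<exists>C. \<forall>N. (\<Sum>n | n \<in> {1..N} \<and> \<not> prime n. mangoldt n / real n) \<le> C"
proof -
  have sm: "summable (\<lambda>n. 4 * real n powr (-3/2))" by (intro summable_mult) (simp add: summable_real_powr_iff)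
  have "(\<Sum>n | n \<in> {1..N} \<and> \<not> prime n. mangoldt n / real n) \<le> (\<Sum>n. 4 * real n powr (-3/2))" for N
  proof -
    have "(\<Sum>n | n \<in> {1..N} \<and> \<not> prime n. mangoldt n / real n) \<le> (\<Sum>(p,e)\<in>{2..N} \<times> {2..N}. ln (real p) * (1 / real p) ^ e)"
    proof (rule mangoldt_sum_image_le)
      fix n assume n: "n \<in> {n. n \<in> {1..N} \<and> \<not> prime n}" "mangoldt n \<noteq> (0::real)"
      obtain p e where pe: "prime p" "e > 0" "n = p ^ e" using mangoldt_support[OF n(2)] .
      have p2: "2 \<le> p" using pe(1) by (rule prime_ge_2_nat)
      have "e \<noteq> 1" using n pe by auto
      then have "2 \<le> e" using pe(2) by linarith
      moreover have "p ^ e \<le> N" using n(1) pe(3) by simp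
      then have "e \<le> N" using exponent_le_power[OF p2, of e] by (rule order_trans[rotated])
      moreover have "p ^ 1 \<le> p ^ e" using pe p2 by (intro power_increasing) auto
      then have "p \<le> N" using n(1) pe by simp
      ultimately show "\<exists>p e. (p, e) \<in> {2..N} \<times> {2..N} \<and> n = p ^ e" using pe p2 by (intro exI[of _ p] exI[of _ e]) auto
    qed auto
    also have "\<dots> = (\<Sum>p\<in>{2..N}. ln (real p) * (\<Sum>e\<in>{2..N}. (1 / real p) ^ e))"
      by (simp add: sum_distrib_left sum.cartesian_product)
    also have "\<dots> \<le> (\<Sum>p\<in>{2..N}. 4 * real p powr (-3/2))"
    proof (rule sum_mono)
      fix p assume "p \<in> {2..N}"
      then have p: "2 \<le> p" by simp
      \<comment> \<open>Half a power of \<open>p\<close> is spent on the logarithm, which leaves the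
        summable exponent \<open>-3/2\<close>.\<close>
      have "ln (real p) * (\<Sum>e\<in>{2..N}. (1 / real p) ^ e) \<le> (real p powr (1/2) / (1/2)) * (2 * (1 / real p) ^ 2)"
        using p by (intro mult_mono ln_powr_bound geometric_tail_le sum_nonneg) (auto simp: field_simps)
      also have "(1 / real p) ^ 2 = real p powr (-2)" using p by (simp add: powr_minus power_divide divide_inverse powr_numeral power_inverse)
      also have "real p powr (1/2) / (1/2) * (2 * real p powr (-2)) = 4 * (real p powr (1/2) * real p powr (-2))" by simp
      also have "real p powr (1/2) * real p powr (-2) = real p powr (-3/2)" by (simp flip: powr_add)
      finally show "ln (real p) * (\<Sum>e\<in>{2..N}. (1 / real p) ^ e) \<le> 4 * real p powr (-3/2)" .
    qed
    also have "\<dots> \<le> (\<Sum>n. 4 * real n powr (-3/2))" using sm by (intro sum_le_suminf) auto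
    finally show ?thesis .
  qed
  then show ?thesis by blast
qed

lemma psi_sum_principal:
  assumes "Q > 0" shows "\<exists>C. \<forall>N\<ge>1. norm (psi_sum (principal Q) N - of_real (ln (real N))) \<le> C"
proof -
  obtain C where C: "\<And>N. (\<Sum>n | n \<in> {1..N} \<and> \<not> coprime n Q. mangoldt n / real n) \<le> C"
    using mangoldt_noncoprime_bounded[OF assms] by blast
  have "norm (psi_sum (principal Q) N - of_real (ln (real N))) \<le> C + 4" if N: "N \<ge> 1" for N
  proof -
    let ?S = "\<Sum>n\<in>{1..N}. mangoldt n / real n"
    let ?T = "\<Sum>n | n \<in> {1..N} \<and> \<not> coprime n Q. mangoldt n / real n"
    have "psi_sum (principal Q) N = of_real (\<Sum>n\<in>{1..N}. mangoldt n / real n * of_bool (coprime n Q))"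
      unfolding psi_sum_def of_real_sum by (intro sum.cong) (auto simp: principal_def scaleR_conv_of_real)
    also have "(\<Sum>n\<in>{1..N}. mangoldt n / real n * of_bool (coprime n Q)) = (\<Sum>n\<in>{1..N}. mangoldt n / real n - mangoldt n / real n * of_bool (\<not> coprime n Q))"
      by (intro sum.cong) auto
    also have "\<dots> = ?S - (\<Sum>n\<in>{1..N}. mangoldt n / real n * of_bool (\<not> coprime n Q))" by (simp only: sum_subtractf)
    also have "(\<Sum>n\<in>{1..N}. mangoldt n / real n * of_bool (\<not> coprime n Q)) = ?T"
      by (intro sum.mono_neutral_cong_right) auto
    finally have eq: "psi_sum (principal Q) N - of_real (ln (real N)) = of_real (?S - ?T - ln (real N))" by simp
    have "norm (psi_sum (principal Q) N - of_real (ln (real N))) = \<bar>?S - ?T - ln (real N)\<bar>"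
      unfolding eq by (rule norm_of_real)
    moreover have "0 \<le> ?T" by (intro sum_nonneg divide_nonneg_nonneg mangoldt_nonneg) auto
    moreover have "?S \<le> ln (real N) + 4" "ln (real N) - 1 \<le> ?S" using mertens_upper[of N] mertens_lower[of N] N by auto
    ultimately show ?thesis using C[of N] by linarith
  qed
  then show ?thesis by blast
qed

section \<open>Nonvanishing in general and the sum over a progression\<close>

lemma psi_sum_orthogonality:
  assumes "Q > 0" "coprime a Q"
  shows "(\<Sum>\<xi>\<in>dchars Q. cnj (\<xi> a) * psi_sum \<xi> N) = of_real (real (totient Q) * (\<Sum>n | n \<in> {1..N} \<and> [n = a] (mod Q). mangoldt n / real n))"
proof -
  have "(\<Sum>\<xi>\<in>dchars Q. cnj (\<xi> a) * psi_sum \<xi> N) = (\<Sum>\<xi>\<in>dchars Q. \<Sum>n\<in>{1..N}. of_real (mangoldt n / real n) * (cnj (\<xi> a) * \<xi> n))"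
    unfolding psi_sum_def sum_distrib_left by (intro sum.cong refl) (simp add: scaleR_conv_of_real)
  also have "\<dots> = (\<Sum>n\<in>{1..N}. of_real (mangoldt n / real n) * (\<Sum>\<xi>\<in>dchars Q. cnj (\<xi> a) * \<xi> n))"
    by (subst sum.swap) (simp add: sum_distrib_left)
  also have "\<dots> = (\<Sum>n\<in>{1..N}. of_real (if [n = a] (mod Q) then mangoldt n / real n * real (totient Q) else 0))"
    by (intro sum.cong refl) (simp add: dchar_orthogonality[OF assms])
  also have "\<dots> = of_real (\<Sum>n\<in>{1..N}. if [n = a] (mod Q) then mangoldt n / real n * real (totient Q) else 0)" by simp
  also have "(\<Sum>n\<in>{1..N}. if [n = a] (mod Q) then mangoldt n / real n * real (totient Q) else 0)
    = (\<Sum>n | n \<in> {1..N} \<and> [n = a] (mod Q). mangoldt n / real n * real (totient Q))"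
    by (intro sum.mono_neutral_cong_right) auto
  also have "\<dots> = real (totient Q) * (\<Sum>n | n \<in> {1..N} \<and> [n = a] (mod Q). mangoldt n / real n)"
    by (simp add: sum_distrib_left mult.commute)
  finally show ?thesis .
qed

lemma Lval_cnj:
  assumes "Q > 0" "dchar Q \<xi>" "\<xi> \<noteq> principal Q"
  shows "Lval (\<lambda>n. cnj (\<xi> n)) = cnj (Lval \<xi>)" "(\<lambda>n. cnj (\<xi> n)) \<noteq> principal Q"
proof -
  have "Lsum (\<lambda>n. cnj (\<xi> n)) = (\<lambda>N. cnj (Lsum \<xi> N))" unfolding Lsum_def by (intro ext) simp
  then have "Lsum (\<lambda>n. cnj (\<xi> n)) \<longlonglongrightarrow> cnj (Lval \<xi>)" using Lsum_tail(2)[OF assms] by (simp add: tendsto_cnj)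
  then show "Lval (\<lambda>n. cnj (\<xi> n)) = cnj (Lval \<xi>)" unfolding Lval_def by (rule limI)
  show "(\<lambda>n. cnj (\<xi> n)) \<noteq> principal Q"
  proof
    assume e: "(\<lambda>n. cnj (\<xi> n)) = principal Q"
    have "\<xi> n = principal Q n" for n
    proof -
      have "\<xi> n = cnj (principal Q n)" using fun_cong[OF e, of n] by (metis complex_cnj_cnj)
      then show ?thesis by (simp add: principal_def)
    qed
    then show False using assms(3) by auto
  qed
qed

text \<open>In the nonnegative sum over \<open>n\<close> congruent to \<open>1\<close> the principal
  character contributes \<open>ln N\<close> and every vanishing character \<open>- ln N\<close>, up
  to constants. A zero of a character that is not real comes together with the zero of its
  conjugate, and two zeros would make the sum negative; real characters have been treated
  separately.\<close>

lemma Lval_nonzero: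
  assumes Q: "Q > 0" and "dchar Q \<zeta>" "\<zeta> \<noteq> principal Q" shows "Lval \<zeta> \<noteq> 0"
proof
  assume L0: "Lval \<zeta> = 0"
  define Z where "Z = {\<xi> \<in> dchars Q. \<xi> \<noteq> principal Q \<and> Lval \<xi> = 0}"
  define G where "G = {\<xi> \<in> dchars Q. \<xi> \<noteq> principal Q \<and> Lval \<xi> \<noteq> 0}"
  have fin: "finite Z" "finite G" using finite_dchars[OF Q] by (auto simp: Z_def G_def)
  have split: "dchars Q = insert (principal Q) (Z \<union> G)" "principal Q \<notin> Z \<union> G" "Z \<inter> G = {}"
    using dchar_principal by (auto simp: Z_def G_def dchars_def)
  have "\<forall>\<xi>\<in>G. \<exists>C. \<forall>N\<ge>1. norm (psi_sum \<xi> N) \<le> C"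
    using psi_sum_bounded[OF Q] by (auto simp: G_def dchars_def)
  then obtain C where C: "\<And>\<xi> N. \<xi> \<in> G \<Longrightarrow> N \<ge> 1 \<Longrightarrow> norm (psi_sum \<xi> N) \<le> C \<xi>" by metis
  obtain C0 where C0: "\<And>N. N \<ge> 1 \<Longrightarrow> norm (psi_sum (principal Q) N - of_real (ln (real N))) \<le> C0"
    using psi_sum_principal[OF Q] by blast
  have card: "2 \<le> card Z"
  proof -
    have z1: "\<zeta> \<in> Z" using assms L0 by (simp add: Z_def dchars_def)
    have z2: "(\<lambda>n. cnj (\<zeta> n)) \<in> Z"
      using assms L0 Lval_cnj[OF assms] dchar_cnj[OF assms(2)] by (simp add: Z_def dchars_def)
    have "(\<lambda>n. cnj (\<zeta> n)) \<noteq> \<zeta>"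
      using Lval_real_nonzero[OF assms] L0 by metis
    then have "card {\<zeta>, (\<lambda>n. cnj (\<zeta> n))} = 2" by (metis card_2_iff)
    moreover have "card {\<zeta>, (\<lambda>n. cnj (\<zeta> n))} \<le> card Z" using z1 z2 fin by (intro card_mono) auto
    ultimately show ?thesis by simp
  qed
  have bound: "ln (real N) \<le> C0 + real (card Z) * real Q + sum C G" if N: "N \<ge> 1" for N
  proof -
    have "0 \<le> real (totient Q) * (\<Sum>n | n \<in> {1..N} \<and> [n = 1] (mod Q). mangoldt n / real n)"
      by (intro mult_nonneg_nonneg sum_nonneg divide_nonneg_nonneg mangoldt_nonneg) auto
    also have "\<dots> = Re (\<Sum>\<xi>\<in>dchars Q. cnj (\<xi> 1) * psi_sum \<xi> N)"
      using psi_sum_orthogonality[OF Q, of 1 N] by simp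
    also have "\<dots> = (\<Sum>\<xi>\<in>dchars Q. Re (psi_sum \<xi> N))"
      unfolding Re_sum
    proof (rule sum.cong)
      fix \<xi> assume "\<xi> \<in> dchars Q"
      then have "\<xi> 1 = 1" using dchar_1 by (simp add: dchars_def del: One_nat_def)
      then show "Re (cnj (\<xi> 1) * psi_sum \<xi> N) = Re (psi_sum \<xi> N)" by (simp del: One_nat_def)
    qed simp
    also have "\<dots> = Re (psi_sum (principal Q) N) + (\<Sum>\<xi>\<in>Z. Re (psi_sum \<xi> N)) + (\<Sum>\<xi>\<in>G. Re (psi_sum \<xi> N))"
      using split fin by (simp add: sum.union_disjoint)
    also have "Re (psi_sum (principal Q) N) \<le> ln (real N) + C0"
      using C0[OF N] complex_Re_le_cmod[of "psi_sum (principal Q) N - of_real (ln (real N))"] by simp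
    also have "(\<Sum>\<xi>\<in>Z. Re (psi_sum \<xi> N)) \<le> (\<Sum>\<xi>\<in>Z. real Q - ln (real N))"
    proof (rule sum_mono)
      fix \<xi> assume "\<xi> \<in> Z"
      then have "norm (psi_sum \<xi> N + of_real (ln (real N))) \<le> real Q"
        using psi_sum_zero_case[OF Q _ _ _ N] by (simp add: Z_def dchars_def)
      then show "Re (psi_sum \<xi> N) \<le> real Q - ln (real N)"
        using complex_Re_le_cmod[of "psi_sum \<xi> N + of_real (ln (real N))"] by simp
    qed
    also have "(\<Sum>\<xi>\<in>Z. real Q - ln (real N)) = real (card Z) * real Q - real (card Z) * ln (real N)"
      by (simp add: right_diff_distrib)
    also have "(\<Sum>\<xi>\<in>G. Re (psi_sum \<xi> N)) \<le> sum C G"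
      using C N complex_Re_le_cmod order_trans by (intro sum_mono) blast
    also have "real (card Z) * real Q - real (card Z) * ln (real N) \<le> real (card Z) * real Q - 2 * ln (real N)"
      using card N by (intro diff_left_mono mult_right_mono) auto
    finally show ?thesis by simp
  qed
  obtain N :: nat where N: "exp (C0 + real (card Z) * real Q + sum C G) < real N" using reals_Archimedean2 by blast
  then have "N \<ge> 1" by (metis exp_gt_zero less_one linorder_not_less not_less_iff_gr_or_eq of_nat_0 order_less_trans)
  have "C0 + real (card Z) * real Q + sum C G < ln (real N)" 
  proof -
    have "ln (exp (C0 + real (card Z) * real Q + sum C G)) < ln (real N)"
      using N \<open>N \<ge> 1\<close> by (subst ln_less_cancel_iff) auto
    then show ?thesis by simp
  qed
  then show False using bound[OF \<open>N \<ge> 1\<close>] by linarith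
qed

text \<open>By orthogonality only the principal character contributes a logarithm. The constant may
  depend on \<open>Q\<close> and \<open>a\<close> in an unspecified way, since \<open>J\<close> is
  chosen after them.\<close>

theorem mertens_progression:
  assumes Q: "Q > 0" and a: "coprime a Q"
  shows "\<exists>C. \<forall>N\<ge>1. \<bar>(\<Sum>n | n \<in> {1..N} \<and> [n = a] (mod Q). mangoldt n / real n) - ln (real N) / real (totient Q)\<bar> \<le> C"
proof -
  define G where "G = dchars Q - {principal Q}"
  have fin: "finite G" using finite_dchars[OF Q] by (auto simp: G_def)
  have split: "dchars Q = insert (principal Q) G" "principal Q \<notin> G"
    using dchar_principal by (auto simp: G_def dchars_def)
  have "\<forall>\<xi>\<in>G. \<exists>C. \<forall>N\<ge>1. norm (psi_sum \<xi> N) \<le> C"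
    using psi_sum_bounded[OF Q] Lval_nonzero[OF Q] by (auto simp: G_def dchars_def)
  then obtain C where C: "\<And>\<xi> N. \<xi> \<in> G \<Longrightarrow> N \<ge> 1 \<Longrightarrow> norm (psi_sum \<xi> N) \<le> C \<xi>" by metis
  obtain C0 where C0: "\<And>N. N \<ge> 1 \<Longrightarrow> norm (psi_sum (principal Q) N - of_real (ln (real N))) \<le> C0"
    using psi_sum_principal[OF Q] by blast
  have "\<bar>(\<Sum>n | n \<in> {1..N} \<and> [n = a] (mod Q). mangoldt n / real n) - ln (real N) / real (totient Q)\<bar>
    \<le> (C0 + sum C G) / real (totient Q)" if N: "N \<ge> 1" for N
  proof -
    let ?S = "\<Sum>n | n \<in> {1..N} \<and> [n = a] (mod Q). mangoldt n / real n"
    have pa: "principal Q a = 1" using a by (simp add: principal_def)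
    have "of_real (real (totient Q) * ?S) = psi_sum (principal Q) N + (\<Sum>\<xi>\<in>G. cnj (\<xi> a) * psi_sum \<xi> N)"
      unfolding psi_sum_orthogonality[OF Q a, symmetric] split(1) using split(2) fin pa by simp
    then have eq: "of_real (real (totient Q) * ?S - ln (real N)) = (psi_sum (principal Q) N - of_real (ln (real N))) + (\<Sum>\<xi>\<in>G. cnj (\<xi> a) * psi_sum \<xi> N)"
      by simp
    have "\<bar>real (totient Q) * ?S - ln (real N)\<bar> = norm ((psi_sum (principal Q) N - of_real (ln (real N))) + (\<Sum>\<xi>\<in>G. cnj (\<xi> a) * psi_sum \<xi> N))"
      unfolding eq[symmetric] by (rule norm_of_real[symmetric])
    also have "\<dots> \<le> C0 + sum C G"
    proof (rule order_trans[OF norm_triangle_ineq add_mono[OF C0[OF N]]])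
      show "norm (\<Sum>\<xi>\<in>G. cnj (\<xi> a) * psi_sum \<xi> N) \<le> sum C G"
      proof (rule sum_norm_le)
        fix \<xi> assume x: "\<xi> \<in> G"
        then have "norm (cnj (\<xi> a)) \<le> 1" using dchar_norm_le[of Q \<xi> a] Q by (simp add: G_def dchars_def)
        then have "norm (cnj (\<xi> a)) * norm (psi_sum \<xi> N) \<le> 1 * norm (psi_sum \<xi> N)" by (intro mult_right_mono) auto
        then show "norm (cnj (\<xi> a) * psi_sum \<xi> N) \<le> C \<xi>" using C[OF x N] by (simp add: norm_mult)
      qed
    qed
    finally have *: "\<bar>real (totient Q) * ?S - ln (real N)\<bar> \<le> C0 + sum C G" .
    have t: "real (totient Q) > 0" using Q by simp
    have "?S - ln (real N) / real (totient Q) = (real (totient Q) * ?S - ln (real N)) / real (totient Q)"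
      using t by (simp add: field_simps)
    then have "\<bar>?S - ln (real N) / real (totient Q)\<bar> = \<bar>real (totient Q) * ?S - ln (real N)\<bar> / real (totient Q)"
      using t by simp
    also have "\<dots> \<le> (C0 + sum C G) / real (totient Q)" using * t by (intro divide_right_mono) auto
    finally show ?thesis .
  qed
  then show ?thesis by blast
qed

section \<open>Elementary estimates\<close>

lemma sum_recip_interval_le:
  assumes "1 \<le> X" "X \<le> Y" shows "(\<Sum>n\<in>{X<..Y}. 1 / real n) \<le> ln (real Y) - ln (real X)"
  using assms(2)
proof (induction Y rule: dec_induct)
  case (step Y)
  have "{X<..Suc Y} = insert (Suc Y) {X<..Y}" using step.hyps by auto
  moreover have "1 / real (Suc Y) \<le> ln (real (Suc Y)) - ln (real Y)"
  proof -
    have "ln (real Y / real (Suc Y)) \<le> real Y / real (Suc Y) - 1" using assms step.hyps by (intro ln_le_minus_one) auto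
    then show ?thesis using assms step.hyps by (simp add: ln_div field_simps)
  qed
  ultimately show ?case using step.IH by simp
qed simp

lemma sum_recip_squares_le:
  assumes "w \<ge> 1" shows "(\<Sum>p\<in>{w<..z}. 1 / (real p)\<^sup>2) \<le> 1 / real w"
proof (cases "w \<le> z")
  case True
  then have "(\<Sum>p\<in>{w<..z}. 1 / (real p)\<^sup>2) \<le> 1 / real w - 1 / real z"
  proof (induction z rule: dec_induct)
    case (step z)
    have "{w<..Suc z} = insert (Suc z) {w<..z}" using step.hyps by auto
    moreover have "1 / (real (Suc z))\<^sup>2 \<le> 1 / real z - 1 / real (Suc z)"
    proof -
      have "1 / (real (Suc z))\<^sup>2 \<le> 1 / (real z * real (Suc z))"
        using assms step.hyps by (intro divide_left_mono) (auto simp: power2_eq_square intro!: mult_right_mono)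
      also have "\<dots> = 1 / real z - 1 / real (Suc z)" using assms step.hyps by (simp add: field_simps)
      finally show ?thesis .
    qed
    ultimately show ?case using step.IH by simp
  qed simp
  also have "\<dots> \<le> 1 / real w" by simp
  finally show ?thesis .
qed simp

text \<open>Removing one prime at a time from the smooth part of the harmonic sum leads to Mertens' product bound.\<close>
lemma smooth_recip_sum_le:
  fixes P :: "nat set"
  assumes "finite P" "\<And>p. p \<in> P \<Longrightarrow> prime p"
  shows "(\<Sum>n | n \<in> {1..N} \<and> prime_factors n \<subseteq> P. 1 / real n) * (\<Prod>p\<in>P. 1 - 1 / real p) \<le> 1"
  using assms
proof (induction P rule: finite_induct)
  case empty
  have "{n. n \<in> {1..N} \<and> prime_factors n \<subseteq> {}} \<subseteq> {1}" by (auto simp: prime_factorization_empty_iff)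
  then have "(\<Sum>n | n \<in> {1..N} \<and> prime_factors n \<subseteq> {}. 1 / real n) \<le> (\<Sum>n\<in>{1}. 1 / real n)"
    by (intro sum_mono2) auto
  then show ?case by simp
next
  case (insert q P)
  let ?S = "\<lambda>P. {n. n \<in> {1..N} \<and> prime_factors n \<subseteq> P}"
  let ?F = "\<lambda>P. \<Sum>n\<in>?S P. 1 / real n"
  have q: "prime q" using insert.prems by simp
  have fin: "finite (?S P)" for P by auto
  have "?S (insert q P) \<subseteq> ?S P \<union> (\<lambda>n. q * n) ` ?S (insert q P)"
  proof
    fix n assume n: "n \<in> ?S (insert q P)"
    show "n \<in> ?S P \<union> (\<lambda>n. q * n) ` ?S (insert q P)"
    proof (cases "q dvd n")
      case True
      then obtain l where l: "n = q * l" by auto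
      then have l0: "l \<noteq> 0" using n by auto
      have "l \<le> n" using l prime_gt_0_nat[OF q] by simp
      moreover have "prime_factors l \<subseteq> prime_factors n" using l l0 n by (intro dvd_prime_factors) auto
      ultimately have "l \<in> ?S (insert q P)" using n l0 by auto
      then show ?thesis using l by blast
    next
      case False
      then have "q \<notin> prime_factors n" by (auto simp: prime_factors_dvd)
      then show ?thesis using n by auto
    qed
  qed
  then have "?F (insert q P) \<le> (\<Sum>n\<in>?S P \<union> (\<lambda>n. q * n) ` ?S (insert q P). 1 / real n)"
    using fin by (intro sum_mono2) auto
  also have "\<dots> \<le> ?F P + (\<Sum>n\<in>(\<lambda>n. q * n) ` ?S (insert q P). 1 / real n)"
    using fin by (simp add: sum_Un sum_nonneg)
  also have "(\<Sum>n\<in>(\<lambda>n. q * n) ` ?S (insert q P). 1 / real n) = (\<Sum>n\<in>?S (insert q P). 1 / real (q * n))"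
    using q by (subst sum.reindex) (auto simp: inj_on_def prime_gt_0_nat)
  also have "\<dots> = ?F (insert q P) / real q" by (simp add: sum_divide_distrib mult.commute)
  finally have "?F (insert q P) * (1 - 1 / real q) \<le> ?F P" by (simp add: algebra_simps)
  moreover have pp: "0 \<le> (\<Prod>p\<in>P. 1 - 1 / real p)"
    using insert.prems by (intro prod_nonneg) (auto simp: prime_gt_0_nat Suc_le_eq)
  ultimately have "?F (insert q P) * (1 - 1 / real q) * (\<Prod>p\<in>P. 1 - 1 / real p) \<le> ?F P * (\<Prod>p\<in>P. 1 - 1 / real p)"
    by (intro mult_right_mono)
  also have "\<dots> \<le> 1" using insert by simp
  finally show ?case using insert.hyps by (simp add: mult.assoc)
qed

text \<open>All integers up to \<open>z\<close> are composed of primes up to \<open>z\<close>, so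
  the smooth harmonic sum dominates \<open>ln z\<close>.\<close>

lemma mertens_product_le:
  assumes "z \<ge> 2" shows "ln (real z) * (\<Prod>p | prime p \<and> p \<le> z. 1 - 1 / real p) \<le> 1"
proof -
  let ?P = "{p::nat. prime p \<and> p \<le> z}"
  have fin: "finite ?P" by (rule finite_subset[of _ "{..z}"]) auto
  have all: "{n. n \<in> {1..z} \<and> prime_factors n \<subseteq> ?P} = {1..z}"
  proof -
    have "prime_factors n \<subseteq> ?P" if "n \<in> {1..z}" for n
    proof
      fix p assume "p \<in> prime_factors n"
      then have "prime p" "p dvd n" by auto
      then show "p \<in> ?P" using that dvd_imp_le[of p n] by auto
    qed
    then show ?thesis by blast
  qed
  have "ln (real z) \<le> ln (real z + 1)" using assms by simp
  also have "\<dots> \<le> harm z" by (rule ln_le_harm)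
  also have "\<dots> = (\<Sum>n\<in>{1..z}. 1 / real n)" by (simp add: harm_def divide_inverse)
  finally have "ln (real z) * (\<Prod>p\<in>?P. 1 - 1 / real p) \<le> (\<Sum>n\<in>{1..z}. 1 / real n) * (\<Prod>p\<in>?P. 1 - 1 / real p)"
    by (intro mult_right_mono prod_nonneg) (auto simp: Suc_le_eq prime_gt_0_nat)
  also have "\<dots> \<le> 1" using smooth_recip_sum_le[OF fin, of z] unfolding all by simp
  finally show ?thesis .
qed

text \<open>The extremal set is an initial segment: the largest element is at least the cardinality,
  and removing it lowers the bound by enough.\<close>

lemma sum_recip_sqrt_le:
  fixes B :: "nat set"
  assumes "finite B" "0 \<notin> B" shows "(\<Sum>p\<in>B. 1 / sqrt (real p)) \<le> 2 * sqrt (real (card B))"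
  using assms
proof (induction "card B" arbitrary: B)
  case 0
  then show ?case by simp
next
  case (Suc n)
  then have ne: "B \<noteq> {}" by auto
  define M where "M = Max B"
  have M: "M \<in> B" using ne Suc.prems by (simp add: M_def)
  have "B \<subseteq> {1..M}" using Suc.prems M_def by (auto simp: Suc_le_eq intro: Nat.gr0I)
  then have "card B \<le> M" using card_mono[of "{1..M}" B] by simp
  then have MS: "Suc n \<le> M" using Suc.hyps(2) by simp
  have c: "card (B - {M}) = n" using M Suc by simp
  have "(\<Sum>p\<in>B. 1 / sqrt (real p)) = 1 / sqrt (real M) + (\<Sum>p\<in>B - {M}. 1 / sqrt (real p))"
    using M Suc.prems by (simp add: sum.remove)
  also have "(\<Sum>p\<in>B - {M}. 1 / sqrt (real p)) \<le> 2 * sqrt (real n)"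
    using Suc.hyps(1)[of "B - {M}"] c Suc.prems by auto
  also have "1 / sqrt (real M) \<le> 2 * sqrt (real (Suc n)) - 2 * sqrt (real n)"
  proof -
    let ?a = "sqrt (real (Suc n))" and ?b = "sqrt (real n)"
    have "1 / sqrt (real M) \<le> 1 / ?a" using MS by (intro divide_left_mono) auto
    also have "\<dots> \<le> 2 * ?a - 2 * ?b"
    proof -
      have a: "?a > 0" by simp
      have "0 \<le> (?a - ?b)\<^sup>2" by simp
      then have "2 * ?a * ?b \<le> ?a\<^sup>2 + ?b\<^sup>2" by (simp add: power2_diff)
      then have "1 \<le> (2 * ?a - 2 * ?b) * ?a" by (simp add: algebra_simps power2_eq_square)
      then show ?thesis using a by (simp add: pos_divide_le_eq)
    qed
    finally show ?thesis .
  qed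
  finally show ?case using Suc.hyps(2) by simp
qed

lemma prod_one_plus_eq_sum_subsets:
  fixes f :: "'a \<Rightarrow> real"
  assumes "finite B" shows "(\<Prod>p\<in>B. 1 + f p) = (\<Sum>D\<in>Pow B. prod f D)"
  using assms
proof (induction B rule: finite_induct)
  case (insert q B)
  have "Pow (insert q B) = Pow B \<union> insert q ` Pow B" by (rule Pow_insert)
  moreover have "Pow B \<inter> insert q ` Pow B = {}" using insert.hyps by auto
  moreover have "inj_on (insert q) (Pow B)" using insert.hyps by (auto simp: inj_on_def)
  moreover have "prod f (insert q D) = f q * prod f D" if "D \<in> Pow B" for D
    using that insert.hyps by (subst prod.insert) (auto intro: finite_subset)
  ultimately have "(\<Sum>D\<in>Pow (insert q B). prod f D) = (\<Sum>D\<in>Pow B. prod f D) + (\<Sum>D\<in>Pow B. f q * prod f D)"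
    using insert.hyps by (simp add: sum.union_disjoint sum.reindex)
  then show ?case using insert by (simp add: sum_distrib_left[symmetric] algebra_simps)
qed simp

text \<open>Rankin's trick for the divisors beyond the truncation point \<open>T\<close>.\<close>
lemma prod_one_plus_truncated:
  fixes B :: "nat set" and h T :: real
  assumes B: "finite B" "\<And>p. p \<in> B \<Longrightarrow> p \<ge> 1" and h: "h \<ge> 0" and T: "T > 0"
  shows "(\<Prod>p\<in>B. 1 + h / real p) \<le> 1 + (\<Sum>D | D \<subseteq> B \<and> D \<noteq> {} \<and> real (\<Prod>D) \<le> T. \<Prod>p\<in>D. h / real p)
     + exp (2 * h * sqrt (real (card B))) / sqrt T"
proof -
  have fin: "finite D" if "D \<subseteq> B" for D using that B(1) finite_subset by auto
  let ?f = "\<lambda>p. h / real p"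
  let ?S = "{D. D \<subseteq> B \<and> D \<noteq> {} \<and> real (\<Prod>D) \<le> T}" and ?L = "{D. D \<subseteq> B \<and> \<not> real (\<Prod>D) \<le> T}"
  have nn: "0 \<le> prod ?f D" for D using h by (intro prod_nonneg) auto
  have "(\<Prod>p\<in>B. 1 + ?f p) = (\<Sum>D\<in>Pow B. prod ?f D)" by (rule prod_one_plus_eq_sum_subsets[OF B(1)])
  also have "\<dots> \<le> (\<Sum>D\<in>{{}} \<union> ?S \<union> ?L. prod ?f D)"
    using B(1) nn by (intro sum_mono2) auto
  also have "\<dots> \<le> (\<Sum>D\<in>{{}} \<union> ?S. prod ?f D) + (\<Sum>D\<in>?L. prod ?f D)"
    using B(1) nn by (subst sum_Un) (auto intro: sum_nonneg)
  also have "(\<Sum>D\<in>{{}} \<union> ?S. prod ?f D) = 1 + (\<Sum>D\<in>?S. prod ?f D)"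
    using B(1) by (subst sum.union_disjoint) auto
  also have "(\<Sum>D\<in>?L. prod ?f D) \<le> (\<Sum>D\<in>Pow B. prod (\<lambda>p. h / sqrt (real p)) D / sqrt T)"
  proof -
    have "(\<Sum>D\<in>?L. prod ?f D) \<le> (\<Sum>D\<in>?L. prod (\<lambda>p. h / sqrt (real p)) D / sqrt T)"
    proof (rule sum_mono)
      fix D assume D: "D \<in> ?L"
      have sq: "prod (\<lambda>p. sqrt (real p)) D = sqrt (real (\<Prod>D))" 
        by (induction D rule: infinite_finite_induct) (auto simp: real_sqrt_mult)
      have gt: "sqrt T < sqrt (real (\<Prod>D))" using D by simp
      have "prod ?f D = prod (\<lambda>p. h / sqrt (real p) / sqrt (real p)) D"
        by (intro prod.cong refl) simp
      also have "\<dots> = prod (\<lambda>p. h / sqrt (real p)) D / sqrt (real (\<Prod>D))" by (simp only: prod_dividef sq)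
      also have "\<dots> \<le> prod (\<lambda>p. h / sqrt (real p)) D / sqrt T"
        using gt T h by (intro divide_left_mono prod_nonneg mult_pos_pos) (auto intro: order_less_trans[OF _ gt])
      finally show "prod ?f D \<le> prod (\<lambda>p. h / sqrt (real p)) D / sqrt T" .
    qed
    also have "\<dots> \<le> (\<Sum>D\<in>Pow B. prod (\<lambda>p. h / sqrt (real p)) D / sqrt T)"
      using B(1) h T by (intro sum_mono2 divide_nonneg_nonneg prod_nonneg) auto
    finally show ?thesis .
  qed
  also have "\<dots> = (\<Prod>p\<in>B. 1 + h / sqrt (real p)) / sqrt T"
    by (simp add: prod_one_plus_eq_sum_subsets[OF B(1)] sum_divide_distrib)
  also have "(\<Prod>p\<in>B. 1 + h / sqrt (real p)) \<le> (\<Prod>p\<in>B. exp (h / sqrt (real p)))"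
    using h by (intro prod_mono) (auto intro: add_nonneg_nonneg)
  also have "\<dots> = exp (\<Sum>p\<in>B. h / sqrt (real p))" using B(1) by (simp add: exp_sum)
  also have "(\<Sum>p\<in>B. h / sqrt (real p)) = h * (\<Sum>p\<in>B. 1 / sqrt (real p))" by (simp add: sum_distrib_left)
  also have "\<dots> \<le> h * (2 * sqrt (real (card B)))"
    using B h by (intro mult_left_mono sum_recip_sqrt_le) fastforce+
  finally show ?thesis using T by (simp add: divide_right_mono mult_ac add_ac)
qed

lemma card_primes_dividing_le:
  fixes x :: nat
  assumes "x > 0" "finite B" "\<And>p. p \<in> B \<Longrightarrow> prime p \<and> p dvd x"
  shows "real (card B) \<le> 2 * ln (real x)"
proof -
  have "B \<subseteq> prime_factors x" using assms by (auto simp: prime_factors_dvd)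
  then have "\<Prod>B dvd x" using assms(1) by (rule prod_primes_dvd)
  then have le: "\<Prod>B \<le> x" using assms(1) by (rule dvd_imp_le)
  have "(\<Prod>p\<in>B. 2) \<le> \<Prod>B" using assms prime_ge_2_nat by (intro prod_mono) auto
  then have "2 ^ card B \<le> x" using le by simp
  then have "2 ^ card B \<le> real x" by (metis of_nat_le_iff of_nat_numeral of_nat_power)
  then have "ln (2 ^ card B) \<le> ln (real x)" using assms(1) by (subst ln_le_cancel_iff) auto
  then have "real (card B) * ln 2 \<le> ln (real x)" by (simp add: ln_realpow)
  moreover have "real (card B) * (1/2) \<le> real (card B) * ln 2"
    using ln2_ge_two_thirds by (intro mult_left_mono) auto
  ultimately show ?thesis by linarith
qed

text \<open>An upper bound counterpart of \<open>sifted_density\<close> for sets that are not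
  intervals, such as the rough integers. It uses only a bound that is uniform over the classes
  modulo \<open>M * \<Prod>D\<close>.\<close>

lemma residue_conditions_le:
  fixes F :: "nat \<Rightarrow> real" and \<Omega> :: "nat \<Rightarrow> nat set"
  assumes "finite D" "finite N" and F: "\<And>n. n \<in> N \<Longrightarrow> 0 \<le> F n"
    and D: "\<And>p. p \<in> D \<Longrightarrow> prime p \<and> \<Omega> p \<subseteq> {..<p} \<and> coprime p M"
    and B: "\<And>r. (\<Sum>n | n \<in> N \<and> [n = r] (mod (M * \<Prod>D)). F n) \<le> B"
  shows "(\<Sum>n | n \<in> N \<and> [n = r] (mod M) \<and> (\<forall>p\<in>D. n mod p \<in> \<Omega> p). F n) \<le> B * (\<Prod>p\<in>D. real (card (\<Omega> p)))"
  using assms(1) D B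
proof (induction D arbitrary: M r rule: finite_induct)
  case empty
  then show ?case by simp
next
  case (insert q D)
  have q: "prime q" "\<Omega> q \<subseteq> {..<q}" "coprime q M" using insert.prems by auto
  have fin: "finite (\<Omega> q)" using q(2) finite_subset by blast
  have "(\<Sum>n | n \<in> {n\<in>N. [n = r] (mod M) \<and> (\<forall>p\<in>D. n mod p \<in> \<Omega> p)} \<and> n mod q \<in> \<Omega> q. F n) =
      (\<Sum>t\<in>\<Omega> q. \<Sum>n | n \<in> {n\<in>N. [n = r] (mod M) \<and> (\<forall>p\<in>D. n mod p \<in> \<Omega> p)} \<and> n mod q = t. F n)"
    using fin assms(2) by (intro sum_partition_card) auto
  moreover have "{n. n \<in> {n\<in>N. [n = r] (mod M) \<and> (\<forall>p\<in>D. n mod p \<in> \<Omega> p)} \<and> n mod q \<in> \<Omega> q}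
        = {n. n \<in> N \<and> [n = r] (mod M) \<and> (\<forall>p\<in>insert q D. n mod p \<in> \<Omega> p)}" by blast
  moreover have "{n. n \<in> {n\<in>N. [n = r] (mod M) \<and> (\<forall>p\<in>D. n mod p \<in> \<Omega> p)} \<and> n mod q = t}
        = {n. n \<in> N \<and> [n = r] (mod M) \<and> n mod q = t \<and> (\<forall>p\<in>D. n mod p \<in> \<Omega> p)}" for t by blast
  ultimately have split: "(\<Sum>n | n \<in> N \<and> [n = r] (mod M) \<and> (\<forall>p\<in>insert q D. n mod p \<in> \<Omega> p). F n)
    = (\<Sum>t\<in>\<Omega> q. \<Sum>n | n \<in> N \<and> [n = r] (mod M) \<and> n mod q = t \<and> (\<forall>p\<in>D. n mod p \<in> \<Omega> p). F n)" by simp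
  have "(\<Sum>n | n \<in> N \<and> [n = r] (mod M) \<and> n mod q = t \<and> (\<forall>p\<in>D. n mod p \<in> \<Omega> p). F n)
      \<le> B * (\<Prod>p\<in>D. real (card (\<Omega> p)))" if t: "t \<in> \<Omega> q" for t
  proof -
    obtain r' where r': "\<And>n. [n = r'] (mod (M * q)) \<longleftrightarrow> [n = r] (mod M) \<and> n mod q = t"
      using mod_insert_cong[OF q(3), of t r] q(2) t by blast
    have "(\<Sum>n | n \<in> N \<and> [n = r'] (mod (M * q)) \<and> (\<forall>p\<in>D. n mod p \<in> \<Omega> p). F n) \<le> B * (\<Prod>p\<in>D. real (card (\<Omega> p)))"
    proof (rule insert.IH)
      fix p assume p: "p \<in> D"
      then have "p \<noteq> q" using insert.hyps by auto
      then show "prime p \<and> \<Omega> p \<subseteq> {..<p} \<and> coprime p (M * q)"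
        using insert.prems(1)[of p] p q(1) by (auto simp: primes_coprime)
    next
      fix r
      show "(\<Sum>n | n \<in> N \<and> [n = r] (mod (M * q * \<Prod>D)). F n) \<le> B"
        using insert.prems(2)[of r] insert.hyps by (simp add: mult_ac)
    qed
    then show ?thesis by (simp add: r')
  qed
  then have "(\<Sum>t\<in>\<Omega> q. \<Sum>n | n \<in> N \<and> [n = r] (mod M) \<and> n mod q = t \<and> (\<forall>p\<in>D. n mod p \<in> \<Omega> p). F n)
    \<le> (\<Sum>t\<in>\<Omega> q. B * (\<Prod>p\<in>D. real (card (\<Omega> p))))" by (intro sum_mono)
  then show ?case unfolding split using insert.hyps by (simp add: mult_ac)
qed

lemma linear_root_unique:
  fixes p v i :: nat
  assumes "prime p" "\<not> p dvd v" "i < p"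
  shows "\<exists>!t. t < p \<and> p dvd t * v + i"
proof -
  have cop: "coprime v p" using assms by (metis coprime_commute prime_imp_coprime)
  obtain x where x: "[v * x = 1] (mod p)" using cong_solve_coprime_nat[OF cop] by auto
  have p0: "p > 0" using assms(1) by (rule prime_gt_0_nat)
  show ?thesis
  proof (rule ex1I[of _ "(x * (p - i)) mod p"], rule conjI)
    show "(x * (p - i)) mod p < p" using p0 by simp
    have "[(x * (p - i)) mod p * v + i = x * (p - i) * v + i] (mod p)"
      by (intro cong_add cong_mult) (auto simp: Cong.cong_def)
    also have "x * (p - i) * v + i = (v * x) * (p - i) + i" by simp
    also have "[(v * x) * (p - i) + i = 1 * (p - i) + i] (mod p)" by (intro cong_add cong_mult x cong_refl)
    also have "1 * (p - i) + i = p" using assms by simp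
    finally show "p dvd (x * (p - i)) mod p * v + i" by (simp add: Cong.cong_def mod_eq_0_iff_dvd)
  next
    fix t assume t: "t < p \<and> p dvd t * v + i"
    have "[t * v + i = 0] (mod p)" using t by (simp add: Cong.cong_def mod_eq_0_iff_dvd)
    moreover have "[(p - i) + i = 0] (mod p)" using assms by (simp add: Cong.cong_def)
    ultimately have "[t * v + i = (p - i) + i] (mod p)" by (simp add: Cong.cong_def)
    then have tv: "[t * v = p - i] (mod p)" by (simp add: cong_add_rcancel_nat)
    have "[t = t * (v * x)] (mod p)" using cong_mult[OF cong_refl[of t] x] by (simp add: cong_sym)
    also have "t * (v * x) = (t * v) * x" by simp
    also have "[(t * v) * x = (p - i) * x] (mod p)" using tv by (rule cong_scalar_right)
    finally have "t mod p = (p - i) * x mod p" by (simp add: Cong.cong_def)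
    then show "t = (x * (p - i)) mod p" using t by (simp add: mult.commute)
  qed
qed

lemma card_linear_roots:
  fixes p v :: nat and S :: "nat set"
  assumes "prime p" "\<not> p dvd v" "S \<subseteq> {..<p}"
  shows "card {t. t < p \<and> (\<exists>i\<in>S. p dvd t * v + i)} = card S"
proof -
  define h where "h = (\<lambda>i. THE t. t < p \<and> p dvd t * v + i)"
  have h: "h i < p \<and> p dvd h i * v + i" if "i \<in> S" for i
  proof -
    have i: "i < p" using that assms(3) by auto
    show ?thesis unfolding h_def by (rule theI'[OF linear_root_unique[OF assms(1,2) i]])
  qed
  have "{t. t < p \<and> (\<exists>i\<in>S. p dvd t * v + i)} = h ` S"
  proof (intro equalityI subsetI)
    fix t assume "t \<in> {t. t < p \<and> (\<exists>i\<in>S. p dvd t * v + i)}"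
    then obtain i where i: "i \<in> S" "t < p" "p dvd t * v + i" by auto
    have "i < p" using i(1) assms(3) by auto
    then have "t = h i" using linear_root_unique[OF assms(1,2), of i] h[OF i(1)] i(2,3) by blast
    then show "t \<in> h ` S" using i by auto
  qed (use h in auto)
  moreover have "inj_on h S"
  proof (rule inj_onI)
    fix i j assume ij: "i \<in> S" "j \<in> S" "h i = h j"
    have "[h i * v + i = 0] (mod p)" "[h i * v + j = 0] (mod p)"
      using h[OF ij(1)] h[OF ij(2)] ij(3) by (auto simp: Cong.cong_def mod_eq_0_iff_dvd)
    then have "[h i * v + i = h i * v + j] (mod p)" by (simp add: Cong.cong_def)
    then have "[i = j] (mod p)" by (simp add: cong_add_lcancel_nat)
    moreover have "i < p" "j < p" using ij assms(3) by auto
    ultimately show "i = j" by (simp add: Cong.cong_def)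
  qed
  ultimately show ?thesis by (simp add: card_image)
qed

lemma card_scaled_roots_le:
  fixes p i x :: nat
  assumes "prime p" "0 < i" "i < p"
  shows "card {t. t < p \<and> [i * t = x] (mod p)} \<le> 1"
proof -
  have cop: "coprime i p" using assms by (metis coprime_commute nat_dvd_not_less prime_imp_coprime)
  have "t = t'" if "t < p" "[i * t = x] (mod p)" "t' < p" "[i * t' = x] (mod p)" for t t'
  proof -
    have "[i * t = i * t'] (mod p)" using that by (simp add: Cong.cong_def)
    then have "[t = t'] (mod p)" using cop by (simp add: cong_mult_lcancel_nat)
    then show ?thesis using that by (simp add: Cong.cong_def)
  qed
  then have "\<forall>t\<in>{t. t < p \<and> [i * t = x] (mod p)}. \<forall>t'\<in>{t. t < p \<and> [i * t = x] (mod p)}. t = t'" by blast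
  moreover have "finite {t. t < p \<and> [i * t = x] (mod p)}" by auto
  ultimately show ?thesis unfolding One_nat_def by (subst card_le_Suc0_iff_eq)
qed

text \<open>Products over \<open>J\<close> blocks are bounded below by exponentials in
  \<open>J\<close>. In terms of \<open>2 ^ J * ln w\<close>, the logarithm of the sifting limit,
  these are mere powers, because \<open>exp J \<le> 4 ^ J\<close>.\<close>

lemma exp_le_power_two_power:
  assumes "6 \<le> w" shows "exp (20 * real n * real J) \<le> (2 ^ J * ln (real w)) ^ (40 * n)"
proof -
  have "1 \<le> ln (real w)"
  proof -
    have "exp 1 \<le> (3::real)" by (rule exp_le)
    then show ?thesis using assms by (simp add: ln_ge_iff)
  qed
  then have "2 ^ J * 1 \<le> 2 ^ J * ln (real w)" by (intro mult_left_mono) auto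
  then have 1: "(2 ^ J)\<^sup>2 \<le> (2 ^ J * ln (real w))\<^sup>2" by (intro power_mono) auto
  have "exp (real J) \<le> (2 ^ J)\<^sup>2"
  proof -
    have "exp (real J) = exp 1 ^ J" by (simp flip: exp_of_nat_mult)
    also have "\<dots> \<le> (2\<^sup>2) ^ J" using exp_le by (intro power_mono) auto
    finally show ?thesis by (simp add: power2_eq_square flip: power_mult_distrib)
  qed
  then have "exp (real J) \<le> (2 ^ J * ln (real w))\<^sup>2" using 1 by (rule order_trans)
  then have "exp (real J) ^ (20 * n) \<le> ((2 ^ J * ln (real w))\<^sup>2) ^ (20 * n)" by (intro power_mono) auto
  also have "exp (real J) ^ (20 * n) = exp (20 * real n * real J)" by (simp flip: exp_of_nat_mult)
  also have "((2 ^ J * ln (real w))\<^sup>2) ^ (20 * n) = (2 ^ J * ln (real w)) ^ (40 * n)" by (simp only: power_mult[symmetric]) simp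
  finally show ?thesis .
qed

section \<open>Primes whose shifts have no medium-sized prime factors\<close>

text \<open>The constant of \<open>rough_class_sum\<close>: a factor \<open>4\<close> from the sieve
  with relative error \<open>3\<close>, a factor \<open>4\<close> from the logarithmic length of the
  range, and \<open>1\<close> for the remainder. The factor \<open>exp 180\<close> is the price of
  omitting nine blocks, each with reciprocal sum at most \<open>10\<close>.\<close>

definition C1 :: real where "C1 = 17 * exp 180"

lemma C1_ge: "17 \<le> C1"
  unfolding C1_def by simp

text \<open>\<open>4 * k + 2\<close> is twice the largest number \<open>2 * k + 1\<close> of classes
  removed per prime. The bound on \<open>m\<close> lets \<open>Z ^ m\<close> exceed the sieve level
  \<open>Z ^ (8 * b + 13)\<close> by the factor \<open>Z ^ 7\<close>. \<open>J \<ge> 9\<close> makes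
  the root \<open>Z1\<close> of \<open>Z\<close> of order \<open>512\<close> again of the form
  \<open>w ^ 2 ^ i\<close>, and \<open>big\<close> guarantees that the density \<open>La\<close> is
  at least \<open>Z1 ^ (-3)\<close>, so that small negative powers of \<open>Z\<close> stay
  negligible.\<close>

locale sieve_setup =
  fixes k w b J m Q :: nat
  assumes k: "k \<ge> 1" and w: "4 * k + 2 \<le> w" and Q: "Q > 0"
    and Q_primes: "\<And>p. prime p \<Longrightarrow> p dvd Q \<longleftrightarrow> p \<le> w"
    and b: "exp (40 * real (2 * k + 1)) / 4 ^ b \<le> 1" and m: "8 * b + 20 \<le> m" and J: "9 \<le> J"
    and big: "real Q * exp (20 * real J) \<le> real (w ^ 2 ^ (J - 9)) ^ 3"
begin

text \<open>
  \<open>cc\<close> is the expected proportion of the rough integers \<open>n\<close> whose shifts \<open>n + 1\<close> up to \<open>n + k\<close> are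
  rough as well, and up to constants \<open>m * La\<close> is the sum of \<open>1 / v\<close> over the rough \<open>v\<close> up to \<open>Z ^ (4 * m)\<close>
  in a residue class. When \<open>v\<close> has to be divisible by further primes, sieving only up to
  \<open>Z1\<close>, which is \<open>Z\<close> to the power \<open>1/512\<close>, keeps the level small; this loses the constant \<open>C1\<close>.
\<close>
definition Z :: nat where "Z = w ^ 2 ^ J"
definition Z1 :: nat where "Z1 = w ^ 2 ^ (J - 9)"
definition PS :: "nat set" where "PS = primes_in w Z"
definition rough :: "nat \<Rightarrow> bool" where "rough n \<longleftrightarrow> (\<forall>p\<in>PS. \<not> p dvd n)"
definition adm :: "nat \<Rightarrow> bool" where "adm n \<longleftrightarrow> (\<forall>i\<in>{1..k}. rough (n + i))"
definition VR :: real where "VR = (\<Prod>p\<in>PS. 1 - 1 / real p)"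
definition VA :: real where "VA = (\<Prod>p\<in>PS. 1 - real (k + 1) / real p)"
definition cc :: real where "cc = VA / VR"
definition T :: real where "T = ln (real Z)"
definition La :: real where "La = T * VR / real Q"
definition \<theta> :: real where "\<theta> = exp (40 * real (2 * k + 1)) / 4 ^ b"

lemma finite_PS [simp]: "finite PS" by (simp add: PS_def)

lemma PS_D:
  assumes "p \<in> PS"
  shows "prime p" "w < p" "p \<le> Z" "4 * k + 2 < p" "coprime p Q" "p > 0"
proof -
  show p: "prime p" "w < p" "p \<le> Z" using assms by (auto simp: PS_def primes_in_def)
  show "4 * k + 2 < p" "p > 0" using p w by auto
  have "\<not> p dvd Q" using Q_primes[OF p(1)] p(2) by simp
  then show "coprime p Q" using p(1) by (simp add: prime_imp_coprime)
qed

lemma w_ge: "6 \<le> w" using w k by linarith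

lemma Z1_ge: "6 \<le> Z1"
proof -
  have "w ^ 2 ^ 0 \<le> Z1" unfolding Z1_def using w_ge by (intro power_two_power_mono) auto
  then show ?thesis using w_ge by simp
qed

lemma Z_eq: "Z = Z1 ^ 512"
proof -
  have "2 ^ J = 2 ^ (J - 9) * (512::nat)" using J power_add[of "2::nat" "J - 9" 9] by simp
  then show ?thesis by (simp add: Z_def Z1_def power_mult)
qed

lemma Z_ge: "Z1 \<le> Z" "6 \<le> Z" "w \<le> Z"
proof -
  have "Z1 ^ 1 \<le> Z" unfolding Z_eq using Z1_ge by (intro power_increasing) auto
  then show "Z1 \<le> Z" "6 \<le> Z" using Z1_ge by auto
  have "w ^ 2 ^ 0 \<le> Z" unfolding Z_def using w_ge by (intro power_two_power_mono) auto
  then show "w \<le> Z" by simp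
qed

lemma T_ge: "1 \<le> T"
proof -
  have "exp 1 \<le> (3::real)" by (rule exp_le)
  also have "\<dots> \<le> real Z" using Z_ge by linarith
  finally show ?thesis unfolding T_def using Z_ge by (simp add: ln_ge_iff)
qed

lemma m_pos: "m \<ge> 20" using m by linarith

lemma \<theta>: "0 < \<theta>" "\<theta> \<le> 1" using b by (auto simp: \<theta>_def)

lemma ln_Z_power: "ln (real (Z ^ n)) = real n * T" using Z_ge by (simp add: T_def ln_realpow)

lemma recip_half: assumes "p \<in> PS" shows "1 / real p \<le> 1/2" "real (k + 1) / real p \<le> 1/2"
  using PS_D[OF assms] by (auto simp: field_simps)

lemma sum_recip_PS: "(\<Sum>p\<in>PS. 1 / real p) \<le> 10 * real J"
  using primes_in_blocks_recip_le[of w 0 J] w_ge by (simp add: PS_def Z_def)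

lemma V_bounds: "exp (- 20 * real J) \<le> VR" "VR \<le> 1" "exp (- 20 * real (k + 1) * real J) \<le> VA" "VA \<le> VR"
proof -
  have "exp (- 20 * real J) \<le> exp (- 2 * (\<Sum>p\<in>PS. 1 / real p))" using sum_recip_PS by simp
  also have "\<dots> \<le> VR" unfolding VR_def using recip_half by (intro prod_one_minus_ge) auto
  finally show "exp (- 20 * real J) \<le> VR" .
  have "(\<Sum>p\<in>PS. real (k + 1) / real p) = real (k + 1) * (\<Sum>p\<in>PS. 1 / real p)" by (simp add: sum_distrib_left)
  also have "\<dots> \<le> real (k + 1) * (10 * real J)" by (intro mult_left_mono sum_recip_PS) auto
  finally have "- 20 * real (k + 1) * real J \<le> - 2 * (\<Sum>p\<in>PS. real (k + 1) / real p)" by linarith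
  then have "exp (- 20 * real (k + 1) * real J) \<le> exp (- 2 * (\<Sum>p\<in>PS. real (k + 1) / real p))"
    by (simp only: exp_le_cancel_iff)
  also have "\<dots> \<le> VA" unfolding VA_def using recip_half by (intro prod_one_minus_ge) auto
  finally show "exp (- 20 * real (k + 1) * real J) \<le> VA" .
  show "VR \<le> 1" unfolding VR_def
  proof (intro prod_le_1)
    fix p assume p: "p \<in> PS"
    show "0 \<le> 1 - 1 / real p \<and> 1 - 1 / real p \<le> 1" using recip_half(1)[OF p] by simp
  qed
  show "VA \<le> VR" unfolding VA_def VR_def
  proof (intro prod_mono conjI)
    fix p assume p: "p \<in> PS"
    show "0 \<le> 1 - real (k + 1) / real p" using recip_half[OF p] by linarith
    show "1 - real (k + 1) / real p \<le> 1 - 1 / real p" by (intro diff_left_mono divide_right_mono) auto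
  qed
qed

lemma VR_pos: "0 < VR" and VA_pos: "0 < VA"
  using V_bounds(1,3) exp_gt_zero less_le_trans by blast+

lemma cc_bounds: "0 < cc" "cc \<le> 1" "exp (- 20 * real (k + 1) * real J) \<le> cc" "VA = cc * VR"
proof -
  show "0 < cc" "cc \<le> 1" "VA = cc * VR" using VR_pos VA_pos V_bounds by (auto simp: cc_def)
  have "VA \<le> cc" using VR_pos VA_pos V_bounds(2) unfolding cc_def by (simp add: le_divide_eq mult_left_le)
  then show "exp (- 20 * real (k + 1) * real J) \<le> cc" using V_bounds(3) by linarith
qed

lemma La_pos: "0 < La" using T_ge VR_pos Q by (simp add: La_def)

lemma La_ge: "1 / real Z1 ^ 3 \<le> La"
proof -
  have "real Q * exp (20 * real J) \<le> real Z1 ^ 3" using big by (simp add: Z1_def)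
  then have "1 / real Z1 ^ 3 \<le> 1 / (real Q * exp (20 * real J))" using Q Z1_ge by (intro divide_left_mono mult_pos_pos) auto
  also have "\<dots> = 1 * exp (- 20 * real J) / real Q" by (simp add: exp_minus field_simps)
  also have "\<dots> \<le> T * VR / real Q" using T_ge V_bounds(1) by (intro divide_right_mono mult_mono) auto
  finally show ?thesis by (simp add: La_def)
qed

section \<open>Rough integers in residue classes\<close>

text \<open>Sieving only by primes up to \<open>Z1\<close> leaves room for a modulus enlarged by up
  to \<open>Z1\<close>: the remainder \<open>Z1 ^ 333 / Z\<close> is still far below
  \<open>La / \<Prod>D\<close>.\<close>

lemma rough_class_sum:
  assumes D: "D \<subseteq> PS" "\<Prod>D \<le> Z1"
  shows "(\<Sum>n | n \<in> {Z<..Z ^ (4 * m)} \<and> [n = r] (mod (Q * \<Prod>D)) \<and> rough n. 1 / real n)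
    \<le> C1 * 2 ^ card D * (real m * La) / real (\<Prod>D)"
proof -
  \<comment> \<open>The primes of \<open>D\<close> divide the modulus, so no class is removed there.
    Each factor \<open>1 - 1 / p\<close> missing for this reason is at least \<open>1 / 2\<close>,
    which produces the power of \<open>2\<close>.\<close>
  define \<Omega> where "\<Omega> = (\<lambda>p. if p \<in> D then {} else {0::nat})"
  define P1 where "P1 = primes_in w Z1"
  define V' where "V' = (\<Prod>p\<in>P1. 1 - real (card (\<Omega> p)) / real p)"
  define H where "H = (\<Sum>n\<in>{Z<..Z ^ (4 * m)}. 1 / real n)"
  have finD: "finite D" using D(1) finite_PS finite_subset by blast
  have Dpos: "0 < \<Prod>D" using D(1) PS_D(6) by (intro prod_pos) auto
  have QD: "Q * \<Prod>D > 0" using Q Dpos by simp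
  have P1: "P1 \<subseteq> PS" using Z_ge by (auto simp: P1_def PS_def primes_in_def)
  have "(\<Sum>n | n \<in> {Z<..Z ^ (4 * m)} \<and> [n = r] (mod (Q * \<Prod>D)) \<and> rough n. 1 / real n)
     \<le> (\<Sum>n | n \<in> {Z<..Z ^ (4 * m)} \<and> [n = r] (mod (Q * \<Prod>D)) \<and> (\<forall>p\<in>primes_in w (w ^ 2 ^ (J - 9)). n mod p \<notin> \<Omega> p). 1 / real n)"
  proof (rule sum_mono2)
    show "{n. n \<in> {Z<..Z ^ (4 * m)} \<and> [n = r] (mod (Q * \<Prod>D)) \<and> rough n}
      \<subseteq> {n. n \<in> {Z<..Z ^ (4 * m)} \<and> [n = r] (mod (Q * \<Prod>D)) \<and> (\<forall>p\<in>primes_in w (w ^ 2 ^ (J - 9)). n mod p \<notin> \<Omega> p)}"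
      using P1 unfolding P1_def Z1_def by (auto simp: rough_def \<Omega>_def mod_eq_0_iff_dvd split: if_splits)
  qed auto
  also have "\<dots> \<le> 4 * (H / real (Q * \<Prod>D) * V') + 1 / real (Suc Z) * real Z1 ^ 333"
  proof -
    \<comment> \<open>For one class per prime \<open>b = 40\<close> makes the sieve parameter at
      most \<open>1\<close>, which suffices for an upper bound. The level is then
      \<open>8 * 40 + 13 = 333\<close>, well below the \<open>512\<close> powers of
      \<open>Z1\<close> contained in \<open>Z\<close>.\<close>
    have "exp 1 \<le> (4::real)" using exp_le by linarith
    then have "exp 1 ^ 40 \<le> (4::real) ^ 40" by (intro power_mono) auto
    then have e: "exp (40 * real 1) / 4 ^ 40 \<le> (1::real)" using exp_of_nat_mult[of 40 "1::real"] by simp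
    have "\<bar>(\<Sum>n | n \<in> {Z<..Z ^ (4 * m)} \<and> [n = r] (mod (Q * \<Prod>D)) \<and> (\<forall>p\<in>primes_in w (w ^ 2 ^ (J - 9)). n mod p \<notin> \<Omega> p). 1 / real n)
       - (\<Sum>n\<in>{Z<..Z ^ (4 * m)}. 1 / real n) / real (Q * \<Prod>D) * (\<Prod>p\<in>primes_in w (w ^ 2 ^ (J - 9)). 1 - real (card (\<Omega> p)) / real p)\<bar>
     \<le> 3 * 1 * ((\<Sum>n\<in>{Z<..Z ^ (4 * m)}. 1 / real n) / real (Q * \<Prod>D) * (\<Prod>p\<in>primes_in w (w ^ 2 ^ (J - 9)). 1 - real (card (\<Omega> p)) / real p))
        + 1 / real (Suc Z) * real (w ^ 2 ^ (J - 9)) ^ (8 * 40 + 13)"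
    proof (rule prime_sieve[where \<kappa> = 1 and g = "\<lambda>n. 1 / real n"])
      show "2 * 1 \<le> w" "2 \<le> w" using w_ge by auto
      show "exp (40 * real 1) / 4 ^ 40 \<le> (1::real)" by (rule e)
      fix p assume p: "p \<in> primes_in w (w ^ 2 ^ (J - 9))"
      then have pP: "p \<in> PS" using P1 unfolding P1_def Z1_def by blast
      have "coprime p (\<Prod>D)" if "p \<notin> D"
      proof (rule prod_coprime_right)
        fix q assume "q \<in> D"
        then show "coprime p q" using that D(1) PS_D(1) pP by (intro primes_coprime) auto
      qed
      then show "\<Omega> p \<subseteq> {..<p} \<and> card (\<Omega> p) \<le> 1 \<and> (coprime p (Q * \<Prod>D) \<or> \<Omega> p = {})"
        using PS_D(5,6)[OF pP] by (auto simp: \<Omega>_def)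
    qed (use QD in \<open>auto simp: frac_le\<close>)
    moreover have ex: "8 * 40 + 13 = (333::nat)" by simp
    ultimately show ?thesis unfolding H_def V'_def P1_def Z1_def ex by linarith
  qed
  also have "\<dots> \<le> 4 * (4 * real m * T / real (Q * \<Prod>D) * (2 ^ card D * (exp 180 * VR))) + La / real (\<Prod>D)"
  proof (intro add_mono mult_left_mono mult_mono divide_right_mono)
    have "Z ^ 1 \<le> Z ^ (4 * m)" using Z_ge m_pos by (intro power_increasing) auto
    then have "H \<le> ln (real (Z ^ (4 * m))) - ln (real Z)"
      unfolding H_def using Z_ge by (intro sum_recip_interval_le) auto
    also have "\<dots> \<le> 4 * real m * T" using T_ge unfolding ln_Z_power T_def[symmetric] by simp
    finally show "H \<le> 4 * real m * T" .
    have half: "1/2 \<le> 1 - 1 / real p \<and> 1 - 1 / real p \<le> 1" if "p \<in> PS" for p using recip_half(1)[OF that] by simp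
    have "V' = (\<Prod>p\<in>P1. if p \<in> D then 1 else 1 - 1 / real p)"
      unfolding V'_def \<Omega>_def by (intro prod.cong) auto
    also have "\<dots> \<le> (\<Prod>p\<in>P1. (if p \<in> D then 2 else 1) * (1 - 1 / real p))"
      using half P1 by (intro prod_mono) force
    also have "\<dots> = (\<Prod>p\<in>P1. if p \<in> D then 2 else 1) * (\<Prod>p\<in>P1. 1 - 1 / real p)" by (simp add: prod.distrib)
    also have "\<dots> \<le> 2 ^ card D * (exp 180 * VR)"
    proof (intro mult_mono)
      have "(\<Prod>p\<in>P1. if p \<in> D then 2 else (1::real)) = 2 ^ card (P1 \<inter> D)"
        by (simp add: prod.If_cases P1_def)
      also have "\<dots> \<le> 2 ^ card D" using finD by (intro power_increasing card_mono) auto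
      finally show "(\<Prod>p\<in>P1. if p \<in> D then 2 else (1::real)) \<le> 2 ^ card D" .
      define P2 where "P2 = primes_in Z1 Z"
      have "w ^ 2 ^ 0 \<le> Z1" unfolding Z1_def using w_ge by (intro power_two_power_mono) auto
      then have sp: "PS = P1 \<union> P2" "P1 \<inter> P2 = {}"
        unfolding PS_def P1_def P2_def using primes_in_split[of w Z1 Z] Z_ge by auto
      have "(\<Sum>p\<in>P2. 1 / real p) \<le> 10 * real (J - (J - 9))"
        unfolding P2_def Z1_def Z_def using w_ge J by (intro primes_in_blocks_recip_le) auto
      then have "exp (- 180) \<le> exp (- 2 * (\<Sum>p\<in>P2. 1 / real p))" using J by simp
      also have "\<dots> \<le> (\<Prod>p\<in>P2. 1 - 1 / real p)" using recip_half sp(1)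
        by (intro prod_one_minus_ge) (auto simp: P2_def)
      finally have P2: "exp (- 180) \<le> (\<Prod>p\<in>P2. 1 - 1 / real p)" .
      have nn: "0 \<le> (\<Prod>p\<in>P1. 1 - 1 / real p)" using half P1 by (intro prod_nonneg) force
      have "(\<Prod>p\<in>P1. 1 - 1 / real p) = exp 180 * ((\<Prod>p\<in>P1. 1 - 1 / real p) * exp (- 180))"
        by (simp add: exp_minus)
      also have "\<dots> \<le> exp 180 * ((\<Prod>p\<in>P1. 1 - 1 / real p) * (\<Prod>p\<in>P2. 1 - 1 / real p))"
        using P2 nn by (intro mult_left_mono) auto
      also have "(\<Prod>p\<in>P1. 1 - 1 / real p) * (\<Prod>p\<in>P2. 1 - 1 / real p) = VR"
        unfolding VR_def sp(1) using sp(2) by (subst prod.union_disjoint) (auto simp: P1_def P2_def)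
      finally show "(\<Prod>p\<in>P1. 1 - 1 / real p) \<le> exp 180 * VR" .
      show "0 \<le> (\<Prod>p\<in>P1. 1 - 1 / real p)" by (rule nn)
    qed simp
    finally show "V' \<le> 2 ^ card D * (exp 180 * VR)" .
    have "0 \<le> 1 - real (card (\<Omega> p)) / real p" if "p \<in> P1" for p
      using half[of p] that P1 by (cases "p \<in> D") (auto simp: \<Omega>_def)
    then show "0 \<le> V'" unfolding V'_def by (intro prod_nonneg) auto
    have "1 / real (Suc Z) * real Z1 ^ 333 \<le> 1 / real Z * real Z1 ^ 333"
      using Z_ge by (intro mult_right_mono divide_left_mono) auto
    also have "\<dots> = 1 / real Z1 ^ 179"
    proof -
      have "real Z = real Z1 ^ 333 * real Z1 ^ 179" by (simp add: Z_eq flip: power_add)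
      then show ?thesis using Z1_ge by (simp add: field_simps)
    qed
    also have "\<dots> \<le> 1 / real Z1 ^ 4" using Z1_ge by (intro divide_left_mono power_increasing) auto
    also have "\<dots> = 1 / real Z1 ^ 3 / real Z1" by (simp add: power_numeral_reduce)
    also have "\<dots> \<le> La / real (\<Prod>D)"
    proof (rule frac_le)
      show "0 < real (\<Prod>D)" using Dpos by (simp only: of_nat_0_less_iff)
      show "real (\<Prod>D) \<le> real Z1" using D(2) by (simp only: of_nat_le_iff)
    qed (use La_ge La_pos in auto)
    finally show "1 / real (Suc Z) * real Z1 ^ 333 \<le> La / real (\<Prod>D)" .
  qed (use T_ge in \<open>auto intro!: mult_nonneg_nonneg divide_nonneg_nonneg prod_nonneg\<close>)
  also have "\<dots> = 16 * exp 180 * 2 ^ card D * (real m * La) / real (\<Prod>D) + 1 * 1 * 1 * (1 * La) / real (\<Prod>D)"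
    by (simp add: La_def)
  also have "\<dots> \<le> 16 * exp 180 * 2 ^ card D * (real m * La) / real (\<Prod>D) + 1 * exp 180 * 2 ^ card D * (real m * La) / real (\<Prod>D)"
    using m_pos La_pos by (intro add_left_mono divide_right_mono mult_mono) (auto intro!: prod_nonneg)
  also have "\<dots> = C1 * 2 ^ card D * (real m * La) / real (\<Prod>D)" by (simp add: C1_def field_simps)
  finally show ?thesis .
qed

section \<open>Joint sieving of the shifts for a pair of multipliers\<close>

text \<open>For rough \<open>v1\<close> and \<open>v2\<close> these are the primes modulo which some
  \<open>t * v1 + i\<close> and some \<open>t * v2 + j\<close> have a common root, so that the pair
  excludes fewer than \<open>2 * k + 1\<close> classes.\<close>

definition bad :: "nat \<Rightarrow> nat \<Rightarrow> nat set" where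
  "bad v1 v2 = {p \<in> PS. \<exists>i\<in>{1..k}. \<exists>j\<in>{1..k}. [i * v2 = j * v1] (mod p)}"

text \<open>The index \<open>0\<close> is included: for \<open>v\<close> prime to \<open>p\<close>
  it contributes the root \<open>0\<close>, so that avoiding all roots expresses the roughness of
  \<open>u\<close> together with that of the shifts of \<open>u * v\<close>.\<close>

definition roots :: "nat \<Rightarrow> nat \<Rightarrow> nat set" where
  "roots v p = {t. t < p \<and> (\<exists>i\<in>{0..k}. p dvd t * v + i)}"

lemma card_roots: assumes "p \<in> PS" "rough v" shows "card (roots v p) = k + 1"
proof -
  have "{0..k} \<subseteq> {..<p}" using PS_D(4)[OF assms(1)] by auto
  moreover have "\<not> p dvd v" using assms by (simp add: rough_def)
  ultimately show ?thesis unfolding roots_def using card_linear_roots[of p v "{0..k}"] PS_D(1)[OF assms(1)] by simp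
qed

lemma mod_mem_roots: assumes "p \<in> PS" shows "u mod p \<in> roots v p \<longleftrightarrow> (\<exists>i\<in>{0..k}. p dvd u * v + i)"
proof -
  have "[(u mod p) * v + i = u * v + i] (mod p)" for i
    by (intro cong_add cong_mult) (auto simp: Cong.cong_def)
  then have "p dvd (u mod p) * v + i \<longleftrightarrow> p dvd u * v + i" for i by (rule cong_dvd_iff)
  then show ?thesis using PS_D(6)[OF assms] by (simp add: roots_def)
qed

lemma avoid_roots_iff:
  assumes "rough v" shows "(\<forall>p\<in>PS. u mod p \<notin> roots v p) \<longleftrightarrow> rough u \<and> adm (u * v)"
proof -
  have "u mod p \<in> roots v p \<longleftrightarrow> p dvd u \<or> (\<exists>i\<in>{1..k}. p dvd u * v + i)" if "p \<in> PS" for p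
  proof -
    have "{0..k} = insert 0 {1..k}" by auto
    moreover have "p dvd u * v \<longleftrightarrow> p dvd u"
      using assms that PS_D(1)[OF that] by (auto simp: rough_def prime_dvd_mult_iff)
    ultimately show ?thesis unfolding mod_mem_roots[OF that] by simp
  qed
  then show ?thesis by (auto simp: rough_def adm_def)
qed

text \<open>Outside \<open>bad\<close> there are at least \<open>2 * k + 1\<close> roots, and
  \<open>(1 - (2 * k + 1) / p) * (1 - 1 / p)\<close> falls short of \<open>(1 - (k + 1) / p)\<close>
  squared by \<open>k ^ 2 / p ^ 2\<close>. At a bad prime only \<open>k + 1\<close> roots are
  certain; the loss is covered by \<open>1 + 4 * k / p\<close> because
  \<open>p > 4 * k + 2\<close>.\<close>

lemma pair_local_factor:
  assumes p: "p \<in> PS" and v: "rough v1" "rough v2"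
  shows "1 - real (card (roots v1 p \<union> roots v2 p)) / real p
    \<le> (1 - 1 / real p) * ((1 - real (k + 1) / real p) / (1 - 1 / real p))\<^sup>2 * (if p \<in> bad v1 v2 then 1 + 4 * real k / real p else 1)"
proof -
  define x where "x = real p"
  define A where "A = 1 - real (k + 1) / x"
  define B where "B = 1 - 1 / x"
  have x: "x > 4 * real k + 2" "x > 0" using PS_D(4)[OF p] PS_D(6)[OF p] unfolding x_def by linarith+
  have AB: "0 < A" "0 < B" using x by (auto simp: A_def B_def field_simps)
  have fin: "finite (roots v p)" for v by (simp add: roots_def)
  have c1: "k + 1 \<le> card (roots v1 p \<union> roots v2 p)"
    using card_mono[OF _ Un_upper1, of "roots v1 p" "roots v2 p"] fin card_roots[OF p v(1)] by simp
  have BAB: "B * (A / B)\<^sup>2 = A\<^sup>2 / B" using AB by (simp add: power2_eq_square)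
  show ?thesis
  proof (cases "p \<in> bad v1 v2")
    case True
    have "1 - real (card (roots v1 p \<union> roots v2 p)) / x \<le> A"
      unfolding A_def using c1 x by (intro diff_left_mono divide_right_mono) auto
    also have "A \<le> A\<^sup>2 / B * (1 + 4 * real k / x)"
    proof -
      have "B * x\<^sup>2 \<le> A * (1 + 4 * real k / x) * x\<^sup>2"
      proof -
        have "B * x\<^sup>2 = (x - 1) * x" using x by (simp add: B_def field_simps power2_eq_square)
        also have "\<dots> = x\<^sup>2 + (3 * real k - 1) * x - real k * (3 * x)" by (simp add: algebra_simps power2_eq_square)
        also have "\<dots> \<le> x\<^sup>2 + (3 * real k - 1) * x - real k * (4 * (real k + 1))"
          using x by (intro diff_left_mono mult_left_mono) auto
        also have "\<dots> = A * (1 + 4 * real k / x) * x\<^sup>2"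
          using x by (simp add: A_def field_simps power2_eq_square)
        finally show ?thesis .
      qed
      then have "B \<le> A * (1 + 4 * real k / x)" using x by (simp add: mult_le_cancel_right)
      then have "A * B \<le> A * (A * (1 + 4 * real k / x))" using AB by (intro mult_left_mono) auto
      then show ?thesis using AB by (simp add: field_simps power2_eq_square)
    qed
    finally show ?thesis using True BAB unfolding A_def B_def x_def by simp
  next
    case False
    have sub: "roots v1 p \<union> {t. t < p \<and> (\<exists>i\<in>{1..k}. p dvd t * v2 + i)} \<subseteq> roots v1 p \<union> roots v2 p"
      by (auto simp: roots_def)
    have disj: "roots v1 p \<inter> {t. t < p \<and> (\<exists>i\<in>{1..k}. p dvd t * v2 + i)} = {}"
    proof (rule ccontr)
      assume "roots v1 p \<inter> {t. t < p \<and> (\<exists>i\<in>{1..k}. p dvd t * v2 + i)} \<noteq> {}"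
      then obtain t i j where t: "i \<in> {0..k}" "p dvd t * v1 + i" "j \<in> {1..k}" "p dvd t * v2 + j"
        unfolding roots_def by blast
      have c: "[t * v1 + i = 0] (mod p)" "[t * v2 + j = 0] (mod p)" using t by (auto simp: Cong.cong_def mod_eq_0_iff_dvd)
      have "[(t * v1 + i) * v2 = 0 * v2] (mod p)" "[(t * v2 + j) * v1 = 0 * v1] (mod p)"
        using cong_scalar_right[OF c(1), of v2] cong_scalar_right[OF c(2), of v1] by auto
      then have "[t * v1 * v2 + i * v2 = t * v1 * v2 + j * v1] (mod p)"
        by (simp add: Cong.cong_def algebra_simps)
      then have e: "[i * v2 = j * v1] (mod p)" by (simp add: cong_add_lcancel_nat)
      show False
      proof (cases "i = 0")
        case True
        then have "p dvd j * v1" using e by (simp add: Cong.cong_def mod_eq_0_iff_dvd)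
        moreover have "\<not> p dvd v1" using v p by (simp add: rough_def)
        ultimately have "p dvd j" using PS_D(1)[OF p] by (simp add: prime_dvd_mult_iff)
        then show False using t(3) PS_D(4)[OF p] by (auto dest: dvd_imp_le)
      next
        case False
        then show False using e t \<open>p \<notin> bad v1 v2\<close> p by (auto simp: bad_def)
      qed
    qed
    have "card {t. t < p \<and> (\<exists>i\<in>{1..k}. p dvd t * v2 + i)} = k"
    proof -
      have "{1..k} \<subseteq> {..<p}" using PS_D(4)[OF p] by auto
      moreover have "\<not> p dvd v2" using v p by (simp add: rough_def)
      ultimately show ?thesis using card_linear_roots[of p v2 "{1..k}"] PS_D(1)[OF p] by simp
    qed
    then have "2 * k + 1 \<le> card (roots v1 p \<union> roots v2 p)"
      using card_mono[OF _ sub] disj fin card_roots[OF p v(1)] by (simp add: card_Un_disjoint)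
    then have "real (2 * k + 1) \<le> real (card (roots v1 p \<union> roots v2 p))" by (simp only: of_nat_le_iff)
    then have "1 - real (card (roots v1 p \<union> roots v2 p)) / x \<le> 1 - real (2 * k + 1) / x"
      using x by (intro diff_left_mono divide_right_mono) auto
    also have "\<dots> \<le> A\<^sup>2 / B"
    proof -
      have "(1 - real (2 * k + 1) / x) * B * x\<^sup>2 \<le> A\<^sup>2 * x\<^sup>2"
        using x by (simp add: A_def B_def field_simps power2_eq_square)
      then have "(1 - real (2 * k + 1) / x) * B \<le> A\<^sup>2" using x by (simp add: mult_le_cancel_right)
      then show ?thesis using AB by (simp add: pos_le_divide_eq)
    qed
    finally show ?thesis using False BAB unfolding A_def B_def x_def by simp
  qed
qed

lemma pair_product_le:
  assumes v: "rough v1" "rough v2"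
  shows "(\<Prod>p\<in>PS. 1 - real (card (roots v1 p \<union> roots v2 p)) / real p) \<le> VR * cc\<^sup>2 * (\<Prod>p\<in>bad v1 v2. 1 + 4 * real k / real p)"
proof -
  have le1: "0 \<le> 1 - real (card (roots v1 p \<union> roots v2 p)) / real p" if "p \<in> PS" for p
  proof -
    have "card (roots v1 p \<union> roots v2 p) \<le> p"
      using card_mono[of "{..<p}" "roots v1 p \<union> roots v2 p"] by (auto simp: roots_def)
    then show ?thesis using PS_D(6)[OF that] by simp
  qed
  have "(\<Prod>p\<in>PS. 1 - real (card (roots v1 p \<union> roots v2 p)) / real p)
    \<le> (\<Prod>p\<in>PS. (1 - 1 / real p) * ((1 - real (k + 1) / real p) / (1 - 1 / real p))\<^sup>2 * (if p \<in> bad v1 v2 then 1 + 4 * real k / real p else 1))"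
    using le1 pair_local_factor[OF _ v] by (intro prod_mono) auto
  also have "\<dots> = VR * cc\<^sup>2 * (\<Prod>p\<in>PS. if p \<in> bad v1 v2 then 1 + 4 * real k / real p else 1)"
  proof -
    have "(\<Prod>p\<in>PS. ((1 - real (k + 1) / real p) / (1 - 1 / real p))\<^sup>2) = cc\<^sup>2"
      by (simp only: prod_power_distrib[symmetric] prod_dividef cc_def VA_def VR_def)
    then show ?thesis by (simp only: prod.distrib VR_def)
  qed
  also have "(\<Prod>p\<in>PS. if p \<in> bad v1 v2 then 1 + 4 * real k / real p else 1) = (\<Prod>p\<in>bad v1 v2. 1 + 4 * real k / real p)"
    by (intro prod.mono_neutral_cong_right) (auto simp: bad_def)
  finally show ?thesis .
qed

lemma sieve_count:
  assumes X: "Z ^ m \<le> X" and \<Omega>: "\<And>p. p \<in> PS \<Longrightarrow> \<Omega> p \<subseteq> {..<p} \<and> card (\<Omega> p) \<le> 2 * k + 1"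
  shows "\<bar>(\<Sum>u | u \<in> {X<..Y} \<and> [u = r] (mod Q) \<and> (\<forall>p\<in>PS. u mod p \<notin> \<Omega> p). 1 / real u)
       - (\<Sum>u\<in>{X<..Y}. 1 / real u) / real Q * (\<Prod>p\<in>PS. 1 - real (card (\<Omega> p)) / real p)\<bar>
     \<le> 3 * \<theta> * ((\<Sum>u\<in>{X<..Y}. 1 / real u) / real Q * (\<Prod>p\<in>PS. 1 - real (card (\<Omega> p)) / real p)) + 1 / real Z ^ 7"
proof -
  have "\<bar>(\<Sum>u | u \<in> {X<..Y} \<and> [u = r] (mod Q) \<and> (\<forall>p\<in>PS. u mod p \<notin> \<Omega> p). 1 / real u)
       - (\<Sum>u\<in>{X<..Y}. 1 / real u) / real Q * (\<Prod>p\<in>PS. 1 - real (card (\<Omega> p)) / real p)\<bar>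
     \<le> 3 * \<theta> * ((\<Sum>u\<in>{X<..Y}. 1 / real u) / real Q * (\<Prod>p\<in>PS. 1 - real (card (\<Omega> p)) / real p)) + 1 / real (Suc X) * real Z ^ (8 * b + 13)"
    unfolding PS_def Z_def
    by (rule prime_sieve[where \<kappa> = "2 * k + 1" and g = "\<lambda>n. 1 / real n"])
      (use w Q \<theta> \<Omega> PS_D(5) in \<open>auto simp: \<theta>_def frac_le PS_def Z_def\<close>)
  also have "1 / real (Suc X) * real Z ^ (8 * b + 13) \<le> 1 / real Z ^ 7"
  proof -
    have "Z ^ (7 + (8 * b + 13)) \<le> Z ^ m" using m Z_ge by (intro power_increasing) auto
    then have "Z ^ (7 + (8 * b + 13)) \<le> Suc X" using X by linarith
    then have "real (Z ^ (7 + (8 * b + 13))) \<le> real (Suc X)" by (simp only: of_nat_le_iff)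
    then have "real Z ^ 7 * real Z ^ (8 * b + 13) \<le> real (Suc X)" by (simp only: power_add of_nat_mult of_nat_power)
    then show ?thesis using Z_ge by (simp add: field_simps)
  qed
  finally show ?thesis by simp
qed

text \<open>The covariance splits into a count for the pair, two single counts and the total. With
  exact densities the main terms would cancel up to the excess of the singular series over
  \<open>1\<close>; the sieve adds multiples of \<open>\<theta>\<close>. Only an upper bound is
  needed later, hence upper bounds for the pair and the total and lower bounds for the single
  counts.\<close>

lemma pair_correlation:
  assumes v: "rough v1" "rough v2" and X: "Z ^ m \<le> X" and Y: "Y \<le> Z ^ (4 * m)"
  shows "(\<Sum>u | u \<in> {X<..Y} \<and> [u = r] (mod Q) \<and> rough u.
       1 / real u * ((of_bool (adm (u * v1)) - cc) * (of_bool (adm (u * v2)) - cc)))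
    \<le> 16 * (real m * La) * cc\<^sup>2 * ((\<Prod>p\<in>bad v1 v2. 1 + 4 * real k / real p) - 1 + 3 * \<theta>) + 4 / real Z ^ 7"
proof -
  define h where "h = (\<Sum>u\<in>{X<..Y}. 1 / real u) / real Q"
  define S' where "S' = (\<Prod>p\<in>bad v1 v2. 1 + 4 * real k / real p)"
  define e where "e = 1 / real Z ^ 7"
  let ?U = "{u. u \<in> {X<..Y} \<and> [u = r] (mod Q) \<and> rough u}"
  have finU: "finite ?U" by auto
  have e0: "0 \<le> e" by (simp add: e_def)
  have h: "0 \<le> h" "h * VR \<le> 4 * (real m * La)"
  proof -
    show "0 \<le> h" unfolding h_def by (intro divide_nonneg_nonneg sum_nonneg) auto
    have "(\<Sum>u\<in>{X<..Y}. 1 / real u) \<le> 4 * real m * T"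
    proof (cases "X \<le> Y")
      case True
      have X1: "1 \<le> X" using X Z_ge by (metis One_nat_def Suc_leI less_le_trans not_numeral_le_zero gr0I zero_less_power)
      then have "(\<Sum>u\<in>{X<..Y}. 1 / real u) \<le> ln (real Y) - ln (real X)" using True by (rule sum_recip_interval_le)
      also have "\<dots> \<le> ln (real (Z ^ (4 * m))) - 0"
      proof (rule diff_mono)
        have "0 < Y" "0 < Z ^ (4 * m)" using X1 True Z_ge by auto
        then show "ln (real Y) \<le> ln (real (Z ^ (4 * m)))"
          using Y by (subst ln_le_cancel_iff) (simp_all only: of_nat_0_less_iff of_nat_le_iff)
      qed (use X1 in simp)
      finally show ?thesis unfolding ln_Z_power by simp
    next
      case False
      then show ?thesis using T_ge by simp
    qed
    then have "(\<Sum>u\<in>{X<..Y}. 1 / real u) / real Q * VR \<le> 4 * real m * T / real Q * VR"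
      using VR_pos by (intro mult_right_mono divide_right_mono) auto
    then show "h * VR \<le> 4 * (real m * La)" by (simp add: h_def La_def)
  qed
  have S0: "(\<Sum>u\<in>?U. 1 / real u) \<le> (1 + 3 * \<theta>) * (h * VR) + e"
  proof -
    have "?U = {u. u \<in> {X<..Y} \<and> [u = r] (mod Q) \<and> (\<forall>p\<in>PS. u mod p \<notin> {0})}"
      by (auto simp: rough_def mod_eq_0_iff_dvd)
    moreover have "\<bar>(\<Sum>u | u \<in> {X<..Y} \<and> [u = r] (mod Q) \<and> (\<forall>p\<in>PS. u mod p \<notin> {0}). 1 / real u) - h * (\<Prod>p\<in>PS. 1 - real (card {0::nat}) / real p)\<bar>
      \<le> 3 * \<theta> * (h * (\<Prod>p\<in>PS. 1 - real (card {0::nat}) / real p)) + e"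
      unfolding h_def e_def using PS_D(6) by (intro sieve_count X) auto
    ultimately show ?thesis unfolding VR_def by (simp add: algebra_simps abs_le_iff)
  qed
  have S1: "(1 - 3 * \<theta>) * (h * VA) - e \<le> (\<Sum>u\<in>?U. 1 / real u * of_bool (adm (u * v)))" if "rough v" for v
  proof -
    have "\<bar>(\<Sum>u | u \<in> {X<..Y} \<and> [u = r] (mod Q) \<and> (\<forall>p\<in>PS. u mod p \<notin> roots v p). 1 / real u) - h * (\<Prod>p\<in>PS. 1 - real (card (roots v p)) / real p)\<bar>
      \<le> 3 * \<theta> * (h * (\<Prod>p\<in>PS. 1 - real (card (roots v p)) / real p)) + e"
      unfolding h_def e_def using card_roots[OF _ that] by (intro sieve_count X) (auto simp: roots_def)
    moreover have "(\<Prod>p\<in>PS. 1 - real (card (roots v p)) / real p) = VA"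
      unfolding VA_def using card_roots[OF _ that] by (intro prod.cong) auto
    moreover have "(\<Sum>u | u \<in> {X<..Y} \<and> [u = r] (mod Q) \<and> (\<forall>p\<in>PS. u mod p \<notin> roots v p). 1 / real u) = (\<Sum>u\<in>?U. 1 / real u * of_bool (adm (u * v)))"
      unfolding avoid_roots_iff[OF that] by (intro sum.mono_neutral_cong_left) auto
    ultimately show ?thesis by (simp add: algebra_simps abs_le_iff)
  qed
  have S2: "(\<Sum>u\<in>?U. 1 / real u * of_bool (adm (u * v1) \<and> adm (u * v2))) \<le> (1 + 3 * \<theta>) * (h * (VR * cc\<^sup>2 * S')) + e"
  proof -
    let ?V = "\<Prod>p\<in>PS. 1 - real (card (roots v1 p \<union> roots v2 p)) / real p"
    \<comment> \<open>Both sets contain the root \<open>0\<close>, so their union has at most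
      \<open>2 * k + 1\<close> elements, the parameter for which \<open>\<theta>\<close> was set
      up.\<close>
    have cU: "card (roots v1 p \<union> roots v2 p) \<le> 2 * k + 1" if "p \<in> PS" for p
    proof -
      have "0 \<in> roots v p" for v using PS_D(6)[OF that] by (auto simp: roots_def intro!: bexI[of _ 0])
      then have "roots v1 p \<union> roots v2 p = roots v1 p \<union> (roots v2 p - {0})" "0 \<in> roots v2 p" by auto
      then have "card (roots v1 p \<union> roots v2 p) \<le> card (roots v1 p) + card (roots v2 p - {0})"
        by (metis card_Un_le)
      then show ?thesis using card_roots[OF that v(1)] card_roots[OF that v(2)] \<open>0 \<in> roots v2 p\<close> by simp
    qed
    have "\<bar>(\<Sum>u | u \<in> {X<..Y} \<and> [u = r] (mod Q) \<and> (\<forall>p\<in>PS. u mod p \<notin> roots v1 p \<union> roots v2 p). 1 / real u) - h * ?V\<bar>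
      \<le> 3 * \<theta> * (h * ?V) + e"
      unfolding h_def e_def using cU by (intro sieve_count X) (auto simp: roots_def)
    then have "(\<Sum>u | u \<in> {X<..Y} \<and> [u = r] (mod Q) \<and> (\<forall>p\<in>PS. u mod p \<notin> roots v1 p \<union> roots v2 p). 1 / real u)
      \<le> (1 + 3 * \<theta>) * (h * ?V) + e" by (simp add: algebra_simps abs_le_iff)
    also have "\<dots> \<le> (1 + 3 * \<theta>) * (h * (VR * cc\<^sup>2 * S')) + e"
      unfolding S'_def using h(1) \<theta> by (intro add_right_mono mult_left_mono pair_product_le v) auto
    also have "(\<Sum>u | u \<in> {X<..Y} \<and> [u = r] (mod Q) \<and> (\<forall>p\<in>PS. u mod p \<notin> roots v1 p \<union> roots v2 p). 1 / real u)
      = (\<Sum>u\<in>?U. 1 / real u * of_bool (adm (u * v1) \<and> adm (u * v2)))"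
    proof -
      have "(\<forall>p\<in>PS. u mod p \<notin> roots v1 p \<union> roots v2 p) \<longleftrightarrow> rough u \<and> adm (u * v1) \<and> adm (u * v2)" for u
        using avoid_roots_iff[OF v(1), of u] avoid_roots_iff[OF v(2), of u] by auto
      then show ?thesis by (intro sum.mono_neutral_cong_left) auto
    qed
    finally show ?thesis .
  qed
  have S'1: "1 \<le> S'" unfolding S'_def by (intro prod_ge_1) auto
  have "(\<Sum>u\<in>?U. 1 / real u * ((of_bool (adm (u * v1)) - cc) * (of_bool (adm (u * v2)) - cc)))
    = (\<Sum>u\<in>?U. 1 / real u * of_bool (adm (u * v1) \<and> adm (u * v2))) - cc * (\<Sum>u\<in>?U. 1 / real u * of_bool (adm (u * v1)))
      - cc * (\<Sum>u\<in>?U. 1 / real u * of_bool (adm (u * v2))) + cc\<^sup>2 * (\<Sum>u\<in>?U. 1 / real u)"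
    unfolding sum_distrib_left sum_subtractf[symmetric] sum.distrib[symmetric]
    by (intro sum.cong refl) (auto simp: algebra_simps power2_eq_square)
  also have "\<dots> \<le> ((1 + 3 * \<theta>) * (h * (VR * cc\<^sup>2 * S')) + e) - cc * ((1 - 3 * \<theta>) * (h * VA) - e) - cc * ((1 - 3 * \<theta>) * (h * VA) - e)
      + cc\<^sup>2 * ((1 + 3 * \<theta>) * (h * VR) + e)"
    using S0 S1[OF v(1)] S1[OF v(2)] S2 cc_bounds(1) by (intro add_mono diff_mono mult_left_mono) auto
  also have "\<dots> = h * VR * cc\<^sup>2 * ((1 + 3 * \<theta>) * (S' - 1) + 12 * \<theta>) + e * (1 + 2 * cc + cc\<^sup>2)"
    unfolding cc_bounds(4) by (simp add: algebra_simps power2_eq_square)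
  also have "\<dots> \<le> 4 * (real m * La) * cc\<^sup>2 * (4 * (S' - 1) + 12 * \<theta>) + e * 4"
  proof (rule add_mono)
    have "(1 + 3 * \<theta>) * (S' - 1) \<le> 4 * (S' - 1)" using S'1 \<theta> by (intro mult_right_mono) auto
    then have i1: "(1 + 3 * \<theta>) * (S' - 1) + 12 * \<theta> \<le> 4 * (S' - 1) + 12 * \<theta>" by simp
    have i2: "0 \<le> (1 + 3 * \<theta>) * (S' - 1) + 12 * \<theta>" using S'1 \<theta> by (intro add_nonneg_nonneg mult_nonneg_nonneg) auto
    have i3: "h * VR * cc\<^sup>2 \<le> 4 * (real m * La) * cc\<^sup>2" using h(2) by (intro mult_right_mono) auto
    have i4: "0 \<le> 4 * (real m * La) * cc\<^sup>2" using La_pos by simp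
    show "h * VR * cc\<^sup>2 * ((1 + 3 * \<theta>) * (S' - 1) + 12 * \<theta>) \<le> 4 * (real m * La) * cc\<^sup>2 * (4 * (S' - 1) + 12 * \<theta>)"
      by (rule mult_mono[OF i3 i1 i4 i2])
    have "cc\<^sup>2 \<le> 1" using cc_bounds by (simp add: power_le_one)
    then have "1 + 2 * cc + cc\<^sup>2 \<le> 4" using cc_bounds(2) by linarith
    then show "e * (1 + 2 * cc + cc\<^sup>2) \<le> e * 4" using e0 by (rule mult_left_mono)
  qed
  also have "\<dots> = 16 * (real m * La) * cc\<^sup>2 * (S' - 1 + 3 * \<theta>) + 4 / real Z ^ 7"
    by (simp add: e_def algebra_simps)
  finally show ?thesis unfolding S'_def .
qed

section \<open>The average of the singular series\<close>

lemma coprime_of_class: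
  assumes "[v = r] (mod Q)" "coprime r Q" shows "coprime v Q"
  using assms cong_imp_coprime[of r v Q] cong_sym by blast

lemma coprime_small:
  assumes "coprime v Q" "i \<in> {1..k}" shows "coprime v i"
proof (rule ccontr)
  assume "\<not> coprime v i"
  then have "gcd v i \<noteq> 1" unfolding coprime_iff_gcd_eq_1 .
  then obtain p where p: "prime p" "p dvd gcd v i" using prime_factor_nat by blast
  then have "p \<le> w" using dvd_imp_le[of p i] assms w by auto
  then have "p dvd Q" using Q_primes[OF p(1)] by simp
  moreover have "p dvd v" using p(2) by simp
  ultimately have "is_unit p" using coprime_common_divisor[OF assms(1), of p] by simp
  then show False using p(1) not_prime_unit by blast
qed

text \<open>Every bad prime divides one of the \<open>k ^ 2\<close> differences
  \<open>j * v1 - i * v2\<close>. None of these is \<open>0\<close>: since \<open>v1\<close> and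
  \<open>v2\<close> are prime to all of \<open>1..k\<close>, an equality would force them to divide
  each other.\<close>

lemma card_bad_le:
  assumes v: "coprime v1 Q" "coprime v2 Q" "v1 \<noteq> v2" "v1 \<in> {Z<..Z ^ (4 * m)}" "v2 \<in> {Z<..Z ^ (4 * m)}"
  shows "real (card (bad v1 v2)) \<le> 10 * (real k)\<^sup>2 * real m * T"
proof -
  let ?I = "{1..k} \<times> {1..k}"
  define x where "x = (\<lambda>(i,j). if i * v2 \<le> j * v1 then j * v1 - i * v2 else i * v2 - j * v1)"
  define B where "B = (\<lambda>(i,j). {p \<in> PS. [i * v2 = j * v1] (mod p)})"
  have each: "real (card (B ij)) \<le> 10 * real m * T" if "ij \<in> ?I" for ij
  proof -
    define i j where "i = fst ij" and "j = snd ij"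
    then have ij: "ij = (i, j)" "i \<in> {1..k}" "j \<in> {1..k}" using that by auto
    have ne: "i * v2 \<noteq> j * v1"
    proof
      assume e: "i * v2 = j * v1"
      have "v2 dvd j * v1" unfolding e[symmetric] by simp
      then have d2: "v2 dvd v1" using coprime_small[OF v(2) ij(3)] by (simp add: coprime_dvd_mult_right_iff)
      have "v1 dvd i * v2" unfolding e by simp
      then have "v1 dvd v2" using coprime_small[OF v(1) ij(2)] by (simp add: coprime_dvd_mult_right_iff)
      then show False using d2 v(3) by (simp add: dvd_antisym)
    qed
    then have xpos: "0 < x ij" unfolding x_def ij(1) by auto
    have "x ij \<le> k * Z ^ (4 * m)"
    proof -
      have "j * v1 \<le> k * Z ^ (4 * m)" "i * v2 \<le> k * Z ^ (4 * m)" using ij v by (auto intro!: mult_mono)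
      then show ?thesis unfolding x_def ij(1) by auto
    qed
    also have "\<dots> \<le> Z * Z ^ (4 * m)" using w Z_ge(3) by (intro mult_right_mono) auto
    also have "\<dots> = Z ^ (4 * m + 1)" by simp
    finally have xle: "x ij \<le> Z ^ (4 * m + 1)" .
    have "real (card (B ij)) \<le> 2 * ln (real (x ij))"
    proof (rule card_primes_dividing_le[OF xpos])
      show "finite (B ij)" by (simp add: B_def ij(1))
      fix p assume p: "p \<in> B ij"
      then have "p \<in> PS" "[i * v2 = j * v1] (mod p)" by (auto simp: B_def ij(1))
      then show "prime p \<and> p dvd x ij"
        using PS_D(1) cong_altdef_nat[of "j * v1" "i * v2" p] cong_altdef_nat[of "i * v2" "j * v1" p]
        unfolding x_def ij(1) by (auto simp: cong_sym_eq)
    qed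
    also have "ln (real (x ij)) \<le> ln (real (Z ^ (4 * m + 1)))"
    proof -
      have "0 < real (x ij)" using xpos by (simp only: of_nat_0_less_iff)
      moreover have "real (x ij) \<le> real (Z ^ (4 * m + 1))" using xle by (simp only: of_nat_le_iff)
      ultimately show ?thesis by (subst ln_le_cancel_iff) linarith+
    qed
    also have "\<dots> = real (4 * m + 1) * T" by (rule ln_Z_power)
    also have "\<dots> \<le> 5 * real m * T" using T_ge m_pos by (intro mult_right_mono) auto
    finally show ?thesis by simp
  qed
  have "bad v1 v2 = (\<Union>ij\<in>?I. B ij)" by (auto simp: bad_def B_def)
  then have "card (bad v1 v2) \<le> (\<Sum>ij\<in>?I. card (B ij))" using card_UN_le[of ?I B] by simp
  then have "real (card (bad v1 v2)) \<le> (\<Sum>ij\<in>?I. real (card (B ij)))" by (metis of_nat_le_iff of_nat_sum)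
  also have "\<dots> \<le> (\<Sum>ij\<in>?I. 10 * real m * T)" by (intro sum_mono each)
  also have "\<dots> = 10 * (real k)\<^sup>2 * real m * T" by (simp add: power2_eq_square)
  finally show ?thesis .
qed

text \<open>The Rankin tail of \<open>prod_one_plus_truncated\<close> with \<open>h = 4 * k\<close>
  and truncation point \<open>Z1\<close>, after inserting \<open>card_bad_le\<close>. The numerator
  is exponential only in the square root of \<open>T\<close>, so the quotient tends to
  \<open>0\<close>.\<close>

definition \<rho>0 :: real where "\<rho>0 = exp (8 * real k * sqrt (10 * (real k)\<^sup>2 * real m * T)) / sqrt (real Z1)"

definition cls :: "nat \<Rightarrow> nat set" where
  "cls r = {v \<in> {Z<..Z ^ (4 * m)}. [v = r] (mod Q) \<and> rough v}"

lemma finite_cls [simp]: "finite (cls r)" by (simp add: cls_def)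

lemma cls_sum: "(\<Sum>v\<in>cls r. 1 / real v) \<le> C1 * (real m * La)"
proof -
  have "cls r = {n. n \<in> {Z<..Z ^ (4 * m)} \<and> [n = r] (mod (Q * \<Prod>{})) \<and> rough n}" by (auto simp: cls_def)
  then show ?thesis using rough_class_sum[of "{}" r] Z1_ge by simp
qed

lemma cls_D: assumes "v \<in> cls r" shows "rough v" "v > 0" "v > Z" "v \<le> Z ^ (4 * m)" "[v = r] (mod Q)"
  using assms by (auto simp: cls_def)

text \<open>At each prime of \<open>D\<close> at most \<open>k ^ 2\<close> classes for
  \<open>v2\<close> are bad. The density \<open>1 / p\<close> of a class and the weight
  \<open>4 * k / p\<close> combine to a convergent \<open>1 / p ^ 2\<close>; the constant is
  \<open>2 * k ^ 2 * 4 * k\<close>, with the \<open>2\<close> from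
  \<open>rough_class_sum\<close>.\<close>

lemma cls_bad_sum:
  assumes D: "D \<subseteq> PS" "real (\<Prod>D) \<le> real Z1"
  shows "(\<Sum>v2 | v2 \<in> cls r \<and> D \<subseteq> bad v1 v2. 1 / real v2) * (\<Prod>p\<in>D. 4 * real k / real p)
    \<le> C1 * (real m * La) * (\<Prod>p\<in>D. 8 * real k ^ 3 / (real p)\<^sup>2)"
proof -
  define \<Omega> where "\<Omega> = (\<lambda>p. {t. t < p \<and> (\<exists>i\<in>{1..k}. \<exists>j\<in>{1..k}. [i * t = j * v1] (mod p))})"
  have finD: "finite D" using D(1) finite_PS finite_subset by blast
  have card\<Omega>: "card (\<Omega> p) \<le> k\<^sup>2" if "p \<in> PS" for p
  proof -
    have "\<Omega> p = (\<Union>ij\<in>{1..k} \<times> {1..k}. {t. t < p \<and> [fst ij * t = snd ij * v1] (mod p)})"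
    proof (intro equalityI subsetI)
      fix t assume "t \<in> \<Omega> p"
      then obtain i j where "i \<in> {1..k}" "j \<in> {1..k}" "t < p" "[i * t = j * v1] (mod p)" unfolding \<Omega>_def by blast
      then show "t \<in> (\<Union>ij\<in>{1..k} \<times> {1..k}. {t. t < p \<and> [fst ij * t = snd ij * v1] (mod p)})"
        by (intro UN_I[of "(i, j)"]) auto
    next
      fix t assume "t \<in> (\<Union>ij\<in>{1..k} \<times> {1..k}. {t. t < p \<and> [fst ij * t = snd ij * v1] (mod p)})"
      then obtain i j where "i \<in> {1..k}" "j \<in> {1..k}" "t < p" "[i * t = j * v1] (mod p)" by force
      then show "t \<in> \<Omega> p" unfolding \<Omega>_def by blast
    qed
    then have "card (\<Omega> p) \<le> (\<Sum>ij\<in>{1..k} \<times> {1..k}. card {t. t < p \<and> [fst ij * t = snd ij * v1] (mod p)})"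
      using card_UN_le[of "{1..k} \<times> {1..k}" "\<lambda>ij. {t. t < p \<and> [fst ij * t = snd ij * v1] (mod p)}"] by simp
    also have "\<dots> \<le> (\<Sum>ij\<in>{1..k} \<times> {1..k}. 1)"
      using PS_D(1,4)[OF that] by (intro sum_mono card_scaled_roots_le) auto
    finally show ?thesis by (simp add: power2_eq_square)
  qed
  have set_eq: "{v2. v2 \<in> cls r \<and> D \<subseteq> bad v1 v2} = {n. n \<in> {n\<in>{Z<..Z ^ (4 * m)}. rough n} \<and> [n = r] (mod Q) \<and> (\<forall>p\<in>D. n mod p \<in> \<Omega> p)}"
  proof -
    have "p \<in> bad v1 n \<longleftrightarrow> n mod p \<in> \<Omega> p" if "p \<in> D" for p n
    proof -
      have pP: "p \<in> PS" using that D by auto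
      have "[i * (n mod p) = i * n] (mod p)" for i by (intro cong_mult) (auto simp: Cong.cong_def)
      then have "[i * (n mod p) = j * v1] (mod p) \<longleftrightarrow> [i * n = j * v1] (mod p)" for i j
        by (simp add: Cong.cong_def)
      then show ?thesis using pP PS_D(6)[OF pP] by (auto simp: bad_def \<Omega>_def)
    qed
    then show ?thesis by (auto simp: cls_def)
  qed
  have "(\<Sum>v2 | v2 \<in> cls r \<and> D \<subseteq> bad v1 v2. 1 / real v2)
    \<le> C1 * 2 ^ card D * (real m * La) / real (\<Prod>D) * (\<Prod>p\<in>D. real (card (\<Omega> p)))"
    unfolding set_eq
  proof (rule residue_conditions_le[OF finD])
    fix p assume "p \<in> D"
    then have "p \<in> PS" using D by auto
    then show "prime p \<and> \<Omega> p \<subseteq> {..<p} \<and> coprime p Q" using PS_D by (auto simp: \<Omega>_def)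
  next
    fix r
    have "{n. n \<in> {n\<in>{Z<..Z ^ (4 * m)}. rough n} \<and> [n = r] (mod (Q * \<Prod>D))} = {n. n \<in> {Z<..Z ^ (4 * m)} \<and> [n = r] (mod (Q * \<Prod>D)) \<and> rough n}" by auto
    then show "(\<Sum>n | n \<in> {n\<in>{Z<..Z ^ (4 * m)}. rough n} \<and> [n = r] (mod (Q * \<Prod>D)). 1 / real n) \<le> C1 * 2 ^ card D * (real m * La) / real (\<Prod>D)"
      using rough_class_sum[OF D(1), of r] D(2) by simp
  qed auto
  also have "\<dots> \<le> C1 * 2 ^ card D * (real m * La) / real (\<Prod>D) * (\<Prod>p\<in>D. (real k)\<^sup>2)"
  proof (intro mult_left_mono prod_mono conjI)
    fix p assume "p \<in> D"
    then have "card (\<Omega> p) \<le> k\<^sup>2" using D card\<Omega> by auto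
    then show "real (card (\<Omega> p)) \<le> (real k)\<^sup>2" by (metis of_nat_le_iff of_nat_power)
  next
    show "0 \<le> C1 * 2 ^ card D * (real m * La) / real (\<Prod>D)"
      using La_pos C1_ge by (intro divide_nonneg_nonneg mult_nonneg_nonneg) (auto intro: prod_nonneg)
  qed auto
  finally have "(\<Sum>v2 | v2 \<in> cls r \<and> D \<subseteq> bad v1 v2. 1 / real v2) * (\<Prod>p\<in>D. 4 * real k / real p)
    \<le> (C1 * 2 ^ card D * (real m * La) / real (\<Prod>D) * (\<Prod>p\<in>D. (real k)\<^sup>2)) * (\<Prod>p\<in>D. 4 * real k / real p)"
    by (intro mult_right_mono prod_nonneg) auto
  also have "\<dots> = C1 * (real m * La) * ((\<Prod>p\<in>D. 2) * (1 / (\<Prod>p\<in>D. real p)) * (\<Prod>p\<in>D. (real k)\<^sup>2) * (\<Prod>p\<in>D. 4 * real k / real p))"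
    by simp
  also have "1 / (\<Prod>p\<in>D. real p) = (\<Prod>p\<in>D. 1 / real p)" by (simp add: prod_dividef)
  also have "(\<Prod>p\<in>D. 2) * (\<Prod>p\<in>D. 1 / real p) * (\<Prod>p\<in>D. (real k)\<^sup>2) * (\<Prod>p\<in>D. 4 * real k / real p)
    = (\<Prod>p\<in>D. 2 * (1 / real p) * (real k)\<^sup>2 * (4 * real k / real p))" by (simp only: prod.distrib)
  also have "\<dots> = (\<Prod>p\<in>D. 8 * real k ^ 3 / (real p)\<^sup>2)"
    by (intro prod.cong refl) (simp add: power2_eq_square power3_eq_cube)
  finally show ?thesis .
qed

text \<open>For fixed \<open>v1\<close> the product over \<open>bad v1 v2\<close> is expanded over
  subsets. Those with product up to \<open>Z1\<close> are averaged over \<open>v2\<close> and sum to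
  an Euler product of \<open>1 + 8 * k ^ 3 / p ^ 2\<close> over primes above \<open>w\<close>, which
  is close to \<open>1\<close>; the others are covered by \<open>\<rho>0\<close>.\<close>

lemma singular_average:
  assumes r: "coprime r Q"
  shows "(\<Sum>v1\<in>cls r. \<Sum>v2\<in>cls r - {v1}. 1 / real v1 * (1 / real v2) * ((\<Prod>p\<in>bad v1 v2. 1 + 4 * real k / real p) - 1))
    \<le> (C1 * (real m * La))\<^sup>2 * (exp (8 * real k ^ 3 / real w) - 1 + \<rho>0)"
proof -
  define \<D> where "\<D> = {D. D \<subseteq> PS \<and> D \<noteq> {} \<and> real (\<Prod>D) \<le> real Z1}"
  have fin\<D>: "finite \<D>" by (auto simp: \<D>_def intro: finite_subset[of _ "Pow PS"])
  have nn: "0 \<le> (\<Prod>p\<in>D. 4 * real k / real p)" for D :: "nat set" by (intro prod_nonneg) auto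
  have \<rho>0: "0 \<le> \<rho>0" by (simp add: \<rho>0_def)
  have pt: "(\<Prod>p\<in>bad v1 v2. 1 + 4 * real k / real p) - 1 \<le> (\<Sum>D | D \<in> \<D> \<and> D \<subseteq> bad v1 v2. \<Prod>p\<in>D. 4 * real k / real p) + \<rho>0"
    if v: "v1 \<in> cls r" "v2 \<in> cls r" "v1 \<noteq> v2" for v1 v2
  proof -
    have fb: "finite (bad v1 v2)" by (simp add: bad_def)
    have "(\<Prod>p\<in>bad v1 v2. 1 + 4 * real k / real p) \<le> 1 + (\<Sum>D | D \<subseteq> bad v1 v2 \<and> D \<noteq> {} \<and> real (\<Prod>D) \<le> real Z1. \<Prod>p\<in>D. 4 * real k / real p)
      + exp (2 * (4 * real k) * sqrt (real (card (bad v1 v2)))) / sqrt (real Z1)"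
      using Z1_ge PS_D(6) by (intro prod_one_plus_truncated fb) (auto simp: bad_def Suc_le_eq)
    moreover have "exp (2 * (4 * real k) * sqrt (real (card (bad v1 v2)))) / sqrt (real Z1) \<le> \<rho>0"
    proof -
      have "real (card (bad v1 v2)) \<le> 10 * (real k)\<^sup>2 * real m * T"
        using cls_D[OF v(1)] cls_D[OF v(2)] v(3) coprime_of_class[OF _ r] by (intro card_bad_le) auto
      then have "2 * (4 * real k) * sqrt (real (card (bad v1 v2))) \<le> 8 * real k * sqrt (10 * (real k)\<^sup>2 * real m * T)"
        by (simp add: mult_left_mono)
      then show ?thesis unfolding \<rho>0_def by (intro divide_right_mono) auto
    qed
    moreover have "{D. D \<subseteq> bad v1 v2 \<and> D \<noteq> {} \<and> real (\<Prod>D) \<le> real Z1} = {D. D \<in> \<D> \<and> D \<subseteq> bad v1 v2}"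
      by (auto simp: \<D>_def bad_def)
    ultimately show ?thesis by simp
  qed
  have inner: "(\<Sum>v2\<in>cls r - {v1}. 1 / real v2 * ((\<Prod>p\<in>bad v1 v2. 1 + 4 * real k / real p) - 1))
    \<le> C1 * (real m * La) * (exp (8 * real k ^ 3 / real w) - 1 + \<rho>0)" if v1: "v1 \<in> cls r" for v1
  proof -
    have "(\<Sum>v2\<in>cls r - {v1}. 1 / real v2 * ((\<Prod>p\<in>bad v1 v2. 1 + 4 * real k / real p) - 1))
      \<le> (\<Sum>v2\<in>cls r - {v1}. 1 / real v2 * ((\<Sum>D | D \<in> \<D> \<and> D \<subseteq> bad v1 v2. \<Prod>p\<in>D. 4 * real k / real p) + \<rho>0))"
      using pt[OF v1] by (intro sum_mono mult_left_mono) auto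
    also have "\<dots> \<le> (\<Sum>v2\<in>cls r. 1 / real v2 * ((\<Sum>D | D \<in> \<D> \<and> D \<subseteq> bad v1 v2. \<Prod>p\<in>D. 4 * real k / real p) + \<rho>0))"
      using nn \<rho>0 by (intro sum_mono2 mult_nonneg_nonneg add_nonneg_nonneg sum_nonneg) auto
    also have "\<dots> = (\<Sum>v2\<in>cls r. \<Sum>D\<in>\<D>. if D \<subseteq> bad v1 v2 then 1 / real v2 * (\<Prod>p\<in>D. 4 * real k / real p) else 0) + (\<Sum>v2\<in>cls r. 1 / real v2) * \<rho>0"
    proof -
      have "(\<Sum>D | D \<in> \<D> \<and> D \<subseteq> bad v1 v2. \<Prod>p\<in>D. 4 * real k / real p) = (\<Sum>D\<in>\<D>. if D \<subseteq> bad v1 v2 then (\<Prod>p\<in>D. 4 * real k / real p) else 0)" for v2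
        using fin\<D> by (intro sum.mono_neutral_cong_left) auto
      then show ?thesis
        by (simp add: distrib_left sum.distrib sum_distrib_left sum_distrib_right if_distrib cong: if_cong)
    qed
    also have "(\<Sum>v2\<in>cls r. \<Sum>D\<in>\<D>. if D \<subseteq> bad v1 v2 then 1 / real v2 * (\<Prod>p\<in>D. 4 * real k / real p) else 0)
      = (\<Sum>D\<in>\<D>. (\<Sum>v2 | v2 \<in> cls r \<and> D \<subseteq> bad v1 v2. 1 / real v2) * (\<Prod>p\<in>D. 4 * real k / real p))"
      unfolding sum_distrib_right
      by (subst sum.swap) (intro sum.cong refl sum.mono_neutral_cong_right; auto)
    also have "\<dots> \<le> (\<Sum>D\<in>\<D>. C1 * (real m * La) * (\<Prod>p\<in>D. 8 * real k ^ 3 / (real p)\<^sup>2))"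
      by (intro sum_mono cls_bad_sum) (auto simp: \<D>_def)
    also have "\<dots> = C1 * (real m * La) * (\<Sum>D\<in>\<D>. \<Prod>p\<in>D. 8 * real k ^ 3 / (real p)\<^sup>2)" by (simp add: sum_distrib_left)
    also have "(\<Sum>D\<in>\<D>. \<Prod>p\<in>D. 8 * real k ^ 3 / (real p)\<^sup>2) \<le> exp (8 * real k ^ 3 / real w) - 1"
    proof -
      have "(\<Sum>D\<in>\<D>. \<Prod>p\<in>D. 8 * real k ^ 3 / (real p)\<^sup>2) \<le> (\<Sum>D\<in>Pow PS - {{}}. \<Prod>p\<in>D. 8 * real k ^ 3 / (real p)\<^sup>2)"
        by (intro sum_mono2 prod_nonneg) (auto simp: \<D>_def)
      also have "\<dots> = (\<Prod>p\<in>PS. 1 + 8 * real k ^ 3 / (real p)\<^sup>2) - 1"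
        by (simp add: prod_one_plus_eq_sum_subsets sum_diff1)
      also have "(\<Prod>p\<in>PS. 1 + 8 * real k ^ 3 / (real p)\<^sup>2) \<le> (\<Prod>p\<in>PS. exp (8 * real k ^ 3 / (real p)\<^sup>2))"
        by (intro prod_mono) (auto intro: add_nonneg_nonneg)
      also have "\<dots> = exp (8 * real k ^ 3 * (\<Sum>p\<in>PS. 1 / (real p)\<^sup>2))" by (simp add: exp_sum sum_distrib_left)
      also have "\<dots> \<le> exp (8 * real k ^ 3 * (1 / real w))"
      proof -
        have "(\<Sum>p\<in>PS. 1 / (real p)\<^sup>2) \<le> (\<Sum>p\<in>{w<..Z}. 1 / (real p)\<^sup>2)"
          by (intro sum_mono2) (auto simp: PS_def primes_in_def)
        also have "\<dots> \<le> 1 / real w" using w_ge by (intro sum_recip_squares_le) auto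
        finally have "(\<Sum>p\<in>PS. 1 / (real p)\<^sup>2) \<le> 1 / real w" .
        then show ?thesis by (intro iffD2[OF exp_le_cancel_iff] mult_left_mono) auto
      qed
      finally show ?thesis by simp
    qed
    also have "(\<Sum>v2\<in>cls r. 1 / real v2) * \<rho>0 \<le> C1 * (real m * La) * \<rho>0"
      using \<rho>0 by (intro mult_right_mono cls_sum)
    finally show ?thesis using La_pos C1_ge by (simp add: distrib_left mult_left_mono)
  qed
  have X0: "0 \<le> exp (8 * real k ^ 3 / real w) - 1 + \<rho>0" using \<rho>0 by simp
  have "(\<Sum>v1\<in>cls r. \<Sum>v2\<in>cls r - {v1}. 1 / real v1 * (1 / real v2) * ((\<Prod>p\<in>bad v1 v2. 1 + 4 * real k / real p) - 1))
    = (\<Sum>v1\<in>cls r. 1 / real v1 * (\<Sum>v2\<in>cls r - {v1}. 1 / real v2 * ((\<Prod>p\<in>bad v1 v2. 1 + 4 * real k / real p) - 1)))"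
    by (simp only: sum_distrib_left mult.assoc)
  also have "\<dots> \<le> (\<Sum>v1\<in>cls r. 1 / real v1 * (C1 * (real m * La) * (exp (8 * real k ^ 3 / real w) - 1 + \<rho>0)))"
    using inner by (intro sum_mono mult_left_mono) auto
  also have "\<dots> = (\<Sum>v1\<in>cls r. 1 / real v1) * (C1 * (real m * La) * (exp (8 * real k ^ 3 / real w) - 1 + \<rho>0))"
    by (simp only: sum_distrib_right)
  also have "\<dots> \<le> (C1 * (real m * La)) * (C1 * (real m * La) * (exp (8 * real k ^ 3 / real w) - 1 + \<rho>0))"
    using X0 La_pos C1_ge by (intro mult_right_mono cls_sum mult_nonneg_nonneg) auto
  also have "\<dots> = (C1 * (real m * La))\<^sup>2 * (exp (8 * real k ^ 3 / real w) - 1 + \<rho>0)" by (simp add: power2_eq_square)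
  finally show ?thesis .
qed

section \<open>The variance estimate for bilinear sums\<close>

text \<open>The relative size of the variance: excess of the singular series, Rankin tail and sieve
  error. The parameter \<open>\<sigma>\<close> stands for the contribution of the diagonal pairs and
  of the sieve remainders, which save a power of \<open>Z\<close>.\<close>

definition err :: "real \<Rightarrow> real" where
  "err \<sigma> = exp (8 * real k ^ 3 / real w) - 1 + \<rho>0 + 3 * \<theta> + \<sigma>"

lemma interval_recip_le: "(\<Sum>u\<in>{Z ^ m<..Z ^ (4 * m)}. 1 / real u) \<le> 4 * real m * T"
proof -
  have "Z ^ m \<le> Z ^ (4 * m)" using Z_ge by (intro power_increasing) auto
  then have "(\<Sum>u\<in>{Z ^ m<..Z ^ (4 * m)}. 1 / real u) \<le> ln (real (Z ^ (4 * m))) - ln (real (Z ^ m))"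
    using Z_ge by (intro sum_recip_interval_le) auto
  also have "\<dots> \<le> 4 * real m * T" using T_ge unfolding ln_Z_power by simp
  finally show ?thesis .
qed

lemma cls_recip_le: "(\<Sum>v\<in>cls r. 1 / real v) \<le> 4 * real m * T"
proof -
  have "(\<Sum>v\<in>cls r. 1 / real v) \<le> (\<Sum>v\<in>{Z<..Z ^ (4 * m)}. 1 / real v)"
    by (intro sum_mono2) (auto simp: cls_def)
  also have "\<dots> \<le> ln (real (Z ^ (4 * m))) - ln (real Z)"
  proof -
    have "Z ^ 1 \<le> Z ^ (4 * m)" using Z_ge m_pos by (intro power_increasing) auto
    then show ?thesis using Z_ge by (intro sum_recip_interval_le) auto
  qed
  also have "\<dots> \<le> 4 * real m * T" using T_ge unfolding ln_Z_power T_def[symmetric] by simp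
  finally show ?thesis .
qed

lemma cls_recip_sq_le: "(\<Sum>v\<in>cls r. 1 / (real v)\<^sup>2) \<le> 1 / real Z"
proof -
  have "(\<Sum>v\<in>cls r. 1 / (real v)\<^sup>2) \<le> (\<Sum>v\<in>{Z<..Z ^ (4 * m)}. 1 / (real v)\<^sup>2)"
    by (intro sum_mono2) (auto simp: cls_def)
  also have "\<dots> \<le> 1 / real Z" using Z_ge by (intro sum_recip_squares_le) auto
  finally show ?thesis .
qed

text \<open>The dispersion step: Cauchy--Schwarz over the long variable \<open>u\<close>, expanding the square over \<open>v\<close>.\<close>
lemma type_two:
  fixes \<alpha> \<beta> :: "nat \<Rightarrow> real"
  assumes r: "coprime r Q" and \<alpha>: "\<And>u. \<bar>\<alpha> u\<bar> \<le> 1" and \<beta>: "\<And>v. 0 \<le> \<beta> v" "\<And>v. \<beta> v \<le> 1"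
    and \<sigma>: "4 / real Z ^ 7 * (4 * real m * T)\<^sup>2 + 4 * real m * T / real Z \<le> 16 * C1\<^sup>2 * (real m * La) ^ 3 * cc\<^sup>2 * \<sigma>"
  shows "\<bar>\<Sum>u | u \<in> cls s \<and> Z ^ m < u. \<Sum>v | v \<in> cls r \<and> Z ^ (2 * m) < u * v \<and> u * v \<le> Z ^ (4 * m).
      \<alpha> u * \<beta> v / (real u * real v) * (of_bool (adm (u * v)) - cc)\<bar> \<le> 4 * C1\<^sup>2 * (real m * La)\<^sup>2 * cc * sqrt (err \<sigma>)"
proof -
  define U where "U = {u. u \<in> cls s \<and> Z ^ m < u}"
  define in_range where "in_range = (\<lambda>u v. Z ^ (2 * m) < u * v \<and> u * v \<le> Z ^ (4 * m))"
  \<comment> \<open>The cut-off is built into \<open>f\<close>, so that \<open>v\<close> runs over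
    all of \<open>cls r\<close> independently of \<open>u\<close> and the square can be
    expanded.\<close>
  define f where "f = (\<lambda>u v. of_bool (in_range u v) * (of_bool (adm (u * v)) - cc))"
  define G where "G = (\<lambda>u. \<Sum>v\<in>cls r. \<beta> v / real v * f u v)"
  have finU: "finite U" by (simp add: U_def)
  have Upos: "real u > 0" if "u \<in> U" for u using that cls_D(2)[of u s] by (simp add: U_def)
  have fabs: "\<bar>f u v\<bar> \<le> 1" for u v using cc_bounds by (auto simp: f_def)
  have lhs: "(\<Sum>u\<in>U. \<Sum>v | v \<in> cls r \<and> Z ^ (2 * m) < u * v \<and> u * v \<le> Z ^ (4 * m).
      \<alpha> u * \<beta> v / (real u * real v) * (of_bool (adm (u * v)) - cc)) = (\<Sum>u\<in>U. (\<alpha> u / sqrt (real u)) * (G u / sqrt (real u)))"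
  proof (rule sum.cong)
    fix u assume u: "u \<in> U"
    have "(\<Sum>v | v \<in> cls r \<and> Z ^ (2 * m) < u * v \<and> u * v \<le> Z ^ (4 * m). \<alpha> u * \<beta> v / (real u * real v) * (of_bool (adm (u * v)) - cc))
      = (\<Sum>v\<in>cls r. \<alpha> u / real u * (\<beta> v / real v * f u v))"
      by (intro sum.mono_neutral_cong_left) (auto simp: f_def in_range_def)
    also have "\<dots> = \<alpha> u / real u * G u" by (simp only: G_def sum_distrib_left)
    also have "\<alpha> u / real u = \<alpha> u / sqrt (real u) / sqrt (real u)" by simp
    finally show "(\<Sum>v | v \<in> cls r \<and> Z ^ (2 * m) < u * v \<and> u * v \<le> Z ^ (4 * m). \<alpha> u * \<beta> v / (real u * real v) * (of_bool (adm (u * v)) - cc))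
      = (\<alpha> u / sqrt (real u)) * (G u / sqrt (real u))" by simp
  qed simp
  have cs: "(\<Sum>u\<in>U. (\<alpha> u / sqrt (real u)) * (G u / sqrt (real u)))\<^sup>2 \<le> (\<Sum>u\<in>U. (\<alpha> u / sqrt (real u))\<^sup>2) * (\<Sum>u\<in>U. (G u / sqrt (real u))\<^sup>2)"
    by (rule Cauchy_Schwarz_ineq_sum)
  have A: "(\<Sum>u\<in>U. (\<alpha> u / sqrt (real u))\<^sup>2) \<le> C1 * (real m * La)"
  proof -
    have "(\<Sum>u\<in>U. (\<alpha> u / sqrt (real u))\<^sup>2) \<le> (\<Sum>u\<in>U. 1 / real u)"
    proof (rule sum_mono)
      fix u assume "u \<in> U"
      have "(\<alpha> u)\<^sup>2 \<le> 1" using \<alpha>[of u] by (simp add: abs_square_le_1)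
      then show "(\<alpha> u / sqrt (real u))\<^sup>2 \<le> 1 / real u" by (simp add: power_divide divide_right_mono)
    qed
    also have "\<dots> \<le> (\<Sum>u\<in>cls s. 1 / real u)" by (intro sum_mono2) (auto simp: U_def)
    also have "\<dots> \<le> C1 * (real m * La)" by (rule cls_sum)
    finally show ?thesis .
  qed
  define E where "E = (\<lambda>v1 v2. \<Sum>u\<in>U. 1 / real u * (f u v1 * f u v2))"
  have Fexp: "(\<Sum>u\<in>U. (G u / sqrt (real u))\<^sup>2) = (\<Sum>v1\<in>cls r. \<Sum>v2\<in>cls r. \<beta> v1 * \<beta> v2 * (1 / real v1 * (1 / real v2)) * E v1 v2)"
  proof -
    have "(G u / sqrt (real u))\<^sup>2 = (\<Sum>v1\<in>cls r. \<Sum>v2\<in>cls r. \<beta> v1 * \<beta> v2 * (1 / real v1 * (1 / real v2)) * (1 / real u * (f u v1 * f u v2)))" for u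
    proof -
      have "(G u / sqrt (real u))\<^sup>2 = 1 / real u * (G u * G u)" by (simp add: power_divide power2_eq_square)
      also have "G u * G u = (\<Sum>v1\<in>cls r. \<Sum>v2\<in>cls r. (\<beta> v1 / real v1 * f u v1) * (\<beta> v2 / real v2 * f u v2))"
        by (simp only: G_def sum_product)
      also have "1 / real u * \<dots> = (\<Sum>v1\<in>cls r. \<Sum>v2\<in>cls r. \<beta> v1 * \<beta> v2 * (1 / real v1 * (1 / real v2)) * (1 / real u * (f u v1 * f u v2)))"
        unfolding sum_distrib_left by (intro sum.cong refl) (simp add: mult_ac)
      finally show ?thesis .
    qed
    then have "(\<Sum>u\<in>U. (G u / sqrt (real u))\<^sup>2) = (\<Sum>u\<in>U. \<Sum>v1\<in>cls r. \<Sum>v2\<in>cls r. \<beta> v1 * \<beta> v2 * (1 / real v1 * (1 / real v2)) * (1 / real u * (f u v1 * f u v2)))"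
      by simp
    also have "\<dots> = (\<Sum>v1\<in>cls r. \<Sum>u\<in>U. \<Sum>v2\<in>cls r. \<beta> v1 * \<beta> v2 * (1 / real v1 * (1 / real v2)) * (1 / real u * (f u v1 * f u v2)))"
      by (rule sum.swap)
    also have "\<dots> = (\<Sum>v1\<in>cls r. \<Sum>v2\<in>cls r. \<Sum>u\<in>U. \<beta> v1 * \<beta> v2 * (1 / real v1 * (1 / real v2)) * (1 / real u * (f u v1 * f u v2)))"
      by (intro sum.cong refl sum.swap)
    finally show ?thesis by (simp only: E_def sum_distrib_left)
  qed
  define M where "M = 16 * (real m * La) * cc\<^sup>2"
  have M0: "0 \<le> M" using La_pos by (simp add: M_def)
  have S1: "0 \<le> (\<Prod>p\<in>bad v1 v2. 1 + 4 * real k / real p) - 1" for v1 v2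
    using prod_ge_1[of "bad v1 v2" "\<lambda>p. 1 + 4 * real k / real p"] by auto
  have Eoff: "E v1 v2 \<le> M * ((\<Prod>p\<in>bad v1 v2. 1 + 4 * real k / real p) - 1) + (M * (3 * \<theta>) + 4 / real Z ^ 7)"
    if v: "v1 \<in> cls r" "v2 \<in> cls r" for v1 v2
  proof -
    \<comment> \<open>For a fixed pair the conditions on both products confine \<open>u\<close> to
      an interval, to which the sieve applies.\<close>
    define X1 where "X1 = max (Z ^ m) (max (Z ^ (2 * m) div v1) (Z ^ (2 * m) div v2))"
    define Y1 where "Y1 = min (Z ^ (4 * m)) (min (Z ^ (4 * m) div v1) (Z ^ (4 * m) div v2))"
    have vp: "v1 > 0" "v2 > 0" using v cls_D by auto
    have lt: "N div v < u \<longleftrightarrow> N < u * v" and le: "u \<le> N div v \<longleftrightarrow> u * v \<le> N" if "v > 0" for N u v :: nat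
      using that by (simp_all add: div_less_iff_less_mult less_eq_div_iff_mult_less_eq)
    have ZZ: "Z \<le> Z ^ m" using power_increasing[of 1 m Z] Z_ge m_pos by simp
    have "{u. u \<in> U \<and> in_range u v1 \<and> in_range u v2} = {u. u \<in> {X1<..Y1} \<and> [u = s] (mod Q) \<and> rough u}"
      using ZZ by (auto simp: U_def cls_def in_range_def X1_def Y1_def lt[OF vp(1)] lt[OF vp(2)] le[OF vp(1)] le[OF vp(2)])
    then have "E v1 v2 = (\<Sum>u | u \<in> {X1<..Y1} \<and> [u = s] (mod Q) \<and> rough u. 1 / real u * ((of_bool (adm (u * v1)) - cc) * (of_bool (adm (u * v2)) - cc)))"
      unfolding E_def using finU by (intro sum.mono_neutral_cong_right) (auto simp: f_def)
    also have "\<dots> \<le> 16 * (real m * La) * cc\<^sup>2 * ((\<Prod>p\<in>bad v1 v2. 1 + 4 * real k / real p) - 1 + 3 * \<theta>) + 4 / real Z ^ 7"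
      using v cls_D(1) by (intro pair_correlation) (auto simp: X1_def Y1_def)
    finally show ?thesis unfolding M_def by (simp only: distrib_left add.assoc)
  qed
  \<comment> \<open>For \<open>v1 = v2\<close> there is no cancellation. The trivial bound suffices,
    as the sum of \<open>1 / v ^ 2\<close> over \<open>v > Z\<close> saves a factor
    \<open>Z\<close>.\<close>
  have Ediag: "E v v \<le> 4 * real m * T" for v
  proof -
    have "E v v \<le> (\<Sum>u\<in>U. 1 / real u)"
      unfolding E_def
    proof (rule sum_mono)
      fix u
      have "f u v * f u v \<le> 1" using fabs[of u v] by (simp add: abs_square_le_1 flip: power2_eq_square)
      then show "1 / real u * (f u v * f u v) \<le> 1 / real u" by (simp add: divide_right_mono)
    qed
    also have "\<dots> \<le> (\<Sum>u\<in>{Z ^ m<..Z ^ (4 * m)}. 1 / real u)" by (intro sum_mono2) (auto simp: U_def cls_def)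
    also have "\<dots> \<le> 4 * real m * T" by (rule interval_recip_le)
    finally show ?thesis .
  qed
  have bb: "0 \<le> \<beta> v1 * \<beta> v2" "\<beta> v1 * \<beta> v2 \<le> 1" for v1 v2
    using \<beta> by (auto intro: mult_le_one)
  \<comment> \<open>Here the nonnegativity of \<open>\<beta>\<close> is used: for \<open>E\<close>
    only upper bounds are known, so the coefficients may be replaced by \<open>1\<close> only if
    they do not change sign.\<close>
  have scale: "\<beta> v1 * \<beta> v2 * (1 / real v1 * (1 / real v2)) * e \<le> 1 / real v1 * (1 / real v2) * e'"
    if "e \<le> e'" "0 \<le> e'" for v1 v2 e e'
  proof -
    have "\<beta> v1 * \<beta> v2 * e \<le> \<beta> v1 * \<beta> v2 * e'" using that bb by (intro mult_left_mono) auto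
    also have "\<dots> \<le> 1 * e'" using that bb by (intro mult_right_mono) auto
    finally have "(1 / real v1 * (1 / real v2)) * (\<beta> v1 * \<beta> v2 * e) \<le> (1 / real v1 * (1 / real v2)) * (1 * e')"
      by (intro mult_left_mono) auto
    then show ?thesis by (simp only: mult_ac mult_1)
  qed
  define X0 where "X0 = exp (8 * real k ^ 3 / real w) - 1 + \<rho>0"
  define c7 where "c7 = M * (3 * \<theta>) + 4 / real Z ^ 7"
  have c70: "0 \<le> c7" using M0 \<theta> by (simp add: c7_def)
  have F: "(\<Sum>u\<in>U. (G u / sqrt (real u))\<^sup>2) \<le> 16 * C1\<^sup>2 * (real m * La) ^ 3 * cc\<^sup>2 * err \<sigma>"
  proof -
    have "(\<Sum>v2\<in>cls r. \<beta> v1 * \<beta> v2 * (1 / real v1 * (1 / real v2)) * E v1 v2)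
      \<le> 1 / (real v1)\<^sup>2 * (4 * real m * T) + (\<Sum>v2\<in>cls r - {v1}. 1 / real v1 * (1 / real v2) * (M * ((\<Prod>p\<in>bad v1 v2. 1 + 4 * real k / real p) - 1) + c7))"
      if v1: "v1 \<in> cls r" for v1
    proof -
      have "(\<Sum>v2\<in>cls r. \<beta> v1 * \<beta> v2 * (1 / real v1 * (1 / real v2)) * E v1 v2)
        = \<beta> v1 * \<beta> v1 * (1 / real v1 * (1 / real v1)) * E v1 v1 + (\<Sum>v2\<in>cls r - {v1}. \<beta> v1 * \<beta> v2 * (1 / real v1 * (1 / real v2)) * E v1 v2)"
        using v1 by (simp add: sum.remove)
      also have "\<dots> \<le> 1 / real v1 * (1 / real v1) * (4 * real m * T) + (\<Sum>v2\<in>cls r - {v1}. 1 / real v1 * (1 / real v2) * (M * ((\<Prod>p\<in>bad v1 v2. 1 + 4 * real k / real p) - 1) + c7))"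
        using v1 T_ge M0 S1 c70 Ediag Eoff
        by (intro add_mono sum_mono scale) (auto simp: c7_def intro!: add_nonneg_nonneg mult_nonneg_nonneg)
      finally show ?thesis by (simp add: power2_eq_square)
    qed
    then have "(\<Sum>u\<in>U. (G u / sqrt (real u))\<^sup>2) \<le> (\<Sum>v1\<in>cls r. 1 / (real v1)\<^sup>2 * (4 * real m * T) + (\<Sum>v2\<in>cls r - {v1}. 1 / real v1 * (1 / real v2) * (M * ((\<Prod>p\<in>bad v1 v2. 1 + 4 * real k / real p) - 1) + c7)))"
      unfolding Fexp by (intro sum_mono)
    also have "\<dots> = (\<Sum>v1\<in>cls r. 1 / (real v1)\<^sup>2) * (4 * real m * T)
       + M * (\<Sum>v1\<in>cls r. \<Sum>v2\<in>cls r - {v1}. 1 / real v1 * (1 / real v2) * ((\<Prod>p\<in>bad v1 v2. 1 + 4 * real k / real p) - 1))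
       + (\<Sum>v1\<in>cls r. \<Sum>v2\<in>cls r - {v1}. 1 / real v1 * (1 / real v2)) * c7"
      unfolding sum_distrib_left sum_distrib_right sum.distrib[symmetric]
      by (intro sum.cong refl) (simp add: distrib_left sum.distrib mult_ac add_ac)
    also have "\<dots> \<le> 1 / real Z * (4 * real m * T) + M * ((C1 * (real m * La))\<^sup>2 * X0)
       + (M * (3 * \<theta>) * (C1 * (real m * La))\<^sup>2 + 4 / real Z ^ 7 * (4 * real m * T)\<^sup>2)"
    proof (intro add_mono mult_right_mono mult_left_mono)
      show "(\<Sum>v1\<in>cls r. 1 / (real v1)\<^sup>2) \<le> 1 / real Z" by (rule cls_recip_sq_le)
      show "(\<Sum>v1\<in>cls r. \<Sum>v2\<in>cls r - {v1}. 1 / real v1 * (1 / real v2) * ((\<Prod>p\<in>bad v1 v2. 1 + 4 * real k / real p) - 1))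
        \<le> (C1 * (real m * La))\<^sup>2 * X0" unfolding X0_def by (rule singular_average[OF r])
      let ?D = "\<Sum>v1\<in>cls r. \<Sum>v2\<in>cls r - {v1}. 1 / real v1 * (1 / real v2)"
      have D0: "?D \<le> (\<Sum>v1\<in>cls r. 1 / real v1) * (\<Sum>v1\<in>cls r. 1 / real v1)"
        unfolding sum_product by (intro sum_mono sum_mono2) auto
      have nn: "0 \<le> (\<Sum>v1\<in>cls r. 1 / real v1)" by (intro sum_nonneg) auto
      have D1: "?D \<le> (C1 * (real m * La))\<^sup>2" "?D \<le> (4 * real m * T)\<^sup>2"
        using mult_mono[OF cls_sum[of r] cls_sum[of r]] mult_mono[OF cls_recip_le[of r] cls_recip_le[of r]] D0 nn La_pos C1_ge T_ge
        by (auto simp: power2_eq_square intro: order_trans)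
      have "?D * c7 = M * (3 * \<theta>) * ?D + 4 / real Z ^ 7 * ?D" by (simp add: c7_def algebra_simps)
      also have "\<dots> \<le> M * (3 * \<theta>) * (C1 * (real m * La))\<^sup>2 + 4 / real Z ^ 7 * (4 * real m * T)\<^sup>2"
        using D1 M0 \<theta> by (intro add_mono mult_left_mono) auto
      finally show "?D * c7 \<le> M * (3 * \<theta>) * (C1 * (real m * La))\<^sup>2 + 4 / real Z ^ 7 * (4 * real m * T)\<^sup>2" .
    qed (use M0 T_ge in auto)
    also have "\<dots> = M * (C1 * (real m * La))\<^sup>2 * (X0 + 3 * \<theta>) + (4 / real Z ^ 7 * (4 * real m * T)\<^sup>2 + 4 * real m * T / real Z)"
      by (simp add: algebra_simps)
    also have "\<dots> \<le> M * (C1 * (real m * La))\<^sup>2 * (X0 + 3 * \<theta>) + 16 * C1\<^sup>2 * (real m * La) ^ 3 * cc\<^sup>2 * \<sigma>"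
      using \<sigma> by simp
    also have "\<dots> = 16 * C1\<^sup>2 * (real m * La) ^ 3 * cc\<^sup>2 * err \<sigma>"
      by (simp add: M_def X0_def err_def power2_eq_square power3_eq_cube algebra_simps)
    finally show ?thesis .
  qed
  \<comment> \<open>The variance bound is at least a sum of squares, which forces
    \<open>err \<sigma>\<close> to be nonnegative; this is needed to take its square root.\<close>
  have B0: "0 \<le> 16 * C1\<^sup>2 * (real m * La) ^ 3 * cc\<^sup>2 * err \<sigma>"
    by (rule order_trans[OF _ F]) (intro sum_nonneg zero_le_power2)
  have "0 < 16 * C1\<^sup>2 * (real m * La) ^ 3 * cc\<^sup>2" using C1_ge m_pos La_pos cc_bounds by simp
  then have err0: "0 \<le> err \<sigma>" using B0 by (simp add: zero_le_mult_iff)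
  have "(\<Sum>u\<in>U. (\<alpha> u / sqrt (real u)) * (G u / sqrt (real u)))\<^sup>2 \<le> (C1 * (real m * La)) * (16 * C1\<^sup>2 * (real m * La) ^ 3 * cc\<^sup>2 * err \<sigma>)"
    using A F La_pos C1_ge by (intro order_trans[OF cs] mult_mono) (auto intro!: sum_nonneg)
  also have "\<dots> = 16 * C1 ^ 3 * (real m * La) ^ 4 * cc\<^sup>2 * err \<sigma>" by (simp add: power2_eq_square power3_eq_cube power4_eq_xxxx algebra_simps)
  \<comment> \<open>One factor \<open>C1\<close> is given away to make the bound a perfect
    square.\<close>
  also have "\<dots> \<le> 16 * C1 ^ 4 * (real m * La) ^ 4 * cc\<^sup>2 * err \<sigma>"
    using err0 C1_ge La_pos by (intro mult_right_mono mult_left_mono power_increasing) auto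
  also have "\<dots> = (4 * C1\<^sup>2 * (real m * La)\<^sup>2 * cc * sqrt (err \<sigma>))\<^sup>2"
    using err0 by (simp add: power_mult_distrib power2_eq_square power4_eq_xxxx)
  finally have "\<bar>\<Sum>u\<in>U. (\<alpha> u / sqrt (real u)) * (G u / sqrt (real u))\<bar> \<le> \<bar>4 * C1\<^sup>2 * (real m * La)\<^sup>2 * cc * sqrt (err \<sigma>)\<bar>"
    by (simp only: abs_le_square_iff)
  also have "\<dots> = 4 * C1\<^sup>2 * (real m * La)\<^sup>2 * cc * sqrt (err \<sigma>)"
    using err0 cc_bounds by (intro abs_of_nonneg) auto
  finally have fin: "\<bar>\<Sum>u\<in>U. (\<alpha> u / sqrt (real u)) * (G u / sqrt (real u))\<bar> \<le> 4 * C1\<^sup>2 * (real m * La)\<^sup>2 * cc * sqrt (err \<sigma>)" .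
  show ?thesis using fin unfolding lhs[symmetric] unfolding U_def .
qed

section \<open>Divisor pairs of rough integers\<close>

lemma Q_gt_1: "Q > 1"
proof -
  have "(2::nat) dvd Q" using Q_primes[of 2] w_ge by simp
  then show ?thesis using Q dvd_imp_le[of 2 Q] by simp
qed

text \<open>Coprimality to \<open>Q\<close> excludes the primes up to \<open>w\<close> and roughness
  those up to \<open>Z\<close>. This gap makes both factors in every proper factorisation
  long.\<close>

lemma rough_factor_large:
  assumes "rough n" "coprime n Q" "l dvd n" "l > 1" shows "l > Z"
proof -
  obtain p where p: "prime p" "p dvd l" using prime_factor_nat[of l] assms(4) by auto
  have "p dvd n" using p(2) assms(3) by (rule dvd_trans)
  have "\<not> p dvd Q"
  proof
    assume "p dvd Q"
    then have "is_unit p" using coprime_common_divisor[OF assms(2) \<open>p dvd n\<close>] by simp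
    then show False using p(1) not_prime_unit by blast
  qed
  then have "w < p" using Q_primes[OF p(1)] by simp
  moreover have "p \<notin> PS" using assms(1) \<open>p dvd n\<close> by (auto simp: rough_def)
  ultimately have "Z < p" using p(1) by (auto simp: PS_def primes_in_def)
  moreover have "p \<le> l" using p(2) assms(4) by (simp add: dvd_imp_le)
  ultimately show ?thesis by simp
qed

lemma rough_dvd: "rough n \<Longrightarrow> l dvd n \<Longrightarrow> rough l"
  by (auto simp: rough_def dest: dvd_trans)

lemma rough_mult: "rough l \<Longrightarrow> rough e \<Longrightarrow> rough (l * e)"
  using PS_D(1) by (auto simp: rough_def prime_dvd_mult_iff)

definition in_range :: "nat \<Rightarrow> nat \<Rightarrow> bool" where
  "in_range x y \<longleftrightarrow> Z ^ (2 * m) < x * y \<and> x * y \<le> Z ^ (4 * m)"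

definition Wset :: "nat set" where "Wset = {v \<in> {Z<..Z ^ (4 * m)}. rough v \<and> coprime v Q}"

definition Pairs :: "nat \<Rightarrow> (nat \<times> nat) set" where
  "Pairs a = {(x, y). x \<in> Wset \<and> y \<in> Wset \<and> in_range x y \<and> [x * y = a] (mod Q)}"

lemma finite_Pairs [simp]: "finite (Pairs a)"
  by (rule finite_subset[of _ "Wset \<times> Wset"]) (auto simp: Pairs_def Wset_def)

lemma Pairs_swap:
  fixes F :: "nat \<Rightarrow> nat \<Rightarrow> real"
  shows "(\<Sum>(x,y)\<in>Pairs a. F x y) = (\<Sum>(x,y)\<in>Pairs a. F y x)"
  by (rule sum.reindex_bij_witness[where i = prod.swap and j = prod.swap]) (auto simp: Pairs_def in_range_def mult.commute)

definition cofactor_class :: "nat \<Rightarrow> nat \<Rightarrow> nat" where "cofactor_class a r = (SOME s. [r * s = a] (mod Q))"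

lemma cofactor_class: assumes "coprime r Q" shows "[r * cofactor_class a r = a] (mod Q)"
proof -
  obtain x where "[r * x = 1] (mod Q)" using cong_solve_coprime_nat[OF assms] by auto
  then have "[r * x * a = 1 * a] (mod Q)" by (rule cong_scalar_right)
  then have "[r * (x * a) = a] (mod Q)" by (simp add: mult.assoc)
  then show ?thesis unfolding cofactor_class_def by (rule someI)
qed

lemma Pairs_sum:
  fixes F :: "nat \<Rightarrow> nat \<Rightarrow> real"
  assumes a: "coprime a Q"
  shows "(\<Sum>(x,y)\<in>Pairs a. F x y) = (\<Sum>r\<in>totatives Q. \<Sum>u\<in>cls (cofactor_class a r). \<Sum>v | v \<in> cls r \<and> in_range u v. F v u)"
proof -
  define B where "B = (\<lambda>r. {(x,y). x \<in> cls r \<and> y \<in> cls (cofactor_class a r) \<and> in_range y x})"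
  have finB: "finite (B r)" for r by (rule finite_subset[of _ "cls r \<times> cls (cofactor_class a r)"]) (auto simp: B_def)
  have tot: "coprime r Q" if "r \<in> totatives Q" for r using that by (simp add: in_totatives_iff)
  have "Pairs a = (\<Union>r\<in>totatives Q. B r)"
  proof (intro equalityI subsetI)
    fix p assume "p \<in> Pairs a"
    then obtain x y where p: "p = (x, y)" "x \<in> Wset" "y \<in> Wset" "in_range x y" "[x * y = a] (mod Q)" by (auto simp: Pairs_def)
    define r where "r = x mod Q"
    have xr: "[x = r] (mod Q)" by (simp add: r_def Cong.cong_def)
    have "[r = x] (mod Q)" by (simp add: r_def Cong.cong_def)
    then have cr: "coprime r Q" by (rule coprime_of_class) (use p(2) in \<open>simp add: Wset_def\<close>)
    have "r \<noteq> 0" using cr Q_gt_1 by (cases "r = 0") auto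
    then have rt: "r \<in> totatives Q" using cr Q by (simp add: in_totatives_iff r_def less_imp_le)
    have "[r * y = x * y] (mod Q)" using xr by (intro cong_mult) (auto simp: cong_sym)
    then have "[r * y = r * cofactor_class a r] (mod Q)" using p(5) cofactor_class[OF cr, of a] by (simp add: Cong.cong_def)
    then have "[y = cofactor_class a r] (mod Q)" using cr by (simp add: cong_mult_lcancel_nat)
    then have "p \<in> B r" using p xr by (auto simp: B_def cls_def Wset_def in_range_def mult.commute)
    then show "p \<in> (\<Union>r\<in>totatives Q. B r)" using rt by blast
  next
    fix p assume "p \<in> (\<Union>r\<in>totatives Q. B r)"
    then obtain r x y where p: "r \<in> totatives Q" "p = (x, y)" "x \<in> cls r" "y \<in> cls (cofactor_class a r)" "in_range y x" by (auto simp: B_def)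
    have "[x * y = r * cofactor_class a r] (mod Q)" using cls_D(5)[OF p(3)] cls_D(5)[OF p(4)] by (rule cong_mult)
    then have xy: "[x * y = a] (mod Q)" using cofactor_class[OF tot[OF p(1)], of a] by (rule cong_trans)
    have "coprime (x * y) Q" using coprime_of_class[OF xy a] .
    then show "p \<in> Pairs a" using p xy by (auto simp: Pairs_def Wset_def cls_def in_range_def mult.commute)
  qed
  moreover have "B r \<inter> B r' = {}" if "r \<in> totatives Q" "r' \<in> totatives Q" "r \<noteq> r'" for r r'
  proof (rule ccontr)
    assume "B r \<inter> B r' \<noteq> {}"
    then obtain x where "[x = r] (mod Q)" "[x = r'] (mod Q)" by (auto simp: B_def cls_def)
    then have "r mod Q = r' mod Q" by (simp add: Cong.cong_def)
    moreover have "r < Q" "r' < Q" using that totatives_less[OF _ Q_gt_1] by auto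
    ultimately show False using that(3) by simp
  qed
  ultimately have "(\<Sum>(x,y)\<in>Pairs a. F x y) = (\<Sum>r\<in>totatives Q. \<Sum>(x,y)\<in>B r. F x y)"
    using finB by (simp add: sum.UNION_disjoint)
  also have "\<dots> = (\<Sum>r\<in>totatives Q. \<Sum>u\<in>cls (cofactor_class a r). \<Sum>v | v \<in> cls r \<and> in_range u v. F v u)"
  proof (rule sum.cong)
    fix r assume "r \<in> totatives Q"
    have "(\<Sum>u\<in>cls (cofactor_class a r). \<Sum>v | v \<in> cls r \<and> in_range u v. F v u) = (\<Sum>(u,v)\<in>Sigma (cls (cofactor_class a r)) (\<lambda>u. {v. v \<in> cls r \<and> in_range u v}). F v u)"
      by (intro sum.Sigma) auto
    also have "\<dots> = (\<Sum>(x,y)\<in>B r. F x y)"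
      by (rule sum.reindex_bij_witness[where i = prod.swap and j = prod.swap]) (auto simp: B_def)
    finally show "(\<Sum>(x,y)\<in>B r. F x y) = (\<Sum>u\<in>cls (cofactor_class a r). \<Sum>v | v \<in> cls r \<and> in_range u v. F v u)" ..
  qed simp
  finally show ?thesis .
qed

lemma Z_m_facts: "Z ^ (2 * m) = Z ^ m * Z ^ m" "Z \<le> Z ^ m" "Z ^ m \<le> Z ^ (2 * m)" "Z ^ (2 * m) \<le> Z ^ (4 * m)"
proof -
  show "Z ^ (2 * m) = Z ^ m * Z ^ m" by (simp add: mult_2 power_add)
  show "Z \<le> Z ^ m" using power_increasing[of 1 m Z] Z_ge m_pos by simp
  show "Z ^ m \<le> Z ^ (2 * m)" "Z ^ (2 * m) \<le> Z ^ (4 * m)" using Z_ge by (auto intro!: power_increasing)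
qed

lemma Z_le_Z_2m: "Z \<le> Z ^ (2 * m)"
  using Z_m_facts(2,3) by (rule order_trans)

lemma mangoldt_range: assumes "n \<le> Z ^ (4 * m)" shows "mangoldt n \<le> 4 * real m * T"
proof (cases "n = 0")
  case True
  then show ?thesis using T_ge by simp
next
  case False
  have "mangoldt n \<le> ln (real n)" using False by (intro mangoldt_le) simp
  also have "\<dots> \<le> ln (real (Z ^ (4 * m)))"
  proof -
    have "0 < real n" using False by simp
    moreover have "real n \<le> real (Z ^ (4 * m))" using assms by (simp only: of_nat_le_iff)
    ultimately show ?thesis by (subst ln_le_cancel_iff) linarith+
  qed
  finally show ?thesis unfolding ln_Z_power by simp
qed

definition D :: "nat \<Rightarrow> real" where "D n = of_bool (adm n) - cc"

text \<open>Fixing the residue of \<open>x\<close> fixes that of \<open>y\<close>, so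
  \<open>type_two\<close> applies once for each of the \<open>totient Q\<close> classes. The
  coefficient \<open>\<alpha>\<close> sits on the outer variable, and \<open>supp\<close> ensures
  that this variable exceeds \<open>Z ^ m\<close>.\<close>

lemma bilinear_bound:
  fixes \<alpha> \<beta> :: "nat \<Rightarrow> real"
  assumes a: "coprime a Q" and \<alpha>: "\<And>u. \<bar>\<alpha> u\<bar> \<le> 1" and \<beta>: "\<And>v. 0 \<le> \<beta> v" "\<And>v. \<beta> v \<le> 1"
    and \<sigma>: "4 / real Z ^ 7 * (4 * real m * T)\<^sup>2 + 4 * real m * T / real Z \<le> 16 * C1\<^sup>2 * (real m * La) ^ 3 * cc\<^sup>2 * \<sigma>"
    and supp: "\<And>u v. in_range u v \<Longrightarrow> \<alpha> u * \<beta> v \<noteq> 0 \<Longrightarrow> Z ^ m < u"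
  shows "\<bar>\<Sum>(x,y)\<in>Pairs a. \<alpha> y * \<beta> x / (real y * real x) * D (y * x)\<bar> \<le> real (totient Q) * (4 * C1\<^sup>2 * (real m * La)\<^sup>2 * cc * sqrt (err \<sigma>))"
proof -
  have "\<bar>\<Sum>(x,y)\<in>Pairs a. \<alpha> y * \<beta> x / (real y * real x) * D (y * x)\<bar>
    = \<bar>\<Sum>r\<in>totatives Q. \<Sum>u\<in>cls (cofactor_class a r). \<Sum>v | v \<in> cls r \<and> in_range u v. \<alpha> u * \<beta> v / (real u * real v) * D (u * v)\<bar>"
    by (simp only: Pairs_sum[OF a])
  also have "\<dots> \<le> (\<Sum>r\<in>totatives Q. 4 * C1\<^sup>2 * (real m * La)\<^sup>2 * cc * sqrt (err \<sigma>))"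
  proof (rule order_trans[OF sum_abs sum_mono])
    fix r assume "r \<in> totatives Q"
    then have r: "coprime r Q" by (simp add: in_totatives_iff)
    have "(\<Sum>u\<in>cls (cofactor_class a r). \<Sum>v | v \<in> cls r \<and> in_range u v. \<alpha> u * \<beta> v / (real u * real v) * D (u * v))
      = (\<Sum>u | u \<in> cls (cofactor_class a r) \<and> Z ^ m < u. \<Sum>v | v \<in> cls r \<and> in_range u v. \<alpha> u * \<beta> v / (real u * real v) * D (u * v))"
    proof (rule sum.mono_neutral_right)
      show "\<forall>u\<in>cls (cofactor_class a r) - {u. u \<in> cls (cofactor_class a r) \<and> Z ^ m < u}. (\<Sum>v | v \<in> cls r \<and> in_range u v. \<alpha> u * \<beta> v / (real u * real v) * D (u * v)) = 0"
      proof
        fix u assume u: "u \<in> cls (cofactor_class a r) - {u. u \<in> cls (cofactor_class a r) \<and> Z ^ m < u}"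
        show "(\<Sum>v | v \<in> cls r \<and> in_range u v. \<alpha> u * \<beta> v / (real u * real v) * D (u * v)) = 0"
        proof (rule sum.neutral, rule ballI)
          fix v assume "v \<in> {v. v \<in> cls r \<and> in_range u v}"
          then have "\<alpha> u * \<beta> v = 0" using supp[of u v] u by blast
          then show "\<alpha> u * \<beta> v / (real u * real v) * D (u * v) = 0" by simp
        qed
      qed
    qed auto
    then show "\<bar>\<Sum>u\<in>cls (cofactor_class a r). \<Sum>v | v \<in> cls r \<and> in_range u v. \<alpha> u * \<beta> v / (real u * real v) * D (u * v)\<bar> \<le> 4 * C1\<^sup>2 * (real m * La)\<^sup>2 * cc * sqrt (err \<sigma>)"
      using type_two[where s = "cofactor_class a r", OF r \<alpha> \<beta> \<sigma>] unfolding in_range_def D_def by simp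
  qed
  also have "\<dots> = real (totient Q) * (4 * C1\<^sup>2 * (real m * La)\<^sup>2 * cc * sqrt (err \<sigma>))" by (simp add: totient_def)
  finally show ?thesis .
qed

definition Nset :: "nat \<Rightarrow> nat set" where
  "Nset a = {n \<in> {Z ^ (2 * m)<..Z ^ (4 * m)}. [n = a] (mod Q) \<and> rough n}"

lemma finite_Nset [simp]: "finite (Nset a)" by (simp add: Nset_def)

lemma proper_divisor_sum:
  fixes F :: "nat \<Rightarrow> nat \<Rightarrow> real"
  assumes a: "coprime a Q"
  shows "(\<Sum>n\<in>Nset a. \<Sum>l | l dvd n \<and> 1 < l \<and> l < n. F l (n div l)) = (\<Sum>(x,y)\<in>Pairs a. F x y)"
proof -
  have pos: "n > 0" if "n \<in> Nset a" for n using that by (auto simp: Nset_def)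
  have "(\<Sum>n\<in>Nset a. \<Sum>l | l dvd n \<and> 1 < l \<and> l < n. F l (n div l)) = (\<Sum>(n,l)\<in>Sigma (Nset a) (\<lambda>n. {l. l dvd n \<and> 1 < l \<and> l < n}). F l (n div l))"
    by (intro sum.Sigma) auto
  also have "\<dots> = (\<Sum>(x,y)\<in>Pairs a. F x y)"
  proof (rule sum.reindex_bij_witness[where i = "\<lambda>(x,y). (x * y, x)" and j = "\<lambda>(n,l). (l, n div l)"])
    fix p assume "p \<in> Sigma (Nset a) (\<lambda>n. {l. l dvd n \<and> 1 < l \<and> l < n})"
    then obtain n l where p: "p = (n, l)" "n \<in> Nset a" "l dvd n" "1 < l" "l < n" by auto
    obtain e where e: "n = l * e" using p(3) by auto
    have nl: "n div l = e" using e p(4) by simp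
    have n: "rough n" "coprime n Q" "Z ^ (2 * m) < n" "n \<le> Z ^ (4 * m)" "[n = a] (mod Q)"
      using p(2) coprime_of_class[OF _ a] by (auto simp: Nset_def)
    have e1: "1 < e" using e p(5) by (metis One_nat_def gr0I less_irrefl_nat less_one linorder_neqE_nat mult.right_neutral mult_is_0 not_less0)
    have "e dvd n" using e by simp
    have "Z < l" "Z < e" using rough_factor_large[OF n(1,2)] p(3,4) e1 \<open>e dvd n\<close> by auto
    moreover have "l \<le> n" "e \<le> n" using p(3) \<open>e dvd n\<close> pos[OF p(2)] by (auto intro: dvd_imp_le)
    moreover from this have "l \<le> Z ^ (4 * m)" "e \<le> Z ^ (4 * m)" using n(4) by linarith+
    moreover have "rough l" "rough e" using rough_dvd[OF n(1)] p(3) \<open>e dvd n\<close> by auto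
    moreover have "coprime l Q" "coprime e Q" using n(2) e by auto
    ultimately show "(case p of (n, l) \<Rightarrow> (l, n div l)) \<in> Pairs a"
      using n e nl p(1) by (auto simp: Pairs_def Wset_def in_range_def)
    show "(case case p of (n, l) \<Rightarrow> (l, n div l) of (x, y) \<Rightarrow> (x * y, x)) = p" using p(1) e nl by simp
    show "(case case p of (n, l) \<Rightarrow> (l, n div l) of (x, y) \<Rightarrow> F x y) = (case p of (n, l) \<Rightarrow> F l (n div l))" using p(1) by simp
  next
    fix p assume "p \<in> Pairs a"
    then obtain x y where p: "p = (x, y)" "x \<in> Wset" "y \<in> Wset" "in_range x y" "[x * y = a] (mod Q)" by (auto simp: Pairs_def)
    have xy: "Z < x" "Z < y" "rough x" "rough y" using p by (auto simp: Wset_def)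
    have g1: "1 < x" "1 < y" using xy Z_ge by auto
    then show "(case case p of (x, y) \<Rightarrow> (x * y, x) of (n, l) \<Rightarrow> (l, n div l)) = p" using p(1) by simp
    have "x < x * y" using g1 by simp
    then show "(case p of (x, y) \<Rightarrow> (x * y, x)) \<in> Sigma (Nset a) (\<lambda>n. {l. l dvd n \<and> 1 < l \<and> l < n})"
      using p xy g1 rough_mult by (auto simp: Nset_def in_range_def)
  qed
  finally show ?thesis .
qed

text \<open>Of two factors with product above \<open>Z ^ (2 * m)\<close> one exceeds
  \<open>Z ^ m\<close> and can serve as the long variable: the cofactor if
  \<open>l \<le> Z ^ m\<close>, and \<open>l\<close> itself otherwise. In the two cases
  \<open>mangoldt\<close> falls on the short and on the long variable.\<close>

lemma type_two_total:
  assumes a: "coprime a Q"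
    and \<sigma>: "4 / real Z ^ 7 * (4 * real m * T)\<^sup>2 + 4 * real m * T / real Z \<le> 16 * C1\<^sup>2 * (real m * La) ^ 3 * cc\<^sup>2 * \<sigma>"
  shows "\<bar>\<Sum>n\<in>Nset a. \<Sum>l | l dvd n \<and> 1 < l \<and> l < n. mangoldt l / real n * D n\<bar>
    \<le> 32 * C1\<^sup>2 * real m ^ 3 * T * real (totient Q) * La\<^sup>2 * cc * sqrt (err \<sigma>)"
proof -
  define L where "L = 4 * real m * T"
  have L: "L > 0" using T_ge m_pos by (simp add: L_def)
  \<comment> \<open>The weight is cut off beyond \<open>Z ^ (4 * m)\<close> so that after division
    by \<open>L\<close> it is at most \<open>1\<close> at every argument, as
    \<open>bilinear_bound\<close> demands.\<close>
  define \<mu> where "\<mu> = (\<lambda>l. if l \<le> Z ^ (4 * m) then mangoldt l / L else 0)"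
  have \<mu>: "0 \<le> \<mu> l" "\<mu> l \<le> 1" for l
    using mangoldt_range[of l] L mangoldt_nonneg[of l] by (auto simp: \<mu>_def L_def)
  define B where "B = real (totient Q) * (4 * C1\<^sup>2 * (real m * La)\<^sup>2 * cc * sqrt (err \<sigma>))"
  define F where "F = (\<lambda>x y. mangoldt x / (real x * real y) * D (x * y))"
  have "(\<Sum>n\<in>Nset a. \<Sum>l | l dvd n \<and> 1 < l \<and> l < n. mangoldt l / real n * D n) = (\<Sum>n\<in>Nset a. \<Sum>l | l dvd n \<and> 1 < l \<and> l < n. F l (n div l))"
    unfolding F_def by (intro sum.cong refl) (auto simp flip: of_nat_mult)
  also have "\<dots> = (\<Sum>(x,y)\<in>Pairs a. F x y)" by (rule proper_divisor_sum[OF a])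
  also have "\<dots> = (\<Sum>(x,y)\<in>Pairs a. of_bool (x \<le> Z ^ m) * F x y) + (\<Sum>(x,y)\<in>Pairs a. of_bool (Z ^ m < x) * F x y)"
    unfolding sum.distrib[symmetric] by (intro sum.cong refl) auto
  also have "(\<Sum>(x,y)\<in>Pairs a. of_bool (Z ^ m < x) * F x y) = (\<Sum>(x,y)\<in>Pairs a. of_bool (Z ^ m < y) * F y x)"
    by (rule Pairs_swap)
  finally have split: "(\<Sum>n\<in>Nset a. \<Sum>l | l dvd n \<and> 1 < l \<and> l < n. mangoldt l / real n * D n)
    = (\<Sum>(x,y)\<in>Pairs a. of_bool (x \<le> Z ^ m) * F x y) + (\<Sum>(x,y)\<in>Pairs a. of_bool (Z ^ m < y) * F y x)" .
  have P: "x \<le> Z ^ (4 * m)" "y \<le> Z ^ (4 * m)" if "(x, y) \<in> Pairs a" for x y using that by (auto simp: Pairs_def Wset_def)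
  have 1: "(\<Sum>(x,y)\<in>Pairs a. of_bool (x \<le> Z ^ m) * F x y) = L * (\<Sum>(x,y)\<in>Pairs a. (\<lambda>_. 1) y * (of_bool (x \<le> Z ^ m) * \<mu> x) / (real y * real x) * D (y * x))"
    unfolding sum_distrib_left using L P by (intro sum.cong refl) (auto simp: F_def \<mu>_def mult.commute)
  have 2: "(\<Sum>(x,y)\<in>Pairs a. of_bool (Z ^ m < y) * F y x) = L * (\<Sum>(x,y)\<in>Pairs a. (of_bool (Z ^ m < y) * \<mu> y) * (\<lambda>_. 1) x / (real y * real x) * D (y * x))"
    unfolding sum_distrib_left using L P by (intro sum.cong refl) (auto simp: F_def \<mu>_def mult.commute)
  have b1: "\<bar>\<Sum>(x,y)\<in>Pairs a. (\<lambda>_. 1) y * (of_bool (x \<le> Z ^ m) * \<mu> x) / (real y * real x) * D (y * x)\<bar> \<le> B"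
    unfolding B_def
  proof (rule bilinear_bound[OF a _ _ _ \<sigma>])
    fix u v assume uv: "in_range u v" "(\<lambda>_. 1) u * (of_bool (v \<le> Z ^ m) * \<mu> v) \<noteq> (0::real)"
    then have v: "v \<le> Z ^ m" by (auto split: if_splits)
    show "Z ^ m < u"
    proof (rule ccontr)
      assume "\<not> Z ^ m < u"
      then have "u * v \<le> Z ^ m * Z ^ m" using v by (intro mult_mono) auto
      then show False using uv(1) Z_m_facts(1) by (simp add: in_range_def)
    qed
  qed (use \<mu> in auto)
  have b2: "\<bar>\<Sum>(x,y)\<in>Pairs a. (of_bool (Z ^ m < y) * \<mu> y) * (\<lambda>_. 1) x / (real y * real x) * D (y * x)\<bar> \<le> B"
    unfolding B_def
    by (rule bilinear_bound[OF a _ _ _ \<sigma>]) (use \<mu> in \<open>auto split: if_splits\<close>)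
  have lin: "\<bar>L * x + L * y\<bar> \<le> L * B + L * B" if "\<bar>x\<bar> \<le> B" "\<bar>y\<bar> \<le> B" for x y
  proof -
    have "\<bar>L * x\<bar> \<le> L * B" "\<bar>L * y\<bar> \<le> L * B" using that L by (simp_all add: abs_mult mult_left_mono)
    then show ?thesis by linarith
  qed
  have "\<bar>\<Sum>n\<in>Nset a. \<Sum>l | l dvd n \<and> 1 < l \<and> l < n. mangoldt l / real n * D n\<bar> \<le> L * B + L * B"
    unfolding split 1 2
    by (rule lin[OF b1 b2])
  also have "\<dots> = 32 * C1\<^sup>2 * real m ^ 3 * T * real (totient Q) * La\<^sup>2 * cc * sqrt (err \<sigma>)"
    by (simp add: L_def B_def power2_eq_square power3_eq_cube)
  finally show ?thesis .
qed

text \<open>The weight \<open>ln n / n\<close> decreases from \<open>3\<close> on, so the sieve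
  applies directly, without dispersion. The shifts of \<open>n\<close> itself are the case
  \<open>v = 1\<close> of \<open>roots\<close>.\<close>

lemma type_one:
  "\<bar>\<Sum>n\<in>Nset a. ln (real n) / real n * D n\<bar> \<le> 48 * \<theta> * cc * (real m)\<^sup>2 * T * La + 4 / real Z ^ 7"
proof -
  let ?X = "Z ^ (2 * m)" and ?Y = "Z ^ (4 * m)"
  define g where "g = (\<lambda>n. ln (real n) / real n)"
  define h where "h = (\<Sum>n\<in>{?X<..?Y}. g n) / real Q"
  define e where "e = 2 / real Z ^ 7"
  have X3: "3 \<le> ?X" using Z_m_facts Z_ge by linarith
  have gg: "0 \<le> g n" "m' \<le> n \<Longrightarrow> ?X < m' \<Longrightarrow> g n \<le> g m'" if "?X < n" for n m'
    using X3 that by (auto simp: g_def intro!: ln_over_antimono)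
  have e: "g (Suc ?X) * real Z ^ (8 * b + 13) \<le> e"
  proof -
    define x where "x = real (Suc ?X)"
    have x: "x > 0" unfolding x_def by (simp only: of_nat_0_less_iff zero_less_Suc)
    \<comment> \<open>A logarithm is at most twice a square root, and the square root of
      \<open>Z ^ (2 * m)\<close> is still the \<open>Z ^ m\<close> that beats the sieve
      level.\<close>
    have "ln (sqrt x) \<le> sqrt x - 1" using x by (intro ln_le_minus_one) auto
    then have "ln x \<le> 2 * sqrt x" using x by (simp add: ln_sqrt)
    then have "ln x / x \<le> 2 * sqrt x / (sqrt x * sqrt x)" using x by (simp add: divide_right_mono)
    also have "\<dots> = 2 / sqrt x" using x by (simp del: real_sqrt_mult_self)
    also have "\<dots> \<le> 2 / real (Z ^ m)"
    proof -
      have "(real (Z ^ m))\<^sup>2 = real ?X" by (simp add: Z_m_facts(1) power2_eq_square del: of_nat_power)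
      then have "(real (Z ^ m))\<^sup>2 \<le> x" by (simp add: x_def)
      then have "real (Z ^ m) \<le> sqrt x" by (rule real_le_rsqrt)
      moreover have "0 < real (Z ^ m)" using Z_ge by simp
      ultimately show ?thesis using x by (intro divide_left_mono mult_pos_pos) auto
    qed
    finally have "g (Suc ?X) * real Z ^ (8 * b + 13) \<le> 2 / real (Z ^ m) * real Z ^ (8 * b + 13)"
      unfolding g_def x_def by (intro mult_right_mono) auto
    also have "\<dots> \<le> e"
    proof -
      have "Z ^ (7 + (8 * b + 13)) \<le> Z ^ m" using m Z_ge by (intro power_increasing) auto
      then have "real (Z ^ (7 + (8 * b + 13))) \<le> real (Z ^ m)" by (simp only: of_nat_le_iff)
      then have "real Z ^ 7 * real Z ^ (8 * b + 13) \<le> real (Z ^ m)" by (simp only: power_add of_nat_mult of_nat_power)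
      then show ?thesis using Z_ge unfolding e_def by (simp add: field_simps)
    qed
    finally show ?thesis .
  qed
  have gen: "\<bar>(\<Sum>n | n \<in> {?X<..?Y} \<and> [n = a] (mod Q) \<and> (\<forall>p\<in>PS. n mod p \<notin> \<Omega> p). g n) - h * (\<Prod>p\<in>PS. 1 - real (card (\<Omega> p)) / real p)\<bar>
      \<le> 3 * \<theta> * (h * (\<Prod>p\<in>PS. 1 - real (card (\<Omega> p)) / real p)) + e"
    if \<Omega>: "\<And>p. p \<in> PS \<Longrightarrow> \<Omega> p \<subseteq> {..<p} \<and> card (\<Omega> p) \<le> 2 * k + 1" for \<Omega>
  proof -
    have "\<bar>(\<Sum>n | n \<in> {?X<..?Y} \<and> [n = a] (mod Q) \<and> (\<forall>p\<in>PS. n mod p \<notin> \<Omega> p). g n) - h * (\<Prod>p\<in>PS. 1 - real (card (\<Omega> p)) / real p)\<bar>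
      \<le> 3 * \<theta> * (h * (\<Prod>p\<in>PS. 1 - real (card (\<Omega> p)) / real p)) + g (Suc ?X) * real Z ^ (8 * b + 13)"
      unfolding h_def
    proof (rule prime_sieve[where \<kappa> = "2 * k + 1" and w = w and b = b and J = J and Q = Q and r = a and X = ?X and Y = ?Y
        and \<Omega> = \<Omega> and g = g and \<theta> = \<theta>, folded Z_def, folded PS_def])
      show "\<Omega> p \<subseteq> {..<p} \<and> card (\<Omega> p) \<le> 2 * k + 1 \<and> (coprime p Q \<or> \<Omega> p = {})" if "p \<in> PS" for p
        using \<Omega>[OF that] PS_D(5)[OF that] by blast
    qed (use w Q \<theta> gg in \<open>simp_all add: \<theta>_def\<close>)
    then show ?thesis using e by linarith
  qed
  have SR: "\<bar>(\<Sum>n\<in>Nset a. g n) - h * VR\<bar> \<le> 3 * \<theta> * (h * VR) + e"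
  proof -
    have "{n. n \<in> {?X<..?Y} \<and> [n = a] (mod Q) \<and> (\<forall>p\<in>PS. n mod p \<notin> {0})} = Nset a"
      by (auto simp: Nset_def rough_def mod_eq_0_iff_dvd)
    then show ?thesis using gen[of "\<lambda>_. {0}"] PS_D(6) unfolding VR_def by simp
  qed
  have SA: "\<bar>(\<Sum>n\<in>Nset a. g n * of_bool (adm n)) - h * VA\<bar> \<le> 3 * \<theta> * (h * VA) + e"
  proof -
    have r1: "rough 1" unfolding rough_def using PS_D(1) by (metis nat_dvd_1_iff_1 not_prime_1)
    have "(\<Sum>n | n \<in> {?X<..?Y} \<and> [n = a] (mod Q) \<and> (\<forall>p\<in>PS. n mod p \<notin> roots 1 p). g n) = (\<Sum>n\<in>Nset a. g n * of_bool (adm n))"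
      unfolding avoid_roots_iff[OF r1] by (intro sum.mono_neutral_cong_left) (auto simp: Nset_def)
    moreover have "(\<Prod>p\<in>PS. 1 - real (card (roots 1 p)) / real p) = VA"
      unfolding VA_def using card_roots[OF _ r1] by (intro prod.cong) auto
    moreover have "\<bar>(\<Sum>n | n \<in> {?X<..?Y} \<and> [n = a] (mod Q) \<and> (\<forall>p\<in>PS. n mod p \<notin> roots 1 p). g n) - h * (\<Prod>p\<in>PS. 1 - real (card (roots 1 p)) / real p)\<bar>
      \<le> 3 * \<theta> * (h * (\<Prod>p\<in>PS. 1 - real (card (roots 1 p)) / real p)) + e"
      using card_roots[OF _ r1] by (intro gen) (auto simp: roots_def)
    ultimately show ?thesis by simp
  qed
  have hV: "h * VR \<le> 8 * (real m)\<^sup>2 * T * La"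
  proof -
    have "(\<Sum>n\<in>{?X<..?Y}. g n) \<le> (\<Sum>n\<in>{?X<..?Y}. 4 * real m * T * (1 / real n))"
    proof (rule sum_mono)
      fix n assume n: "n \<in> {?X<..?Y}"
      have "0 < real n" "real n \<le> real ?Y" using n by (auto simp del: of_nat_power)
      then have "ln (real n) \<le> ln (real ?Y)" by (subst ln_le_cancel_iff) linarith+
      also have "\<dots> = 4 * real m * T" unfolding ln_Z_power by simp
      finally show "g n \<le> 4 * real m * T * (1 / real n)" unfolding g_def by (simp add: divide_right_mono)
    qed
    also have "\<dots> = 4 * real m * T * (\<Sum>n\<in>{?X<..?Y}. 1 / real n)" by (simp only: sum_distrib_left)
    also have "\<dots> \<le> 4 * real m * T * (ln (real ?Y) - ln (real ?X))"
      using Z_m_facts(4) X3 T_ge Z_ge by (intro mult_left_mono sum_recip_interval_le) auto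
    also have "\<dots> = 8 * (real m)\<^sup>2 * T\<^sup>2" unfolding ln_Z_power by (simp add: power2_eq_square algebra_simps)
    finally have "h * VR \<le> 8 * (real m)\<^sup>2 * T\<^sup>2 / real Q * VR"
      unfolding h_def using VR_pos by (intro mult_right_mono divide_right_mono) auto
    then show ?thesis by (simp add: La_def power2_eq_square)
  qed
  have "\<bar>\<Sum>n\<in>Nset a. ln (real n) / real n * D n\<bar> = \<bar>(\<Sum>n\<in>Nset a. g n * of_bool (adm n)) - cc * (\<Sum>n\<in>Nset a. g n)\<bar>"
    unfolding D_def g_def sum_distrib_left sum_subtractf[symmetric] by (intro arg_cong[of _ _ abs] sum.cong refl) (simp add: algebra_simps)
  also have "\<dots> \<le> \<bar>(\<Sum>n\<in>Nset a. g n * of_bool (adm n)) - h * VA\<bar> + cc * \<bar>(\<Sum>n\<in>Nset a. g n) - h * VR\<bar>"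
  proof -
    have "(\<Sum>n\<in>Nset a. g n * of_bool (adm n)) - cc * (\<Sum>n\<in>Nset a. g n)
      = ((\<Sum>n\<in>Nset a. g n * of_bool (adm n)) - h * VA) - cc * ((\<Sum>n\<in>Nset a. g n) - h * VR)"
      unfolding cc_bounds(4) by (simp add: algebra_simps)
    moreover have "\<bar>cc * ((\<Sum>n\<in>Nset a. g n) - h * VR)\<bar> = cc * \<bar>(\<Sum>n\<in>Nset a. g n) - h * VR\<bar>"
      using cc_bounds by (simp add: abs_mult)
    ultimately show ?thesis by linarith
  qed
  also have "\<dots> \<le> (3 * \<theta> * (h * VA) + e) + cc * (3 * \<theta> * (h * VR) + e)"
    using SA SR cc_bounds by (intro add_mono mult_left_mono) auto
  also have "\<dots> = 6 * \<theta> * cc * (h * VR) + (1 + cc) * e" unfolding cc_bounds(4) by (simp add: algebra_simps)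
  also have "\<dots> \<le> 6 * \<theta> * cc * (8 * (real m)\<^sup>2 * T * La) + 2 * e"
    using hV \<theta> cc_bounds by (intro add_mono mult_left_mono mult_right_mono) (auto simp: e_def)
  finally show ?thesis by (simp add: e_def)
qed

section \<open>Large square divisors and the existence of a suitable prime\<close>

text \<open>Writing \<open>n + i\<close> as \<open>j\<close> times the square of \<open>q\<close>
  leaves a harmonic sum over \<open>j\<close>, with a factor \<open>2\<close> because
  \<open>n + i \<le> 2 * n\<close>.\<close>

lemma square_divisor_sum:
  assumes "i \<le> k" "q > 0"
  shows "(\<Sum>n | n \<in> {Z ^ (2 * m)<..Z ^ (4 * m)} \<and> q\<^sup>2 dvd n + i. 1 / real n) \<le> 12 * real m * T * (1 / (real q)\<^sup>2)"
proof -
  let ?A = "{n. n \<in> {Z ^ (2 * m)<..Z ^ (4 * m)} \<and> q\<^sup>2 dvd n + i}"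
  define M where "M = Z ^ (5 * m)"
  have kZ: "k \<le> Z" using w Z_ge by linarith
  have "(\<Sum>n\<in>?A. 1 / real n) \<le> (\<Sum>n\<in>?A. 2 / (real q)\<^sup>2 * (1 / real ((n + i) div q\<^sup>2)))"
  proof (rule sum_mono)
    fix n assume n: "n \<in> ?A"
    obtain j where j: "n + i = q\<^sup>2 * j" using n by auto
    have n0: "0 < n" using n by auto
    then have j0: "0 < j" using j by (cases j) auto
    have "Z ^ (2 * m) < n" "i \<le> k" using n assms(1) by simp_all
    then have "i \<le> n" using kZ Z_le_Z_2m by linarith
    then have "real (n + i) \<le> 2 * real n" by simp
    then have "1 / real n \<le> 2 / real (n + i)" using n0 by (simp add: field_simps)
    also have "\<dots> = 2 / (real q)\<^sup>2 * (1 / real j)" unfolding j by simp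
    also have "j = (n + i) div q\<^sup>2" using j assms(2) by simp
    finally show "1 / real n \<le> 2 / (real q)\<^sup>2 * (1 / real ((n + i) div q\<^sup>2))" .
  qed
  also have "\<dots> = 2 / (real q)\<^sup>2 * (\<Sum>n\<in>?A. 1 / real ((n + i) div q\<^sup>2))" by (simp only: sum_distrib_left)
  also have "(\<Sum>n\<in>?A. 1 / real ((n + i) div q\<^sup>2)) = (\<Sum>j\<in>(\<lambda>n. (n + i) div q\<^sup>2) ` ?A. 1 / real j)"
  proof (subst sum.reindex)
    show "inj_on (\<lambda>n. (n + i) div q\<^sup>2) ?A"
    proof (rule inj_onI)
      fix n n' assume "n \<in> ?A" "n' \<in> ?A" "(n + i) div q\<^sup>2 = (n' + i) div q\<^sup>2"
      then have "n + i = n' + i" by (metis (no_types, lifting) dvd_mult_div_cancel mem_Collect_eq)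
      then show "n = n'" by simp
    qed
  qed simp
  also have "\<dots> \<le> (\<Sum>j\<in>{1..M}. 1 / real j)"
  proof (rule sum_mono2)
    show "(\<lambda>n. (n + i) div q\<^sup>2) ` ?A \<subseteq> {1..M}"
    proof
      fix j assume "j \<in> (\<lambda>n. (n + i) div q\<^sup>2) ` ?A"
      then obtain n where n: "n \<in> ?A" "j = (n + i) div q\<^sup>2" by auto
      have "j \<le> n + i" using n(2) by (metis div_le_dividend)
      also have "\<dots> \<le> Z ^ (4 * m) + Z ^ m" using n(1) assms(1) kZ Z_m_facts(2) by auto
      also have "\<dots> \<le> Z ^ m * Z ^ (4 * m)"
      proof -
        have "Z ^ m \<le> Z ^ (4 * m)" using Z_m_facts by linarith
        then have "Z ^ (4 * m) + Z ^ m \<le> 2 * Z ^ (4 * m)" by simp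
        also have "\<dots> \<le> Z ^ m * Z ^ (4 * m)" using Z_m_facts(2) Z_ge by (intro mult_right_mono) auto
        finally show ?thesis .
      qed
      also have "\<dots> = M" by (simp add: M_def flip: power_add)
      finally have "j \<le> M" .
      moreover have "0 < j" using n assms(2) by (auto simp: div_greater_zero_iff dvd_imp_le)
      ultimately show "j \<in> {1..M}" by simp
    qed
  qed auto
  also have "\<dots> \<le> 6 * real m * T"
  proof -
    have M1: "1 \<le> M" using Z_ge by (simp add: M_def)
    have "(\<Sum>j\<in>{1..M}. 1 / real j) = 1 + (\<Sum>j\<in>{1<..M}. 1 / real j)"
      using sum_atLeast1_split[OF M1, of "\<lambda>j. 1 / real j"] by simp
    also have "\<dots> \<le> 1 + (ln (real M) - ln (real 1))" by (intro add_left_mono sum_recip_interval_le M1) simp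
    also have "\<dots> = 1 * 1 + 5 * real m * T" unfolding M_def ln_Z_power by simp
    also have "\<dots> \<le> real m * T + 5 * real m * T" using m_pos T_ge by (intro add_right_mono mult_mono) auto
    finally show ?thesis by simp
  qed
  finally show ?thesis by (simp add: mult_left_mono divide_right_mono)
qed

definition sqbad :: "nat \<Rightarrow> bool" where
  "sqbad n \<longleftrightarrow> (\<exists>i\<in>{0..k}. \<exists>q>Z. q\<^sup>2 dvd n + i)"

lemma sqbad_sum:
  "(\<Sum>n\<in>Nset a. mangoldt n / real n * of_bool (sqbad n)) \<le> 48 * real (k + 1) * (real m)\<^sup>2 * T\<^sup>2 / real Z"
proof -
  let ?I = "{Z ^ (2 * m)<..Z ^ (4 * m)}" and ?R = "{Z<..Z ^ (4 * m) + k}"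
  have "(\<Sum>n\<in>Nset a. mangoldt n / real n * of_bool (sqbad n)) \<le> (\<Sum>n\<in>Nset a. 4 * real m * T * (1 / real n * of_bool (sqbad n)))"
  proof (rule sum_mono)
    fix n assume "n \<in> Nset a"
    then have "mangoldt n \<le> 4 * real m * T" by (intro mangoldt_range) (simp add: Nset_def)
    then have "mangoldt n * (1 / real n * of_bool (sqbad n)) \<le> 4 * real m * T * (1 / real n * of_bool (sqbad n))"
      by (intro mult_right_mono) auto
    then show "mangoldt n / real n * of_bool (sqbad n) \<le> 4 * real m * T * (1 / real n * of_bool (sqbad n))" by simp
  qed
  also have "\<dots> = 4 * real m * T * (\<Sum>n\<in>Nset a. 1 / real n * of_bool (sqbad n))" by (simp only: sum_distrib_left)
  also have "(\<Sum>n\<in>Nset a. 1 / real n * of_bool (sqbad n)) \<le> (\<Sum>n\<in>?I. \<Sum>i\<in>{0..k}. \<Sum>q\<in>?R. 1 / real n * of_bool (q\<^sup>2 dvd n + i))"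
  proof -
    have "(\<Sum>n\<in>Nset a. 1 / real n * of_bool (sqbad n)) \<le> (\<Sum>n\<in>?I. 1 / real n * of_bool (sqbad n))"
      by (intro sum_mono2) (auto simp: Nset_def)
    also have "\<dots> \<le> (\<Sum>n\<in>?I. \<Sum>i\<in>{0..k}. \<Sum>q\<in>?R. 1 / real n * of_bool (q\<^sup>2 dvd n + i))"
    proof (rule sum_mono)
      fix n assume n: "n \<in> ?I"
      show "1 / real n * of_bool (sqbad n) \<le> (\<Sum>i\<in>{0..k}. \<Sum>q\<in>?R. 1 / real n * of_bool (q\<^sup>2 dvd n + i))"
      proof (cases "sqbad n")
        case True
        then obtain i q where iq: "i \<in> {0..k}" "Z < q" "q\<^sup>2 dvd n + i" by (auto simp: sqbad_def)
        have "q \<le> q\<^sup>2" by (simp add: power2_nat_le_imp_le)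
        also have "q\<^sup>2 \<le> n + i" using iq(3) n by (intro dvd_imp_le) auto
        also have "\<dots> \<le> Z ^ (4 * m) + k" using n iq by auto
        finally have q: "q \<in> ?R" using iq by simp
        have "1 / real n = 1 / real n * of_bool (q\<^sup>2 dvd n + i)" using iq by simp
        also have "\<dots> \<le> (\<Sum>q\<in>?R. 1 / real n * of_bool (q\<^sup>2 dvd n + i))"
          using q by (intro member_le_sum) auto
        also have "\<dots> \<le> (\<Sum>i\<in>{0..k}. \<Sum>q\<in>?R. 1 / real n * of_bool (q\<^sup>2 dvd n + i))"
          using iq by (intro member_le_sum[of i "{0..k}" "\<lambda>i. \<Sum>q\<in>?R. 1 / real n * of_bool (q\<^sup>2 dvd n + i)"]) (auto intro!: sum_nonneg)
        finally show ?thesis using True by simp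
      next
        case False
        then show ?thesis by (simp add: sum_nonneg)
      qed
    qed
    finally show ?thesis .
  qed
  also have "(\<Sum>n\<in>?I. \<Sum>i\<in>{0..k}. \<Sum>q\<in>?R. 1 / real n * of_bool (q\<^sup>2 dvd n + i)) = (\<Sum>i\<in>{0..k}. \<Sum>q\<in>?R. \<Sum>n\<in>?I. 1 / real n * of_bool (q\<^sup>2 dvd n + i))"
    by (subst sum.swap) (intro sum.cong refl sum.swap)
  also have "\<dots> \<le> (\<Sum>i\<in>{0..k}. \<Sum>q\<in>?R. 12 * real m * T * (1 / (real q)\<^sup>2))"
  proof (intro sum_mono)
    fix i q assume iq: "i \<in> {0..k}" "q \<in> ?R"
    have "(\<Sum>n\<in>?I. 1 / real n * of_bool (q\<^sup>2 dvd n + i)) = (\<Sum>n | n \<in> ?I \<and> q\<^sup>2 dvd n + i. 1 / real n)"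
      by (intro sum.mono_neutral_cong_right) auto
    then show "(\<Sum>n\<in>?I. 1 / real n * of_bool (q\<^sup>2 dvd n + i)) \<le> 12 * real m * T * (1 / (real q)\<^sup>2)"
      using square_divisor_sum[of i q] iq by simp
  qed
  also have "\<dots> = real (k + 1) * (12 * real m * T * (\<Sum>q\<in>?R. 1 / (real q)\<^sup>2))" by (simp add: sum_distrib_left)
  also have "\<dots> \<le> real (k + 1) * (12 * real m * T * (1 / real Z))"
    using T_ge Z_ge by (intro mult_left_mono sum_recip_squares_le) auto
  finally have "(\<Sum>n\<in>Nset a. mangoldt n / real n * of_bool (sqbad n)) \<le> 4 * real m * T * (real (k + 1) * (12 * real m * T * (1 / real Z)))"
    using T_ge by (simp add: mult_left_mono)
  then show ?thesis by (simp add: power2_eq_square mult_ac)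
qed

text \<open>If every admissible \<open>n\<close> of positive weight were \<open>sqbad\<close>, the
  weighted admissible count would be tiny. But \<open>type_one\<close> and
  \<open>type_two_total\<close> keep it within their error bounds of \<open>cc\<close> times the
  full sum, which is at least \<open>cc * M\<close>.\<close>

lemma good_prime_exists:
  assumes a: "coprime a Q"
    and \<sigma>: "4 / real Z ^ 7 * (4 * real m * T)\<^sup>2 + 4 * real m * T / real Z \<le> 16 * C1\<^sup>2 * (real m * La) ^ 3 * cc\<^sup>2 * \<sigma>"
    and main: "M \<le> (\<Sum>p | p \<in> {Z ^ (2 * m)<..Z ^ (4 * m)} \<and> prime p \<and> [p = a] (mod Q). mangoldt p / real p)"
    and num: "48 * \<theta> * cc * (real m)\<^sup>2 * T * La + 4 / real Z ^ 7
       + 32 * C1\<^sup>2 * real m ^ 3 * T * real (totient Q) * La\<^sup>2 * cc * sqrt (err \<sigma>)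
       + 48 * real (k + 1) * (real m)\<^sup>2 * T\<^sup>2 / real Z < cc * M"
  shows "\<exists>p. prime p \<and> p \<in> {Z ^ (2 * m)<..Z ^ (4 * m)} \<and> [p = a] (mod Q)
     \<and> (\<forall>i\<in>{1..k}. \<forall>q. prime q \<longrightarrow> q dvd p + i \<longrightarrow> q \<le> w \<or> Z < q \<and> \<not> q\<^sup>2 dvd p + i)"
proof -
  have "\<exists>n\<in>Nset a. mangoldt n \<noteq> (0::real) \<and> adm n \<and> \<not> sqbad n"
  proof (rule ccontr)
    assume neg: "\<not> (\<exists>n\<in>Nset a. mangoldt n \<noteq> (0::real) \<and> adm n \<and> \<not> sqbad n)"
    have "(\<Sum>n\<in>Nset a. mangoldt n / real n * of_bool (adm n)) \<le> (\<Sum>n\<in>Nset a. mangoldt n / real n * of_bool (sqbad n))"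
      using neg by (intro sum_mono) (auto simp: mangoldt_nonneg)
    also note sqbad_sum
    finally have up: "(\<Sum>n\<in>Nset a. mangoldt n / real n * of_bool (adm n)) \<le> 48 * real (k + 1) * (real m)\<^sup>2 * T\<^sup>2 / real Z" .
    have "M \<le> (\<Sum>n\<in>Nset a. mangoldt n / real n)"
    proof (rule order_trans[OF main sum_mono2])
      show "{p. p \<in> {Z ^ (2 * m)<..Z ^ (4 * m)} \<and> prime p \<and> [p = a] (mod Q)} \<subseteq> Nset a"
      proof
        fix p assume p: "p \<in> {p. p \<in> {Z ^ (2 * m)<..Z ^ (4 * m)} \<and> prime p \<and> [p = a] (mod Q)}"
        have "rough p" unfolding rough_def
        proof (intro ballI notI)
          fix q assume q: "q \<in> PS" "q dvd p"
          then have "q = p" using PS_D(1)[OF q(1)] p primes_dvd_imp_eq by auto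
          then show False using PS_D(3)[OF q(1)] p Z_m_facts by auto
        qed
        then show "p \<in> Nset a" using p by (simp add: Nset_def)
      qed
    qed (auto simp: mangoldt_nonneg)
    then have "cc * M \<le> cc * (\<Sum>n\<in>Nset a. mangoldt n / real n)" using cc_bounds by (intro mult_left_mono) auto
    moreover have "(\<Sum>n\<in>Nset a. mangoldt n / real n * of_bool (adm n)) = (\<Sum>n\<in>Nset a. mangoldt n / real n * D n) + cc * (\<Sum>n\<in>Nset a. mangoldt n / real n)"
      unfolding sum_distrib_left sum.distrib[symmetric] D_def by (intro sum.cong refl) (simp add: algebra_simps)
    moreover have "(\<Sum>n\<in>Nset a. mangoldt n / real n * D n) = (\<Sum>n\<in>Nset a. ln (real n) / real n * D n) - (\<Sum>n\<in>Nset a. \<Sum>l | l dvd n \<and> 1 < l \<and> l < n. mangoldt l / real n * D n)"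
      unfolding sum_subtractf[symmetric]
    proof (rule sum.cong)
      fix n assume n: "n \<in> Nset a"
      then have "Z ^ (2 * m) < n" by (simp add: Nset_def)
      then have n1: "1 < n" using Z_le_Z_2m Z_ge by linarith
      have "ln (real n) = (\<Sum>l | l dvd n. mangoldt l)" using mangoldt_sum[of n, where 'a = real] n1 by simp
      also have "{l. l dvd n} = insert 1 (insert n {l. l dvd n \<and> 1 < l \<and> l < n})"
      proof (intro equalityI subsetI)
        fix l assume "l \<in> {l. l dvd n}"
        then have "l dvd n" "l \<le> n" "l \<noteq> 0" using n1 by (auto intro: dvd_imp_le Nat.gr0I)
        then show "l \<in> insert 1 (insert n {l. l dvd n \<and> 1 < l \<and> l < n})" by auto
      qed auto
      also have "(\<Sum>l\<in>insert 1 (insert n {l. l dvd n \<and> 1 < l \<and> l < n}). mangoldt l) = mangoldt n + (\<Sum>l | l dvd n \<and> 1 < l \<and> l < n. mangoldt l)"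
        using n1 by simp
      finally have "mangoldt n = ln (real n) - (\<Sum>l | l dvd n \<and> 1 < l \<and> l < n. mangoldt l)" by simp
      then show "mangoldt n / real n * D n = ln (real n) / real n * D n - (\<Sum>l | l dvd n \<and> 1 < l \<and> l < n. mangoldt l / real n * D n)"
        by (simp add: diff_divide_distrib left_diff_distrib sum_divide_distrib sum_distrib_right)
    qed simp
    ultimately show False
      using up num type_one[of a] type_two_total[OF a \<sigma>] by linarith
  qed
  then obtain n where n: "n \<in> Nset a" "mangoldt n \<noteq> (0::real)" "adm n" "\<not> sqbad n" by blast
  obtain p e where pe: "prime p" "e > 0" "n = p ^ e" using mangoldt_support[OF n(2)] .
  have nN: "n \<in> {Z ^ (2 * m)<..Z ^ (4 * m)}" "[n = a] (mod Q)" "rough n" using n(1) by (auto simp: Nset_def)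
  have pn: "p dvd n" using pe by simp
  have "p > Z" using rough_factor_large[OF nN(3) coprime_of_class[OF nN(2) a] pn] prime_gt_1_nat[OF pe(1)] by simp
  have "e = 1"
  proof (rule ccontr)
    assume "e \<noteq> 1"
    then have "2 \<le> e" using pe(2) by linarith
    then have "p\<^sup>2 dvd n + 0" unfolding pe(3) by (simp add: le_imp_power_dvd)
    then have "sqbad n" unfolding sqbad_def using \<open>p > Z\<close> by (intro bexI[of _ 0] exI[of _ p]) auto
    then show False using n(4) by simp
  qed
  then have "prime n" using pe by simp
  moreover have "q \<le> w \<or> Z < q \<and> \<not> q\<^sup>2 dvd n + i" if i: "i \<in> {1..k}" and q: "prime q" "q dvd n + i" for i q
  proof (cases "q \<le> w")
    case False
    have "rough (n + i)" using n(3) i by (simp add: adm_def)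
    then have "q \<notin> PS" using q by (auto simp: rough_def)
    then have "Z < q" using q(1) False by (auto simp: PS_def primes_in_def)
    moreover have "\<not> q\<^sup>2 dvd n + i" using n(4) i \<open>Z < q\<close> by (auto simp: sqbad_def)
    ultimately show ?thesis by simp
  qed simp
  ultimately show ?thesis using nN by blast
qed

section \<open>Numerical balance and choice of the parameters\<close>

text \<open>The primes dividing \<open>Q\<close> are exactly those up to \<open>w\<close>, so
  \<open>VR * totient Q / Q\<close> is Mertens' product over all primes up to \<open>Z\<close>,
  whose logarithm is \<open>T\<close>. This makes the factor \<open>totient Q * La ^ 2\<close> of
  the bilinear bound comparable with the \<open>1 / totient Q\<close> of the main term.\<close>

lemma La_le: "La \<le> 1 / real (totient Q)"
proof -
  have "La * real (totient Q) = T * VR * (\<Prod>p\<in>prime_factors Q. 1 - 1 / real p)"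
    using Q unfolding La_def totient_formula2 by simp
  also have "\<dots> = T * (VR * (\<Prod>p | prime p \<and> p \<le> w. 1 - 1 / real p))"
  proof -
    have "prime_factors Q = {p. prime p \<and> p \<le> w}" using Q_primes Q by (auto simp: prime_factors_dvd)
    then show ?thesis by simp
  qed
  also have "VR * (\<Prod>p | prime p \<and> p \<le> w. 1 - 1 / real p) = (\<Prod>p | prime p \<and> p \<le> Z. 1 - 1 / real p)"
    unfolding VR_def
  proof (subst prod.union_disjoint[symmetric])
    show "PS \<inter> {p. prime p \<and> p \<le> w} = {}" by (auto simp: PS_def primes_in_def)
    show "prod (\<lambda>p. 1 - 1 / real p) (PS \<union> {p. prime p \<and> p \<le> w}) = (\<Prod>p | prime p \<and> p \<le> Z. 1 - 1 / real p)"
      using Z_ge(3) by (intro prod.cong) (auto simp: PS_def primes_in_def)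
    show "finite {p. prime p \<and> p \<le> w}" by (rule finite_subset[of _ "{..w}"]) auto
  qed simp
  also have "T * \<dots> \<le> 1" unfolding T_def using Z_ge by (intro mertens_product_le) simp
  finally show ?thesis using Q by (simp add: field_simps)
qed

text \<open>Bookkeeping in units of \<open>G = m * T / (4 * totient Q)\<close>: the primes
  contribute \<open>8 * G\<close> up to constants, which take at most \<open>G\<close>;
  \<open>type_one\<close> and \<open>type_two_total\<close> lose at most \<open>cc * G\<close> each,
  and the remaining terms less than that. The square root of \<open>x\<^sub>0\<close> is exactly
  what turns the bilinear bound, after \<open>La_le\<close>, into \<open>cc * G\<close>.\<close>

lemma good_prime_numeric:
  fixes C\<^sub>0 C\<^sub>1 x\<^sub>0 :: real
  assumes a: "coprime a Q"
    and C0: "\<And>N. N \<ge> 1 \<Longrightarrow> \<bar>(\<Sum>n | n \<in> {1..N} \<and> [n = a] (mod Q). mangoldt n / real n) - ln (real N) / real (totient Q)\<bar> \<le> C\<^sub>0"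
    and Cn: "\<And>N::nat. (\<Sum>n | n \<in> {1..N} \<and> \<not> prime n. mangoldt n / real n) \<le> C\<^sub>1"
    and x0: "x\<^sub>0 = (1 / (128 * C1\<^sup>2 * (real m)\<^sup>2))\<^sup>2"
    and h1: "3 * \<theta> \<le> x\<^sub>0 / 4" and h2: "48 * \<theta> * real m \<le> 1 / 4" and h3: "exp (8 * real k ^ 3 / real w) - 1 \<le> x\<^sub>0 / 4"
    and h4: "\<rho>0 \<le> x\<^sub>0 / 4"
    and h5: "4 / real Z ^ 7 * (4 * real m * T)\<^sup>2 + 4 * real m * T / real Z \<le> 16 * C1\<^sup>2 * (real m * La) ^ 3 * cc\<^sup>2 * (x\<^sub>0 / 4)"
    and h6: "2 * C\<^sub>0 + C\<^sub>1 \<le> real m * T / (4 * real (totient Q))"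
    and h7: "4 / real Z ^ 7 + 48 * real (k + 1) * (real m)\<^sup>2 * T\<^sup>2 / real Z < cc * (real m * T / (4 * real (totient Q)))"
  shows "\<exists>p. prime p \<and> p \<in> {Z ^ (2 * m)<..Z ^ (4 * m)} \<and> [p = a] (mod Q)
     \<and> (\<forall>i\<in>{1..k}. \<forall>q. prime q \<longrightarrow> q dvd p + i \<longrightarrow> q \<le> w \<or> Z < q \<and> \<not> q\<^sup>2 dvd p + i)"
proof (rule good_prime_exists[OF a h5])
  let ?X = "Z ^ (2 * m)" and ?Y = "Z ^ (4 * m)"
  let ?\<phi> = "real (totient Q)" and ?f = "\<lambda>n. mangoldt n / real n"
  define G where "G = real m * T / (4 * ?\<phi>)"
  have \<phi>: "?\<phi> > 0" using Q by simp
  have mT: "real m * T > 0" using m_pos T_ge by simp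
  show "2 * real m * T / ?\<phi> - (2 * C\<^sub>0 + C\<^sub>1) \<le> (\<Sum>p | p \<in> {?X<..?Y} \<and> prime p \<and> [p = a] (mod Q). ?f p)"
  proof -
    define A where "A = {n \<in> {1..?Y}. [n = a] (mod Q)}"
    have XY: "1 \<le> ?X" "?X \<le> ?Y" "1 \<le> ?Y" using Z_m_facts Z_ge by auto
    \<comment> \<open>The primes of the range are what remains of the progression up to
      \<open>?Y\<close> after discarding the part up to \<open>?X\<close> and all nonprimes.\<close>
    have "(\<Sum>n\<in>A. ?f n) \<le> (\<Sum>n\<in>{n \<in> {1..?X}. [n = a] (mod Q)} \<union> ({n \<in> {1..?Y}. \<not> prime n} \<union> {p. p \<in> {?X<..?Y} \<and> prime p \<and> [p = a] (mod Q)}). ?f n)"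
      by (intro sum_mono2) (auto simp: A_def mangoldt_nonneg)
    also have "\<dots> \<le> (\<Sum>n | n \<in> {1..?X} \<and> [n = a] (mod Q). ?f n) + ((\<Sum>n | n \<in> {1..?Y} \<and> \<not> prime n. ?f n)
        + (\<Sum>p | p \<in> {?X<..?Y} \<and> prime p \<and> [p = a] (mod Q). ?f p))"
    proof -
      have U: "sum ?f (S \<union> S') \<le> sum ?f S + sum ?f S'" if "finite S" "finite S'" for S S' :: "nat set"
        unfolding sum.union_inter[OF that, symmetric] by (simp add: sum_nonneg mangoldt_nonneg)
      show ?thesis by (intro order_trans[OF U] add_mono order_refl) auto
    qed
    finally have "(\<Sum>n | n \<in> {1..?Y} \<and> [n = a] (mod Q). ?f n) \<le> (\<Sum>n | n \<in> {1..?X} \<and> [n = a] (mod Q). ?f n) + ((\<Sum>n | n \<in> {1..?Y} \<and> \<not> prime n. ?f n)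
        + (\<Sum>p | p \<in> {?X<..?Y} \<and> prime p \<and> [p = a] (mod Q). ?f p))" unfolding A_def .
    moreover have "4 * real m * T / ?\<phi> = ln (real ?Y) / ?\<phi>" "2 * real m * T / ?\<phi> = ln (real ?X) / ?\<phi>"
      unfolding ln_Z_power by simp_all
    moreover have "4 * real m * T / ?\<phi> = 2 * real m * T / ?\<phi> + 2 * real m * T / ?\<phi>" by (simp flip: add_divide_distrib)
    moreover have "t2 - (2 * C\<^sub>0 + C\<^sub>1) \<le> P"
      if "SY \<le> SX + (N + P)" "t4 = lY" "t2 = lX" "t4 = t2 + t2" "\<bar>SX - lX\<bar> \<le> C\<^sub>0" "\<bar>SY - lY\<bar> \<le> C\<^sub>0" "N \<le> C\<^sub>1"
      for SY SX N P t4 t2 lY lX using that by linarith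
    ultimately show ?thesis using C0[OF XY(1)] C0[OF XY(3)] Cn[of ?Y] by blast
  qed
  have La: "0 < La" "La \<le> 1 / ?\<phi>" using La_pos La_le by auto
  have "48 * \<theta> * cc * (real m)\<^sup>2 * T * La = (48 * \<theta> * real m) * La * (cc * (real m * T))" by (simp add: power2_eq_square)
  also have "\<dots> \<le> 1 / 4 * (1 / ?\<phi>) * (cc * (real m * T))"
    using La mT cc_bounds h2 \<theta> by (intro mult_right_mono mult_mono) auto
  also have "\<dots> = cc * G" by (simp add: G_def)
  finally have 1: "48 * \<theta> * cc * (real m)\<^sup>2 * T * La \<le> cc * G" .
  define y where "y = 128 * C1\<^sup>2 * (real m)\<^sup>2"
  have y: "y > 0" using C1_ge m_pos by (simp add: y_def)
  have e0: "0 \<le> err (x\<^sub>0 / 4)" using \<theta> by (simp add: err_def x0 \<rho>0_def)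
  have "err (x\<^sub>0 / 4) \<le> x\<^sub>0" using h1 h3 h4 by (simp add: err_def)
  then have "sqrt (err (x\<^sub>0 / 4)) \<le> sqrt x\<^sub>0" by simp
  also have "\<dots> = 1 / y" using y by (simp add: x0 y_def)
  finally have s: "sqrt (err (x\<^sub>0 / 4)) \<le> 1 / y" .
  have "32 * C1\<^sup>2 * real m ^ 3 * T * ?\<phi> * La\<^sup>2 * cc * sqrt (err (x\<^sub>0 / 4)) \<le> 32 * C1\<^sup>2 * real m ^ 3 * T * ?\<phi> * (1 / ?\<phi>)\<^sup>2 * cc * (1 / y)"
    using s La T_ge C1_ge cc_bounds(1) \<phi> y e0 by (intro mult_mono mult_right_mono mult_left_mono power_mono mult_nonneg_nonneg) auto
  also have "\<dots> = cc * G" using \<phi> C1_ge m_pos by (simp add: G_def y_def power2_eq_square power3_eq_cube field_simps)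
  finally have 2: "32 * C1\<^sup>2 * real m ^ 3 * T * ?\<phi> * La\<^sup>2 * cc * sqrt (err (x\<^sub>0 / 4)) \<le> cc * G" .
  have "cc * (3 * G) \<le> cc * (2 * real m * T / ?\<phi> - (2 * C\<^sub>0 + C\<^sub>1))"
  proof (intro mult_left_mono)
    have "2 * real m * T / ?\<phi> = 8 * G" by (simp add: G_def)
    moreover have "2 * C\<^sub>0 + C\<^sub>1 \<le> G" using h6 by (simp add: G_def)
    moreover have "G > 0" using mT \<phi> by (simp add: G_def)
    ultimately show "3 * G \<le> 2 * real m * T / ?\<phi> - (2 * C\<^sub>0 + C\<^sub>1)" by linarith
  qed (use cc_bounds in simp)
  then show "48 * \<theta> * cc * (real m)\<^sup>2 * T * La + 4 / real Z ^ 7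
       + 32 * C1\<^sup>2 * real m ^ 3 * T * real (totient Q) * La\<^sup>2 * cc * sqrt (err (x\<^sub>0 / 4))
       + 48 * real (k + 1) * (real m)\<^sup>2 * T\<^sup>2 / real Z < cc * (2 * real m * T / ?\<phi> - (2 * C\<^sub>0 + C\<^sub>1))"
    using 1 2 h7 unfolding G_def[symmetric] by linarith
qed

lemma T_eq: "T = 2 ^ J * ln (real w)"
  unfolding T_def Z_def using w_ge by (simp add: ln_realpow)

lemma Z_exp: "real Z = exp T" "real Z1 = exp (T / 512)"
proof -
  show "real Z = exp T" unfolding T_def using Z_ge by simp
  have "T = 512 * ln (real Z1)" unfolding T_def Z_eq using Z1_ge by (simp add: ln_realpow)
  then show "real Z1 = exp (T / 512)" using Z1_ge by simp
qed

lemma exp_J_le: "exp (20 * real n * real J) \<le> T ^ (40 * n)"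
  using exp_le_power_two_power[OF w_ge] unfolding T_eq .

lemma cc_ge_T: "1 / T ^ (40 * (k + 1)) \<le> cc"
proof -
  have "1 / T ^ (40 * (k + 1)) \<le> 1 / exp (20 * real (k + 1) * real J)"
    using exp_J_le[of "k + 1"] T_ge by (intro divide_left_mono) auto
  also have "\<dots> = exp (- 20 * real (k + 1) * real J)"
  proof -
    have "- 20 * real (k + 1) * real J = - (20 * real (k + 1) * real J)" by (simp add: algebra_simps)
    then show ?thesis by (simp only: exp_minus inverse_eq_divide)
  qed
  also have "\<dots> \<le> cc" by (rule cc_bounds(3))
  finally show ?thesis .
qed

lemma La_ge_T: "1 / (real Q * T ^ 40) \<le> La"
proof -
  have "1 / T ^ 40 \<le> 1 / exp (20 * real J)"
    using exp_J_le[of 1] T_ge by (intro divide_left_mono) auto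
  also have "\<dots> \<le> VR" using V_bounds(1) by (simp add: exp_minus field_simps)
  also have "\<dots> \<le> T * VR" using T_ge VR_pos by simp
  finally show ?thesis using Q unfolding La_def by (simp add: field_simps)
qed

end

lemma eventually_power_le_exp: "eventually (\<lambda>T::real. C * T ^ N \<le> exp (T / 1024)) at_top"
proof -
  have "((\<lambda>T::real. (T / 1024) ^ N / exp (T / 1024)) \<longlongrightarrow> 0) at_top"
    by (rule filterlim_compose[OF tendsto_power_div_exp_0]) real_asymp
  then have "eventually (\<lambda>T. (T / 1024) ^ N / exp (T / 1024) < 1 / ((\<bar>C\<bar> + 1) * 1024 ^ N)) at_top"
    by (rule order_tendstoD) (simp add: add_nonneg_pos)
  then show ?thesis using eventually_ge_at_top[of 0]
  proof eventually_elim
    case (elim T)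
    define K where "K = (\<bar>C\<bar> + 1) * 1024 ^ N"
    have K: "K > 0" by (simp add: K_def add_nonneg_pos)
    have "(T / 1024) ^ N * K < exp (T / 1024)" using elim(1) K unfolding K_def[symmetric] by (simp add: pos_less_divide_eq pos_divide_less_eq)
    moreover have "(T / 1024) ^ N * K = (\<bar>C\<bar> + 1) * T ^ N" by (simp add: K_def power_divide)
    ultimately have "(\<bar>C\<bar> + 1) * T ^ N \<le> exp (T / 1024)" by linarith
    moreover have "C * T ^ N \<le> (\<bar>C\<bar> + 1) * T ^ N" using elim by (intro mult_right_mono) auto
    ultimately show ?case by linarith
  qed
qed

lemma eventually_sqrt_exp_small:
  assumes "\<epsilon> > 0"
  shows "eventually (\<lambda>T::real. exp (c * sqrt (d * T)) / sqrt (exp (T / 512)) \<le> \<epsilon>) at_top"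
proof -
  define a where "a = c * sqrt d"
  have "eventually (\<lambda>T::real. 1 / \<epsilon> \<le> exp (T / 2048)) at_top"
    by (rule filterlim_at_top[THEN iffD1, rule_format]) real_asymp
  then show ?thesis using eventually_ge_at_top[of "(2048 * a)\<^sup>2"]
  proof eventually_elim
    case (elim T)
    have T: "0 \<le> T" using elim(2) zero_le_power2[of "2048 * a"] by linarith
    have "2048 * a \<le> sqrt T" using elim(2) by (intro real_le_rsqrt)
    then have "2048 * a * sqrt T \<le> sqrt T * sqrt T" using T by (intro mult_right_mono) auto
    then have 1: "c * sqrt (d * T) \<le> T / 2048" using T by (simp add: a_def real_sqrt_mult mult_ac)
    have "sqrt (exp (T / 512)) = exp (T / 1024)"
      by (rule real_sqrt_unique) (simp_all add: power2_eq_square flip: exp_add)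
    then have "exp (c * sqrt (d * T)) / sqrt (exp (T / 512)) = exp (c * sqrt (d * T) - T / 1024)" by (simp add: exp_diff)
    also have "\<dots> \<le> exp (- (T / 2048))" using 1 by simp
    also have "\<dots> \<le> \<epsilon>" using elim(1) assms by (simp add: exp_minus field_simps)
    finally show ?case .
  qed
qed

text \<open>The tolerance for the sieve error shrinks like the fourth power of
  \<open>1 / (8 * b + 20)\<close>, which cannot compete with the decay of
  \<open>4 ^ (-b)\<close>.\<close>

lemma sieve_constant_exists:
  fixes E c :: real
  assumes "E \<ge> 0" and c: "c > 0"
  shows "\<exists>b. E / 4 ^ b \<le> 1 \<and> 3 * (E / 4 ^ b) \<le> (1 / (128 * c\<^sup>2 * (real (8 * b + 20))\<^sup>2))\<^sup>2 / 4 \<and> 48 * (E / 4 ^ b) * real (8 * b + 20) \<le> 1 / 4"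
proof -
  \<comment> \<open>\<open>192 = 4 * 48\<close> comes from the third condition and
    \<open>12 = 3 * 4\<close> from the second, so that one limit settles all three.\<close>
  define G where "G = 192 + 12 * (128 * c\<^sup>2)\<^sup>2"
  have "((\<lambda>b::nat. E * G * ((8 * real b + 20) ^ 4 / 4 ^ b)) \<longlongrightarrow> E * G * 0) at_top"
    by (intro tendsto_mult tendsto_const) real_asymp
  then have "eventually (\<lambda>b::nat. E * G * ((8 * real b + 20) ^ 4 / 4 ^ b) < 1) at_top"
    by (rule order_tendstoD) simp
  then obtain b where b: "E * G * ((8 * real b + 20) ^ 4 / 4 ^ b) < 1" by (auto simp: eventually_sequentially)
  define D where "D = E / 4 ^ b"
  define M where "M = real (8 * b + 20)"
  have M: "1 \<le> M" by (simp add: M_def)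
  have D: "0 \<le> D" using assms by (simp add: D_def)
  have DG: "D * M ^ 4 * G < 1" using b by (simp add: D_def M_def mult_ac)
  have M4: "1 \<le> M ^ 4" "M \<le> M ^ 4" using M power_increasing[of 1 4 M] by (simp_all add: one_le_power)
  have G: "192 \<le> G" "12 * (128 * c\<^sup>2)\<^sup>2 \<le> G" by (simp_all add: G_def)
  have A: "D * M ^ 4 * x < 1" if "x \<le> G" for x
    using mult_left_mono[OF that, of "D * M ^ 4"] D M DG by simp
  have "D * M * 192 \<le> D * M ^ 4 * 192" using D M4 by (intro mult_right_mono mult_left_mono) auto
  then have "D * M * 192 < 1" using A[OF G(1)] by linarith
  moreover have "D \<le> D * M" using D M by (simp add: mult_le_cancel_left1)
  ultimately have "D \<le> 1" "48 * D * M \<le> 1 / 4" by linarith+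
  moreover have "3 * D \<le> (1 / (128 * c\<^sup>2 * M\<^sup>2))\<^sup>2 / 4"
  proof -
    have "D * (12 * (128 * c\<^sup>2 * M\<^sup>2)\<^sup>2) \<le> 1" using A[OF G(2)] by (simp add: power_mult_distrib mult_ac)
    moreover have "0 < (128 * c\<^sup>2 * M\<^sup>2)\<^sup>2" using c M by simp
    ultimately show ?thesis by (simp add: power_one_over field_simps)
  qed
  ultimately show ?thesis unfolding D_def M_def by blast
qed

text \<open>The order of the quantifiers is the point: \<open>C\<close> and \<open>w0\<close> depend
  on \<open>k\<close> alone, \<open>B\<close> may be chosen in terms of \<open>C\<close>, and only
  \<open>J\<close> adapts to \<open>Q\<close>, \<open>a\<close> and \<open>B\<close>. Prime factors
  of \<open>p + i\<close> above \<open>w\<close> exceed \<open>Z\<close>, and \<open>p + i\<close>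
  is at most \<open>Z ^ (5 * m)\<close>, hence \<open>C = 5 * m\<close>.\<close>

lemma sieve_primes:
  fixes k :: nat
  assumes k: "k \<ge> 1"
  shows "\<exists>C w0 :: nat. \<forall>w\<ge>w0. \<forall>Q a B. Q > 0 \<longrightarrow> (\<forall>p. prime p \<longrightarrow> (p dvd Q \<longleftrightarrow> p \<le> w)) \<longrightarrow> coprime a Q \<longrightarrow>
    (\<exists>p. prime p \<and> [p = a] (mod Q) \<and> (\<forall>i\<in>{1..k}. card {q. prime q \<and> w < q \<and> q dvd p + i} \<le> C
      \<and> (\<forall>q. prime q \<longrightarrow> q dvd p + i \<longrightarrow> q \<le> w \<or> B < q \<and> \<not> q\<^sup>2 dvd p + i)))"
proof -
  define c where "c = C1"
  have c: "c > 0" using C1_ge by (simp add: c_def)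
  obtain b where b: "exp (40 * real (2 * k + 1)) / 4 ^ b \<le> 1"
    "3 * (exp (40 * real (2 * k + 1)) / 4 ^ b) \<le> (1 / (128 * c\<^sup>2 * (real (8 * b + 20))\<^sup>2))\<^sup>2 / 4"
    "48 * (exp (40 * real (2 * k + 1)) / 4 ^ b) * real (8 * b + 20) \<le> 1 / 4"
    using sieve_constant_exists[OF _ c, of "exp (40 * real (2 * k + 1))"] by auto
  define m where "m = 8 * b + 20"
  define x0 where "x0 = (1 / (128 * c\<^sup>2 * (real m)\<^sup>2))\<^sup>2"
  have x0: "x0 > 0" using c by (simp add: x0_def m_def)
  have "((\<lambda>w::nat. exp (8 * real k ^ 3 / real w) - 1) \<longlongrightarrow> 0) at_top" by real_asymp
  then have "eventually (\<lambda>w::nat. exp (8 * real k ^ 3 / real w) - 1 < x0 / 4) at_top"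
    by (rule order_tendstoD) (use x0 in simp)
  then obtain w1 where w1: "\<And>w. w \<ge> w1 \<Longrightarrow> exp (8 * real k ^ 3 / real w) - 1 < x0 / 4"
    by (auto simp: eventually_sequentially)
  have "\<exists>p. prime p \<and> [p = a] (mod Q) \<and> (\<forall>i\<in>{1..k}. card {q. prime q \<and> w < q \<and> q dvd p + i} \<le> 5 * m
      \<and> (\<forall>q. prime q \<longrightarrow> q dvd p + i \<longrightarrow> q \<le> w \<or> B < q \<and> \<not> q\<^sup>2 dvd p + i))"
    if w: "w \<ge> max (4 * k + 2) w1" and Q: "Q > 0" and QP: "\<forall>p. prime p \<longrightarrow> (p dvd Q \<longleftrightarrow> p \<le> w)" and a: "coprime a Q"
    for w Q a B :: nat
  proof -
    obtain C0 where C0: "\<And>N. N \<ge> 1 \<Longrightarrow> \<bar>(\<Sum>n | n \<in> {1..N} \<and> [n = a] (mod Q). mangoldt n / real n) - ln (real N) / real (totient Q)\<bar> \<le> C0"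
      using mertens_progression[OF Q a] by auto
    obtain Cn where Cn: "\<And>N::nat. (\<Sum>n | n \<in> {1..N} \<and> \<not> prime n. mangoldt n / real n) \<le> Cn"
      using mangoldt_nonprime_bounded by auto
    define \<phi> where "\<phi> = real (totient Q)"
    have \<phi>: "\<phi> > 0" using Q by (simp add: \<phi>_def)
    \<comment> \<open>The powers of \<open>T\<close> lost in the lower bounds for
      \<open>La ^ 3\<close> and for the square of \<open>cc\<close>: \<open>3 * 40\<close> and
      \<open>2 * 40 * (k + 1)\<close>.\<close>
    define N where "N = 120 + 80 * (k + 1)"
    define H where "H = 16 * c\<^sup>2 * (real m) ^ 3 * (x0 / 4) / real Q ^ 3"
    have m0: "real m > 0" by (simp add: m_def)
    have H: "H > 0" using c m0 x0 Q by (simp add: H_def)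
    \<comment> \<open>The summand \<open>1\<close> makes the last inequality strict.\<close>
    define H' where "H' = (4 + 48 * real (k + 1) * (real m)\<^sup>2) / (real m / (4 * \<phi>)) + 1"
    \<comment> \<open>All conditions on \<open>J\<close> are expressed through
      \<open>T = 2 ^ J * ln w\<close>, because each of them holds for every large \<open>T\<close>.
      The factor \<open>T ^ 0\<close> only gives the condition on \<open>B\<close> the shape of
      \<open>eventually_power_le_exp\<close>.\<close>
    define good where "good = (\<lambda>T. 1 \<le> T \<and> real Q * T ^ 40 \<le> exp (T / 1024)
      \<and> exp (8 * real k * sqrt (10 * (real k)\<^sup>2 * real m * T)) / sqrt (exp (T / 512)) \<le> x0 / 4
      \<and> 68 * (real m)\<^sup>2 / H * T ^ (N + 2) \<le> exp (T / 1024) \<and> (2 * C0 + Cn) * (4 * \<phi>) / real m \<le> T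
      \<and> H' * T ^ (40 * (k + 1) + 2) \<le> exp (T / 1024) \<and> real B * T ^ 0 \<le> exp (T / 1024))"
    have "eventually good at_top"
      unfolding good_def by (intro eventually_conj eventually_ge_at_top eventually_power_le_exp eventually_sqrt_exp_small) (use x0 in simp)
    moreover have "filterlim (\<lambda>J::nat. 2 ^ J * ln (real w)) at_top at_top"
    proof -
      have "ln (real w) > 0" using w k by (intro ln_gt_zero) simp
      then show ?thesis by real_asymp
    qed
    ultimately have "eventually (\<lambda>J::nat. good (2 ^ J * ln (real w))) at_top" by (rule eventually_compose_filterlim)
    then have "eventually (\<lambda>J::nat. good (2 ^ J * ln (real w)) \<and> 9 \<le> J) at_top"
      by (intro eventually_conj eventually_ge_at_top)
    then obtain J where J: "good (2 ^ J * ln (real w))" "9 \<le> J" by (auto simp: eventually_sequentially)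
    have w6: "6 \<le> w" using w k by simp
    have lnw: "real w > 0" using w6 by simp
    note bJ = b and wJ = w and JJ = J(1)
    interpret sieve_setup k w b J m Q
    proof
      have "real (w ^ 2 ^ (J - 9)) ^ 3 = exp (ln (real w)) ^ (2 ^ (J - 9) * 3)" using lnw by (simp add: power_mult)
      also have "\<dots> = exp (3 * (2 ^ (J - 9) * ln (real w)))" unfolding exp_of_nat_mult[symmetric] by (simp add: mult_ac)
      also have "3 * (2 ^ (J - 9) * ln (real w)) = 3 * (2 ^ J * ln (real w) / 512)"
        using J(2) power_add[of "2::real" "J - 9" 9] by simp
      finally have 1: "real (w ^ 2 ^ (J - 9)) ^ 3 = exp (3 * (2 ^ J * ln (real w) / 512))" .
      have "real Q * exp (20 * real J) \<le> real Q * (2 ^ J * ln (real w)) ^ 40"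
        using exp_le_power_two_power[OF w6, of 1 J] by (simp add: mult_left_mono)
      also have "\<dots> \<le> exp (2 ^ J * ln (real w) / 1024)" using J(1) by (simp add: good_def)
      also have "\<dots> \<le> exp (3 * (2 ^ J * ln (real w) / 512))"
      proof -
        have "exp (x / 1024) \<le> exp (3 * (x / 512))" if "1 \<le> x" for x :: real using that by simp
        then show ?thesis using J(1) unfolding good_def by blast
      qed
      finally show "real Q * exp (20 * real J) \<le> real (w ^ 2 ^ (J - 9)) ^ 3" unfolding 1 .
      show "k \<ge> 1" "4 * k + 2 \<le> w" "Q > 0" "9 \<le> J" using k w Q J by auto
      show "p dvd Q \<longleftrightarrow> p \<le> w" if "prime p" for p using QP that by blast
      show "exp (40 * real (2 * k + 1)) / 4 ^ b \<le> 1" by (rule b(1))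
      show "8 * b + 20 \<le> m" by (simp add: m_def)
    qed
    have g: "good T" using JJ by (simp only: T_eq)
    have T1: "1 \<le> T" by (rule T_ge)
    have Z7: "1 / real Z ^ 7 \<le> 1 / exp T"
    proof -
      have "real Z ^ 1 \<le> real Z ^ 7" using Z_ge by (intro power_increasing) auto
      then show ?thesis unfolding Z_exp by (simp add: frac_le)
    qed
    have ET: "exp (T / 1024) \<le> exp T" using T1 by simp
    have "\<exists>p. prime p \<and> p \<in> {Z ^ (2 * m)<..Z ^ (4 * m)} \<and> [p = a] (mod Q)
       \<and> (\<forall>i\<in>{1..k}. \<forall>q. prime q \<longrightarrow> q dvd p + i \<longrightarrow> q \<le> w \<or> Z < q \<and> \<not> q\<^sup>2 dvd p + i)"
    proof (rule good_prime_numeric[OF a C0 Cn x0_def[unfolded c_def]])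
      show "3 * \<theta> \<le> x0 / 4" "48 * \<theta> * real m \<le> 1 / 4" using bJ by (simp_all add: \<theta>_def m_def x0_def)
      show "exp (8 * real k ^ 3 / real w) - 1 \<le> x0 / 4" using w1[of w] wJ by simp
      show "\<rho>0 \<le> x0 / 4" using g by (simp add: \<rho>0_def Z_exp good_def)
      show "2 * C0 + Cn \<le> real m * T / (4 * real (totient Q))"
        using g m0 \<phi> by (simp add: good_def \<phi>_def field_simps)
      show "4 / real Z ^ 7 * (4 * real m * T)\<^sup>2 + 4 * real m * T / real Z \<le> 16 * C1\<^sup>2 * (real m * La) ^ 3 * cc\<^sup>2 * (x0 / 4)"
      proof -
        define y where "y = (real m)\<^sup>2 * T\<^sup>2 * (1 / exp T)"
        have "4 / real Z ^ 7 * (4 * real m * T)\<^sup>2 = 64 * (real m)\<^sup>2 * T\<^sup>2 * (1 / real Z ^ 7)" by (simp add: power2_eq_square)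
        also have "\<dots> \<le> 64 * (real m)\<^sup>2 * T\<^sup>2 * (1 / exp T)" by (intro mult_left_mono Z7) auto
        also have "\<dots> = 64 * y" by (simp add: y_def)
        finally have 1: "4 / real Z ^ 7 * (4 * real m * T)\<^sup>2 \<le> 64 * y" .
        have 2: "4 * real m * T / real Z \<le> 4 * y"
        proof -
          have "1 * 1 \<le> real m * T" using T1 m_pos by (intro mult_mono) auto
          then have "1 * (real m * T) \<le> (real m * T) * (real m * T)" by (intro mult_right_mono) auto
          then show ?thesis by (simp add: y_def Z_exp power2_eq_square divide_right_mono mult_ac)
        qed
        have "4 / real Z ^ 7 * (4 * real m * T)\<^sup>2 + 4 * real m * T / real Z \<le> 68 * y"
          using 1 2 by linarith
        also have "68 * y = 68 * (real m)\<^sup>2 * T\<^sup>2 * (1 / exp T)" by (simp add: y_def)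
        also have "\<dots> \<le> H * (1 / T ^ N)"
        proof -
          have "68 * (real m)\<^sup>2 / H * T ^ (N + 2) \<le> exp T" using g ET unfolding good_def by linarith
          then show ?thesis using H T1 by (simp add: field_simps power_add power2_eq_square)
        qed
        also have "\<dots> = 16 * c\<^sup>2 * (real m * (1 / (real Q * T ^ 40))) ^ 3 * (1 / T ^ (40 * (k + 1)))\<^sup>2 * (x0 / 4)"
        proof -
          have "T ^ N = (T ^ 40) ^ 3 * (T ^ (40 * (k + 1)))\<^sup>2"
            unfolding N_def by (simp flip: power_mult power_add)
          then show ?thesis by (simp add: H_def power_mult_distrib power_divide)
        qed
        also have "\<dots> \<le> 16 * C1\<^sup>2 * (real m * La) ^ 3 * cc\<^sup>2 * (x0 / 4)"
          unfolding c_def using La_ge_T cc_ge_T T1 x0 La_pos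
          by (intro mult_right_mono mult_mono mult_left_mono power_mono mult_nonneg_nonneg) auto
        finally show ?thesis .
      qed
      show "4 / real Z ^ 7 + 48 * real (k + 1) * (real m)\<^sup>2 * T\<^sup>2 / real Z < cc * (real m * T / (4 * real (totient Q)))"
      proof -
        let ?n = "40 * (k + 1)" and ?d = "real m / (4 * \<phi>)"
        have d: "?d > 0" using m0 \<phi> by simp
        have "4 / real Z ^ 7 \<le> 4 * T\<^sup>2 * (1 / exp T)"
        proof -
          have "4 / real Z ^ 7 = 4 * 1 * (1 / real Z ^ 7)" by simp
          also have "\<dots> \<le> 4 * T\<^sup>2 * (1 / exp T)" using Z7 T1 by (intro mult_mono) auto
          finally show ?thesis .
        qed
        then have "4 / real Z ^ 7 + 48 * real (k + 1) * (real m)\<^sup>2 * T\<^sup>2 / real Z \<le> (4 + 48 * real (k + 1) * (real m)\<^sup>2) * T\<^sup>2 * (1 / exp T)"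
          by (simp add: Z_exp algebra_simps add_divide_distrib)
        also have "\<dots> = (H' - 1) * ?d * T\<^sup>2 * (1 / exp T)" using \<phi> m0 by (simp add: H'_def)
        also have "\<dots> < H' * ?d * T\<^sup>2 * (1 / exp T)"
          using d T1 by (intro mult_strict_right_mono) auto
        also have "\<dots> \<le> ?d * (1 / T ^ ?n)"
        proof -
          have "H' * T ^ (?n + 2) \<le> exp T" using g ET unfolding good_def by linarith
          then have "H' * (T ^ ?n * T\<^sup>2) \<le> exp T" by (simp only: power_add)
          moreover have "T ^ ?n > 0" using T1 by simp
          moreover have "H' * x * (1 / e) \<le> 1 / y" if "H' * (y * x) \<le> e" "y > 0" "e > 0" for x y e
            using that by (simp add: field_simps)
          ultimately have "H' * T\<^sup>2 * (1 / exp T) \<le> 1 / T ^ ?n" by simp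
          then have "?d * (H' * T\<^sup>2 * (1 / exp T)) \<le> ?d * (1 / T ^ ?n)" using d by (intro mult_left_mono) auto
          then show ?thesis by (simp only: mult_ac)
        qed
        also have "\<dots> \<le> ?d * T * cc"
        proof -
          have "1 * (1 / T ^ ?n) \<le> T * cc" using cc_ge_T T1 by (intro mult_mono) auto
          then show ?thesis using d by (simp only: mult.assoc mult_1) (intro mult_left_mono, auto)
        qed
        also have "\<dots> = cc * (real m * T / (4 * real (totient Q)))" by (simp add: \<phi>_def)
        finally show ?thesis .
      qed
    qed
    then obtain p where p: "prime p" "p \<in> {Z ^ (2 * m)<..Z ^ (4 * m)}" "[p = a] (mod Q)"
      and pq0: "\<forall>i\<in>{1..k}. \<forall>q. prime q \<longrightarrow> q dvd p + i \<longrightarrow> q \<le> w \<or> Z < q \<and> \<not> q\<^sup>2 dvd p + i"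
      by (elim exE conjE)
    note pq = pq0[rule_format]
    have BZ: "B \<le> Z"
    proof -
      have "real B \<le> exp (T / 1024)" using g by (simp add: good_def)
      also note ET
      also have "exp T = real Z" by (simp only: Z_exp)
      finally have "real B \<le> real Z" .
      then show ?thesis by simp
    qed
    have cd: "card {q. prime q \<and> w < q \<and> q dvd p + i} \<le> 5 * m" if i: "i \<in> {1..k}" for i
    proof -
      let ?S = "{q. prime q \<and> w < q \<and> q dvd p + i}"
      have p0: "p + i > 0" using i by simp
      have fin: "finite ?S" by (rule finite_subset[of _ "{..p + i}"]) (use p0 in \<open>auto intro: dvd_imp_le\<close>)
      have "Z ^ card ?S = (\<Prod>q\<in>?S. Z)" by simp
      also have "\<dots> \<le> \<Prod>?S"
      proof (intro prod_mono conjI)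
        fix q assume "q \<in> ?S"
        then show "Z \<le> q" using pq[OF i, of q] by simp
      qed simp
      also have "\<dots> \<le> p + i" using fin p0 by (intro dvd_imp_le prod_primes_dvd) (auto simp: prime_factors_dvd)
      also have "\<dots> \<le> Z ^ (4 * m) + Z ^ (4 * m)"
      proof -
        have "p \<le> Z ^ (4 * m)" using p(2) by simp
        moreover have "i \<le> Z" using i w Z_ge by simp
        ultimately show ?thesis using Z_m_facts by linarith
      qed
      also have "\<dots> \<le> Z ^ m * Z ^ (4 * m)"
      proof -
        have "2 \<le> Z ^ m" using Z_m_facts Z_ge by linarith
        then have "2 * Z ^ (4 * m) \<le> Z ^ m * Z ^ (4 * m)" by (rule mult_right_mono) simp
        then show ?thesis by (simp only: mult_2)
      qed
      also have "\<dots> = Z ^ (5 * m)" by (simp flip: power_add)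
      finally have S: "Z ^ card ?S \<le> Z ^ (5 * m)" .
      have "1 < Z" using Z_ge by simp
      then show ?thesis using S by (rule power_le_imp_le_exp)
    qed
    have "q \<le> w \<or> B < q \<and> \<not> q\<^sup>2 dvd p + i" if "i \<in> {1..k}" "prime q" "q dvd p + i" for i q
      using pq[OF that] BZ by auto
    then show ?thesis using p(1,3) cd by (intro exI[of _ p] conjI ballI allI impI)
  qed
  then have "\<forall>w\<ge>max (4 * k + 2) w1. \<forall>Q a B. Q > 0 \<longrightarrow> (\<forall>p. prime p \<longrightarrow> (p dvd Q \<longleftrightarrow> p \<le> w)) \<longrightarrow> coprime a Q \<longrightarrow>
    (\<exists>p. prime p \<and> [p = a] (mod Q) \<and> (\<forall>i\<in>{1..k}. card {q. prime q \<and> w < q \<and> q dvd p + i} \<le> 5 * m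
      \<and> (\<forall>q. prime q \<longrightarrow> q dvd p + i \<longrightarrow> q \<le> w \<or> B < q \<and> \<not> q\<^sup>2 dvd p + i)))"
    by (intro allI impI)
  then show ?thesis by - (rule exI, rule exI, assumption)
qed

section \<open>Approximation by products and the choice of the residue class\<close>

text \<open>The bound \<open>B\<close> is arbitrary so that the sets for different shifts can be
  made disjoint and kept away from the primes up to \<open>k + 1\<close>.\<close>

definition approximable :: "(nat \<Rightarrow> real) \<Rightarrow> real \<Rightarrow> bool" where
  "approximable f t \<longleftrightarrow> (\<forall>B. \<forall>\<eta>>0. \<exists>P. finite P \<and> (\<forall>p\<in>P. prime p \<and> B < p) \<and> \<bar>(\<Prod>p\<in>P. f p) - t\<bar> < \<eta>)"

text \<open>The primes with \<open>g p > 1\<close> beyond a large bound are taken one after the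
  other until the product reaches \<open>t\<close>. It does so because a product of factors
  \<open>1 + x\<close> dominates the sum of the \<open>x\<close>, and it overshoots by at most its
  last factor, which is below \<open>1 + \<eta>\<close>.\<close>

lemma greedy_product:
  fixes g :: "nat \<Rightarrow> real" and B :: nat
  assumes lim: "\<forall>\<epsilon>>0. \<exists>N. \<forall>p. prime p \<and> p \<ge> N \<longrightarrow> \<bar>g p - 1\<bar> < \<epsilon>"
    and div: "\<not> summable (\<lambda>p. if prime p \<and> g p > 1 then g p - 1 else 0)"
    and t: "t \<ge> 1" and \<eta>: "\<eta> > 0"
  shows "\<exists>P. finite P \<and> (\<forall>p\<in>P. prime p \<and> B < p) \<and> t \<le> (\<Prod>p\<in>P. g p) \<and> (\<Prod>p\<in>P. g p) \<le> t * (1 + \<eta>)"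
proof -
  obtain N where N: "\<And>p. prime p \<Longrightarrow> p \<ge> N \<Longrightarrow> \<bar>g p - 1\<bar> < \<eta>" using lim \<eta> by blast
  define N0 where "N0 = max N (Suc B)"
  define S where "S = (\<lambda>n. {p \<in> {N0..<N0 + n}. prime p \<and> g p > 1})"
  define h where "h = (\<lambda>p. if prime p \<and> g p > 1 then g p - 1 else 0)"
  have fin: "finite (S n)" for n by (simp add: S_def)
  have "\<not> summable (\<lambda>n. h (n + N0))" using div unfolding h_def[symmetric] summable_iff_shift .
  moreover have "summable (\<lambda>n. h (n + N0))" if "\<And>n. (\<Sum>i<n. h (i + N0)) \<le> t"
  proof (rule bounded_imp_summable)
    show "(\<Sum>i\<le>n. h (i + N0)) \<le> t" for n using that[of "Suc n"] by (simp only: lessThan_Suc_atMost)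
  qed (simp add: h_def)
  ultimately obtain n0 where "t < (\<Sum>i<n0. h (i + N0))" by (meson not_le)
  also have "\<dots> = (\<Sum>p\<in>{N0..<N0 + n0}. h p)"
    by (rule sum.reindex_bij_witness[where i = "\<lambda>p. p - N0" and j = "\<lambda>i. i + N0"]) auto
  also have "\<dots> = (\<Sum>p\<in>S n0. g p - 1)" by (rule sum.mono_neutral_cong_right) (auto simp: S_def h_def)
  also have "\<dots> \<le> (\<Prod>p\<in>S n0. 1 + (g p - 1))" by (rule sum_le_prod) (auto simp: S_def)
  finally have ex: "t \<le> (\<Prod>p\<in>S n0. g p)" by simp
  define n where "n = (LEAST n. t \<le> (\<Prod>p\<in>S n. g p))"
  have n: "t \<le> (\<Prod>p\<in>S n. g p)" unfolding n_def using ex by (rule LeastI)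
  have up: "(\<Prod>p\<in>S n. g p) \<le> t * (1 + \<eta>)"
  proof (cases n)
    case 0
    have "S 0 = {}" by (auto simp: S_def)
    then have "(\<Prod>p\<in>S n. g p) = 1" using 0 by simp
    moreover have "1 * 1 \<le> t * (1 + \<eta>)" using t \<eta> by (intro mult_mono) auto
    ultimately show ?thesis by simp
  next
    case (Suc n')
    have less: "(\<Prod>p\<in>S n'. g p) < t" using not_less_Least[of n' "\<lambda>n. t \<le> (\<Prod>p\<in>S n. g p)"] Suc unfolding n_def[symmetric] by simp
    show ?thesis
    proof (cases "prime (N0 + n') \<and> g (N0 + n') > 1")
      case True
      have "S n = insert (N0 + n') (S n')" "N0 + n' \<notin> S n'" using True Suc by (auto simp: S_def)
      then have "(\<Prod>p\<in>S n. g p) = (\<Prod>p\<in>S n'. g p) * g (N0 + n')" using fin by (simp add: mult.commute)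
      also have "N \<le> N0 + n'" by (simp add: N0_def trans_le_add1)
      then have "g (N0 + n') \<le> 1 + \<eta>" using N[of "N0 + n'"] True by auto
      then have "(\<Prod>p\<in>S n'. g p) * g (N0 + n') \<le> t * (1 + \<eta>)"
        using less True t by (intro mult_mono) auto
      finally show ?thesis .
    next
      case False
      then have "S n = S n'" using Suc by (auto simp: S_def less_Suc_eq)
      then show ?thesis using less n by simp
    qed
  qed
  have "\<forall>p\<in>S n. prime p \<and> B < p" by (auto simp: S_def N0_def)
  then show ?thesis using fin n up by blast
qed

lemma approximable_ge_1:
  assumes "\<forall>\<epsilon>>0. \<exists>N. \<forall>p. prime p \<and> p \<ge> N \<longrightarrow> \<bar>f p - 1\<bar> < \<epsilon>"
    and "\<not> summable (\<lambda>p. if prime p \<and> f p > 1 then f p - 1 else 0)" and t: "t \<ge> 1"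
  shows "approximable f t"
  unfolding approximable_def
proof (intro allI impI)
  fix B :: nat and \<eta> :: real assume \<eta>: "\<eta> > 0"
  obtain P where P: "finite P" "\<forall>p\<in>P. prime p \<and> B < p" "t \<le> (\<Prod>p\<in>P. f p)" "(\<Prod>p\<in>P. f p) \<le> t * (1 + \<eta> / (2 * t))"
    using greedy_product[OF assms, of "\<eta> / (2 * t)" B] \<eta> t by auto
  have "t * (1 + \<eta> / (2 * t)) = t + \<eta> / 2" using t by (simp add: field_simps)
  then have "\<bar>(\<Prod>p\<in>P. f p) - t\<bar> < \<eta>" using P \<eta> by linarith
  then show "\<exists>P. finite P \<and> (\<forall>p\<in>P. prime p \<and> B < p) \<and> \<bar>(\<Prod>p\<in>P. f p) - t\<bar> < \<eta>" using P by blast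
qed

text \<open>The greedy choice is applied to \<open>1 / f\<close>, for which divergence is preserved
  because \<open>1 / f p - 1\<close> is at least \<open>1 - f p\<close>.\<close>

lemma approximable_le_1:
  assumes pos: "\<And>n. n > 0 \<Longrightarrow> f n > 0"
    and lim: "\<forall>\<epsilon>>0. \<exists>N. \<forall>p. prime p \<and> p \<ge> N \<longrightarrow> \<bar>f p - 1\<bar> < \<epsilon>"
    and div: "\<not> summable (\<lambda>p. if prime p \<and> f p < 1 then 1 - f p else 0)" and t: "0 \<le> t" "t \<le> 1"
  shows "approximable f t"
proof -
  have fp: "f p > 0" if "prime p" for p using pos[of p] prime_gt_0_nat[OF that] by simp
  define g where "g = (\<lambda>p. 1 / f p)"
  have lim': "\<forall>\<epsilon>>0. \<exists>N. \<forall>p. prime p \<and> p \<ge> N \<longrightarrow> \<bar>g p - 1\<bar> < \<epsilon>"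
  proof (intro allI impI)
    fix \<epsilon> :: real assume "\<epsilon> > 0"
    then obtain N where N: "\<And>p. prime p \<and> p \<ge> N \<Longrightarrow> \<bar>f p - 1\<bar> < min (1/2) (\<epsilon> / 2)"
      using lim[rule_format, of "min (1/2) (\<epsilon> / 2)"] by auto
    have "\<bar>g p - 1\<bar> < \<epsilon>" if p: "prime p \<and> p \<ge> N" for p
    proof -
      have f: "\<bar>f p - 1\<bar> < 1/2" "\<bar>f p - 1\<bar> < \<epsilon> / 2" using N[OF p] by auto
      then have f2: "f p > 1/2" by linarith
      have "\<bar>g p - 1\<bar> = \<bar>f p - 1\<bar> * (1 / f p)" using f2 by (simp add: g_def field_simps abs_if)
      also have "\<dots> \<le> \<bar>f p - 1\<bar> * 2" using f2 by (intro mult_left_mono) (auto simp: field_simps)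
      also have "\<dots> < \<epsilon>" using f(2) by simp
      finally show ?thesis .
    qed
    then show "\<exists>N. \<forall>p. prime p \<and> p \<ge> N \<longrightarrow> \<bar>g p - 1\<bar> < \<epsilon>" by blast
  qed
  have div': "\<not> summable (\<lambda>p. if prime p \<and> g p > 1 then g p - 1 else 0)"
  proof
    assume s: "summable (\<lambda>p. if prime p \<and> g p > 1 then g p - 1 else 0)"
    have "summable (\<lambda>p. if prime p \<and> f p < 1 then 1 - f p else 0)"
    proof (rule summable_comparison_test'[OF s, where N = 0])
      fix p :: nat
      show "norm (if prime p \<and> f p < 1 then 1 - f p else 0) \<le> (if prime p \<and> g p > 1 then g p - 1 else 0)"
      proof (cases "prime p \<and> f p < 1")
        case True
        have f: "f p > 0" using fp True by blast
        have "0 \<le> (1 - f p)\<^sup>2 / f p" using f by simp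
        also have "\<dots> = (g p - 1) - (1 - f p)" using f by (simp add: g_def field_simps power2_eq_square)
        finally have "1 - f p \<le> g p - 1" by simp
        moreover have "g p > 1" using True f by (simp add: g_def)
        ultimately show ?thesis using True by simp
      qed auto
    qed
    then show False using div by contradiction
  qed
  have main: "\<exists>P. finite P \<and> (\<forall>p\<in>P. prime p \<and> B < p) \<and> u * (1 - \<eta>) \<le> (\<Prod>p\<in>P. f p) \<and> (\<Prod>p\<in>P. f p) \<le> u"
    if u: "0 < u" "u \<le> 1" and \<eta>: "\<eta> > 0" for B :: nat and u \<eta> :: real
  proof -
    obtain P where P: "finite P" "\<forall>p\<in>P. prime p \<and> B < p" "1 / u \<le> (\<Prod>p\<in>P. g p)" "(\<Prod>p\<in>P. g p) \<le> 1 / u * (1 + \<eta>)"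
      using greedy_product[OF lim' div', of "1 / u" \<eta> B] u \<eta> by auto
    have pf: "(\<Prod>p\<in>P. f p) > 0" using P(2) fp by (intro prod_pos) auto
    have eq: "(\<Prod>p\<in>P. g p) = 1 / (\<Prod>p\<in>P. f p)" by (simp add: g_def prod_dividef)
    have 1: "(\<Prod>p\<in>P. f p) \<le> u" using P(3) pf u unfolding eq by (simp add: field_simps)
    have "u \<le> (\<Prod>p\<in>P. f p) * (1 + \<eta>)" using P(4) pf u unfolding eq by (simp add: field_simps)
    also have "\<dots> \<le> (\<Prod>p\<in>P. f p) + u * \<eta>" using mult_right_mono[OF 1, of \<eta>] \<eta> by (simp add: distrib_left)
    finally have "u * (1 - \<eta>) \<le> (\<Prod>p\<in>P. f p)" by (simp add: algebra_simps)
    then show ?thesis using P 1 by blast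
  qed
  show ?thesis unfolding approximable_def
  proof (intro allI impI)
    fix B :: nat and \<eta> :: real assume \<eta>: "\<eta> > 0"
    \<comment> \<open>The target \<open>0\<close> has no reciprocal and is replaced by a small
      positive number.\<close>
    define u where "u = (if t = 0 then min 1 (\<eta> / 2) else t)"
    have u: "0 < u" "u \<le> 1" using t \<eta> by (auto simp: u_def)
    obtain P where P: "finite P" "\<forall>p\<in>P. prime p \<and> B < p" "u * (1 - \<eta> / 2) \<le> (\<Prod>p\<in>P. f p)" "(\<Prod>p\<in>P. f p) \<le> u"
      using main[OF u, of "\<eta> / 2" B] \<eta> by auto
    have "\<bar>(\<Prod>p\<in>P. f p) - t\<bar> < \<eta>"
    proof (cases "t = 0")
      case True
      have "(\<Prod>p\<in>P. f p) > 0" using P(2) fp by (intro prod_pos) auto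
      moreover have "u \<le> \<eta> / 2" using True by (simp add: u_def)
      ultimately show ?thesis using P(4) \<eta> True by simp
    next
      case False
      then have "u = t" by (simp add: u_def)
      moreover have "u * (\<eta> / 2) \<le> 1 * (\<eta> / 2)" using u \<eta> by (intro mult_right_mono) auto
      moreover have "u - u * (\<eta> / 2) \<le> (\<Prod>p\<in>P. f p)" using P(3) by (simp add: algebra_simps)
      ultimately show ?thesis using P(4) \<eta> by linarith
    qed
    then show "\<exists>P. finite P \<and> (\<forall>p\<in>P. prime p \<and> B < p) \<and> \<bar>(\<Prod>p\<in>P. f p) - t\<bar> < \<eta>" using P by blast
  qed
qed

text \<open>Each new set is chosen beyond the largest prime used so far.\<close>

lemma approximable_disjoint:
  fixes t \<eta> :: "nat \<Rightarrow> real" and B k :: nat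
  assumes ap: "\<And>i. i \<in> {1..k} \<Longrightarrow> approximable f (t i)" and \<eta>: "\<And>i. i \<in> {1..k} \<Longrightarrow> \<eta> i > 0"
  shows "\<exists>P. (\<forall>i\<in>{1..k}. finite (P i) \<and> (\<forall>p\<in>P i. prime p \<and> B < p) \<and> \<bar>(\<Prod>p\<in>P i. f p) - t i\<bar> < \<eta> i)
     \<and> (\<forall>i\<in>{1..k}. \<forall>j\<in>{1..k}. i \<noteq> j \<longrightarrow> P i \<inter> P j = {})"
proof -
  have "\<exists>P. (\<forall>i\<in>{1..j}. finite (P i) \<and> (\<forall>p\<in>P i. prime p \<and> B < p) \<and> \<bar>(\<Prod>p\<in>P i. f p) - t i\<bar> < \<eta> i)
     \<and> (\<forall>i\<in>{1..j}. \<forall>i'\<in>{1..j}. i \<noteq> i' \<longrightarrow> P i \<inter> P i' = {})" if "j \<le> k" for j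
    using that
  proof (induction j)
    case 0
    then show ?case by simp
  next
    case (Suc j)
    obtain P where P0: "\<forall>i\<in>{1..j}. finite (P i) \<and> (\<forall>p\<in>P i. prime p \<and> B < p) \<and> \<bar>(\<Prod>p\<in>P i. f p) - t i\<bar> < \<eta> i"
      "\<forall>i\<in>{1..j}. \<forall>i'\<in>{1..j}. i \<noteq> i' \<longrightarrow> P i \<inter> P i' = {}" using Suc.IH[OF Suc_leD[OF Suc.prems]] by blast
    note P = P0(1)[rule_format] P0(2)[rule_format]
    define U where "U = (\<Union>i\<in>{1..j}. P i)"
    have finU: "finite U" using P(1) by (auto simp: U_def)
    have jk: "Suc j \<in> {1..k}" using Suc.prems by simp
    obtain R where R: "finite R" "\<forall>p\<in>R. prime p \<and> max B (Max (insert 0 U)) < p" "\<bar>(\<Prod>p\<in>R. f p) - t (Suc j)\<bar> < \<eta> (Suc j)"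
      using ap[OF jk, unfolded approximable_def, rule_format, OF \<eta>[OF jk], of "max B (Max (insert 0 U))"] by blast
    have RU: "R \<inter> U = {}"
    proof (rule ccontr)
      assume "R \<inter> U \<noteq> {}"
      then obtain p where p: "p \<in> R" "p \<in> U" by blast
      have "p \<le> Max (insert 0 U)" using p(2) finU by (intro Max_ge) auto
      moreover have "Max (insert 0 U) < p" using R(2) p(1) by simp
      ultimately show False by simp
    qed
    then have RP: "R \<inter> P i = {}" if "i \<in> {1..j}" for i using that unfolding U_def by blast
    have "\<forall>i\<in>{1..Suc j}. finite ((P(Suc j := R)) i) \<and> (\<forall>p\<in>(P(Suc j := R)) i. prime p \<and> B < p) \<and> \<bar>(\<Prod>p\<in>(P(Suc j := R)) i. f p) - t i\<bar> < \<eta> i"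
    proof
      fix i assume i: "i \<in> {1..Suc j}"
      show "finite ((P(Suc j := R)) i) \<and> (\<forall>p\<in>(P(Suc j := R)) i. prime p \<and> B < p) \<and> \<bar>(\<Prod>p\<in>(P(Suc j := R)) i. f p) - t i\<bar> < \<eta> i"
      proof (cases "i = Suc j")
        case True
        then show ?thesis using R by simp
      next
        case False
        then have "i \<in> {1..j}" using i by simp
        then show ?thesis using P(1)[of i] False by simp
      qed
    qed
    moreover have "(P(Suc j := R)) i \<inter> (P(Suc j := R)) i' = {}" if "i \<in> {1..Suc j}" "i' \<in> {1..Suc j}" "i \<noteq> i'" for i i'
    proof -
      have ne: "i \<noteq> i'" using that(3) .
      have "i \<in> {1..j} \<or> i = Suc j" "i' \<in> {1..j} \<or> i' = Suc j" using that by auto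
      then consider "i = Suc j" "i' \<in> {1..j}" | "i' = Suc j" "i \<in> {1..j}" | "i \<in> {1..j}" "i' \<in> {1..j}"
        using ne by blast
      then show ?thesis using RP P(2) that(3) by cases auto
    qed
    ultimately show ?case by blast
  qed
  from this[OF order_refl] show ?thesis .
qed

section \<open>The residue class and the factorisation of the shifts\<close>

text \<open>This explains the form of \<open>K\<close>, which equals
  \<open>fact (k - 1) * fact (k + 1)\<close>: the first factor absorbs any \<open>d < k\<close>, and
  the second keeps \<open>K div d\<close> divisible by all primes up to \<open>k + 1\<close>, so
  that these primes can be kept out of the cofactor of \<open>d\<close>.\<close>

lemma fact_dvd_quotient:
  fixes k d :: nat
  assumes "1 \<le> d" "d < k" shows "d * fact (k + 1) dvd k * (k + 1) * (fact (k - 1))\<^sup>2"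
proof -
  obtain j where j: "k = Suc j" using assms by (cases k) auto
  have "d dvd fact (k - 1)" using assms by (intro dvd_fact) auto
  then have "d * fact (k + 1) dvd fact (k - 1) * fact (k + 1)" by (rule mult_dvd_mono) simp
  also have "fact (k - 1) * fact (k + 1) = k * (k + 1) * (fact (k - 1))\<^sup>2" by (simp add: j power2_eq_square algebra_simps)
  finally show ?thesis .
qed

lemma prime_dvd_shift_modulus_iff:
  fixes k p :: nat
  assumes "prime p" "k \<ge> 1" shows "p dvd k * (k + 1) * (fact (k - 1))\<^sup>2 \<longleftrightarrow> p \<le> k + 1"
proof -
  obtain j where j: "k = Suc j" using assms by (cases k) auto
  have "k * (k + 1) * (fact (k - 1))\<^sup>2 = fact (k - 1) * fact (k + 1)" by (simp add: j power2_eq_square algebra_simps)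
  then show ?thesis using assms by (simp only: prime_dvd_mult_iff prime_dvd_fact_iff) auto
qed

lemma not_coprime_common_prime:
  fixes a b :: nat
  assumes "\<not> coprime a b" shows "\<exists>p. prime p \<and> p dvd a \<and> p dvd b"
proof -
  obtain c where c: "c dvd a" "c dvd b" "\<not> is_unit c" using assms by (rule not_coprimeE)
  then obtain p where "prime p" "p dvd c" using prime_factor_nat[of c] by auto
  then show ?thesis using c by (meson dvd_trans)
qed

text \<open>The residue class prescribes which primes up to \<open>w\<close> divide the shifts \<open>p + i\<close>: those of the
  fixed divisor, and those of \<open>P i\<close> exactly once.\<close>
lemma residue_class_exists:
  fixes k w :: nat and P :: "nat \<Rightarrow> nat set"
  defines "K \<equiv> k * (k + 1) * (fact (k - 1))\<^sup>2"
  assumes k: "k \<ge> 1" and kw: "k + 1 \<le> w"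
    and P: "\<forall>i\<in>{1..k}. \<forall>q\<in>P i. prime q \<and> k + 1 < q \<and> q \<le> w"
    and disj: "\<forall>i\<in>{1..k}. \<forall>j\<in>{1..k}. i \<noteq> j \<longrightarrow> P i \<inter> P j = {}"
  shows "\<exists>Q a. Q > 0 \<and> (\<forall>p. prime p \<longrightarrow> (p dvd Q \<longleftrightarrow> p \<le> w)) \<and> coprime a Q \<and>
    (\<forall>p. [p = a] (mod Q) \<longrightarrow> [p + 1 = K] (mod K\<^sup>2) \<and>
      (\<forall>i\<in>{1..k}. \<forall>q. prime q \<longrightarrow> k + 1 < q \<longrightarrow> q \<le> w \<longrightarrow> (q dvd p + i \<longleftrightarrow> q \<in> P i) \<and> (q \<in> P i \<longrightarrow> \<not> q\<^sup>2 dvd p + i)))"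
proof -
  define R where "R = {q. prime q \<and> k + 1 < q \<and> q \<le> w}"
  define U where "U = (\<Union>i\<in>{1..k}. P i)"
  define ix where "ix = (\<lambda>q. THE i. i \<in> {1..k} \<and> q \<in> P i)"
  have ix: "ix q = i" if "i \<in> {1..k}" "q \<in> P i" for q i
    unfolding ix_def by (rule the_equality) (use that disj in blast)+
  \<comment> \<open>The index \<open>1\<close>, not a prime, carries the modulus
    \<open>K ^ 2\<close> for the primes up to \<open>k + 1\<close>. Squares of the primes in
    \<open>U\<close> are needed to fix their exact multiplicity.\<close>
  define M where "M = (\<lambda>q. if q = 1 then K\<^sup>2 else if q \<in> U then q\<^sup>2 else q)"
  \<comment> \<open>For \<open>q\<close> in \<open>P i\<close> this gives \<open>p + i\<close>
    congruent to \<open>q\<close> modulo \<open>q ^ 2\<close>, hence exactly one factor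
    \<open>q\<close>. For the other primes \<open>p\<close> is congruent to \<open>1\<close>, and
    \<open>p + i\<close> to \<open>1 + i\<close>, which is positive and less than
    \<open>q\<close>.\<close>
  define u where "u = (\<lambda>q. if q = 1 then K - 1 else if q \<in> U then q\<^sup>2 + q - ix q else 1)"
  define Q where "Q = (\<Prod>q\<in>insert 1 R. M q)"
  have finR: "finite R" by (rule finite_subset[of _ "{..w}"]) (auto simp: R_def)
  have R1: "1 \<notin> R" by (simp add: R_def)
  have K0: "K > 0" using k by (simp add: K_def)
  have pK: "p dvd K \<longleftrightarrow> p \<le> k + 1" if "prime p" for p unfolding K_def by (rule prime_dvd_shift_modulus_iff[OF that k])
  have pM: "p dvd M q \<longleftrightarrow> p = q" if "prime p" "q \<in> R" for p q
  proof -
    have q: "prime q" "q \<noteq> 1" using that by (auto simp: R_def)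
    then show ?thesis using that(1) by (auto simp: M_def prime_dvd_power_iff dest: primes_dvd_imp_eq)
  qed
  have pM1: "p dvd M 1 \<longleftrightarrow> p \<le> k + 1" if "prime p" for p
    using pK[OF that] that by (simp add: M_def prime_dvd_power_iff)
  have cop: "coprime (M q) (M q')" if qq: "q \<in> insert 1 R" "q' \<in> insert 1 R" "q \<noteq> q'" for q q'
  proof (rule ccontr)
    assume "\<not> coprime (M q) (M q')"
    then obtain p where p: "prime p" "p dvd M q" "p dvd M q'" using not_coprime_common_prime by blast
    show False using qq p pM[OF p(1)] pM1[OF p(1)] by (auto simp: R_def)
  qed
  have Q0: "Q > 0" unfolding Q_def using K0 by (intro prod_pos) (auto simp: M_def R_def dest: prime_gt_0_nat)
  have QP: "p dvd Q \<longleftrightarrow> p \<le> w" if p: "prime p" for p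
  proof -
    have "p dvd Q \<longleftrightarrow> (\<exists>q\<in>insert 1 R. p dvd M q)" unfolding Q_def using finR p by (simp only: prime_dvd_prod_iff finite_insert)
    also have "\<dots> \<longleftrightarrow> p \<le> k + 1 \<or> p \<in> R" using pM[OF p] pM1[OF p] by auto
    also have "\<dots> \<longleftrightarrow> p \<le> w" using p kw by (auto simp: R_def)
    finally show ?thesis .
  qed
  obtain a where a: "\<And>q. q \<in> insert 1 R \<Longrightarrow> [a = u q] (mod M q)"
    using chinese_remainder_nat[of "insert 1 R" M u] finR cop by auto
  have UR: "q \<in> R" if "i \<in> {1..k}" "q \<in> P i" for i q using P[THEN bspec, THEN bspec, OF that] by (simp add: R_def)
  \<comment> \<open>The shift \<open>0\<close> is included here because it yields the coprimality of
    \<open>a\<close> and \<open>Q\<close>.\<close>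
  have main: "[p + 1 = K] (mod K\<^sup>2) \<and>
      (\<forall>i\<in>{0..k}. \<forall>q. prime q \<longrightarrow> k + 1 < q \<longrightarrow> q \<le> w \<longrightarrow> (q dvd p + i \<longleftrightarrow> i \<ge> 1 \<and> q \<in> P i) \<and> (i \<ge> 1 \<longrightarrow> q \<in> P i \<longrightarrow> \<not> q\<^sup>2 dvd p + i))"
    if p: "[p = a] (mod Q)" for p
  proof (intro conjI ballI allI impI)
    have pq: "[p = u q] (mod M q)" if "q \<in> insert 1 R" for q
    proof -
      have "M q dvd Q" unfolding Q_def using that finR by (intro dvd_prodI) auto
      then have "[p = a] (mod M q)" using p by (rule cong_dvd_modulus_nat[rotated])
      then show ?thesis using a[OF that] by (rule cong_trans)
    qed
    have "[p = K - 1] (mod K\<^sup>2)" using pq[of 1] by (simp add: M_def u_def)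
    then have "[p + 1 = (K - 1) + 1] (mod K\<^sup>2)" by (rule cong_add) simp
    then show "[p + 1 = K] (mod K\<^sup>2)" using K0 by simp
    fix i q assume i: "i \<in> {0..k}" and q: "prime q" "k + 1 < q" "q \<le> w"
    have qR: "q \<in> R" "q \<noteq> 1" using q by (auto simp: R_def)
    have sq: "[p + j = q] (mod q\<^sup>2)" if j: "j \<in> {1..k}" "q \<in> P j" for j
    proof -
      have "q \<in> U" using j by (auto simp: U_def)
      then have "[p = q\<^sup>2 + q - j] (mod q\<^sup>2)" using pq[of q] qR ix[OF j] by (simp add: M_def u_def)
      then have "[p + j = q\<^sup>2 + q - j + j] (mod q\<^sup>2)" by (rule cong_add) simp
      also have "q\<^sup>2 + q - j + j = q\<^sup>2 + q" using j q by simp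
      also have "[q\<^sup>2 + q = q] (mod q\<^sup>2)" by (simp add: Cong.cong_def)
      finally show ?thesis .
    qed
    have sq1: "[p + j = 0] (mod q)" if j: "j \<in> {1..k}" "q \<in> P j" for j
    proof -
      have "[p + j = q] (mod q)" using sq[OF j] by (rule cong_dvd_modulus_nat) simp
      then show ?thesis by (simp add: Cong.cong_def)
    qed
    show "q dvd p + i \<longleftrightarrow> i \<ge> 1 \<and> q \<in> P i"
    proof
      assume d: "q dvd p + i"
      show "i \<ge> 1 \<and> q \<in> P i"
      proof (cases "q \<in> U")
        case True
        then obtain j where j: "j \<in> {1..k}" "q \<in> P j" by (auto simp: U_def)
        have "q dvd p + j" using sq1[OF j] by (simp add: Cong.cong_def mod_eq_0_iff_dvd)
        then have "int q dvd int (p + i) - int (p + j)" using d by (intro dvd_diff) (simp_all only: int_dvd_int_iff)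
        then have "int q dvd int i - int j" by simp
        moreover have "\<bar>int i - int j\<bar> < int q" using i j q by auto
        ultimately have "int i - int j = 0" using zdvd_not_zless[of "\<bar>int i - int j\<bar>" "int q"] by fastforce
        then show ?thesis using j by simp
      next
        case False
        then have "[p = 1] (mod q)" using pq[of q] qR by (simp add: M_def u_def)
        then have "[p + i = 1 + i] (mod q)" by (rule cong_add) simp
        then have "q dvd 1 + i" using d by (simp add: cong_dvd_iff)
        then show ?thesis using i q dvd_imp_le[of q "1 + i"] by simp
      qed
    next
      assume "i \<ge> 1 \<and> q \<in> P i"
      then show "q dvd p + i" using sq1[of i] i by (simp add: Cong.cong_def mod_eq_0_iff_dvd)
    qed
    assume "i \<ge> 1" "q \<in> P i"
    then have s: "[p + i = q] (mod q\<^sup>2)" using sq i by simp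
    show "\<not> q\<^sup>2 dvd p + i"
    proof
      assume "q\<^sup>2 dvd p + i"
      then have "q\<^sup>2 dvd q" using s by (simp add: cong_dvd_iff)
      then have "q\<^sup>2 \<le> q" using q by (intro dvd_imp_le) auto
      then show False using q by (simp add: power2_eq_square)
    qed
  qed
  have "coprime a Q"
  proof (rule ccontr)
    assume "\<not> coprime a Q"
    then obtain q where q: "prime q" "q dvd a" "q dvd Q" using not_coprime_common_prime by blast
    show False
    proof (cases "q \<le> k + 1")
      case True
      then have "q dvd K" using pK q by blast
      then have "q dvd K\<^sup>2" by (simp add: power2_eq_square)
      then have "[a + 1 = K] (mod q)" by (rule cong_dvd_modulus_nat[OF conjunct1[OF main[OF cong_refl]]])
      then have "q dvd a + 1" using \<open>q dvd K\<close> by (simp add: cong_dvd_iff)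
      then show False using q by (metis dvd_add_right_iff nat_dvd_1_iff_1 not_prime_1)
    next
      case False
      moreover have "q \<le> w" using QP[OF q(1)] q(3) by simp
      ultimately have "\<not> q dvd a + 0" using bspec[OF conjunct2[OF main[OF cong_refl]], of 0] q(1) by auto
      then show False using q(2) by simp
    qed
  qed
  then show ?thesis using Q0 QP main by (intro exI[of _ Q] exI[of _ a]) auto
qed

lemma multiplicative_prod_primes:
  assumes mult: "multiplicative f" and "finite S" "\<And>p. p \<in> S \<Longrightarrow> prime p"
  shows "f (\<Prod>S) = (\<Prod>p\<in>S. f p)"
  using assms(2,3)
proof (induction S)
  case empty
  then show ?case using mult by (simp add: multiplicative_def)
next
  case (insert p S)
  have "coprime p (\<Prod>S)" using insert by (intro prod_coprime_right primes_coprime) auto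
  moreover have "p > 0" "\<Prod>S > 0" using insert by (auto intro!: prime_gt_0_nat prod_pos)
  ultimately have "f (p * \<Prod>S) = f p * f (\<Prod>S)" using mult unfolding multiplicative_def by blast
  then show ?case using insert by simp
qed

text \<open>The congruence gives \<open>p + 1 = K * (1 + K * h)\<close>. For \<open>i > 1\<close>
  adding \<open>i - 1\<close> and dividing by it leaves \<open>1\<close> plus a multiple of
  \<open>fact (k + 1)\<close>. In both cases no prime up to \<open>k + 1\<close> divides the
  cofactor; the primes of \<open>P\<close> are split off once, and what remains has only prime
  factors above \<open>w\<close>.\<close>

lemma shift_factorization:
  fixes k n w i :: nat and P :: "nat set" and d K :: nat
  assumes k: "k \<ge> 1" and i: "i \<in> {1..k}"
  defines "K \<equiv> k * (k + 1) * (fact (k - 1))\<^sup>2"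
  defines "d \<equiv> if i = 1 then K else i - 1"
  assumes p1: "[p + 1 = K] (mod K\<^sup>2)"
    and P: "finite P" "\<And>q. q \<in> P \<Longrightarrow> prime q \<and> k + 1 < q \<and> q \<le> w"
    and q: "\<And>q. prime q \<Longrightarrow> k + 1 < q \<Longrightarrow> q \<le> w \<Longrightarrow> (q dvd p + i \<longleftrightarrow> q \<in> P) \<and> (q \<in> P \<longrightarrow> \<not> q\<^sup>2 dvd p + i)"
    and kw: "k + 1 \<le> w"
  shows "\<exists>r. p + i = d * \<Prod>P * r \<and> coprime d (\<Prod>P) \<and> coprime (d * \<Prod>P) r \<and> (\<forall>q. prime q \<longrightarrow> q dvd r \<longrightarrow> w < q)"
proof -
  have K0: "K > 0" using k by (simp add: K_def)
  have pK: "q dvd K \<longleftrightarrow> q \<le> k + 1" if "prime q" for q unfolding K_def by (rule prime_dvd_shift_modulus_iff[OF that k])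
  have d0: "d > 0" using K0 i by (auto simp: d_def)
  have dK: "d dvd K"
  proof (cases "i = 1")
    case False
    then have "(i - 1) * fact (k + 1) dvd K" using i unfolding K_def by (intro fact_dvd_quotient) auto
    then show ?thesis using False by (auto simp: d_def elim: dvd_mult_left)
  qed (simp add: d_def)
  \<comment> \<open>With \<open>K\<close> less than its square the congruence determines the
    remainder of \<open>p + 1\<close> exactly.\<close>
  have K2: "K < K\<^sup>2"
  proof -
    have "2 dvd K" using pK[of 2] k by simp
    then have "2 \<le> K" using K0 by (rule dvd_imp_le)
    then show ?thesis by (simp add: power2_eq_square)
  qed
  define h where "h = (p + 1) div K\<^sup>2"
  have "(p + 1) mod K\<^sup>2 = K" using p1 K2 by (simp add: Cong.cong_def)
  then have ph: "p + 1 = K * (1 + K * h)" using div_mult_mod_eq[of "p + 1" "K\<^sup>2"] by (simp add: h_def power2_eq_square algebra_simps)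
  have "\<exists>v. p + i = d * v \<and> (\<forall>q. prime q \<longrightarrow> q \<le> k + 1 \<longrightarrow> \<not> q dvd v)"
  proof (cases "i = 1")
    case True
    have "\<not> q dvd 1 + K * h" if "prime q" "q \<le> k + 1" for q
    proof
      assume "q dvd 1 + K * h"
      moreover have "q dvd K * h" using pK[OF that(1)] that(2) by simp
      ultimately have "q dvd 1" using dvd_add_left_iff by blast
      then show False using that(1) not_prime_unit by blast
    qed
    then show ?thesis using ph True by (intro exI[of _ "1 + K * h"]) (simp add: d_def)
  next
    case False
    then have "d * fact (k + 1) dvd K" using i unfolding K_def d_def by (simp only: if_False) (intro fact_dvd_quotient, auto)
    then obtain e where e: "K = d * fact (k + 1) * e" by blast
    have "p + i = (p + 1) + d" using False i by (simp add: d_def)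
    also have "\<dots> = d * (1 + fact (k + 1) * e * (1 + K * h))" unfolding ph by (subst e) (simp add: algebra_simps)
    finally have v: "p + i = d * (1 + fact (k + 1) * e * (1 + K * h))" .
    have "\<not> q dvd 1 + fact (k + 1) * e * (1 + K * h)" if "prime q" "q \<le> k + 1" for q
    proof
      assume "q dvd 1 + fact (k + 1) * e * (1 + K * h)"
      moreover have "q dvd fact (k + 1) * e * (1 + K * h)" using that prime_dvd_fact_iff[OF that(1), of "k + 1"] by (intro dvd_mult2) simp
      ultimately have "q dvd 1" using dvd_add_left_iff by blast
      then show False using that(1) not_prime_unit by blast
    qed
    then show ?thesis using v by blast
  qed
  then obtain v where v: "p + i = d * v" and vq: "\<And>q. prime q \<Longrightarrow> q \<le> k + 1 \<Longrightarrow> \<not> q dvd v" by blast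
  have v0: "v > 0" using v i by (cases v) auto
  have qd: "\<not> q dvd d" if "prime q" "k + 1 < q" for q
    using dvd_trans[OF _ dK, of q] pK[OF that(1)] that(2) by auto
  have "\<Prod>P dvd v"
  proof (rule prod_primes_dvd[OF _ v0])
    show "P \<subseteq> prime_factors v"
    proof
      fix x assume x: "x \<in> P"
      then have "x dvd d * v" using q[of x] P(2)[OF x] unfolding v by blast
      then have "x dvd v" using qd[of x] P(2)[OF x] by (simp add: prime_dvd_mult_iff)
      then show "x \<in> prime_factors v" using P(2)[OF x] v0 by (simp add: prime_factors_dvd)
    qed
  qed
  then obtain r where r: "v = \<Prod>P * r" by blast
  have big: "w < x" if x: "prime x" "x dvd r" for x
  proof (rule ccontr)
    assume "\<not> w < x"
    have "x dvd v" using x(2) r by simp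
    then have "k + 1 < x" using vq[OF x(1)] by (meson not_le)
    have "x dvd p + i" using \<open>x dvd v\<close> v by simp
    then have xP: "x \<in> P" using q[OF x(1) \<open>k + 1 < x\<close>] \<open>\<not> w < x\<close> by simp
    then have "x dvd \<Prod>P" using P(1) by (intro dvd_prodI[where f = "\<lambda>x. x"])
    then have "x * x dvd \<Prod>P * r" using x(2) by (rule mult_dvd_mono)
    then have "x\<^sup>2 dvd p + i" unfolding v r power2_eq_square by (rule dvd_mult)
    then show False using q[OF x(1) \<open>k + 1 < x\<close>] \<open>\<not> w < x\<close> xP by simp
  qed
  have prP: "x \<in> P" if x: "prime x" "x dvd \<Prod>P" for x
  proof -
    obtain y where "y \<in> P" "x dvd y" using x P(1) by (auto simp: prime_dvd_prod_iff)
    then show ?thesis using P(2)[of y] x(1) primes_dvd_imp_eq by blast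
  qed
  have "coprime d (\<Prod>P)"
  proof (rule ccontr)
    assume "\<not> coprime d (\<Prod>P)"
    then obtain x where "prime x" "x dvd d" "x dvd \<Prod>P" using not_coprime_common_prime by blast
    then show False using prP[of x] P(2)[of x] qd[of x] by blast
  qed
  moreover have "coprime (d * \<Prod>P) r"
  proof (rule ccontr)
    assume "\<not> coprime (d * \<Prod>P) r"
    then obtain x where x: "prime x" "x dvd d * \<Prod>P" "x dvd r" using not_coprime_common_prime by blast
    then have "w < x" using big by blast
    then have "\<not> x dvd d" using qd[OF x(1)] kw by simp
    then have "x \<in> P" using x prP by (simp add: prime_dvd_mult_iff)
    then show False using P(2)[of x] \<open>w < x\<close> by simp
  qed
  ultimately show ?thesis using v r big by (intro exI[of _ r]) (simp add: mult.assoc)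
qed

section \<open>Assembling the approximation\<close>

text \<open>The order of choice avoids circularity: the sets \<open>P i\<close> come from the
  targets, \<open>C\<close> from \<open>k\<close>, then the tolerance \<open>\<delta>\<close> per
  prime and the bound \<open>B\<close> beyond which \<open>f\<close> meets it, then
  \<open>w\<close>, and finally \<open>Q\<close>, \<open>a\<close> and \<open>p\<close>.\<close>

lemma prime_shifts_close_to_targets:
  fixes f :: "nat \<Rightarrow> real" and k :: nat and t :: "nat \<Rightarrow> real"
  defines "K \<equiv> k * (k + 1) * (fact (k - 1))\<^sup>2"
  assumes k: "k \<ge> 1" and mult: "multiplicative f"
    and pos: "\<And>n. n > 0 \<Longrightarrow> f n > 0"
    and lim: "\<forall>\<epsilon>>0. \<exists>N. \<forall>p. prime p \<and> p \<ge> N \<longrightarrow> \<bar>f p - 1\<bar> < \<epsilon>"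
    and ap: "\<And>i. i \<in> {1..k} \<Longrightarrow> approximable f (t i)" and \<epsilon>: "\<epsilon> > 0"
  shows "\<exists>p. prime p \<and> (\<forall>i\<in>{1..k}. \<bar>f (p + i) - f (if i = 1 then K else i - 1) * t i\<bar> < \<epsilon>)"
proof -
  define d where "d = (\<lambda>i. if i = 1 then K else i - 1)"
  have d0: "d i > 0" if "i \<in> {1..k}" for i using that k by (auto simp: d_def K_def)
  have fd: "f (d i) > 0" if "i \<in> {1..k}" for i using pos d0[OF that] .
  have "\<exists>P. (\<forall>i\<in>{1..k}. finite (P i) \<and> (\<forall>p\<in>P i. prime p \<and> k + 1 < p) \<and> \<bar>(\<Prod>p\<in>P i. f p) - t i\<bar> < \<epsilon> / (2 * f (d i)))
      \<and> (\<forall>i\<in>{1..k}. \<forall>j\<in>{1..k}. i \<noteq> j \<longrightarrow> P i \<inter> P j = {})"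
    by (rule approximable_disjoint) (use ap fd \<epsilon> in auto)
  then obtain P where P: "\<forall>i\<in>{1..k}. finite (P i) \<and> (\<forall>p\<in>P i. prime p \<and> k + 1 < p) \<and> \<bar>(\<Prod>p\<in>P i. f p) - t i\<bar> < \<epsilon> / (2 * f (d i))"
    and disj: "\<forall>i\<in>{1..k}. \<forall>j\<in>{1..k}. i \<noteq> j \<longrightarrow> P i \<inter> P j = {}" by blast
  note P = P[THEN bspec]
  define Y where "Y = (\<lambda>i. f (d i) * (\<Prod>p\<in>P i. f p))"
  have near: "\<bar>Y i - f (d i) * t i\<bar> < \<epsilon> / 2" if i: "i \<in> {1..k}" for i
  proof -
    have "\<bar>Y i - f (d i) * t i\<bar> = f (d i) * \<bar>(\<Prod>p\<in>P i. f p) - t i\<bar>"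
      using fd[OF i] by (simp add: Y_def abs_mult flip: right_diff_distrib)
    also have "\<dots> < f (d i) * (\<epsilon> / (2 * f (d i)))" using P[OF i] fd[OF i] by (intro mult_strict_left_mono) auto
    also have "\<dots> = \<epsilon> / 2" using fd[OF i] by simp
    finally show ?thesis .
  qed
  have Y0: "Y i > 0" if i: "i \<in> {1..k}" for i
    unfolding Y_def using d0[OF i] P[OF i] by (intro mult_pos_pos prod_pos pos) (auto dest: prime_gt_0_nat)
  \<comment> \<open>Dividing by the sum of all \<open>Y i\<close> gives one relative tolerance that
    serves every shift, with absolute error at most half of \<open>\<epsilon>\<close>.\<close>
  define \<tau> where "\<tau> = \<epsilon> / (2 * (\<Sum>i\<in>{1..k}. Y i))"
  have Ys: "Y i \<le> (\<Sum>i\<in>{1..k}. Y i)" if "i \<in> {1..k}" for i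
    using that Y0 by (intro member_le_sum) (auto intro: less_imp_le)
  have S0: "(\<Sum>i\<in>{1..k}. Y i) > 0" using Ys[of 1] Y0[of 1] k by fastforce
  have \<tau>: "\<tau> > 0" using \<epsilon> S0 by (simp add: \<tau>_def)
  from sieve_primes[OF k] obtain C w0 :: nat where main: "\<forall>w\<ge>w0. \<forall>Q a B. Q > 0 \<longrightarrow> (\<forall>p. prime p \<longrightarrow> (p dvd Q \<longleftrightarrow> p \<le> w)) \<longrightarrow> coprime a Q \<longrightarrow>
    (\<exists>p. prime p \<and> [p = a] (mod Q) \<and> (\<forall>i\<in>{1..k}. card {q. prime q \<and> w < q \<and> q dvd p + i} \<le> C
      \<and> (\<forall>q. prime q \<longrightarrow> q dvd p + i \<longrightarrow> q \<le> w \<or> B < q \<and> \<not> q\<^sup>2 dvd p + i)))"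
    by (elim exE)
  \<comment> \<open>At most \<open>C\<close> factors within \<open>\<delta>\<close> of
    \<open>1\<close> have a product within \<open>exp (C * \<delta>) - 1 \<le> \<tau>\<close> of
    \<open>1\<close>; \<open>C + 1\<close> in the denominator avoids a division by
    \<open>0\<close>.\<close>
  define \<delta> where "\<delta> = ln (1 + \<tau>) / real (C + 1)"
  have \<delta>: "\<delta> > 0" using \<tau> by (simp add: \<delta>_def)
  have "exp (real C * \<delta>) \<le> exp (ln (1 + \<tau>))"
  proof -
    have "real C * \<delta> \<le> real (C + 1) * \<delta>" using \<delta> by (intro mult_right_mono) auto
    also have "\<dots> = ln (1 + \<tau>)" by (simp add: \<delta>_def)
    finally show ?thesis by simp
  qed
  then have exp\<delta>: "exp (real C * \<delta>) \<le> 1 + \<tau>" using \<tau> by simp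
  obtain B where B: "\<And>q. prime q \<Longrightarrow> q \<ge> B \<Longrightarrow> \<bar>f q - 1\<bar> < \<delta>" using lim \<delta> by blast
  \<comment> \<open>All primes of the sets \<open>P i\<close> must lie below \<open>w\<close>, where
    the congruence and not the sieve decides divisibility.\<close>
  define w where "w = Max (insert w0 (insert (k + 1) (\<Union>i\<in>{1..k}. P i)))"
  have finU: "finite (insert w0 (insert (k + 1) (\<Union>i\<in>{1..k}. P i)))" using P by auto
  have wP: "q \<le> w" if "i \<in> {1..k}" "q \<in> P i" for i q
    unfolding w_def using that by (intro Max_ge[OF finU]) auto
  have w: "w0 \<le> w" "k + 1 \<le> w" unfolding w_def by (intro Max_ge[OF finU], simp)+
  have Pw: "prime q \<and> k + 1 < q \<and> q \<le> w" if "i \<in> {1..k}" "q \<in> P i" for i q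
    using P[OF that(1)] wP[OF that] that(2) by auto
  have "\<forall>i\<in>{1..k}. \<forall>q\<in>P i. prime q \<and> k + 1 < q \<and> q \<le> w" using Pw by blast
  from residue_class_exists[OF k w(2) this disj]
  obtain Q a where Q: "Q > 0" "\<forall>p. prime p \<longrightarrow> (p dvd Q \<longleftrightarrow> p \<le> w)" "coprime a Q"
    and cls: "\<forall>p. [p = a] (mod Q) \<longrightarrow> [p + 1 = K] (mod K\<^sup>2) \<and>
      (\<forall>i\<in>{1..k}. \<forall>q. prime q \<longrightarrow> k + 1 < q \<longrightarrow> q \<le> w \<longrightarrow> (q dvd p + i \<longleftrightarrow> q \<in> P i) \<and> (q \<in> P i \<longrightarrow> \<not> q\<^sup>2 dvd p + i))"
    unfolding K_def by (elim exE conjE)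
  from main[THEN spec, THEN mp, OF w(1), THEN spec, THEN spec, THEN spec, THEN mp, THEN mp, THEN mp, OF Q, of B]
  obtain p where p: "prime p" "[p = a] (mod Q)"
    and pB: "\<forall>i\<in>{1..k}. card {q. prime q \<and> w < q \<and> q dvd p + i} \<le> C
      \<and> (\<forall>q. prime q \<longrightarrow> q dvd p + i \<longrightarrow> q \<le> w \<or> B < q \<and> \<not> q\<^sup>2 dvd p + i)" by (elim exE conjE)
  note pc = pB[THEN bspec, THEN conjunct1]
  note pq = pB[THEN bspec, THEN conjunct2, rule_format]
  have cls1: "[p + 1 = K] (mod K\<^sup>2)" using cls p(2) by blast
  have cls2: "(q dvd p + i \<longleftrightarrow> q \<in> P i) \<and> (q \<in> P i \<longrightarrow> \<not> q\<^sup>2 dvd p + i)"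
    if "i \<in> {1..k}" "prime q" "k + 1 < q" "q \<le> w" for i q
    using cls[rule_format, OF p(2), THEN conjunct2] that by blast
  have "\<bar>f (p + i) - f (d i) * t i\<bar> < \<epsilon>" if i: "i \<in> {1..k}" for i
  proof -
    have "\<exists>r. p + i = d i * \<Prod>(P i) * r \<and> coprime (d i) (\<Prod>(P i)) \<and> coprime (d i * \<Prod>(P i)) r \<and> (\<forall>q. prime q \<longrightarrow> q dvd r \<longrightarrow> w < q)"
      unfolding d_def K_def
      by (rule shift_factorization[OF k i cls1[unfolded K_def] _ _ _ w(2)]) (use P[OF i] Pw[OF i] cls2[OF i] in blast)+
    then obtain r where r: "p + i = d i * \<Prod>(P i) * r" "coprime (d i) (\<Prod>(P i))" "coprime (d i * \<Prod>(P i)) r"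
      and rw: "\<And>q. prime q \<Longrightarrow> q dvd r \<Longrightarrow> w < q" by blast
    have r0: "r > 0" "d i * \<Prod>(P i) > 0" "\<Prod>(P i) > 0" using r(1) i by (auto intro!: Nat.gr0I)
    have rd: "q dvd p + i" if "q dvd r" for q using that r(1) by simp
    have sq: "\<not> q\<^sup>2 dvd r" if "prime q" for q
    proof
      assume s: "q\<^sup>2 dvd r"
      then have "q dvd r" by (rule dvd_trans[rotated]) (simp add: power2_eq_square)
      then show False using pq[OF i that rd] rw[OF that] rd[OF s] by fastforce
    qed
    have sqf: "squarefree r"
    proof (rule squarefreeI)
      fix x assume x: "x\<^sup>2 dvd r"
      show "is_unit x"
      proof (rule ccontr)
        assume "\<not> is_unit x"
        then obtain q where q: "prime q" "q dvd x" using prime_factor_nat[of x] by auto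
        then have "q\<^sup>2 dvd r" using x by (meson dvd_power_same dvd_trans)
        then show False using sq[OF q(1)] by contradiction
      qed
    qed
    let ?S = "prime_factors r"
    have S: "prime q" "w < q" "B < q" "q dvd p + i" if "q \<in> ?S" for q
    proof -
      show q: "prime q" using that by auto
      have "q dvd r" using that by auto
      then show "w < q" "q dvd p + i" using rw[OF q] rd by auto
      then show "B < q" using pq[OF i q] by auto
    qed
    have "card ?S \<le> card {q. prime q \<and> w < q \<and> q dvd p + i}"
    proof (rule card_mono)
      show "finite {q. prime q \<and> w < q \<and> q dvd p + i}"
        by (rule finite_subset[of _ "{..p + i}"]) (use i in \<open>auto intro: dvd_imp_le\<close>)
    qed (use S in auto)
    then have cS: "card ?S \<le> C" using pc[OF i] by simp
    have "f (p + i) = f (d i * \<Prod>(P i)) * f r" using mult r0 r(3) unfolding r(1) multiplicative_def by blast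
    also have "f (d i * \<Prod>(P i)) = f (d i) * f (\<Prod>(P i))" using mult r0 r(2) d0[OF i] unfolding multiplicative_def by blast
    also have "f (\<Prod>(P i)) = (\<Prod>p\<in>P i. f p)" using P[OF i] by (intro multiplicative_prod_primes[OF mult]) auto
    also have "f r = (\<Prod>q\<in>?S. f q)"
      using multiplicative_prod_primes[OF mult, of ?S] prod_prime_factors_squarefree[OF sqf] by auto
    finally have fpi: "f (p + i) = Y i * (\<Prod>q\<in>?S. f q)" by (simp add: Y_def)
    have "\<bar>(\<Prod>q\<in>?S. f q) - 1\<bar> \<le> \<tau>"
    proof -
      have "norm ((\<Prod>q\<in>?S. 1 + (f q - 1)) - 1) \<le> (\<Prod>q\<in>?S. 1 + norm (f q - 1)) - 1"
        by (rule norm_prod_minus1_le_prod_minus1)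
      also have "(\<Prod>q\<in>?S. 1 + norm (f q - 1)) \<le> (\<Prod>q\<in>?S. exp \<delta>)"
      proof (intro prod_mono conjI)
        fix q assume "q \<in> ?S"
        then have "norm (f q - 1) \<le> \<delta>" using B[of q] S[of q] by (simp add: less_imp_le)
        then show "1 + norm (f q - 1) \<le> exp \<delta>" using exp_ge_add_one_self[of \<delta>] by linarith
      qed simp
      also have "\<dots> = exp (real (card ?S) * \<delta>)" by (simp add: exp_of_nat_mult)
      also have "\<dots> \<le> exp (real C * \<delta>)" using cS \<delta> by simp
      finally show ?thesis using exp\<delta> by simp
    qed
    then have "Y i * \<bar>(\<Prod>q\<in>?S. f q) - 1\<bar> \<le> Y i * \<tau>" using Y0[OF i] by (intro mult_left_mono) auto
    also have "\<dots> \<le> (\<Sum>i\<in>{1..k}. Y i) * \<tau>" using Ys[OF i] \<tau> by (intro mult_right_mono) auto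
    also have "\<dots> = \<epsilon> / 2" using S0 by (simp add: \<tau>_def)
    finally have "Y i * \<bar>(\<Prod>q\<in>?S. f q) - 1\<bar> \<le> \<epsilon> / 2" .
    moreover have "f (p + i) - Y i = Y i * ((\<Prod>q\<in>?S. f q) - 1)" unfolding fpi by (simp add: right_diff_distrib)
    ultimately have "\<bar>f (p + i) - Y i\<bar> \<le> \<epsilon> / 2" using Y0[OF i] by (simp add: abs_mult)
    then show ?thesis using near[OF i] by linarith
  qed
  then show ?thesis using p(1) unfolding d_def by blast
qed

theorem theorem1p3:
  fixes f :: "nat \<Rightarrow> real" and k :: nat
  assumes k2: "k \<ge> 2"
    and mult: "multiplicative f"
    and pos: "\<And>n. n > 0 \<Longrightarrow> f n > 0"
    and lim: "\<forall>\<epsilon>>0. \<exists>N. \<forall>p. prime p \<and> p \<ge> N \<longrightarrow> \<bar>f p - 1\<bar> < \<epsilon>"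
  defines "K \<equiv> k * (k + 1) * (fact (k - 1))\<^sup>2"
  shows "(\<not> summable (\<lambda>p. if prime p \<and> f p > 1 then f p - 1 else 0) \<longrightarrow>
            prime_tuples_dense_in f k (\<lambda>i. if i = 1 then {f K..} else {f (i - 1)..}))
       \<and> (\<not> summable (\<lambda>p. if prime p \<and> f p < 1 then 1 - f p else 0) \<longrightarrow>
            prime_tuples_dense_in f k (\<lambda>i. if i = 1 then {0..f K} else {0..f (i - 1)}))"
proof -
  define d where "d = (\<lambda>i. if i = 1 then K else i - 1)"
  have k: "k \<ge> 1" using k2 by simp
  have fd: "f (d i) > 0" if "i \<in> {1..k}" for i using that k by (intro pos) (auto simp: d_def K_def)
  \<comment> \<open>Both boxes become conditions on the quotients \<open>x i / f (d i)\<close>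
    alone: at least \<open>1\<close> in the first case, between \<open>0\<close> and
    \<open>1\<close> in the second.\<close>
  have core: "\<exists>p. prime p \<and> (\<forall>i\<in>{1..k}. \<bar>f (p + i) - x i\<bar> < \<epsilon>)"
    if ap: "\<And>i. i \<in> {1..k} \<Longrightarrow> approximable f (x i / f (d i))" and \<epsilon>: "\<epsilon> > 0" for x :: "nat \<Rightarrow> real" and \<epsilon>
  proof -
    have ex: "\<exists>p. prime p \<and> (\<forall>i\<in>{1..k}. \<bar>f (p + i) - f (d i) * (x i / f (d i))\<bar> < \<epsilon>)"
    proof -
      have "\<exists>p. prime p \<and> (\<forall>i\<in>{1..k}. \<bar>f (p + i) - f (if i = 1 then k * (k + 1) * (fact (k - 1))\<^sup>2 else i - 1) * (x i / f (d i))\<bar> < \<epsilon>)"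
        by (rule prime_shifts_close_to_targets[where t = "\<lambda>i. x i / f (d i)", OF k mult _ lim _ \<epsilon>]) (use pos ap in auto)
      then show ?thesis unfolding d_def K_def .
    qed
    obtain p where p: "prime p" "\<And>i. i \<in> {1..k} \<Longrightarrow> \<bar>f (p + i) - f (d i) * (x i / f (d i))\<bar> < \<epsilon>"
      using ex by blast
    moreover have "f (d i) * (x i / f (d i)) = x i" if "i \<in> {1..k}" for i using fd[OF that] by simp
    ultimately show ?thesis by auto
  qed
  show ?thesis unfolding prime_tuples_dense_in_def
  proof (intro conjI impI allI)
    fix x :: "nat \<Rightarrow> real" and \<epsilon> :: real
    assume div: "\<not> summable (\<lambda>p. if prime p \<and> f p > 1 then f p - 1 else 0)"
      and x: "\<forall>i\<in>{1..k}. x i \<in> (if i = 1 then {f K..} else {f (i - 1)..})" and \<epsilon>: "\<epsilon> > 0"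
    have "approximable f (x i / f (d i))" if i: "i \<in> {1..k}" for i
    proof (rule approximable_ge_1[OF lim div])
      have "f (d i) \<le> x i" using bspec[OF x i] by (auto simp: d_def split: if_splits)
      then show "1 \<le> x i / f (d i)" using fd[OF i] by simp
    qed
    then show "\<exists>p. prime p \<and> (\<forall>i\<in>{1..k}. \<bar>f (p + i) - x i\<bar> < \<epsilon>)" using \<epsilon> by (rule core)
  next
    fix x :: "nat \<Rightarrow> real" and \<epsilon> :: real
    assume div: "\<not> summable (\<lambda>p. if prime p \<and> f p < 1 then 1 - f p else 0)"
      and x: "\<forall>i\<in>{1..k}. x i \<in> (if i = 1 then {0..f K} else {0..f (i - 1)})" and \<epsilon>: "\<epsilon> > 0"
    have "approximable f (x i / f (d i))" if i: "i \<in> {1..k}" for i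
    proof (rule approximable_le_1[OF _ lim div])
      have "0 \<le> x i" "x i \<le> f (d i)" using bspec[OF x i] by (auto simp: d_def split: if_splits)
      then show "0 \<le> x i / f (d i)" "x i / f (d i) \<le> 1" using fd[OF i] by simp_all
      show "f n > 0" if "n > 0" for n using pos that .
    qed
    then show "\<exists>p. prime p \<and> (\<forall>i\<in>{1..k}. \<bar>f (p + i) - x i\<bar> < \<epsilon>)" using \<epsilon> by (rule core)
  qed
qed

end
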